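(* Let $0<\sigma<1$ and let $F_\sigma(x)=\sum_{n=1}^\infty \frac{(-x)^n}{n!\,\Gamma(-n\sigma)}$. With $\kappa=1-\sigma$, $h=\sigma^\sigma$, $X=\kappa(hx)^{1/\kappa}$, $A(\sigma)=\sqrt{\frac{2\pi}{\sigma}}\left(\frac{\sigma}{\kappa}\right)^{\sigma}$, $A'(\sigma)=A(\sigma)\left(\frac{\sigma}{\kappa}\right)^{\kappa}$, and the coefficients $c_j(\sigma)$ (with $c_0(\sigma)=1$) defined in the context, the following asymptotic expansions hold as $x\to+\infty$: $$F_\sigma(x)\sim \frac{A'(\sigma)}{2\pi}\, X^{1/2}e^{-X}\sum_{j=0}^\infty c_j(\sigma)(-X)^{-j}\qquad(0<\sigma<1),$$ and $$F_\sigma(-x)\sim\begin{cases}E'(x)+H'(x) & (0<\sigma<\tfrac12),\\ H'(x) & (\tfrac12<\sigma<1),\end{cases}$$ where $E'(x)$ and $H'(x)$ are the formal exponential and algebraic expansions $$E'(x):=\frac{A'(\sigma)}{\pi}X^{1/2}e^{X\cos(\pi\sigma/\kappa)}\sum_{j=0}^\infty c_j(\sigma)(-X)^{-j}\cos\left[X\sin\frac{\pi\sigma}{\kappa}+\frac{\pi}{\kappa}\left(\tfrac12-j\right)\right],$$ $$H'(x):=\frac1\sigma\sum_{k=0}^\infty\frac{x^{-(k+1)/\sigma}}{k!\,\Gamma\left(1-\frac{k+1}{\sigma}\right)}.$$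
   Context: Here $x$ is real and positive, $\sigma$ is fixed, and $1/\Gamma$ is the entire reciprocal gamma function (so it is $0$ at non-positive integers). The series for $F_\sigma$ converges for all finite arguments. Coefficients $c_j(\sigma)$: put $\vartheta=\sigma-\tfrac12$ and $\vartheta'=1-\vartheta$. The $c_j(\sigma)$ are the coefficients in the inverse factorial expansion, valid for every positive integer $M$ and every small $\epsilon>0$, $$\frac{\Gamma(\sigma s+\sigma)\Gamma(\kappa s+\vartheta')}{\Gamma(1+s)}=\kappa A(\sigma)(h\kappa^\kappa)^s\left\{\sum_{j=0}^{M-1}\frac{c_j(\sigma)}{(\kappa s+\vartheta')_j}+\frac{O(1)}{(\kappa s+\vartheta')_M}\right\}$$ as $|s|\to\infty$ uniformly in $|\arg s|\le\pi-\epsilon$, where $(a)_j=\Gamma(a+j)/\Gamma(a)$. In particular $c_0(\sigma)=1$ and $c_1(\sigma)=\frac{(2-\sigma)(1-2\sigma)}{24\sigma}$. Meaning of $\sim$: asymptotic expansion in the Poincaré sense for fixed $\sigma$. The first expansion means that for every $M\ge1$, $F_\sigma(x)=\frac{A'(\sigma)}{2\pi}X^{1/2}e^{-X}\left\{\sum_{j=0}^{M-1}c_j(\sigma)(-X)^{-j}+O(X^{-M})\right\}$. For $F_\sigma(-x)\sim E'(x)+H'(x)$: for all $M,N\ge1$, $F_\sigma(-x)$ equals the sum of $E'(x)$ truncated to $0\le j\le M-1$ and $H'(x)$ truncated to $0\le k\le N-1$, up to an error $O\left(X^{1/2-M}e^{X\cos(\pi\sigma/\kappa)}\right)+O\left(x^{-(N+1)/\sigma}\right)$.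 For $F_\sigma(-x)\sim H'(x)$: for every $N\ge1$ the error of truncating $H'$ to $0\le k\le N-1$ is $O\left(x^{-(N+1)/\sigma}\right)$. *)

theory Defs
  imports "HOL-Analysis.Analysis" "HOL-Library.Landau_Symbols"
begin

definition wright_F :: "real \<Rightarrow> real \<Rightarrow> real" where
  "wright_F \<sigma> x = (\<Sum>n. (- x) ^ Suc n / fact (Suc n) * rGamma (- (real (Suc n) * \<sigma>)))"

definition kap :: "real \<Rightarrow> real" where
  "kap \<sigma> = 1 - \<sigma>"

definition hpar :: "real \<Rightarrow> real" where
  "hpar \<sigma> = \<sigma> powr \<sigma>"

definition bigX :: "real \<Rightarrow> real \<Rightarrow> real" where
  "bigX \<sigma> x = kap \<sigma> * (hpar \<sigma> * x) powr (1 / kap \<sigma>)"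

definition Acon :: "real \<Rightarrow> real" where
  "Acon \<sigma> = sqrt (2 * pi / \<sigma>) * (\<sigma> / kap \<sigma>) powr \<sigma>"

definition Acon' :: "real \<Rightarrow> real" where
  "Acon' \<sigma> = Acon \<sigma> * (\<sigma> / kap \<sigma>) powr kap \<sigma>"

definition theta' :: "real \<Rightarrow> real" where
  "theta' \<sigma> = 1 - (\<sigma> - 1 / 2)"

definition gamma_quot :: "real \<Rightarrow> complex \<Rightarrow> complex" where
  "gamma_quot \<sigma> s =
     Gamma (of_real \<sigma> * s + of_real \<sigma>) * Gamma (of_real (kap \<sigma>) * s + of_real (theta' \<sigma>)) / Gamma (1 + s)"

definition gamma_quot_factor :: "real \<Rightarrow> complex \<Rightarrow> complex" where
  "gamma_quot_factor \<sigma> s =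
     of_real (kap \<sigma> * Acon \<sigma>) * of_real (hpar \<sigma> * kap \<sigma> powr kap \<sigma>) powr s"

text \<open>The filter of complex \<open>s\<close> tending to infinity within \<open>\<bar>arg s\<bar> \<le> \<pi> - \<epsilon>\<close>; a Landau bound
  along it is uniform in \<open>arg s\<close>.\<close>

definition sector_at_infinity :: "real \<Rightarrow> complex filter" where
  "sector_at_infinity \<epsilon> = inf at_infinity (principal {s. \<bar>Arg s\<bar> \<le> pi - \<epsilon>})"

definition inverse_factorial_expansion :: "real \<Rightarrow> (nat \<Rightarrow> real) \<Rightarrow> bool" where
  "inverse_factorial_expansion \<sigma> c \<longleftrightarrow>
     (\<forall>M\<ge>1. \<forall>\<epsilon>. 0 < \<epsilon> \<and> \<epsilon> < pi \<longrightarrow>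
        (\<lambda>s. gamma_quot \<sigma> s / gamma_quot_factor \<sigma> s
              - (\<Sum>j<M. of_real (c j) / pochhammer (of_real (kap \<sigma>) * s + of_real (theta' \<sigma>)) j))
        \<in> O[sector_at_infinity \<epsilon>](\<lambda>s. 1 / pochhammer (of_real (kap \<sigma>) * s + of_real (theta' \<sigma>)) M))"

text \<open>The coefficients of an inverse factorial expansion are determined by the function, so the
  definite description picks out the one sequence for which the expansion is valid.\<close>

definition c_coeff :: "real \<Rightarrow> nat \<Rightarrow> real" where
  "c_coeff \<sigma> = (THE c. inverse_factorial_expansion \<sigma> c)"

text \<open>Partial sums of the formal expansions \<open>E'(x)\<close> (terms \<open>0 \<le> j < M\<close>) and
  \<open>H'(x)\<close> (terms \<open>0 \<le> k < N\<close>).\<close>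

definition E'_trunc :: "real \<Rightarrow> nat \<Rightarrow> real \<Rightarrow> real" where
  "E'_trunc \<sigma> M x =
     Acon' \<sigma> / pi * bigX \<sigma> x powr (1 / 2) * exp (bigX \<sigma> x * cos (pi * \<sigma> / kap \<sigma>)) *
     (\<Sum>j<M. c_coeff \<sigma> j / (- bigX \<sigma> x) ^ j *
        cos (bigX \<sigma> x * sin (pi * \<sigma> / kap \<sigma>) + pi / kap \<sigma> * (1 / 2 - real j)))"

definition H'_trunc :: "real \<Rightarrow> nat \<Rightarrow> real \<Rightarrow> real" where
  "H'_trunc \<sigma> N x =
     1 / \<sigma> * (\<Sum>k<N. x powr (- (real (k + 1) / \<sigma>)) / fact k * rGamma (1 - real (k + 1) / \<sigma>))"

end

theory Submission
  imports Defs "HOL-Complex_Analysis.Complex_Analysis" "HOL-Real_Asymp.Real_Asymp"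
begin

text \<open>
  The proof is the method of steepest descent, arranged so that no contour has to be integrated over.
  For \<open>c > 0\<close> and \<open>d = - \<xi> c\<^sup>\<sigma>\<close> put \<open>w(z) = exp (c e\<^sup>z + d e\<^sup>\<sigma>\<^sup>z + z)\<close>. Expanding in powers of \<open>d\<close> and
  using Euler's integral together with the reflection formula for \<open>1 / \<Gamma>\<close> shows that
  \<open>F\<^sub>\<sigma>(\<xi>) = (c / \<pi>) Im \<integral> w\<close> along the line \<open>Im z = \<pi>\<close> (lemma \<open>wright_F_line_integral\<close>).
  Since \<open>w\<close> is entire it has a primitive \<open>P\<close>, and the integral is a difference of limits of \<open>P\<close>. At the
  left end the limit of \<open>P\<close> is the same on all horizontal lines, at the right end on all those with
  \<open>cos (Im z) < 0\<close> in one strip. Deforming the contour therefore just means to write the difference of the two limits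
  as a sum of increments of \<open>P\<close>.

  Let \<open>\<kappa> = 1 - \<sigma>\<close> and \<open>c = X \<sigma> / \<kappa>\<close>. The exponent is then governed by
  \<open>f(z) = (e\<^sup>\<sigma>\<^sup>z - \<sigma> e\<^sup>z) / \<kappa>\<close>, which has a saddle at \<open>0\<close> with \<open>f(0) = 1\<close>. For \<open>\<xi> = x > 0\<close> the exponent is \<open>- X f(z) + z\<close>;
  the path crosses \<open>0\<close> vertically and yields \<open>e\<^sup>-\<^sup>X\<close>. For \<open>\<xi> = - x\<close> a translation by
  \<open>\<i> \<pi> / \<kappa>\<close> turns it, up to a constant factor of \<open>w\<close>, into \<open>X e\<^sup>\<i>\<^sup>\<beta> f(z) + z\<close> with \<open>\<beta> = \<pi> \<sigma> / \<kappa>\<close>, and the saddle yields \<open>E'\<close>.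
  \<^item> If \<open>\<sigma> < 1 / 3\<close>, the line \<open>Im z = \<pi> / \<kappa>\<close> is an admissible path of descent. As \<open>cos \<beta> > 0\<close>, the error
    term in \<open>E'\<close> absorbs the bounded function \<open>H'\<close>.
  \<^item> If \<open>\<sigma> > 1 / 3\<close>, there is a line \<open>Im z = \<theta>\<close> with \<open>cos \<theta> < 0\<close> and \<open>cos \<sigma>\<theta> < 0\<close>. On it \<open>exp (c e\<^sup>z)\<close> may be
    replaced by its Taylor polynomial, as in Watson's lemma, which gives \<open>H'\<close>. For \<open>\<sigma> < 1 / 2\<close> the
    expansion \<open>E'\<close> is then exponentially small because \<open>cos \<beta> < 0\<close>.
  \<^item> If \<open>\<sigma> = 1 / 3\<close>, then \<open>cos \<beta> = 0\<close> and neither part is negligible. The path comes in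
    slightly above the height \<open>3 \<pi> / 2\<close>, where Watson's argument applies, descends through the
    saddle, and leaves slightly below that height, where the integrand is exponentially small.

  The saddle expansion (lemma \<open>saddle_expansion\<close>) is obtained by repeated integration by parts with
  unspecified coefficients \<open>a\<^sub>j\<close>, the same for all directions through the saddle. That \<open>a\<^sub>j = c\<^sub>j\<close> (lemma
  \<open>saddle_series_eq_c_coeff\<close>) is seen as follows. Let \<open>Q(u)\<close> be \<open>\<Gamma>(\<sigma>u) \<Gamma>(\<kappa>u + 1/2) / \<Gamma>(u)\<close> divided by its leading
  behaviour. Stirling's formula gives \<open>Q(u) \<sim> \<Sum> c\<^sub>j / (\<kappa>u + 1/2)\<^sub>j\<close> in every sector avoiding the negative axis;
  in particular the \<open>c\<^sub>j\<close> exist and are unique. The reflection formula shows that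
  \<open>Q(u) Q(- u) - 1\<close> is exponentially small on the imaginary axis, hence
  \<open>1 / Q(s) \<sim> \<Sum> c\<^sub>j / (1/2 - \<kappa>s)\<^sub>j\<close>. On the other hand, the Mellin transform of \<open>F\<^sub>\<sigma>\<close> is \<open>\<Gamma>(s) / \<Gamma>(\<sigma>s)\<close>, and
  integrating the expansion of \<open>F\<^sub>\<sigma>(x)\<close> for \<open>x > 0\<close> term by term gives \<open>1 / Q(s) \<sim> \<Sum> a\<^sub>j / (1/2 - \<kappa>s)\<^sub>j\<close>.
  Inverse factorial series are unique.
\<close>


section \<open>Primitives of entire functions and the Euler integral\<close>

abbreviation pt :: "real \<Rightarrow> real \<Rightarrow> complex" where
  "pt u v \<equiv> of_real u + \<i> * of_real v"

lemma primitive_vector_derivative: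
  fixes P f :: "complex \<Rightarrow> complex"
  assumes "\<And>z. (P has_field_derivative f z) (at z)"
  shows "((\<lambda>u. P (complex_of_real u + h)) has_vector_derivative f (complex_of_real u + h)) (at u within S)"
proof -
  have "((\<lambda>u. complex_of_real u + h) has_vector_derivative 1) (at u within S)"
    by (auto intro!: derivative_eq_intros)
  from field_vector_diff_chain_within[OF this has_field_derivative_at_within[OF assms]]
  show ?thesis by (simp add: o_def)
qed

lemma entire_primitive:
  assumes "f holomorphic_on UNIV"
  shows "\<exists>P. \<forall>z. (P has_field_derivative f z) (at z)"
  using holomorphic_convex_primitive'[OF convex_UNIV open_UNIV assms] by auto

lemma primitive_continuous_line:
  assumes "\<And>z. (P has_field_derivative f z) (at z)" "f holomorphic_on UNIV"
  shows "continuous_on S (\<lambda>u. f (complex_of_real u + h))"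
  by (intro continuous_on_compose2[OF holomorphic_on_imp_continuous_on[OF assms(2)]] continuous_intros) auto

lemma primitive_tail_right:
  fixes P f :: "complex \<Rightarrow> complex"
  assumes P: "\<And>z. (P has_field_derivative f z) (at z)" and f: "f holomorphic_on UNIV"
      and int: "set_integrable lborel {a..} (\<lambda>u. f (complex_of_real u + h))"
  shows "((\<lambda>u. P (of_real u + h)) \<longlongrightarrow>
           P (of_real a + h) + (LBINT u:{a..}. f (of_real u + h))) at_top"
proof -
  have "((\<lambda>b. LBINT u:{a..b}. f (of_real u + h)) \<longlongrightarrow> (LBINT u:{a..}. f (of_real u + h))) at_top"
    by (rule tendsto_set_lebesgue_integral_at_top[OF _ int]) auto
  hence "((\<lambda>b. P (of_real a + h) + (LBINT u:{a..b}. f (of_real u + h))) \<longlongrightarrow>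
      P (of_real a + h) + (LBINT u:{a..}. f (of_real u + h))) at_top"
    by (intro tendsto_intros)
  thus ?thesis
  proof (rule Lim_transform_eventually)
    show "\<forall>\<^sub>F b in at_top. P (of_real a + h) + (LBINT u:{a..b}. f (of_real u + h)) = P (of_real b + h)"
      using eventually_ge_at_top[of a]
    proof eventually_elim
      case (elim b)
      have "(LBINT u:{a..b}. f (of_real u + h)) = P (of_real b + h) - P (of_real a + h)"
        unfolding set_lebesgue_integral_def
        by (rule integral_FTC_atLeastAtMost[OF elim])
           (auto intro!: primitive_vector_derivative P primitive_continuous_line[OF P f])
      thus ?case by simp
    qed
  qed
qed

lemma primitive_tail_left:
  fixes P f :: "complex \<Rightarrow> complex"
  assumes P: "\<And>z. (P has_field_derivative f z) (at z)" and f: "f holomorphic_on UNIV"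
      and int: "set_integrable lborel {..b} (\<lambda>u. f (complex_of_real u + h))"
  shows "((\<lambda>u. P (of_real u + h)) \<longlongrightarrow>
           P (of_real b + h) - (LBINT u:{..b}. f (of_real u + h))) at_bot"
proof -
  have "((\<lambda>a. LBINT u:{a..b}. f (of_real u + h)) \<longlongrightarrow> (LBINT u:{..b}. f (of_real u + h))) at_bot"
    by (rule tendsto_set_lebesgue_integral_at_bot[OF _ int]) auto
  hence "((\<lambda>a. P (of_real b + h) - (LBINT u:{a..b}. f (of_real u + h))) \<longlongrightarrow>
      P (of_real b + h) - (LBINT u:{..b}. f (of_real u + h))) at_bot"
    by (intro tendsto_intros)
  thus ?thesis
  proof (rule Lim_transform_eventually)
    show "\<forall>\<^sub>F a in at_bot. P (of_real b + h) - (LBINT u:{a..b}. f (of_real u + h)) = P (of_real a + h)"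
      using eventually_le_at_bot[of b]
    proof eventually_elim
      case (elim a)
      have "(LBINT u:{a..b}. f (of_real u + h)) = P (of_real b + h) - P (of_real a + h)"
        unfolding set_lebesgue_integral_def
        by (rule integral_FTC_atLeastAtMost[OF elim])
           (auto intro!: primitive_vector_derivative P primitive_continuous_line[OF P f])
      thus ?case by simp
    qed
  qed
qed

lemma primitive_line_integral:
  fixes P f :: "complex \<Rightarrow> complex"
  assumes P: "\<And>z. (P has_field_derivative f z) (at z)" and f: "f holomorphic_on UNIV"
      and int: "integrable lborel (\<lambda>u. f (complex_of_real u + h))"
  obtains L R where "((\<lambda>u. P (of_real u + h)) \<longlongrightarrow> L) at_bot"
    "((\<lambda>u. P (of_real u + h)) \<longlongrightarrow> R) at_top"
    "(LBINT u. f (of_real u + h)) = R - L"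
proof -
  let ?g = "\<lambda>u. f (complex_of_real u + h)"
  have s: "set_integrable lborel A ?g" if "A \<in> sets borel" for A
    unfolding set_integrable_def using int integrable_mult_indicator[of A lborel ?g] that by simp
  have U: "(LBINT u. ?g u) = (LBINT u:{..0}. ?g u) + (LBINT u:{0..}. ?g u)"
  proof -
    have "(LBINT u:{..0}\<union>{0<..}. ?g u) = (LBINT u:{..0}. ?g u) + (LBINT u:{0<..}. ?g u)"
      by (rule set_integral_Un) (auto intro: s)
    moreover have "{..0}\<union>{0<..} = (UNIV::real set)" by auto
    moreover have "(LBINT u:{0<..}. ?g u) = (LBINT u:{0..}. ?g u)"
      unfolding set_lebesgue_integral_def
    proof (rule integral_cong_AE)
      show "AE x in lborel. indicat_real {0<..} x *\<^sub>R ?g x = indicat_real {0..} x *\<^sub>R ?g x"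
        using AE_lborel_singleton[of 0] by eventually_elim (auto simp: indicator_def)
    qed (use s[of "{0<..}"] s[of "{0..}"] in \<open>auto simp: set_integrable_def dest!: borel_measurable_integrable\<close>)
    ultimately show ?thesis by (simp add: set_lebesgue_integral_def)
  qed
  show ?thesis
    by (rule that[OF primitive_tail_left[OF P f s[of "{..0}"]] primitive_tail_right[OF P f s[of "{0..}"]]])
       (auto simp: U)
qed

lemma primitive_vertical_bound:
  assumes P: "\<And>z. (P has_field_derivative f z) (at z)"
      and B: "\<And>v. v \<in> closed_segment a b \<Longrightarrow> norm (f (pt u v)) \<le> B"
  shows "norm (P (pt u b) - P (pt u a)) \<le> B * \<bar>b - a\<bar>"
proof -
  have "norm (P (pt u b) - P (pt u a))
    \<le> B * norm ((pt u b) - (pt u a))"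
  proof (rule field_differentiable_bound)
    show "convex (closed_segment (pt u a) (pt u b))" by simp
    show "norm (f z) \<le> B" if "z \<in> closed_segment (pt u a) (pt u b)" for z
    proof -
      from that obtain t where t: "0 \<le> t" "t \<le> 1"
        "z = (1 - t) *\<^sub>R (pt u a) + t *\<^sub>R (pt u b)"
        unfolding in_segment by auto
      have "z = of_real u + \<i> * of_real ((1 - t) *\<^sub>R a + t *\<^sub>R b)"
        using t by (simp add: scaleR_conv_of_real algebra_simps)
      moreover have "(1 - t) *\<^sub>R a + t *\<^sub>R b \<in> closed_segment a b" using t unfolding in_segment by blast
      ultimately show ?thesis using B by blast
    qed
  qed (auto intro: has_field_derivative_at_within P)
  also have "(pt u b) - (pt u a) = \<i> * complex_of_real (b - a)"
    by (simp add: algebra_simps)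
  finally show ?thesis by (simp only: norm_mult norm_ii norm_of_real mult_1)
qed

text \<open>If the derivative of \<open>P\<close> tends to \<open>0\<close> uniformly on a horizontal strip, vertical displacements do not
  change the limit of \<open>P\<close>. This is what replaces the shift of a contour. The height \<open>\<eta>\<close> may vary along
  the filter, which is needed for curves that are only asymptotically horizontal.\<close>
lemma primitive_strip_limit:
  fixes F :: "real filter"
  assumes P: "\<And>z. (P has_field_derivative f z) (at z)"
      and g: "(g \<longlongrightarrow> 0) F"
      and B: "\<And>u v. v \<in> S \<Longrightarrow> norm (f (pt u v)) \<le> g u"
      and S: "convex S" "bounded S" "a \<in> S" "\<forall>\<^sub>F r in G. \<eta> r \<in> S" "filterlim U F G"
      and L: "((\<lambda>u. P (pt u a)) \<longlongrightarrow> L) F"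
  shows "((\<lambda>r. P (pt (U r) (\<eta> r))) \<longlongrightarrow> L) G"
proof -
  from \<open>bounded S\<close> obtain D where D: "\<And>x. x \<in> S \<Longrightarrow> \<bar>x\<bar> \<le> D" by (auto simp: bounded_iff)
  have "((\<lambda>r. P (pt (U r) (\<eta> r)) - P (pt (U r) a)) \<longlongrightarrow> 0) G"
  proof (rule Lim_null_comparison)
    show "\<forall>\<^sub>F r in G. norm (P (pt (U r) (\<eta> r)) - P (pt (U r) a)) \<le> g (U r) * (2 * D)"
      using S(4)
    proof eventually_elim
      case (elim r)
      have "norm (P (pt (U r) (\<eta> r)) - P (pt (U r) a)) \<le> g (U r) * \<bar>\<eta> r - a\<bar>"
        by (rule primitive_vertical_bound[OF P])
           (use elim S closed_segment_subset[of a S "\<eta> r"] in \<open>auto intro!: B\<close>)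
      also have "\<dots> \<le> g (U r) * (2 * D)"
        using D[OF elim] D[OF S(3)] order_trans[OF norm_ge_zero B[OF S(3)]]
        by (intro mult_left_mono) (auto simp: abs_le_iff)
      finally show ?case .
    qed
    show "((\<lambda>r. g (U r) * (2 * D)) \<longlongrightarrow> 0) G"
      using tendsto_mult_right[OF filterlim_compose[OF g S(5)], of "2*D"] by simp
  qed
  from tendsto_add[OF this filterlim_compose[OF L S(5)]] show ?thesis by simp
qed

text \<open>Euler's integral in the variable \<open>t = e\<^sup>u\<close>, the form in which integrals along horizontal lines
  produce Gamma values.\<close>
lemma exp_gamma_integral_1:
  assumes p: "p > (0::real)"
  shows "integrable lborel (\<lambda>u. exp (p * u - exp u))"
    and "(LBINT u. exp (p * u - exp u)) = Gamma p"
proof -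
  let ?f = "\<lambda>t::real. t powr (p - 1) / exp t"
  have hi: "(?f has_integral Gamma p) {0<..}"
    using Gamma_integral_real[OF p] has_integral_interior[of "{0::real..}" ?f "Gamma p"] by simp
  hence gi: "integral {0<..} ?f = Gamma p" by (rule integral_unique)
  have ai: "?f absolutely_integrable_on {0<..}"
    by (rule nonnegative_absolutely_integrable_1) (use hi in \<open>auto simp: integrable_on_def\<close>)
  have rng: "range (exp :: real \<Rightarrow> real) = {0<..}"
    by (force intro: exp_ln[symmetric])
  have "(\<lambda>u. \<bar>exp u\<bar> * ?f (exp u)) absolutely_integrable_on UNIV \<and>
        integral UNIV (\<lambda>u. \<bar>exp u\<bar> * ?f (exp u)) = Gamma p"
    using has_absolute_integral_change_of_variables_1'[of UNIV exp exp ?f "Gamma p"] ai gi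
    by (auto simp: rng intro!: derivative_eq_intros inj_onI)
  moreover have "\<bar>exp u\<bar> * ?f (exp u) = exp (p * u - exp u)" for u :: real
    by (simp add: powr_def exp_diff field_simps flip: exp_add)
  ultimately have *: "(\<lambda>u. exp (p * u - exp u)) absolutely_integrable_on UNIV"
       "integral UNIV (\<lambda>u. exp (p * u - exp u)) = Gamma p" by simp_all
  from *(1) have l: "integrable lebesgue (\<lambda>u. exp (p * u - exp u))" by (simp add: set_integrable_def)
  have m: "(\<lambda>u. exp (p * u - exp u)) \<in> borel_measurable lborel" by measurable
  from l show i: "integrable lborel (\<lambda>u. exp (p * u - exp u))"
    using integrable_completion[OF m] by simp
  show "(LBINT u. exp (p * u - exp u)) = Gamma p"
    using *(2) integral_lborel[OF i] by simp
qed


lemma exp_gamma_integral_pos: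
  assumes p: "p > (0::real)" and q: "q > 0" and c: "c > 0"
  shows "integrable lborel (\<lambda>u. exp (p * u - c * exp (q * u)))"
    and "(LBINT u. exp (p * u - c * exp (q * u))) = Gamma (p / q) / q * c powr (- (p / q))"
proof -
  let ?g = "\<lambda>u. exp ((p / q) * u - exp u)"
  let ?h = "\<lambda>u. c powr (- (p / q)) * ?g (ln c + q * u)"
  have i: "integrable lborel ?g" by (rule exp_gamma_integral_1) (use p q in auto)
  have I: "(LBINT u. ?g u) = Gamma (p / q)" by (rule exp_gamma_integral_1) (use p q in auto)
  have eq: "exp (p * u - c * exp (q * u)) = ?h u" for u
  proof -
    have "exp (ln c + q * u) = c * exp (q * u)" using c by (simp add: exp_add)
    moreover have "p / q * (ln c + q * u) = p / q * ln c + p * u" using q by (simp add: field_simps)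
    ultimately show ?thesis using c by (simp add: powr_def algebra_simps flip: exp_add)
  qed
  show "integrable lborel (\<lambda>u. exp (p * u - c * exp (q * u)))"
    unfolding eq using lborel_integrable_real_affine[OF i, of q "ln c"] q by (intro integrable_mult_right) auto
  show "(LBINT u. exp (p * u - c * exp (q * u))) = Gamma (p / q) / q * c powr (- (p / q))"
    unfolding eq using lborel_integral_real_affine[of q ?g "ln c"] q I by (simp add: field_simps)
qed

lemma exp_gamma_integral_1_complex:
  assumes p: "p > (0::real)" and c: "Re c > 0"
  shows "(LBINT u. exp (of_real (p * u) - c * of_real (exp u))) = of_real (Gamma p) * exp (- of_real p * Ln c)"
proof -
  define f where "f = (\<lambda>z::complex. exp (of_real p * z - exp z))"
  have fh: "f holomorphic_on UNIV" unfolding f_def by (intro holomorphic_intros)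
  from entire_primitive[OF this] obtain P where P: "\<And>z. (P has_field_derivative f z) (at z)" by blast
  have c0: "c \<noteq> 0" using c by auto
  define l where "l = Re (Ln c)"
  define \<psi> where "\<psi> = Im (Ln c)"
  have \<psi>: "\<bar>\<psi>\<bar> < pi / 2" unfolding \<psi>_def using Im_Ln_less_pi c c0 Re_Ln_pos_lt_imp[of c]
    by (simp add: Re_Ln_pos_lt_imp)
  define k where "k = cos \<psi>"
  have k: "k > 0" unfolding k_def using \<psi> by (intro cos_gt_zero_pi) auto
  define g where "g = (\<lambda>u. exp (p * u - k * exp (1 * u)))"
  have B: "norm (f (pt u v)) \<le> g u" if "v \<in> {- \<bar>\<psi>\<bar>..\<bar>\<psi>\<bar>}" for u v
  proof -
    have "cos v = cos \<bar>v\<bar>" by simp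
    also have "cos \<bar>v\<bar> \<ge> cos \<bar>\<psi>\<bar>" using that \<psi> by (intro cos_monotone_0_pi_le) auto
    finally have "k \<le> cos v" by (simp add: k_def)
    thus ?thesis by (simp add: f_def g_def Re_exp)
  qed
  have gi: "integrable lborel g" unfolding g_def by (rule exp_gamma_integral_pos[OF p _ k]) auto
  have fi: "integrable lborel (\<lambda>u. f (pt u v))" if "v \<in> {- \<bar>\<psi>\<bar>..\<bar>\<psi>\<bar>}" for v
  proof (rule Bochner_Integration.integrable_bound[OF gi])
    show "(\<lambda>u. f (pt u v)) \<in> borel_measurable lborel"
      unfolding f_def by measurable
    show "AE u in lborel. norm (f (pt u v)) \<le> norm (g u)"
      using B[OF that] abs_ge_self order_trans by (intro AE_I2) fastforce
  qed
  obtain L R where LR: "((\<lambda>u. P (pt u 0)) \<longlongrightarrow> L) at_bot"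
    "((\<lambda>u. P (pt u 0)) \<longlongrightarrow> R) at_top"
    "(LBINT u. f (pt u 0)) = R - L"
    by (rule primitive_line_integral[OF P fh fi[of 0]]) auto
  obtain L' R' where LR': "((\<lambda>u. P (pt u \<psi>)) \<longlongrightarrow> L') at_bot"
    "((\<lambda>u. P (pt u \<psi>)) \<longlongrightarrow> R') at_top"
    "(LBINT u. f (pt u \<psi>)) = R' - L'"
    by (rule primitive_line_integral[OF P fh fi[of \<psi>]]) auto
  have gt: "(g \<longlongrightarrow> 0) at_top" unfolding g_def using k p by real_asymp
  have gb: "(g \<longlongrightarrow> 0) at_bot" unfolding g_def using k p by real_asymp
  have "((\<lambda>u. P (pt u \<psi>)) \<longlongrightarrow> R) at_top"
    by (rule primitive_strip_limit[OF P gt B _ _ _ _ filterlim_ident LR(2), of "{- \<bar>\<psi>\<bar>..\<bar>\<psi>\<bar>}"]) auto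
  hence 1: "R = R'" using LR'(2) by (intro tendsto_unique) auto
  have "((\<lambda>u. P (pt u \<psi>)) \<longlongrightarrow> L) at_bot"
    by (rule primitive_strip_limit[OF P gb B _ _ _ _ filterlim_ident LR(1), of "{- \<bar>\<psi>\<bar>..\<bar>\<psi>\<bar>}"]) auto
  hence 2: "L = L'" using LR'(1) by (intro tendsto_unique) auto
  have "(LBINT u. f (of_real u)) = (LBINT u. complex_of_real (exp (p * u - exp u)))"
    by (intro Bochner_Integration.integral_cong) (auto simp: f_def exp_of_real simp flip: of_real_mult of_real_diff)
  also have "\<dots> = of_real (Gamma p)" by (simp add: exp_gamma_integral_1[OF p])
  finally have G: "(LBINT u. f (pt u \<psi>)) = of_real (Gamma p)" using LR(3) LR'(3) 1 2 by simp
  have Lc: "Ln c = of_real l + \<i> * of_real \<psi>" by (simp add: complex_eq_iff l_def \<psi>_def)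
  have "(LBINT u. exp (of_real (p * u) - c * of_real (exp u))) =
        (LBINT u. exp (- of_real p * Ln c) * f (pt (l + 1 * u) \<psi>))"
  proof (intro Bochner_Integration.integral_cong refl)
    fix u :: real
    have "of_real (l + 1 * u) + \<i> * of_real \<psi> = of_real u + Ln c" by (simp add: Lc)
    hence "f (pt (l + 1 * u) \<psi>) = exp (of_real p * (of_real u + Ln c) - exp (of_real u) * c)"
      using c0 by (simp only: f_def exp_add[of "of_real u" "Ln c"] exp_Ln[OF c0])
    thus "exp (of_real (p * u) - c * of_real (exp u)) =
        exp (- of_real p * Ln c) * f (pt (l + 1 * u) \<psi>)"
      by (simp add: algebra_simps exp_of_real flip: exp_add)
  qed
  also have "\<dots> = exp (- of_real p * Ln c) * (LBINT u. f (pt (l + 1 * u) \<psi>))"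
    by (rule integral_mult_right_zero)
  also have "(LBINT u. f (pt (l + 1 * u) \<psi>)) = of_real (Gamma p)"
    using lborel_integral_real_affine[of 1 "\<lambda>u. f (pt u \<psi>)" l] G by simp
  finally show ?thesis by (simp add: mult.commute)
qed

lemma exp_gamma_integrable_complex:
  assumes p: "p > (0::real)" and q: "q > 0" and c: "Re c > 0"
  shows "integrable lborel (\<lambda>u. exp (of_real (p * u) - c * of_real (exp (q * u))))"
  by (rule Bochner_Integration.integrable_bound[OF exp_gamma_integral_pos(1)[OF p q c]])
     (auto intro!: AE_I2 borel_measurable_continuous_onI continuous_intros)

lemma exp_gamma_integral_complex:
  assumes p: "p > (0::real)" and q: "q > 0" and c: "Re c > 0"
  shows "(LBINT u. exp (of_real (p * u) - c * of_real (exp (q * u)))) =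
           of_real (Gamma (p / q) / q) * exp (- of_real (p / q) * Ln c)"
proof -
  let ?g = "\<lambda>u. exp (of_real ((p / q) * u) - c * of_real (exp u))"
  have "(LBINT u. ?g u) = \<bar>q\<bar> *\<^sub>R (LBINT u. ?g (0 + q * u))"
    by (rule lborel_integral_real_affine) (use q in auto)
  also have "(LBINT u. ?g u) = of_real (Gamma (p / q)) * exp (- of_real (p / q) * Ln c)"
    by (rule exp_gamma_integral_1_complex) (use p q c in auto)
  finally show ?thesis using q by (simp add: scaleR_conv_of_real field_simps)
qed


section \<open>A line integral for the Wright function\<close>

definition wfun :: "real \<Rightarrow> real \<Rightarrow> real \<Rightarrow> real \<Rightarrow> complex \<Rightarrow> complex" where
  "wfun \<sigma> c d m z = exp (of_real c * exp z + of_real d * exp (of_real \<sigma> * z) + of_real m * z)"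

lemma wfun_holomorphic: "wfun \<sigma> c d m holomorphic_on S"
  unfolding wfun_def[abs_def] by (intro holomorphic_intros)

lemma Re_exp_line: "Re (exp (pt u v)) = exp u * cos v"
  by (simp add: Re_exp)

lemma norm_wfun:
  "norm (wfun \<sigma> c d m (pt u v)) =
     exp (c * exp u * cos v + d * exp (\<sigma> * u) * cos (\<sigma> * v) + m * u)"
proof -
  have "of_real \<sigma> * (pt u v) = of_real (\<sigma> * u) + \<i> * of_real (\<sigma> * v)"
    by (simp add: algebra_simps)
  moreover have "norm (exp (of_real c * A + of_real d * B + of_real m * C)) = exp (c * Re A + d * Re B + m * Re C)"
    for A B C by simp
  ultimately show ?thesis unfolding wfun_def by (simp only: Re_exp_line) (simp add: mult.assoc)
qed

lemma wfun_measurable: "(\<lambda>u. wfun \<sigma> c d m (of_real u + h)) \<in> borel_measurable lborel"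
  unfolding wfun_def by measurable

lemma exp_domination:
  fixes \<sigma> k d :: real
  assumes \<sigma>: "0 < \<sigma>" "\<sigma> < 1" and k: "k > 0"
  obtains C where "\<And>u. \<bar>d\<bar> * exp (\<sigma> * u) \<le> C + k * exp u"
proof -
  have "((\<lambda>u::real. exp ((\<sigma> - 1) * u) :: real) \<longlongrightarrow> 0) at_top" using \<sigma> by real_asymp
  moreover have "k / (\<bar>d\<bar> + 1) > 0" using k by simp
  ultimately have "eventually (\<lambda>u. exp ((\<sigma> - 1) * u) < k / (\<bar>d\<bar> + 1)) at_top" by (rule order_tendstoD)
  then obtain U where U: "\<And>u. u \<ge> U \<Longrightarrow> exp ((\<sigma> - 1) * u) < k / (\<bar>d\<bar> + 1)"
    by (auto simp: eventually_at_top_linorder)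
  show ?thesis
  proof (rule that[of "\<bar>d\<bar> * exp (\<sigma> * U)"])
    fix u show "\<bar>d\<bar> * exp (\<sigma> * u) \<le> \<bar>d\<bar> * exp (\<sigma> * U) + k * exp u"
    proof (cases "u \<ge> U")
      case True
      have "\<bar>d\<bar> * exp (\<sigma> * u) \<le> (\<bar>d\<bar> + 1) * exp ((\<sigma> - 1) * u) * exp u"
        by (simp add: algebra_simps flip: exp_add)
      also have "\<dots> \<le> (\<bar>d\<bar> + 1) * (k / (\<bar>d\<bar> + 1)) * exp u"
        using U[OF True] by (intro mult_right_mono mult_left_mono) auto
      also have "\<dots> = k * exp u" by simp
      finally show ?thesis by (simp add: add_increasing)
    next
      case False
      hence "\<bar>d\<bar> * exp (\<sigma> * u) \<le> \<bar>d\<bar> * exp (\<sigma> * U)" using \<sigma> by (intro mult_left_mono) auto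
      thus ?thesis using k by (simp add: add_increasing2)
    qed
  qed
qed

lemma wfun_right_bound:
  assumes c: "c > 0" and v: "cos v \<le> - k"
  shows "norm (wfun \<sigma> c d m (pt u v)) \<le> exp (- (c * k) * exp u + \<bar>d\<bar> * exp (\<sigma> * u) + m * u)"
proof -
  have "c * exp u * cos v \<le> c * exp u * (- k)" using c v by (intro mult_left_mono) auto
  hence "c * exp u * cos v \<le> - (c * k) * exp u" by (simp add: mult_ac)
  moreover have "d * exp (\<sigma> * u) * cos (\<sigma> * v) \<le> \<bar>d\<bar> * exp (\<sigma> * u) * 1"
  proof -
    have "d * exp (\<sigma> * u) * cos (\<sigma> * v) \<le> \<bar>d * exp (\<sigma> * u) * cos (\<sigma> * v)\<bar>" by simp
    also have "\<dots> \<le> \<bar>d\<bar> * exp (\<sigma> * u) * 1" unfolding abs_mult by (intro mult_mono) auto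
    finally show ?thesis .
  qed
  ultimately show ?thesis unfolding norm_wfun exp_le_cancel_iff by linarith
qed

lemma wfun_left_bound:
  assumes c: "c > 0"
  shows "norm (wfun \<sigma> c d m (pt u v)) \<le> exp (c * exp u + \<bar>d\<bar> * exp (\<sigma> * u) + m * u)"
proof -
  have "c * exp u * cos v \<le> c * exp u * 1" using c by (intro mult_left_mono) auto
  moreover have "d * exp (\<sigma> * u) * cos (\<sigma> * v) \<le> \<bar>d\<bar> * exp (\<sigma> * u) * 1"
  proof -
    have "d * exp (\<sigma> * u) * cos (\<sigma> * v) \<le> \<bar>d * exp (\<sigma> * u) * cos (\<sigma> * v)\<bar>" by simp
    also have "\<dots> \<le> \<bar>d\<bar> * exp (\<sigma> * u) * 1" unfolding abs_mult by (intro mult_mono) auto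
    finally show ?thesis .
  qed
  ultimately show ?thesis unfolding norm_wfun exp_le_cancel_iff by linarith
qed

lemma double_exp_tendsto_0:
  fixes K D \<sigma> m :: real
  assumes "0 < K" "0 < \<sigma>" "\<sigma> < 1"
  shows "((\<lambda>u. exp (- K * exp u + D * exp (\<sigma> * u) + m * u)) \<longlongrightarrow> 0) at_top"
  using assms by real_asymp

text \<open>Far to the right \<open>e\<^sup>z\<close> dominates \<open>e\<^sup>\<sigma>\<^sup>z\<close>, so that only the sign of \<open>cos (Im z)\<close> matters for decay.\<close>
lemma wfun_right_limit:
  assumes \<sigma>: "0 < \<sigma>" "\<sigma> < 1" and c: "c > 0"
      and P: "\<And>z. (P has_field_derivative wfun \<sigma> c d m z) (at z)"
      and S: "convex S" "bounded S" "a \<in> S" "\<forall>\<^sub>F r in G. \<eta> r \<in> S" "filterlim U at_top G"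
      and k: "k > 0" "\<And>v. v \<in> S \<Longrightarrow> cos v \<le> - k"
      and L: "((\<lambda>u. P (pt u a)) \<longlongrightarrow> L) at_top"
  shows "((\<lambda>r. P (pt (U r) (\<eta> r))) \<longlongrightarrow> L) G"
proof (rule primitive_strip_limit[OF P _ _ S L])
  have "c * k > 0" using c k by simp
  thus "((\<lambda>u. exp (- (c * k) * exp u + \<bar>d\<bar> * exp (\<sigma> * u) + m * u)) \<longlongrightarrow> 0) at_top"
    using \<sigma> by (rule double_exp_tendsto_0)
qed (use wfun_right_bound[OF c k(2)] in auto)

text \<open>Far to the left the factor \<open>e\<^sup>m\<^sup>z\<close> decays whatever the height is.\<close>
lemma wfun_left_limit:
  assumes \<sigma>: "0 < \<sigma>" and c: "c > 0" and m: "m > 0"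
      and P: "\<And>z. (P has_field_derivative wfun \<sigma> c d m z) (at z)"
      and L: "((\<lambda>u. P (pt u a)) \<longlongrightarrow> L) at_bot"
  shows "((\<lambda>u. P (pt u b)) \<longlongrightarrow> L) at_bot"
proof (rule primitive_strip_limit[OF P, where S = "closed_segment a b" and a = a])
  have "((\<lambda>u. exp (c * exp u)) \<longlongrightarrow> 1) at_bot" by real_asymp
  moreover have "((\<lambda>u. exp (\<bar>d\<bar> * exp (\<sigma> * u))) \<longlongrightarrow> 1) at_bot" using \<sigma> by real_asymp
  moreover have "((\<lambda>u. exp (m * u)) \<longlongrightarrow> 0) at_bot" using m by real_asymp
  ultimately have "((\<lambda>u. exp (c * exp u) * exp (\<bar>d\<bar> * exp (\<sigma> * u)) * exp (m * u)) \<longlongrightarrow> 1 * 1 * 0) at_bot"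
    by (intro tendsto_mult)
  thus "((\<lambda>u. exp (c * exp u + \<bar>d\<bar> * exp (\<sigma> * u) + m * u)) \<longlongrightarrow> 0) at_bot"
    by (simp add: exp_add)
qed (use wfun_left_bound[OF c] L in \<open>auto intro: bounded_closed_segment filterlim_ident\<close>)

lemma wfun_integrable:
  assumes \<sigma>: "0 < \<sigma>" "\<sigma> < 1" and c: "c > 0" and m: "m > 0" and v: "cos v < 0"
  shows "integrable lborel (\<lambda>u. wfun \<sigma> c d m (pt u v))"
proof -
  define k where "k = - cos v"
  have k: "k > 0" "cos v \<le> - k" using v by (auto simp: k_def)
  have ck: "c * k / 2 > 0" using c k by simp
  obtain C where C: "\<And>u. \<bar>d\<bar> * exp (\<sigma> * u) \<le> C + c * k / 2 * exp u"
    using exp_domination[OF \<sigma> ck, of d] by blast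
  have i: "integrable lborel (\<lambda>u. exp C * exp (m * u - c * k / 2 * exp (1 * u)))"
    by (intro integrable_mult_right exp_gamma_integral_pos m ck) auto
  show ?thesis
  proof (rule Bochner_Integration.integrable_bound[OF i wfun_measurable], intro AE_I2)
    fix u
    have "norm (wfun \<sigma> c d m (pt u v)) \<le> exp (- (c * k) * exp u + \<bar>d\<bar> * exp (\<sigma> * u) + m * u)"
      by (rule wfun_right_bound[OF c k(2)])
    also have "\<dots> \<le> exp (C + (m * u - c * k / 2 * exp u))" using C[of u] by (simp add: algebra_simps)
    also have "\<dots> = norm (exp C * exp (m * u - c * k / 2 * exp (1 * u)))" by (simp add: exp_add)
    finally show "norm (wfun \<sigma> c d m (pt u v)) \<le> norm (exp C * exp (m * u - c * k / 2 * exp (1 * u)))" .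
  qed
qed

text \<open>The limit of \<open>P\<close> at the left end lies on the real axis as well, where the integrand is real. Hence
  the imaginary part of this limit can be read off at any real point, in particular at the saddle.\<close>
lemma Im_primitive_real_axis:
  assumes P: "\<And>z. (P has_field_derivative f z) (at z)" and f: "\<And>u. f (of_real u) \<in> \<real>"
  shows "Im (P (of_real a)) = Im (P (of_real b))"
proof -
  have "((\<lambda>u. Im (P (of_real u))) has_real_derivative 0) (at u)" for u
  proof -
    have "((\<lambda>u. P (complex_of_real u + 0)) has_vector_derivative f (of_real u + 0)) (at u)"
      by (rule primitive_vector_derivative[OF P])
    hence "((\<lambda>u. Im (P (complex_of_real u + 0))) has_vector_derivative Im (f (of_real u + 0))) (at u)"
      by (rule bounded_linear.has_vector_derivative[OF bounded_linear_Im])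
    moreover have "Im (f (of_real u)) = 0" using f by (simp add: complex_is_Real_iff)
    ultimately show ?thesis by (simp add: has_real_derivative_iff_has_vector_derivative)
  qed
  thus ?thesis by (intro DERIV_isconst_all) auto
qed

lemma wfun_real: "wfun \<sigma> c d m (of_real u) \<in> \<real>"
proof -
  have "wfun \<sigma> c d m (of_real u) = of_real (exp (c * exp u + d * exp (\<sigma> * u) + m * u))"
    by (simp add: wfun_def exp_of_real flip: of_real_mult of_real_add)
  thus ?thesis by simp
qed

lemma wfun_line_pi:
  assumes \<sigma>: "0 < \<sigma>" "\<sigma> < 1" and c: "c > 0" and m: "m > 0"
      and P: "\<And>z. (P has_field_derivative wfun \<sigma> c d m z) (at z)"
  obtains L L0 where "((\<lambda>u. P (pt u pi)) \<longlongrightarrow> L) at_top"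
     "((\<lambda>u. P (pt u pi)) \<longlongrightarrow> L0) at_bot"
     "\<And>a. Im L0 = Im (P (of_real a))"
     "(LBINT u. wfun \<sigma> c d m (pt u pi)) = L - L0"
proof -
  obtain L0 L where L: "((\<lambda>u. P (pt u pi)) \<longlongrightarrow> L0) at_bot"
    "((\<lambda>u. P (pt u pi)) \<longlongrightarrow> L) at_top"
    "(LBINT u. wfun \<sigma> c d m (pt u pi)) = L - L0"
    by (rule primitive_line_integral[OF P wfun_holomorphic wfun_integrable[OF \<sigma> c m, of pi]]) auto
  have Im: "Im L0 = Im (P (of_real a))" for a
  proof -
    have "((\<lambda>u. P (pt u 0)) \<longlongrightarrow> L0) at_bot" by (rule wfun_left_limit[OF \<sigma>(1) c m P L(1)])
    hence "((\<lambda>u. Im (P (of_real u))) \<longlongrightarrow> Im L0) at_bot" by (auto intro: tendsto_Im)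
    moreover have "(\<lambda>u. Im (P (of_real u))) = (\<lambda>u. Im (P (of_real a)))"
      using Im_primitive_real_axis[OF P wfun_real] by blast
    ultimately show ?thesis by (metis tendsto_const tendsto_unique trivial_limit_at_bot_linorder)
  qed
  show ?thesis by (rule that[OF L(2) L(1) Im L(3)])
qed

lemma rGamma_real_reflection:
  assumes "p < (1::real)"
  shows "rGamma p = Gamma (1 - p) * sin (pi * p) / pi"
proof -
  have "complex_of_real (rGamma p * rGamma (1 - p)) = of_real (sin (pi * p) / pi)"
    using rGamma_reflection_complex[of "of_real p"]
    by (simp add: rGamma_complex_of_real[symmetric] sin_of_real[symmetric])
  hence "rGamma p * rGamma (1 - p) = sin (pi * p) / pi" by (simp only: of_real_eq_iff)
  moreover have "Gamma (1 - p) > 0" using assms by (intro Gamma_real_pos) auto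
  ultimately show ?thesis by (simp add: rGamma_inverse_Gamma[of "1 - p"] field_simps)
qed

lemma norm_exp_partial_sum: "norm (\<Sum>n<N. w ^ n / fact n :: complex) \<le> exp (norm w)"
proof -
  have "norm (\<Sum>n<N. w ^ n / fact n) \<le> (\<Sum>n<N. norm w ^ n /\<^sub>R fact n)"
    by (rule order_trans[OF norm_sum]) (auto intro!: sum_mono simp: norm_divide norm_power norm_mult norm_inverse divide_inverse mult.commute)
  also have "\<dots> \<le> (\<Sum>n. norm w ^ n /\<^sub>R fact n)"
    by (rule sum_le_suminf[OF summable_exp_generic]) auto
  also have "\<dots> = exp (norm w)" by (simp add: exp_def)
  finally show ?thesis .
qed

text \<open>On \<open>Im z = \<pi>\<close> the factor \<open>exp (c e\<^sup>z)\<close> decays doubly exponentially, so the series of \<open>exp (d e\<^sup>\<sigma>\<^sup>z)\<close> may be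
  integrated termwise. Up to a power of \<open>c\<close> the \<open>n\<close>-th term is \<open>\<Gamma>(1 + n\<sigma>)\<close> times a phase, whose imaginary part turns it
  into \<open>1 / \<Gamma>(- n\<sigma>)\<close>; the term \<open>n = 0\<close> is real and drops out.\<close>
theorem wright_F_line_integral:
  assumes \<sigma>: "0 < \<sigma>" "\<sigma> < 1" and c: "c > 0"
  shows "wright_F \<sigma> \<xi> = c / pi * Im (LBINT u. wfun \<sigma> c (- \<xi> * c powr \<sigma>) 1 (pt u pi))"
proof -
  define d where "d = - \<xi> * c powr \<sigma>"
  define w where "w = (\<lambda>u. of_real d * exp (of_real \<sigma> * (pt u pi)))"
  define b where "b = (\<lambda>u. exp (of_real c * exp (pt u pi) + (pt u pi)))"
  define s where "s = (\<lambda>N u. (\<Sum>n<N. w u ^ n / fact n) * b u)"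
  define T where "T = (\<lambda>n. (- \<xi>) ^ n / fact n * rGamma (- (real n * \<sigma>)))"
  have wm: "w \<in> borel_measurable lborel" unfolding w_def by measurable
  have bm: "b \<in> borel_measurable lborel" unfolding b_def by measurable
  have f: "wfun \<sigma> c d 1 (pt u pi) = exp (w u) * b u" for u
    by (simp only: wfun_def w_def b_def exp_add[symmetric] of_real_1 mult_1_left add_ac)
  have nw: "norm (w u) = \<bar>d\<bar> * exp (\<sigma> * u)" for u by (simp add: w_def norm_mult)
  have nb: "norm (b u) = exp (u - c * exp u)" for u by (simp add: b_def Re_exp_line)
  have trm: "(LBINT u. w u ^ n / fact n * b u) = of_real (d ^ n / fact n * (Gamma (1 + real n * \<sigma>) * c powr (- (1 + real n * \<sigma>)))) * cis (pi * (1 + real n * \<sigma>))"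
      "integrable lborel (\<lambda>u. w u ^ n / fact n * b u)" for n
  proof -
    define p where "p = 1 + real n * \<sigma>"
    have p: "p > 0" using \<sigma> by (simp add: p_def add_pos_nonneg)
    have eq: "w u ^ n / fact n * b u = of_real (d ^ n / fact n) * cis (pi * p) * of_real (exp (p * u - c * exp (1 * u)))" for u
    proof -
      have 1: "w u ^ n = of_real (d ^ n) * exp (of_nat n * (of_real \<sigma> * (pt u pi)))"
        by (simp add: w_def power_mult_distrib exp_of_nat_mult)
      have 2: "b u = exp (- of_real (c * exp u) + (pt u pi))"
        by (simp add: b_def exp_add exp_of_real exp_pi_i)
      have "exp (of_nat n * (of_real \<sigma> * (pt u pi))) * b u = exp (\<i> * of_real (pi * p)) * of_real (exp (p * u - c * exp (1 * u)))"
        unfolding 2 exp_of_real[symmetric] exp_add[symmetric] by (simp add: p_def algebra_simps)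
      thus ?thesis unfolding 1 by (simp add: cis_conv_exp)
    qed
    have i: "integrable lborel (\<lambda>u. exp (p * u - c * exp (1 * u)))" by (intro exp_gamma_integral_pos p c) auto
    show "integrable lborel (\<lambda>u. w u ^ n / fact n * b u)" unfolding eq
      by (intro integrable_mult_right integrable_of_real i)
    have "(LBINT u. complex_of_real (exp (p * u - c * exp (1 * u)))) = of_real (Gamma (p / 1) / 1 * c powr (- (p / 1)))"
      using exp_gamma_integral_pos(2)[OF p zero_less_one c] by (simp only: integral_complex_of_real)
    thus "(LBINT u. w u ^ n / fact n * b u) = of_real (d ^ n / fact n * (Gamma (1 + real n * \<sigma>) * c powr (- (1 + real n * \<sigma>)))) * cis (pi * (1 + real n * \<sigma>))"
      unfolding eq by (simp add: p_def)
  qed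
  have Tn: "c / pi * Im (LBINT u. w u ^ n / fact n * b u) = T n" for n
  proof -
    have "c powr (- (1 + real n * \<sigma>)) * (c powr \<sigma>) ^ n * c = 1"
      using c by (simp add: powr_power powr_minus powr_add powr_diff field_simps mult.commute)
    moreover have "rGamma (- (real n * \<sigma>)) = Gamma (1 + real n * \<sigma>) * sin (pi * (- (real n * \<sigma>))) / pi"
      using rGamma_real_reflection[of "- (real n * \<sigma>)"] \<sigma> by (simp add: add_pos_nonneg less_le_trans[of _ 0])
    moreover have "sin (pi * (1 + real n * \<sigma>)) = sin (pi * (- (real n * \<sigma>)))"
      by (simp add: distrib_left sin_add)
    moreover have "Im (LBINT u. w u ^ n / fact n * b u) = (- \<xi>) ^ n * (c powr \<sigma>) ^ n / fact n * (Gamma (1 + real n * \<sigma>) * c powr (- (1 + real n * \<sigma>))) * sin (pi * (1 + real n * \<sigma>))"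
    proof -
      have "Im (of_real A * cis t) = A * sin t" for A t by simp
      thus ?thesis unfolding trm by (simp only: d_def power_mult_distrib)
    qed
    ultimately show ?thesis by (simp add: T_def mult_ac)
  qed
  have "(\<lambda>N. LBINT u. s N u) \<longlonglongrightarrow> (LBINT u. exp (w u) * b u)"
  proof -
    obtain C where C: "\<And>u. \<bar>d\<bar> * exp (\<sigma> * u) \<le> C + c / 2 * exp u"
      using exp_domination[OF \<sigma>, of "c / 2" d] c by auto
    show ?thesis
    proof (rule integral_dominated_convergence[where w = "\<lambda>u. exp C * exp (1 * u - c / 2 * exp (1 * u))"])
      show "integrable lborel (\<lambda>u. exp C * exp (1 * u - c / 2 * exp (1 * u)))"
        by (intro integrable_mult_right exp_gamma_integral_pos) (use c in auto)
      show "(\<lambda>u. exp (w u) * b u) \<in> borel_measurable lborel" using wm bm by measurable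
      show "s N \<in> borel_measurable lborel" for N unfolding s_def using wm bm by measurable
      show "AE u in lborel. (\<lambda>N. s N u) \<longlonglongrightarrow> exp (w u) * b u"
      proof (intro AE_I2)
        fix u
        have "(\<lambda>n. w u ^ n /\<^sub>R fact n) sums exp (w u)" by (rule exp_converges)
        hence "(\<lambda>n. w u ^ n / fact n) sums exp (w u)" by (simp add: scaleR_conv_of_real divide_inverse mult.commute)
        thus "(\<lambda>N. s N u) \<longlonglongrightarrow> exp (w u) * b u" unfolding s_def sums_def by (intro tendsto_intros)
      qed
      show "AE u in lborel. norm (s N u) \<le> exp C * exp (1 * u - c / 2 * exp (1 * u))" for N
      proof (intro AE_I2)
        fix u
        have "norm (s N u) \<le> exp (norm (w u)) * norm (b u)"
          unfolding s_def norm_mult by (intro mult_right_mono norm_exp_partial_sum) auto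
        also have "\<dots> = exp (\<bar>d\<bar> * exp (\<sigma> * u) + (u - c * exp u))" by (simp add: nw nb exp_add)
        also have "\<dots> \<le> exp (C + (1 * u - c / 2 * exp (1 * u)))" using C[of u] by simp
        finally show "norm (s N u) \<le> exp C * exp (1 * u - c / 2 * exp (1 * u))" by (simp add: exp_add)
      qed
    qed
  qed
  hence "(\<lambda>N. c / pi * Im (LBINT u. s N u)) \<longlonglongrightarrow> c / pi * Im (LBINT u. exp (w u) * b u)"
    by (intro tendsto_intros)
  moreover have "c / pi * Im (LBINT u. s N u) = (\<Sum>n<N. T n)" for N
  proof -
    have "(LBINT u. s N u) = (\<Sum>n<N. (LBINT u. w u ^ n / fact n * b u))"
      unfolding s_def sum_distrib_right by (rule Bochner_Integration.integral_sum) (rule trm)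
    thus ?thesis by (simp only: Im_sum sum_distrib_left Tn)
  qed
  ultimately have "T sums (c / pi * Im (LBINT u. exp (w u) * b u))" by (simp add: sums_def)
  hence "(\<lambda>n. T (Suc n)) sums (c / pi * Im (LBINT u. exp (w u) * b u) - T 0)"
    by (simp add: sums_Suc_iff)
  moreover have "T 0 = 0" by (simp add: T_def)
  ultimately have "wright_F \<sigma> \<xi> = c / pi * Im (LBINT u. exp (w u) * b u)"
    unfolding wright_F_def T_def by (simp add: sums_iff)
  thus ?thesis unfolding d_def[symmetric] f .
qed


section \<open>The Hankel integral, a ray representation and the Mellin transform\<close>

lemma FTC_atLeast:
  fixes G H :: "real \<Rightarrow> complex"
  assumes H: "\<And>r. r \<ge> a \<Longrightarrow> (H has_vector_derivative G r) (at r)"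
      and G: "continuous_on {a..} G" "set_integrable lborel {a..} G" and L: "(H \<longlongrightarrow> L) at_top"
  shows "(LBINT r:{a..}. G r) = L - H a"
proof -
  have "((\<lambda>b. LBINT u:{a..b}. G u) \<longlongrightarrow> (LBINT u:{a..}. G u)) at_top"
    by (rule tendsto_set_lebesgue_integral_at_top[OF _ G(2)]) auto
  moreover have "\<forall>\<^sub>F b in at_top. (LBINT u:{a..b}. G u) = H b - H a"
    using eventually_ge_at_top[of a]
  proof eventually_elim
    case (elim b)
    show ?case unfolding set_lebesgue_integral_def
    proof (rule integral_FTC_atLeastAtMost[OF elim])
      show "(H has_vector_derivative G x) (at x within {a..b})" if "a \<le> x" "x \<le> b" for x
        by (rule has_vector_derivative_at_within[OF H[OF that(1)]])
      show "continuous_on {a..b} G" by (rule continuous_on_subset[OF G(1)]) auto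
    qed
  qed
  ultimately have "((\<lambda>b. H b - H a) \<longlongrightarrow> (LBINT u:{a..}. G u)) at_top" by (rule Lim_transform_eventually)
  moreover have "((\<lambda>b. H b - H a) \<longlongrightarrow> L - H a) at_top" by (intro tendsto_intros L)
  ultimately show ?thesis by (intro tendsto_unique) auto
qed

text \<open>Hankel's integral for \<open>1 / \<Gamma>(p)\<close>. On the line \<open>Im z = \<pi>\<close> it converges at the left end only for \<open>p < 1\<close>. The
  case \<open>p = 1/2\<close> is computed directly, and integration by parts leads from \<open>p\<close> to \<open>p + 1\<close>. Half-integers
  are enough because the Mellin transform will be needed on one unbounded sequence only.\<close>
lemma hankel_half_integer:
  assumes \<sigma>: "0 < \<sigma>" "\<sigma> < 1"
      and Q: "\<And>z. (Q has_field_derivative wfun \<sigma> 1 0 (1 - (real n + 1 / 2)) z) (at z)"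
  shows "\<exists>L. ((\<lambda>u. Q (pt u pi)) \<longlongrightarrow> L) at_top \<and>
             rGamma (real n + 1 / 2) = Im (L - Q (of_real a)) / pi"
  using Q
proof (induction n arbitrary: Q)
  case 0
  have Q: "\<And>z. (Q has_field_derivative wfun \<sigma> 1 0 (1 / 2) z) (at z)" using "0.prems" by simp
  obtain L L0 where L: "((\<lambda>u. Q (pt u pi)) \<longlongrightarrow> L) at_top"
     "((\<lambda>u. Q (pt u pi)) \<longlongrightarrow> L0) at_bot"
     "\<And>a. Im L0 = Im (Q (of_real a))"
     "(LBINT u. wfun \<sigma> 1 0 (1 / 2) (pt u pi)) = L - L0"
    using wfun_line_pi[OF \<sigma> zero_less_one _ Q] by auto
  have "wfun \<sigma> 1 0 (1 / 2) (pt u pi) = \<i> * of_real (exp (1 / 2 * u - 1 * exp (1 * u)))" for u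
  proof -
    have e: "exp (pt u pi) = - of_real (exp u)" by (simp add: exp_add exp_of_real)
    have "of_real 1 * - of_real (exp u) + of_real 0 * exp (of_real \<sigma> * (pt u pi)) + of_real (1 / 2) * (pt u pi) =
      \<i> * of_real (pi / 2) + complex_of_real (1 / 2 * u - 1 * exp (1 * u))" by (simp add: distrib_left)
    hence "wfun \<sigma> 1 0 (1 / 2) (pt u pi) = exp (\<i> * of_real (pi / 2)) * exp (of_real (1 / 2 * u - 1 * exp (1 * u)))"
      unfolding wfun_def e by (simp only: exp_add)
    thus ?thesis by (simp only: exp_of_real cis_conv_exp[symmetric] cis_pi_half)
  qed
  hence "L - L0 = \<i> * of_real (Gamma (1 / 2))"
    using exp_gamma_integral_pos(2)[of "1 / 2" 1 1] L(4) by simp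
  hence "Im (L - Q (of_real a)) = Gamma (1 / 2)" using L(3)[of a] by (simp add: complex_eq_iff)
  moreover have "rGamma (1 / 2) = Gamma (1 / 2 :: real) / pi"
    using rGamma_real_reflection[of "1 / 2"] by simp
  ultimately show ?case using L(1) by (intro exI[of _ L]) simp
next
  case (Suc n)
  define p where "p = real n + 1 / 2"
  have p: "p > 0" by (simp add: p_def add_nonneg_pos)
  define R where "R = (\<lambda>z::complex. exp (exp z - of_real p * z))"
  have Q: "\<And>z. (Q has_field_derivative wfun \<sigma> 1 0 (- p) z) (at z)"
  proof -
    have "1 - (real (Suc n) + 1 / 2) = - p" by (simp add: p_def)
    thus "\<And>z::complex. (Q has_field_derivative wfun \<sigma> 1 0 (- p) z) (at z)" using Suc.prems by simp
  qed
  have "((\<lambda>z. R z + of_real p * Q z) has_field_derivative wfun \<sigma> 1 0 (1 - p) z) (at z)" for z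
  proof -
    have "((\<lambda>z. R z + of_real p * Q z) has_field_derivative (exp z - of_real p) * R z + of_real p * wfun \<sigma> 1 0 (- p) z) (at z)"
      unfolding R_def by (auto intro!: derivative_eq_intros Q)
    also have "(exp z - of_real p) * R z + of_real p * wfun \<sigma> 1 0 (- p) z = exp z * R z"
      by (simp add: R_def wfun_def algebra_simps)
    also have "\<dots> = wfun \<sigma> 1 0 (1 - p) z" by (simp add: R_def wfun_def algebra_simps flip: exp_add)
    finally show ?thesis .
  qed
  from Suc.IH[OF this[unfolded p_def]] obtain L where
    L: "((\<lambda>u. R (pt u pi) + of_real p * Q (pt u pi)) \<longlongrightarrow> L) at_top"
       "rGamma p = Im (L - (R (of_real a) + of_real p * Q (of_real a))) / pi"
    by (auto simp: p_def)
  have "((\<lambda>u. R (pt u pi)) \<longlongrightarrow> 0) at_top"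
  proof (rule Lim_null_comparison)
    show "\<forall>\<^sub>F u in at_top. norm (R (pt u pi)) \<le> exp (- exp u - p * u)"
      by (intro always_eventually allI) (simp add: R_def Re_exp_line)
    show "((\<lambda>u. exp (- exp u - p * u)) \<longlongrightarrow> 0) at_top" using p by real_asymp
  qed
  from tendsto_diff[OF L(1) this] have "((\<lambda>u. of_real p * Q (pt u pi)) \<longlongrightarrow> L) at_top" by simp
  from tendsto_divide[OF this tendsto_const[of "of_real p"]]
  have L': "((\<lambda>u. Q (pt u pi)) \<longlongrightarrow> L / of_real p) at_top" using p by simp
  have "R (of_real a) \<in> \<real>"
  proof -
    have "R (of_real a) = of_real (exp (exp a - p * a))" by (simp add: R_def exp_of_real flip: of_real_mult of_real_diff)
    thus ?thesis by simp
  qed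
  hence "Im (L - (R (of_real a) + of_real p * Q (of_real a))) = p * Im (L / of_real p - Q (of_real a))"
    using p by (simp add: complex_is_Real_iff right_diff_distrib)
  with L(2) have "rGamma p = p * (Im (L / of_real p - Q (of_real a)) / pi)" by simp
  moreover have "p * rGamma (p + 1) = rGamma p" by (rule rGamma_plus1)
  ultimately have "p * rGamma (p + 1) = p * (Im (L / of_real p - Q (of_real a)) / pi)" by (simp only:)
  hence "rGamma (p + 1) = Im (L / of_real p - Q (of_real a)) / pi" using p unfolding mult_cancel_left by linarith
  thus ?case using L' by (intro exI[of _ "L / of_real p"]) (simp add: p_def add_ac)
qed

text \<open>With \<open>\<zeta> = e\<^sup>z\<close> the half of Hankel's loop in the upper half-plane can be taken to be the ray from \<open>1\<close> in the direction \<open>\<phi>\<close>. It starts at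
  \<open>1\<close> and not at \<open>0\<close> to avoid the singularity of powers of \<open>\<zeta>\<close>.\<close>
definition ray :: "real \<Rightarrow> real \<Rightarrow> complex" where
  "ray \<phi> r = 1 + of_real r * cis \<phi>"

lemma ray_facts:
  assumes \<phi>: "pi / 2 < \<phi>" "\<phi> < pi" and r: "r \<ge> 0"
  shows "ray \<phi> r \<notin> \<real>\<^sub>\<le>\<^sub>0" "ray \<phi> r \<noteq> 0" "norm (ray \<phi> r) \<ge> sin \<phi>" "0 \<le> Im (Ln (ray \<phi> r))" "Im (Ln (ray \<phi> r)) \<le> \<phi>"
proof -
  have sp: "sin \<phi> > 0" using \<phi> pi_gt_zero by (intro sin_gt_zero) linarith+
  have Imr: "Im (ray \<phi> r) = r * sin \<phi>" "Re (ray \<phi> r) = 1 + r * cos \<phi>" by (simp_all add: ray_def)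
  show np: "ray \<phi> r \<notin> \<real>\<^sub>\<le>\<^sub>0" using sp Imr by (auto simp: complex_nonpos_Reals_iff)
  thus nz: "ray \<phi> r \<noteq> 0" by auto
  have "(sin \<phi>)\<^sup>2 \<le> (norm (ray \<phi> r))\<^sup>2"
  proof -
    have sq: "(1 + r * b)\<^sup>2 + (r * a)\<^sup>2 = 1 + 2 * r * b + r\<^sup>2 * (a\<^sup>2 + b\<^sup>2)" for a b
      by (simp add: power2_eq_square algebra_simps)
    have "(norm (ray \<phi> r))\<^sup>2 = (1 + r * cos \<phi>)\<^sup>2 + (r * sin \<phi>)\<^sup>2" by (simp add: cmod_power2 Imr)
    also have "\<dots> = 1 + 2 * r * cos \<phi> + r\<^sup>2 * ((sin \<phi>)\<^sup>2 + (cos \<phi>)\<^sup>2)" by (rule sq)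
    also have "1 + 2 * r * cos \<phi> + r\<^sup>2 * ((sin \<phi>)\<^sup>2 + (cos \<phi>)\<^sup>2) = 1 + 2 * r * cos \<phi> + r\<^sup>2" by (simp only: sin_cos_squared_add mult_1_right)
    also have "\<dots> = (r + cos \<phi>)\<^sup>2 + (1 - (cos \<phi>)\<^sup>2)" by (simp add: power2_eq_square algebra_simps)
    finally show ?thesis by (simp add: sin_squared_eq)
  qed
  thus "norm (ray \<phi> r) \<ge> sin \<phi>" by (rule power2_le_imp_le) simp
  define \<theta> where "\<theta> = Im (Ln (ray \<phi> r))"
  have "Im (ray \<phi> r) \<ge> 0" using sp r Imr by simp
  thus th0: "0 \<le> Im (Ln (ray \<phi> r))" using Im_Ln_pos_le[OF nz] by simp
  have thpi: "\<theta> \<le> pi" unfolding \<theta>_def by (rule Im_Ln_le_pi[OF nz])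
  have pol: "ray \<phi> r = of_real (norm (ray \<phi> r)) * cis \<theta>"
    using exp_eq_polar[of "Ln (ray \<phi> r)"] nz by (simp add: \<theta>_def)
  have "ray \<phi> r * cis (- \<phi>) = (of_real (norm (ray \<phi> r)) * cis \<theta>) * cis (- \<phi>)"
    using pol by (rule arg_cong)
  also have "\<dots> = of_real (norm (ray \<phi> r)) * cis (\<theta> - \<phi>)" by (simp add: cis_mult mult.assoc)
  finally have "ray \<phi> r * cis (- \<phi>) = of_real (norm (ray \<phi> r)) * cis (\<theta> - \<phi>)" .
  hence "Im (ray \<phi> r * cis (- \<phi>)) = norm (ray \<phi> r) * sin (\<theta> - \<phi>)" by simp
  moreover have "Im (ray \<phi> r * cis (- \<phi>)) = - sin \<phi>" by (simp add: Imr algebra_simps)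
  ultimately have neg: "norm (ray \<phi> r) * sin (\<theta> - \<phi>) < 0" using sp by simp
  show "Im (Ln (ray \<phi> r)) \<le> \<phi>"
  proof (rule ccontr)
    assume "\<not> Im (Ln (ray \<phi> r)) \<le> \<phi>"
    hence "sin (\<theta> - \<phi>) > 0" using thpi \<phi> pi_gt_zero by (intro sin_gt_zero) (auto simp: \<theta>_def[symmetric])
    with neg show False by (simp add: mult_less_0_iff)
  qed
qed


text \<open>The real part of \<open>\<zeta>\<^sup>\<sigma>\<close> has a positive lower bound on the ray, which makes \<open>exp (- x \<zeta>\<^sup>\<sigma>)\<close>
  exponentially small in \<open>x\<close>, uniformly on the ray.\<close>
lemma ray_power_Re:
  assumes \<phi>: "pi / 2 < \<phi>" "\<phi> < pi" "\<sigma> * \<phi> < pi / 2" and \<sigma>: "\<sigma> > 0" and r: "r \<ge> 0"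
  shows "Re (exp (of_real \<sigma> * Ln (ray \<phi> r))) \<ge> sin \<phi> powr \<sigma> * cos (\<sigma> * \<phi>)"
    and "sin \<phi> powr \<sigma> * cos (\<sigma> * \<phi>) > 0"
proof -
  note R = ray_facts[OF \<phi>(1,2) r]
  have sp: "sin \<phi> > 0" using \<phi> pi_gt_zero by (intro sin_gt_zero) linarith+
  have cp: "cos (\<sigma> * \<phi>) > 0" using \<phi> \<sigma> pi_gt_zero by (intro cos_gt_zero_pi) (auto intro: less_trans[of _ 0])
  show "sin \<phi> powr \<sigma> * cos (\<sigma> * \<phi>) > 0" using sp cp by simp
  have "Re (exp (of_real \<sigma> * Ln (ray \<phi> r))) = norm (ray \<phi> r) powr \<sigma> * cos (\<sigma> * Im (Ln (ray \<phi> r)))"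
    using R(2) by (simp add: Re_exp powr_def)
  also have "\<dots> \<ge> sin \<phi> powr \<sigma> * cos (\<sigma> * \<phi>)"
  proof (intro mult_mono)
    show "sin \<phi> powr \<sigma> \<le> norm (ray \<phi> r) powr \<sigma>" using R(3) sp \<sigma> by (intro powr_mono2) auto
    show "cos (\<sigma> * \<phi>) \<le> cos (\<sigma> * Im (Ln (ray \<phi> r)))"
      using R(4,5) \<sigma> \<phi> pi_gt_zero by (intro cos_monotone_0_pi_le mult_left_mono) auto
  qed (use cp in auto)
  finally show "Re (exp (of_real \<sigma> * Ln (ray \<phi> r))) \<ge> sin \<phi> powr \<sigma> * cos (\<sigma> * \<phi>)" .
qed

definition ray_integrand :: "real \<Rightarrow> real \<Rightarrow> real \<Rightarrow> real \<Rightarrow> real \<Rightarrow> complex" where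
  "ray_integrand \<phi> \<sigma> d m r = cis \<phi> * exp (ray \<phi> r + of_real d * exp (of_real \<sigma> * Ln (ray \<phi> r)) + of_real m * Ln (ray \<phi> r))"

lemma ray_primitive_integral:
  assumes \<sigma>: "0 < \<sigma>" "\<sigma> < 1" and \<phi>: "pi / 2 < \<phi>" "\<phi> < pi"
    and P: "\<And>z. (P has_field_derivative wfun \<sigma> 1 d m z) (at z)"
    and L: "((\<lambda>u. P (pt u pi)) \<longlongrightarrow> L) at_top"
    and int: "set_integrable lborel {0..} (ray_integrand \<phi> \<sigma> d (m - 1))"
  shows "(LBINT r:{0..}. ray_integrand \<phi> \<sigma> d (m - 1) r) = L - P 0"
proof -
  let ?\<gamma> = "\<lambda>r. Ln (ray \<phi> r)"
  have "(LBINT r:{0..}. ray_integrand \<phi> \<sigma> d (m - 1) r) = L - P (?\<gamma> 0)"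
  proof (rule FTC_atLeast[OF _ _ int])
    show "((\<lambda>r. P (?\<gamma> r)) has_vector_derivative ray_integrand \<phi> \<sigma> d (m - 1) r) (at r)" if "r \<ge> 0" for r
    proof -
      note R = ray_facts[OF \<phi> that]
      have d1: "(ray \<phi> has_vector_derivative cis \<phi>) (at r)"
        unfolding ray_def by (auto intro!: derivative_eq_intros)
      have d2: "((\<lambda>t. P (Ln t)) has_field_derivative wfun \<sigma> 1 d m (?\<gamma> r) * (1 / ray \<phi> r)) (at (ray \<phi> r))"
        using DERIV_chain2[OF P has_field_derivative_Ln[OF R(1)]] by (simp add: inverse_eq_divide)
      have "((\<lambda>r. P (?\<gamma> r)) has_vector_derivative cis \<phi> * (wfun \<sigma> 1 d m (?\<gamma> r) * (1 / ray \<phi> r))) (at r)"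
        using field_vector_diff_chain_at[OF d1 d2] by (simp only: o_def)
      also have "wfun \<sigma> 1 d m (?\<gamma> r) * (1 / ray \<phi> r) = exp (ray \<phi> r + of_real d * exp (of_real \<sigma> * ?\<gamma> r) + of_real (m - 1) * ?\<gamma> r)"
      proof -
        have "1 / ray \<phi> r = exp (- ?\<gamma> r)" using R(2) by (simp add: exp_minus inverse_eq_divide)
        hence "wfun \<sigma> 1 d m (?\<gamma> r) * (1 / ray \<phi> r) = exp (of_real 1 * exp (?\<gamma> r) + of_real d * exp (of_real \<sigma> * ?\<gamma> r) + of_real m * ?\<gamma> r + - ?\<gamma> r)"
          by (simp only: wfun_def exp_add[symmetric])
        also have "of_real 1 * exp (?\<gamma> r) = ray \<phi> r" using R(2) by simp
        finally show ?thesis by (simp add: algebra_simps)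
      qed
      finally show ?thesis by (simp add: ray_integrand_def)
    qed
    show "continuous_on {0..} (ray_integrand \<phi> \<sigma> d (m - 1))"
    proof -
      have 1: "continuous_on {0..} (ray \<phi>)" unfolding ray_def by (intro continuous_intros)
      have 2: "continuous_on {0..} (\<lambda>r. Ln (ray \<phi> r))"
        by (rule continuous_on_Ln'[OF 1]) (use ray_facts(1)[OF \<phi>] in auto)
      show ?thesis unfolding ray_integrand_def by (intro continuous_intros 1 2)
    qed
    define v1 where "v1 = (pi / 2 + \<phi>) / 2"
    have v1: "pi / 2 < v1" "v1 < \<phi>" using \<phi> by (auto simp: v1_def)
    have nrm: "filterlim (\<lambda>r. norm (ray \<phi> r)) at_top at_top"
    proof (rule filterlim_at_top_mono)
      show "filterlim (\<lambda>r::real. r - 1) at_top at_top" by real_asymp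
      show "\<forall>\<^sub>F r in at_top. r - 1 \<le> norm (ray \<phi> r)"
        using eventually_ge_at_top[of 0]
      proof eventually_elim
        case (elim r)
        have "norm (of_real r * cis \<phi>) \<le> norm (ray \<phi> r) + norm (1::complex)"
          using norm_triangle_ineq4[of "ray \<phi> r" 1] by (simp add: ray_def)
        thus ?case using elim by (simp add: norm_mult)
      qed
    qed
    have arg: "((\<lambda>r. Im (?\<gamma> r)) \<longlongrightarrow> \<phi>) at_top"
    proof -
      have "((\<lambda>r. Ln (of_real (1 / r) + cis \<phi>)) \<longlongrightarrow> Ln (of_real 0 + cis \<phi>)) at_top"
      proof (intro tendsto_intros)
        show "((\<lambda>r::real. 1 / r) \<longlongrightarrow> 0) at_top" by real_asymp
        have "sin \<phi> > 0" using \<phi> pi_gt_zero by (intro sin_gt_zero) linarith+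
        thus "of_real 0 + cis \<phi> \<notin> \<real>\<^sub>\<le>\<^sub>0" by (auto simp: complex_nonpos_Reals_iff)
      qed
      hence "((\<lambda>r. Im (Ln (of_real (1 / r) + cis \<phi>))) \<longlongrightarrow> Im (Ln (cis \<phi>))) at_top" by (auto intro: tendsto_Im)
      also have "Im (Ln (cis \<phi>)) = \<phi>" using \<phi> pi_gt_zero by (subst Ln_cis) auto
      finally show ?thesis
      proof (rule Lim_transform_eventually)
        show "\<forall>\<^sub>F r in at_top. Im (Ln (of_real (1 / r) + cis \<phi>)) = Im (?\<gamma> r)"
          using eventually_gt_at_top[of 0]
        proof eventually_elim
          case (elim r)
          have eq: "ray \<phi> r = of_real r * (of_real (1 / r) + cis \<phi>)" using elim by (simp add: ray_def algebra_simps)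
          have "of_real (1 / r) + cis \<phi> \<noteq> 0" using ray_facts(2)[OF \<phi>, of r] elim eq by auto
          from Ln_times_of_real[OF elim this] show ?case using elim by (simp add: eq Ln_of_real)
        qed
      qed
    qed
    have "((\<lambda>r. P (of_real (ln (norm (ray \<phi> r))) + \<i> * of_real (Im (?\<gamma> r)))) \<longlongrightarrow> L) at_top"
    proof (rule wfun_right_limit[OF \<sigma> zero_less_one P, where S = "{v1..pi}" and a = pi and k = "- cos v1"])
      show "\<forall>\<^sub>F r in at_top. Im (?\<gamma> r) \<in> {v1..pi}"
        using order_tendstoD(1)[OF arg v1(2)] eventually_ge_at_top[of 0]
        by eventually_elim (use ray_facts(5)[OF \<phi>] \<phi> in force)
      show "filterlim (\<lambda>r. ln (norm (ray \<phi> r))) at_top at_top" by (rule filterlim_compose[OF ln_at_top nrm])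
      have "cos v1 < cos (pi / 2)" using v1 \<phi> by (intro cos_monotone_0_pi) auto
      thus "- cos v1 > 0" by simp
      show "cos v \<le> - (- cos v1)" if "v \<in> {v1..pi}" for v
        using that v1 pi_gt_zero cos_monotone_0_pi_le[of v1 v] by simp
    qed (use v1 \<phi> L in auto)
    moreover have "\<forall>\<^sub>F r in at_top. P (of_real (ln (norm (ray \<phi> r))) + \<i> * of_real (Im (?\<gamma> r))) = P (?\<gamma> r)"
      using eventually_ge_at_top[of 0]
    proof eventually_elim
      case (elim r)
      have "of_real (ln (norm (ray \<phi> r))) + \<i> * of_real (Im (?\<gamma> r)) = ?\<gamma> r"
        using ray_facts(2)[OF \<phi> elim] by (simp add: complex_eq_iff)
      thus ?case by simp
    qed
    ultimately show "((\<lambda>r. P (?\<gamma> r)) \<longlongrightarrow> L) at_top" by (rule Lim_transform_eventually)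
  qed
  thus ?thesis by (simp add: ray_def)
qed

lemma ray_exp_integrable:
  assumes "k > (0::real)"
  shows "integrable lborel (\<lambda>r. indicator {0..} r * exp (- k * r) :: real)"
proof -
  have "(\<lambda>r. exp (- k * r)) absolutely_integrable_on {0..}"
    by (intro nonnegative_absolutely_integrable_1 integrable_on_exp_minus_to_infinity assms) auto
  hence "integrable lebesgue (\<lambda>r. indicator {0..} r * exp (- k * r) :: real)" by (simp add: set_integrable_def)
  moreover have m: "(\<lambda>r. indicator {0..} r * exp (- k * r) :: real) \<in> borel_measurable lborel" by measurable
  ultimately show ?thesis using integrable_completion[OF m] by simp
qed


text \<open>The form in which the line integral is used: the value \<open>F\<^sub>\<sigma>(\<xi>)\<close> depends only on the limit of \<open>P\<close> at the
  right end and on the imaginary part of \<open>P\<close> on the real axis.\<close>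
lemma wright_F_primitive:
  assumes \<sigma>: "0 < \<sigma>" "\<sigma> < 1" and c: "c > 0"
      and P: "\<And>z. (P has_field_derivative wfun \<sigma> c (- \<xi> * c powr \<sigma>) 1 z) (at z)"
  obtains L L0 where "((\<lambda>u. P (pt u pi)) \<longlongrightarrow> L) at_top"
     "((\<lambda>u. P (pt u pi)) \<longlongrightarrow> L0) at_bot"
     "\<And>a. Im L0 = Im (P (of_real a))"
     "\<And>a. wright_F \<sigma> \<xi> = c / pi * Im (L - P (of_real a))"
proof -
  obtain L L0 where L: "((\<lambda>u. P (pt u pi)) \<longlongrightarrow> L) at_top"
     "((\<lambda>u. P (pt u pi)) \<longlongrightarrow> L0) at_bot"
     "\<And>a. Im L0 = Im (P (of_real a))"
     "(LBINT u. wfun \<sigma> c (- \<xi> * c powr \<sigma>) 1 (pt u pi)) = L - L0"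
    by (rule wfun_line_pi[OF \<sigma> c zero_less_one P]) blast
  show ?thesis
    by (rule that[OF L(1,2,3)]) (simp only: wright_F_line_integral[OF \<sigma> c] L(4) minus_complex.sel L(3)[symmetric])
qed

text \<open>The conditions on \<open>\<phi>\<close> say that both \<open>e\<^sup>\<zeta>\<close> and \<open>exp (- x \<zeta>\<^sup>\<sigma>)\<close> decay on the ray. They can always be met.\<close>
locale wright_ray =
  fixes \<sigma> \<phi> :: real
  assumes \<sigma>: "0 < \<sigma>" "\<sigma> < 1" and \<phi>: "pi / 2 < \<phi>" "\<phi> < pi" "\<sigma> * \<phi> < pi / 2"
begin

definition c0 where "c0 = sin \<phi> powr \<sigma> * cos (\<sigma> * \<phi>)"
definition k0 where "k0 = - cos \<phi>"

lemma c0_pos: "c0 > 0" unfolding c0_def by (rule ray_power_Re(2)[OF \<phi> \<sigma>(1) order_refl])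
lemma k0_pos: "k0 > 0"
  unfolding k0_def using \<phi> cos_monotone_0_pi[of "pi / 2" \<phi>] by simp

lemma norm_ray_integrand_0:
  assumes "r \<ge> 0" "x \<ge> 0"
  shows "norm (ray_integrand \<phi> \<sigma> (- x) 0 r) \<le> exp 1 * exp (- k0 * r) * exp (- c0 * x)"
proof -
  have "norm (ray_integrand \<phi> \<sigma> (- x) 0 r) = exp (1 + r * cos \<phi> - x * Re (exp (of_real \<sigma> * Ln (ray \<phi> r))))"
    by (simp add: ray_integrand_def norm_mult) (simp add: ray_def)
  also have "\<dots> \<le> exp (1 + r * cos \<phi> - x * c0)"
    using mult_left_mono[OF ray_power_Re(1)[OF \<phi> \<sigma>(1) assms(1)] assms(2)] by (simp add: c0_def)
  also have "\<dots> = exp 1 * exp (- k0 * r) * exp (- c0 * x)"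
    by (simp add: k0_def mult_ac flip: exp_add)
  finally show ?thesis .
qed

lemma ray_measurable: "(\<lambda>r. indicator {0..} r *\<^sub>R ray_integrand \<phi> \<sigma> d m r) \<in> borel_measurable borel"
proof -
  have 1: "continuous_on {0..} (ray \<phi>)" unfolding ray_def by (intro continuous_intros)
  have 2: "continuous_on {0..} (\<lambda>r. Ln (ray \<phi> r))"
    by (rule continuous_on_Ln'[OF 1]) (use ray_facts(1)[OF \<phi>(1,2)] in auto)
  show ?thesis unfolding ray_integrand_def by (intro borel_measurable_continuous_on_indicator continuous_intros 1 2) auto
qed

lemma ray_integrable_0:
  assumes "x \<ge> 0"
  shows "set_integrable lborel {0..} (ray_integrand \<phi> \<sigma> (- x) 0)"
  unfolding set_integrable_def
proof (rule Bochner_Integration.integrable_bound)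
  show "integrable lborel (\<lambda>r. exp 1 * (indicator {0..} r * exp (- k0 * r)) :: real)"
    by (intro integrable_mult_right ray_exp_integrable k0_pos)
  show "(\<lambda>r. indicator {0..} r *\<^sub>R ray_integrand \<phi> \<sigma> (- x) 0 r) \<in> borel_measurable lborel"
    using ray_measurable by simp
  have "norm (ray_integrand \<phi> \<sigma> (- x) 0 r) \<le> exp 1 * exp (- k0 * r)" if "r \<ge> 0" for r
  proof -
    have "norm (ray_integrand \<phi> \<sigma> (- x) 0 r) \<le> exp 1 * exp (- k0 * r) * exp (- c0 * x)"
      by (rule norm_ray_integrand_0[OF that assms])
    also have "\<dots> \<le> exp 1 * exp (- k0 * r) * 1"
      using c0_pos assms by (intro mult_left_mono) auto
    finally show ?thesis by (simp only: mult_1_right)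
  qed
  thus "AE r in lborel. norm (indicator {0..} r *\<^sub>R ray_integrand \<phi> \<sigma> (- x) 0 r) \<le> norm (exp 1 * (indicator {0..} r * exp (- k0 * r)) :: real)"
    by (intro AE_I2) (auto simp: indicator_def)
qed

lemma wright_F_ray:
  assumes "x \<ge> 0"
  shows "wright_F \<sigma> x = Im (LBINT r:{0..}. ray_integrand \<phi> \<sigma> (- x) 0 r) / pi"
proof -
  obtain P where P: "\<And>z. (P has_field_derivative wfun \<sigma> 1 (- x) 1 z) (at z)"
    using entire_primitive[OF wfun_holomorphic] by blast
  have P': "\<And>z. (P has_field_derivative wfun \<sigma> 1 (- x * 1 powr \<sigma>) 1 z) (at z)" using P by simp
  obtain L where L: "((\<lambda>u. P (pt u pi)) \<longlongrightarrow> L) at_top"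
     "\<And>a. wright_F \<sigma> x = 1 / pi * Im (L - P (of_real a))"
    by (rule wright_F_primitive[OF \<sigma> zero_less_one P']) blast
  have "(LBINT r:{0..}. ray_integrand \<phi> \<sigma> (- x) (1 - 1) r) = L - P 0"
    by (rule ray_primitive_integral[OF \<sigma> \<phi>(1,2) P L(1)]) (use ray_integrable_0[OF assms] in simp)
  thus ?thesis using L(2)[of 0] by simp
qed

lemma wright_F_bounded:
  obtains C where "\<And>x. x \<ge> 0 \<Longrightarrow> \<bar>wright_F \<sigma> x\<bar> \<le> C"
proof -
  have "\<bar>wright_F \<sigma> x\<bar> \<le> (LBINT r. exp 1 * (indicator {0..} r * exp (- k0 * r))) / pi" if x: "x \<ge> 0" for x
  proof -
    have "\<bar>Im (LBINT r:{0..}. ray_integrand \<phi> \<sigma> (- x) 0 r)\<bar> \<le> norm (LBINT r:{0..}. ray_integrand \<phi> \<sigma> (- x) 0 r)"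
      by (rule abs_Im_le_cmod)
    also have "\<dots> \<le> (LBINT r. exp 1 * (indicator {0..} r * exp (- k0 * r)))"
      unfolding set_lebesgue_integral_def
    proof (rule Bochner_Integration.integral_norm_bound_integral)
      show "integrable lborel (\<lambda>r. indicat_real {0..} r *\<^sub>R ray_integrand \<phi> \<sigma> (- x) 0 r)"
        using ray_integrable_0[OF x] by (simp add: set_integrable_def)
      show "integrable lborel (\<lambda>r. exp 1 * (indicator {0..} r * exp (- k0 * r)) :: real)"
        by (intro integrable_mult_right ray_exp_integrable k0_pos)
      have "norm (ray_integrand \<phi> \<sigma> (- x) 0 r) \<le> exp 1 * exp (- k0 * r)" if "r \<ge> 0" for r
      proof -
        have "norm (ray_integrand \<phi> \<sigma> (- x) 0 r) \<le> exp 1 * exp (- k0 * r) * exp (- c0 * x)"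
          by (rule norm_ray_integrand_0[OF that x])
        also have "\<dots> \<le> exp 1 * exp (- k0 * r) * 1"
          using c0_pos x by (intro mult_left_mono) auto
        finally show ?thesis by (simp only: mult_1_right)
      qed
      thus "norm (indicat_real {0..} r *\<^sub>R ray_integrand \<phi> \<sigma> (- x) 0 r) \<le> exp 1 * (indicator {0..} r * exp (- k0 * r))" for r
        by (auto simp: indicator_def)
    qed
    finally show ?thesis using wright_F_ray[OF x] by (simp add: divide_right_mono)
  qed
  thus ?thesis by (rule that)
qed

lemma mellin_inner:
  assumes s: "s > 0" and r: "r \<ge> 0"
  shows "(LBINT w. of_real (exp (s * w)) * ray_integrand \<phi> \<sigma> (- exp w) 0 r) = of_real (Gamma s) * ray_integrand \<phi> \<sigma> 0 (- (s * \<sigma>)) r"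
proof -
  define A where "A = exp (of_real \<sigma> * Ln (ray \<phi> r))"
  have ReA: "Re A > 0" using ray_power_Re[OF \<phi> \<sigma>(1) r] by (simp add: A_def)
  have LnA: "Ln A = of_real \<sigma> * Ln (ray \<phi> r)"
  proof -
    note R = ray_facts[OF \<phi>(1,2) r]
    have "\<sigma> * Im (Ln (ray \<phi> r)) \<le> 1 * pi" using R \<sigma> \<phi> by (intro mult_mono) auto
    moreover have "0 \<le> \<sigma> * Im (Ln (ray \<phi> r))" using R \<sigma> by simp
    moreover have "- pi < \<sigma> * Im (Ln (ray \<phi> r))" using calculation pi_gt_zero by linarith
    ultimately show ?thesis unfolding A_def by (intro Ln_exp) auto
  qed
  have "(LBINT w. of_real (exp (s * w)) * ray_integrand \<phi> \<sigma> (- exp w) 0 r) =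
        (LBINT w. (cis \<phi> * exp (ray \<phi> r)) * exp (of_real (s * w) - A * of_real (exp (1 * w))))"
    by (intro Bochner_Integration.integral_cong refl)
       (simp add: ray_integrand_def A_def[symmetric] exp_add exp_diff exp_minus exp_of_real[symmetric] field_simps)
  also have "\<dots> = (cis \<phi> * exp (ray \<phi> r)) * (LBINT w. exp (of_real (s * w) - A * of_real (exp (1 * w))))"
    by (rule integral_mult_right_zero)
  also have "(LBINT w. exp (of_real (s * w) - A * of_real (exp (1 * w)))) = of_real (Gamma s) * exp (- of_real s * Ln A)"
    using exp_gamma_integral_complex[OF s zero_less_one ReA] by simp
  finally have "(LBINT w. of_real (exp (s * w)) * ray_integrand \<phi> \<sigma> (- exp w) 0 r) =
      of_real (Gamma s) * (cis \<phi> * (exp (ray \<phi> r) * exp (- of_real s * Ln A)))" by (simp only: mult_ac)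
  also have "cis \<phi> * (exp (ray \<phi> r) * exp (- of_real s * Ln A)) = ray_integrand \<phi> \<sigma> 0 (- (s * \<sigma>)) r"
    by (simp add: ray_integrand_def LnA mult.assoc flip: exp_add)
  finally show ?thesis .
qed

lemma mellin_measurable:
  "(\<lambda>(w, r). indicator {0..} r *\<^sub>R (of_real (exp (s * w)) * ray_integrand \<phi> \<sigma> (- exp w) 0 r)) \<in> borel_measurable (lborel \<Otimes>\<^sub>M lborel)"
proof -
  have 1: "continuous_on (UNIV \<times> {0..}) (\<lambda>p::real\<times>real. ray \<phi> (snd p))" unfolding ray_def by (intro continuous_intros)
  have 2: "continuous_on (UNIV \<times> {0..}) (\<lambda>p::real\<times>real. Ln (ray \<phi> (snd p)))"
    by (rule continuous_on_Ln'[OF 1]) (use ray_facts(1)[OF \<phi>(1,2)] in auto)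
  have "(\<lambda>p::real\<times>real. indicator (UNIV \<times> {0..}) p *\<^sub>R (of_real (exp (s * fst p)) * ray_integrand \<phi> \<sigma> (- exp (fst p)) 0 (snd p))) \<in> borel_measurable borel"
    unfolding ray_integrand_def
    by (intro borel_measurable_continuous_on_indicator continuous_intros 1 2) (auto intro!: borel_closed closed_Times)
  also have "(\<lambda>p::real\<times>real. indicator (UNIV \<times> {0..}) p *\<^sub>R (of_real (exp (s * fst p)) * ray_integrand \<phi> \<sigma> (- exp (fst p)) 0 (snd p))) =
    (\<lambda>(w, r). indicator {0..} r *\<^sub>R (of_real (exp (s * w)) * ray_integrand \<phi> \<sigma> (- exp w) 0 r))"
    by (intro ext) (auto simp only: indicator_def mem_Times_iff fst_conv snd_conv UNIV_I simp_thms split: prod.splits)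
  finally show ?thesis by (simp only: lborel_prod measurable_lborel1 measurable_lborel2)
qed

lemma mellin_integrable:
  assumes s: "s > 0"
  shows "integrable (lborel \<Otimes>\<^sub>M lborel) (\<lambda>(w, r). indicator {0..} r *\<^sub>R (of_real (exp (s * w)) * ray_integrand \<phi> \<sigma> (- exp w) 0 r))"
proof (rule Bochner_Integration.integrable_bound[OF _ mellin_measurable])
  let ?g = "\<lambda>w. exp (s * w - c0 * exp (1 * w))" and ?h = "\<lambda>r. exp 1 * (indicator {0..} r * exp (- k0 * r)) :: real"
  have g: "integrable lborel ?g" by (intro exp_gamma_integral_pos s c0_pos) auto
  have h: "integrable lborel ?h" by (intro integrable_mult_right ray_exp_integrable k0_pos)
  show "integrable (lborel \<Otimes>\<^sub>M lborel) (\<lambda>(w, r). ?g w * ?h r)"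
  proof (rule lborel_pair.Fubini_integrable)
    show "(\<lambda>(w, r). ?g w * ?h r) \<in> borel_measurable (lborel \<Otimes>\<^sub>M lborel)" by measurable
    have "(LBINT r. norm (case (w, r) of (w, r) \<Rightarrow> ?g w * ?h r)) = ?g w * (LBINT r. ?h r)" for w
    proof -
      have "(LBINT r. norm (case (w, r) of (w, r) \<Rightarrow> ?g w * ?h r)) = (LBINT r. ?g w * ?h r)"
        by (intro Bochner_Integration.integral_cong) (auto simp: abs_mult)
      also have "\<dots> = ?g w * (LBINT r. ?h r)" by (rule integral_mult_right_zero)
      finally show ?thesis .
    qed
    thus "integrable lborel (\<lambda>w. LBINT r. norm (case (w, r) of (w, r) \<Rightarrow> ?g w * ?h r))"
      using g by (simp only: integrable_mult_left)
    show "AE w in lborel. integrable lborel (\<lambda>r. case (w, r) of (w, r) \<Rightarrow> ?g w * ?h r)"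
      using h by (intro AE_I2) (simp only: prod.case integrable_mult_right)
  qed
  have "norm (of_real (exp (s * w)) * ray_integrand \<phi> \<sigma> (- exp w) 0 r) \<le> ?g w * (exp 1 * exp (- k0 * r))" if "r \<ge> 0" for w r
  proof -
    have "norm (of_real (exp (s * w)) * ray_integrand \<phi> \<sigma> (- exp w) 0 r) \<le> exp (s * w) * (exp 1 * exp (- k0 * r) * exp (- c0 * exp w))"
      unfolding norm_mult using norm_ray_integrand_0[OF that, of "exp w"] by (intro mult_mono) auto
    also have "\<dots> = ?g w * (exp 1 * exp (- k0 * r))"
    proof -
      have "exp (s * w) * exp (- c0 * exp w) = ?g w" by (simp flip: exp_add)
      thus ?thesis by (metis mult.assoc mult.commute)
    qed
    finally show ?thesis .
  qed
  note bnd = this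
  show "AE p in lborel \<Otimes>\<^sub>M lborel. norm (case p of (w, r) \<Rightarrow> indicator {0..} r *\<^sub>R (of_real (exp (s * w)) * ray_integrand \<phi> \<sigma> (- exp w) 0 r))
      \<le> norm (case p of (w, r) \<Rightarrow> ?g w * ?h r)"
  proof (intro AE_I2)
    fix p :: "real \<times> real"
    obtain w r where p: "p = (w, r)" by (cases p)
    show "norm (case p of (w, r) \<Rightarrow> indicator {0..} r *\<^sub>R (of_real (exp (s * w)) * ray_integrand \<phi> \<sigma> (- exp w) 0 r))
      \<le> norm (case p of (w, r) \<Rightarrow> ?g w * ?h r)"
    proof (cases "r \<ge> 0")
      case True
      have "norm (?g w * ?h r) = ?g w * (exp 1 * exp (- k0 * r))" using True by (simp add: abs_mult)
      moreover have "indicator {0..} r = (1::real)" using True by simp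
      ultimately show ?thesis using bnd[OF True, of w] unfolding p prod.case by (simp only: scaleR_one)
    qed (simp add: p)
  qed
qed

text \<open>By the ray representation \<open>F\<^sub>\<sigma>(x) = Im (\<integral> exp (\<zeta> - x \<zeta>\<^sup>\<sigma>) d\<zeta>) / \<pi>\<close>. Integrating \<open>x\<^sup>s\<^sup>-\<^sup>1\<close> against it under the integral sign
  gives \<open>\<Gamma>(s) \<zeta>\<^sup>-\<^sup>\<sigma>\<^sup>s\<close>, and what remains is Hankel's integral for \<open>1 / \<Gamma>(\<sigma>s)\<close>. The substitution \<open>x = e\<^sup>w\<close>
  accounts for the additive form of the transform.\<close>
theorem wright_F_mellin:
  fixes n :: nat
  defines "s \<equiv> (real n + 1 / 2) / \<sigma>"
  shows "integrable lborel (\<lambda>w. exp (s * w) * wright_F \<sigma> (exp w))"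
    and "(LBINT w. exp (s * w) * wright_F \<sigma> (exp w)) = Gamma s * rGamma (real n + 1 / 2)"
proof -
  define K where "K = (\<lambda>w r. indicator {0..} r *\<^sub>R (of_real (exp (s * w)) * ray_integrand \<phi> \<sigma> (- exp w) 0 r))"
  have s: "s > 0" using \<sigma> by (simp add: s_def add_nonneg_pos)
  have K: "integrable (lborel \<Otimes>\<^sub>M lborel) (\<lambda>(w, r). K w r)" unfolding K_def by (rule mellin_integrable[OF s])
  have Kr: "(LBINT r. K w r) = of_real (exp (s * w)) * (LBINT r:{0..}. ray_integrand \<phi> \<sigma> (- exp w) 0 r)" for w
    unfolding K_def set_lebesgue_integral_def by (subst integral_mult_right_zero[symmetric]) (simp add: mult.commute)
  have F: "exp (s * w) * wright_F \<sigma> (exp w) = Im (LBINT r. K w r) / pi" for w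
    unfolding Kr wright_F_ray[OF exp_ge_zero] by simp
  have int: "integrable lborel (\<lambda>w. LBINT r. K w r)"
    using lborel_pair.integrable_fst[OF K] by simp
  show "integrable lborel (\<lambda>w. exp (s * w) * wright_F \<sigma> (exp w))"
    unfolding F by (intro integrable_divide_zero integrable_Im int)
  obtain Q where Q: "\<And>z. (Q has_field_derivative wfun \<sigma> 1 0 (1 - (real n + 1 / 2)) z) (at z)"
    using entire_primitive[OF wfun_holomorphic] by blast
  obtain L where L: "((\<lambda>u. Q (pt u pi)) \<longlongrightarrow> L) at_top"
    "rGamma (real n + 1 / 2) = Im (L - Q (of_real 0)) / pi"
    using hankel_half_integer[OF \<sigma> Q, of 0] by blast
  have ss: "s * \<sigma> = real n + 1 / 2" using \<sigma> by (simp add: s_def)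
  have ee: "1 - (real n + 1 / 2) - 1 = - (s * \<sigma>)" by (simp add: ss)
  have Kw: "(LBINT w. K w r) = indicator {0..} r *\<^sub>R (of_real (Gamma s) * ray_integrand \<phi> \<sigma> 0 (- (s * \<sigma>)) r)" for r
    using mellin_inner[OF s, of r] by (auto simp: K_def indicator_def)
  have "integrable lborel (\<lambda>r. LBINT w. K w r)"
    using lborel_pair.integrable_snd[OF K] by simp
  hence "integrable lborel (\<lambda>r. of_real (1 / Gamma s) * (LBINT w. K w r))" by (rule integrable_mult_right)
  also have "(\<lambda>r. of_real (1 / Gamma s) * (LBINT w. K w r)) = (\<lambda>r. indicator {0..} r *\<^sub>R ray_integrand \<phi> \<sigma> 0 (- (s * \<sigma>)) r)"
    using Gamma_real_pos[OF s] by (auto simp: Kw fun_eq_iff)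
  finally have ir: "set_integrable lborel {0..} (ray_integrand \<phi> \<sigma> 0 (1 - (real n + 1 / 2) - 1))"
    by (simp only: set_integrable_def ee)
  have "(LBINT w. LBINT r. K w r) = (LBINT r. LBINT w. K w r)"
    by (rule lborel_pair.Fubini_integral[OF K, symmetric])
  also have "\<dots> = of_real (Gamma s) * (LBINT r:{0..}. ray_integrand \<phi> \<sigma> 0 (1 - (real n + 1 / 2) - 1) r)"
    unfolding Kw set_lebesgue_integral_def ee by (subst integral_mult_right_zero[symmetric]) (simp add: mult.commute)
  also have "\<dots> = of_real (Gamma s) * (L - Q 0)"
    using ray_primitive_integral[OF \<sigma> \<phi>(1,2) Q L(1) ir] by simp
  finally have I: "(LBINT w. LBINT r. K w r) = of_real (Gamma s) * (L - Q 0)" .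
  have "(LBINT w. exp (s * w) * wright_F \<sigma> (exp w)) = Im (LBINT w. LBINT r. K w r) / pi"
    unfolding F by (simp add: integral_Im[OF int])
  also have "\<dots> = Gamma s * rGamma (real n + 1 / 2)" unfolding I L(2) by simp
  finally show "(LBINT w. exp (s * w) * wright_F \<sigma> (exp w)) = Gamma s * rGamma (real n + 1 / 2)" .
qed

end


section \<open>The saddle point expansion\<close>

text \<open>The reference integral of the saddle point method: half of a Gaussian integral in the direction \<open>\<mu>\<close>, cut off at \<open>b\<close>.
  The condition on \<open>(b / \<mu>)\<^sup>2\<close> says that \<open>b\<close> lies in the valley, so that the missing tail is exponentially small.\<close>
lemma gaussian_segment:
  fixes G :: "complex \<Rightarrow> complex"
  assumes X: "X > 0" and \<mu>: "\<mu> \<noteq> 0" and b: "Re (b / \<mu>) > 0" "Re ((b / \<mu>)\<^sup>2) > 0"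
      and G: "\<And>w. (G has_field_derivative exp (- (of_real X / \<mu>\<^sup>2) * w\<^sup>2)) (at w)"
  shows "norm (G b - G 0 - of_real (sqrt pi / (2 * sqrt X)) * \<mu>) \<le> norm b * exp (- X * Re ((b / \<mu>)\<^sup>2)) / (X * Re ((b / \<mu>)\<^sup>2))"
proof -
  define \<beta> where "\<beta> = b / \<mu>"
  define c where "c = of_real X * \<beta>\<^sup>2"
  have Rec: "Re c > 0" using X b by (simp add: c_def \<beta>_def)
  define f where "f = (\<lambda>v. b * exp (v - c * exp (2 * v)))"
  define H where "H = (\<lambda>v. G (b * exp v))"
  have fh: "f holomorphic_on UNIV" unfolding f_def by (intro holomorphic_intros)
  have H: "(H has_field_derivative f v) (at v)" for v
  proof -
    have "((\<lambda>v. b * exp v) has_field_derivative b * exp v) (at v)" by (auto intro!: derivative_eq_intros)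
    from DERIV_chain2[OF G this] have "(H has_field_derivative exp (- (of_real X / \<mu>\<^sup>2) * (b * exp v)\<^sup>2) * (b * exp v)) (at v)"
      by (simp add: H_def)
    also have "(of_real X / \<mu>\<^sup>2) * (b * exp v)\<^sup>2 = c * exp (2 * v)"
      by (simp add: c_def \<beta>_def power_divide power_mult_distrib exp_double)
    hence "exp (- (of_real X / \<mu>\<^sup>2) * (b * exp v)\<^sup>2) * (b * exp v) = f v"
      by (simp add: f_def exp_diff exp_minus divide_inverse)
    finally show ?thesis .
  qed
  have fr: "f (of_real u + 0) = b * exp (of_real (1 * u) - c * of_real (exp (2 * u)))" for u
    by (simp add: f_def flip: exp_of_real)
  have int: "integrable lborel (\<lambda>u. f (of_real u + 0))"
    unfolding fr by (intro integrable_mult_right exp_gamma_integrable_complex Rec) auto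
  obtain L R where LR: "((\<lambda>u. H (of_real u + 0)) \<longlongrightarrow> L) at_bot" "((\<lambda>u. H (of_real u + 0)) \<longlongrightarrow> R) at_top"
    "(LBINT u. f (of_real u + 0)) = R - L"
    by (rule primitive_line_integral[OF H fh int])
  have "((\<lambda>u. H (of_real u + 0)) \<longlongrightarrow> G (b * 0)) at_bot"
  proof -
    have "((\<lambda>u. b * of_real (exp u)) \<longlongrightarrow> b * of_real 0) at_bot"
      by (intro tendsto_intros exp_at_bot)
    moreover have "isCont G (b * of_real 0)" using DERIV_isCont[OF G] .
    ultimately have "((\<lambda>u. G (b * of_real (exp u))) \<longlongrightarrow> G (b * of_real 0)) at_bot" by (rule isCont_tendsto_compose[rotated])
    thus ?thesis by (simp add: H_def exp_of_real)
  qed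
  from tendsto_unique[OF _ LR(1) this] have L: "L = G 0" by simp
  have Lnc: "exp (- of_real (1 / 2) * Ln c) = of_real (1 / sqrt X) / \<beta>"
  proof -
    have b0: "\<beta> \<noteq> 0" using b by (auto simp: \<beta>_def)
    have "\<bar>Im (Ln \<beta>)\<bar> < pi / 2" by (rule Re_Ln_pos_lt_imp) (use b in \<open>simp add: \<beta>_def\<close>)
    hence "Ln (\<beta>\<^sup>2) = 2 * Ln \<beta>" using b0 by (intro Ln_unique) (auto simp: exp_double)
    moreover have "Ln c = of_real (ln X) + Ln (\<beta>\<^sup>2)"
      unfolding c_def using X b0 by (subst Ln_times_of_real) (auto simp: Ln_of_real)
    ultimately have "- of_real (1 / 2) * Ln c = of_real (- ln X / 2) + - Ln \<beta>" by (simp add: field_simps)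
    hence "exp (- of_real (1 / 2) * Ln c) = of_real (exp (- ln X / 2)) * exp (- Ln \<beta>)" by (simp only: exp_add exp_of_real)
    also have "exp (- ln X / 2) = 1 / sqrt X"
      using X by (simp add: exp_minus inverse_eq_divide flip: powr_half_sqrt) (simp add: powr_def)
    also have "exp (- Ln \<beta>) = 1 / \<beta>" using b0 by (simp add: exp_minus inverse_eq_divide)
    finally show ?thesis by (simp only: times_divide_eq_right mult_1_right)
  qed
  have "R - L = b * (of_real (Gamma (1 / 2) / 2) * exp (- of_real (1 / 2) * Ln c))"
    unfolding LR(3)[symmetric] fr using exp_gamma_integral_complex[of 1 2 c] Rec by simp
  also have "\<dots> = of_real (sqrt pi / (2 * sqrt X)) * \<mu>"
    unfolding Lnc Gamma_one_half_real using \<mu> b by (auto simp: \<beta>_def field_simps)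
  finally have RL: "R - L = of_real (sqrt pi / (2 * sqrt X)) * \<mu>" .
  define r where "r = Re c"
  have rpos: "r > 0" using Rec by (simp add: r_def)
  have tail: "norm (H (of_real V + 0) - H (of_real 0 + 0)) \<le> norm b / r * exp (- r)" if V: "V > 0" for V
  proof -
    define \<phi> where "\<phi> = (\<lambda>v. - (norm b / r) * exp (- r * exp v))"
    have "norm (H (of_real V + 0) - H (of_real 0 + 0)) \<le> \<phi> V - \<phi> 0"
    proof (rule differentiable_bound_general[where f' = "\<lambda>v. f (of_real v + 0)" and \<phi>' = "\<lambda>v. norm b * exp v * exp (- r * exp v)"])
      show "continuous_on {0..V} (\<lambda>v. H (of_real v + 0))"
        by (intro continuous_at_imp_continuous_on ballI has_vector_derivative_continuous[OF primitive_vector_derivative[OF H]])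
      show "continuous_on {0..V} \<phi>" unfolding \<phi>_def by (intro continuous_intros)
      show "((\<lambda>v. H (of_real v + 0)) has_vector_derivative f (of_real x + 0)) (at x)" for x
        by (rule primitive_vector_derivative[OF H])
      show "(\<phi> has_vector_derivative norm b * exp x * exp (- r * exp x)) (at x)" for x
        unfolding \<phi>_def has_real_derivative_iff_has_vector_derivative[symmetric]
        using rpos by (auto intro!: derivative_eq_intros)
      show "norm (f (of_real x + 0)) \<le> norm b * exp x * exp (- r * exp x)" if "0 < x" for x
      proof -
        have "norm (f (of_real x + 0)) = norm b * exp (x - r * exp (2 * x))"
          unfolding fr norm_mult by (simp add: r_def)
        also have "\<dots> \<le> norm b * exp (x - r * exp x)"
          using that rpos by (intro mult_left_mono) auto
        finally show ?thesis by (simp add: exp_diff exp_minus divide_inverse)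
      qed
    qed (use V in auto)
    also have "\<dots> \<le> norm b / r * exp (- r)"
      using rpos by (simp add: \<phi>_def)
    finally show ?thesis .
  qed
  have "norm (R - H (of_real 0 + 0)) \<le> norm b / r * exp (- r)"
  proof (rule tendsto_upperbound)
    show "((\<lambda>V. norm (H (of_real V + 0) - H (of_real 0 + 0))) \<longlongrightarrow> norm (R - H (of_real 0 + 0))) at_top"
      by (intro tendsto_intros LR(2))
    show "\<forall>\<^sub>F V in at_top. norm (H (of_real V + 0) - H (of_real 0 + 0)) \<le> norm b / r * exp (- r)"
      using eventually_gt_at_top[of 0] by eventually_elim (rule tail)
  qed auto
  moreover have "H (of_real 0 + 0) = G b" by (simp add: H_def)
  moreover have "R = G 0 + of_real (sqrt pi / (2 * sqrt X)) * \<mu>" using RL L by (simp add: algebra_simps)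
  ultimately have "norm (G 0 + of_real (sqrt pi / (2 * sqrt X)) * \<mu> - G b) \<le> norm b / r * exp (- r)" by simp
  moreover have "norm (G b - G 0 - of_real (sqrt pi / (2 * sqrt X)) * \<mu>) = norm (G 0 + of_real (sqrt pi / (2 * sqrt X)) * \<mu> - G b)"
    by (subst norm_minus_commute) (simp add: algebra_simps)
  moreover have "r = X * Re ((b / \<mu>)\<^sup>2)" by (simp add: r_def c_def \<beta>_def)
  ultimately show ?thesis by simp
qed

definition phase :: "real \<Rightarrow> complex \<Rightarrow> complex" where
  "phase \<sigma> z = (exp (of_real \<sigma> * z) - of_real \<sigma> * exp z) / of_real (1 - \<sigma>)"

lemma phase_0: "\<sigma> < 1 \<Longrightarrow> phase \<sigma> 0 = 1" by (simp add: phase_def)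

lemma phase_holomorphic: "phase \<sigma> holomorphic_on S"
  unfolding phase_def[abs_def] by (cases "\<sigma> = 1") (auto intro!: holomorphic_intros)

text \<open>A Morse coordinate \<open>w = z \<rho>(z)\<close> at the saddle, in which \<open>1 - f\<close> is a square. The value of \<open>\<rho>\<close> at
  \<open>0\<close> fixes the choice of the square root and comes from \<open>f''(0) = - \<sigma>\<close>.\<close>
lemma phase_coordinate:
  assumes \<sigma>: "0 < \<sigma>" "\<sigma> < 1"
  shows "\<exists>r \<rho>. r > 0 \<and> \<rho> holomorphic_on ball 0 r \<and> \<rho> 0 = of_real (sqrt (\<sigma> / 2)) \<and>
    (\<forall>z\<in>ball 0 r. 1 - phase \<sigma> z = (z * \<rho> z)\<^sup>2 \<and> \<rho> z \<noteq> 0 \<and> deriv (\<lambda>z. z * \<rho> z) z \<noteq> 0)"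
proof -
  define g where "g = (\<lambda>z. 1 - phase \<sigma> z)"
  have gh: "g holomorphic_on UNIV" unfolding g_def by (intro holomorphic_intros phase_holomorphic)
  have g0: "g 0 = 0" using \<sigma> by (simp add: g_def phase_0)
  have dg: "(g has_field_derivative 0) (at 0)"
    unfolding g_def phase_def using \<sigma> by (auto intro!: derivative_eq_intros)
  define g1 where "g1 = (\<lambda>z. if z = 0 then deriv g 0 else (g z - g 0) / (z - 0))"
  have g1h: "g1 holomorphic_on UNIV" unfolding g1_def by (rule pole_lemma[OF gh]) auto
  have g10: "g1 0 = 0" using DERIV_imp_deriv[OF dg] by (simp add: g1_def)
  define q where "q = (\<lambda>z. if z = 0 then deriv g1 0 else (g1 z - g1 0) / (z - 0))"
  have qh: "q holomorphic_on UNIV" unfolding q_def by (rule pole_lemma[OF g1h]) auto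
  have gq: "g z = z\<^sup>2 * q z" for z
    using g0 g10 by (auto simp: q_def g1_def power2_eq_square)
  have q0: "q 0 = of_real (\<sigma> / 2)"
  proof -
    have "isCont q 0" using holomorphic_on_imp_continuous_on[OF qh] by (simp add: continuous_on_eq_continuous_at)
    hence "((\<lambda>x. q (of_real x)) \<longlongrightarrow> q 0) (at_right 0)"
      by (rule isCont_tendsto_compose) (auto intro!: tendsto_eq_intros)
    moreover have "((\<lambda>x. q (of_real x)) \<longlongrightarrow> of_real (\<sigma> / 2)) (at_right 0)"
    proof -
      have "((\<lambda>x::real. (1 - (exp (\<sigma> * x) - \<sigma> * exp x) / (1 - \<sigma>)) / x\<^sup>2) \<longlongrightarrow> \<sigma> / 2) (at_right 0)"
        using \<sigma> by real_asymp (auto simp: field_simps power2_eq_square)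
      hence "((\<lambda>x::real. complex_of_real ((1 - (exp (\<sigma> * x) - \<sigma> * exp x) / (1 - \<sigma>)) / x\<^sup>2)) \<longlongrightarrow> of_real (\<sigma> / 2)) (at_right 0)"
        by (rule tendsto_of_real)
      thus ?thesis
      proof (rule Lim_transform_eventually)
        show "\<forall>\<^sub>F x in at_right 0. complex_of_real ((1 - (exp (\<sigma> * x) - \<sigma> * exp x) / (1 - \<sigma>)) / x\<^sup>2) = q (of_real x)"
          using eventually_at_right_less[of 0]
        proof eventually_elim
          case (elim x)
          have "complex_of_real (1 - (exp (\<sigma> * x) - \<sigma> * exp x) / (1 - \<sigma>)) = g (of_real x)"
            by (simp add: g_def phase_def exp_of_real[symmetric])
          thus ?case using elim gq[of "of_real x"] by simp
        qed
      qed
    qed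
    ultimately show ?thesis by (intro tendsto_unique) auto
  qed
  have qc: "continuous_on UNIV q" by (rule holomorphic_on_imp_continuous_on[OF qh])
  have "open (q -` {z. Re z > 0})" by (intro open_vimage qc open_halfspace_Re_gt)
  moreover have "0 \<in> q -` {z. Re z > 0}"
  proof -
    have "Re (q 0) = \<sigma> / 2" unfolding q0 by simp
    thus ?thesis using \<sigma> by simp
  qed
  ultimately obtain r1 where r1: "r1 > 0" "ball 0 r1 \<subseteq> q -` {z. Re z > 0}" by (meson open_contains_ball)
  define \<rho> where "\<rho> = (\<lambda>z. csqrt (q z))"
  have Req: "Re (q z) > 0" if "z \<in> ball 0 r1" for z using r1 that by auto
  have \<rho>h: "\<rho> holomorphic_on ball 0 r1"
    unfolding \<rho>_def
    by (intro holomorphic_intros holomorphic_on_subset[OF qh]) (use Req in \<open>force simp: complex_nonpos_Reals_iff\<close>)+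
  define w where "w = (\<lambda>z. z * \<rho> z)"
  have wh: "w holomorphic_on ball 0 r1" unfolding w_def by (intro holomorphic_intros \<rho>h)
  have \<rho>0: "\<rho> 0 = of_real (sqrt (\<sigma> / 2))" unfolding \<rho>_def q0 using \<sigma> by (subst csqrt_of_real) auto
  have "(w has_field_derivative 1 * \<rho> 0 + deriv \<rho> 0 * 0) (at 0)"
    unfolding w_def by (intro DERIV_mult DERIV_ident holomorphic_derivI[OF \<rho>h]) (use r1 in auto)
  hence dw0: "deriv w 0 = \<rho> 0" by (simp add: DERIV_imp_deriv)
  have "continuous_on (ball 0 r1) (deriv w)"
    by (intro holomorphic_on_imp_continuous_on holomorphic_deriv wh) auto
  hence "isCont (deriv w) 0" using r1 by (simp add: continuous_on_eq_continuous_at)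
  moreover have "deriv w 0 \<noteq> 0" using dw0 \<rho>0 \<sigma> by simp
  ultimately have "eventually (\<lambda>z. deriv w z \<noteq> 0) (nhds 0)"
    by (simp add: isCont_def tendsto_imp_eventually_ne eventually_nhds_conv_at)
  then obtain r2 where r2: "r2 > 0" "\<And>z. z \<in> ball 0 r2 \<Longrightarrow> deriv w z \<noteq> 0"
    unfolding eventually_nhds_metric by (auto simp: dist_commute)
  show ?thesis
  proof (intro exI[of _ "min r1 r2"] exI[of _ \<rho>] conjI ballI)
    show "\<rho> holomorphic_on ball 0 (min r1 r2)" by (rule holomorphic_on_subset[OF \<rho>h]) auto
    show "1 - phase \<sigma> z = (z * \<rho> z)\<^sup>2" if "z \<in> ball 0 (min r1 r2)" for z
      using gq[of z] by (simp add: g_def \<rho>_def power_mult_distrib)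
    show "\<rho> z \<noteq> 0" if "z \<in> ball 0 (min r1 r2)" for z using Req[of z] that by (auto simp: \<rho>_def)
    show "deriv (\<lambda>z. z * \<rho> z) z \<noteq> 0" if "z \<in> ball 0 (min r1 r2)" for z
      using r2(2)[of z] that by (simp add: w_def)
  qed (use r1 r2 \<rho>0 in auto)
qed


text \<open>If every amplitude is a multiple of \<open>s\<close> plus a multiple of \<open>f'\<close>, the latter part can be integrated by parts
  against \<open>e\<^sup>\<Lambda>\<^sup>f\<close> and returns an amplitude with an additional factor \<open>1 / \<Lambda>\<close>. Iteration
  produces an expansion whose coefficients \<open>a\<close> depend neither on \<open>\<Lambda>\<close> nor on the end points
  of the path. Stating it for primitives avoids path integrals altogether.\<close>
lemma by_parts_hierarchy:
  fixes f s :: "complex \<Rightarrow> complex"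
  assumes B: "open B" and f: "f holomorphic_on B" and h: "h holomorphic_on B"
    and dec: "\<forall>h. h holomorphic_on B \<longrightarrow> (\<exists>a k. k holomorphic_on B \<and> (\<forall>z\<in>B. h z = a * s z + k z * deriv f z))"
  shows "\<exists>(a :: nat \<Rightarrow> complex) (H :: nat \<Rightarrow> complex \<Rightarrow> complex) (K :: nat \<Rightarrow> complex \<Rightarrow> complex).
    (\<forall>j. H j holomorphic_on B) \<and> (\<forall>j. K j holomorphic_on B) \<and>
    (\<forall>M \<Lambda> P S. \<Lambda> \<noteq> 0 \<longrightarrow> (\<forall>z\<in>B. (P has_field_derivative h z * exp (\<Lambda> * f z)) (at z)) \<longrightarrow>
       (\<forall>z\<in>B. (S has_field_derivative s z * exp (\<Lambda> * f z)) (at z)) \<longrightarrow>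
       (\<exists>R. (\<forall>z\<in>B. (R has_field_derivative H M z * exp (\<Lambda> * f z)) (at z)) \<and>
           (\<forall>z. P z = (\<Sum>j<M. a j / \<Lambda> ^ j) * S z + (\<Sum>j<M. K j z / \<Lambda> ^ Suc j) * exp (\<Lambda> * f z) + R z / \<Lambda> ^ M)))"
proof -
  from dec obtain A \<K> where AK: "\<And>h. h holomorphic_on B \<Longrightarrow> \<K> h holomorphic_on B"
    "\<And>h z. h holomorphic_on B \<Longrightarrow> z \<in> B \<Longrightarrow> h z = A h * s z + \<K> h z * deriv f z"
    by metis
  define H where "H = rec_nat h (\<lambda>_ h z. - deriv (\<K> h) z)"
  have HS: "H (Suc j) z = - deriv (\<K> (H j)) z" for j z by (simp add: H_def)
  have Hh: "H j holomorphic_on B" for j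
  proof (induction j)
    case (Suc j)
    have "(\<lambda>z. - deriv (\<K> (H j)) z) holomorphic_on B"
      by (intro holomorphic_intros holomorphic_deriv AK Suc B)
    thus ?case by (simp add: HS[abs_def])
  qed (simp add: H_def h)
  define K where "K = (\<lambda>j. \<K> (H j))"
  define a where "a = (\<lambda>j. A (H j))"
  have Kh: "K j holomorphic_on B" for j unfolding K_def by (intro AK Hh)
  have main: "\<exists>R. (\<forall>z\<in>B. (R has_field_derivative H M z * exp (\<Lambda> * f z)) (at z)) \<and>
           (\<forall>z. P z = (\<Sum>j<M. a j / \<Lambda> ^ j) * S z + (\<Sum>j<M. K j z / \<Lambda> ^ Suc j) * exp (\<Lambda> * f z) + R z / \<Lambda> ^ M)"
    if \<Lambda>: "\<Lambda> \<noteq> 0" and P: "\<And>z. z \<in> B \<Longrightarrow> (P has_field_derivative h z * exp (\<Lambda> * f z)) (at z)"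
      and S: "\<And>z. z \<in> B \<Longrightarrow> (S has_field_derivative s z * exp (\<Lambda> * f z)) (at z)" for M \<Lambda> P S
  proof (induction M)
    case 0
    show ?case by (rule exI[of _ P]) (use P in \<open>simp add: H_def\<close>)
  next
    case (Suc M)
    then obtain R where R: "\<And>z. z \<in> B \<Longrightarrow> (R has_field_derivative H M z * exp (\<Lambda> * f z)) (at z)"
      "\<And>z. P z = (\<Sum>j<M. a j / \<Lambda> ^ j) * S z + (\<Sum>j<M. K j z / \<Lambda> ^ Suc j) * exp (\<Lambda> * f z) + R z / \<Lambda> ^ M" by blast
    define R' where "R' = (\<lambda>z. \<Lambda> * R z - \<Lambda> * a M * S z - K M z * exp (\<Lambda> * f z))"
    have "(R' has_field_derivative H (Suc M) z * exp (\<Lambda> * f z)) (at z)" if z: "z \<in> B" for z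
    proof -
      have dK: "(K M has_field_derivative deriv (K M) z) (at z)" by (rule holomorphic_derivI[OF Kh B z])
      have df: "(f has_field_derivative deriv f z) (at z)" by (rule holomorphic_derivI[OF f B z])
      have "(R' has_field_derivative \<Lambda> * (H M z * exp (\<Lambda> * f z)) - \<Lambda> * a M * (s z * exp (\<Lambda> * f z)) -
          (deriv (K M) z * exp (\<Lambda> * f z) + (exp (\<Lambda> * f z) * (\<Lambda> * deriv f z)) * K M z)) (at z)"
        unfolding R'_def by (intro DERIV_diff DERIV_cmult DERIV_mult R S dK z DERIV_fun_exp df)
      also have "H M z = a M * s z + K M z * deriv f z" unfolding a_def K_def by (rule AK(2)[OF Hh z])
      also have "\<Lambda> * ((a M * s z + K M z * deriv f z) * exp (\<Lambda> * f z)) - \<Lambda> * a M * (s z * exp (\<Lambda> * f z)) -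
          (deriv (K M) z * exp (\<Lambda> * f z) + (exp (\<Lambda> * f z) * (\<Lambda> * deriv f z)) * K M z) = H (Suc M) z * exp (\<Lambda> * f z)"
        by (simp add: HS K_def algebra_simps)
      finally show ?thesis .
    qed
    moreover have "P z = (\<Sum>j<Suc M. a j / \<Lambda> ^ j) * S z + (\<Sum>j<Suc M. K j z / \<Lambda> ^ Suc j) * exp (\<Lambda> * f z) + R' z / \<Lambda> ^ Suc M" for z
    proof -
      have "R' z / \<Lambda> ^ Suc M = R z / \<Lambda> ^ M - a M / \<Lambda> ^ M * S z - K M z / \<Lambda> ^ Suc M * exp (\<Lambda> * f z)"
        using \<Lambda> by (simp add: R'_def diff_divide_distrib)
      thus ?thesis unfolding R(2)[of z] sum.lessThan_Suc by (simp only: distrib_right) simp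
    qed
    ultimately show ?case by blast
  qed
  show ?thesis
  proof (rule exI[of _ a], rule exI[of _ H], rule exI[of _ K], intro conjI allI impI)
    fix M \<Lambda> P S
    assume "\<Lambda> \<noteq> 0" "\<forall>z\<in>B. (P has_field_derivative h z * exp (\<Lambda> * f z)) (at z)"
      "\<forall>z\<in>B. (S has_field_derivative s z * exp (\<Lambda> * f z)) (at z)"
    thus "\<exists>R. (\<forall>z\<in>B. (R has_field_derivative H M z * exp (\<Lambda> * f z)) (at z)) \<and>
           (\<forall>z. P z = (\<Sum>j<M. a j / \<Lambda> ^ j) * S z + (\<Sum>j<M. K j z / \<Lambda> ^ Suc j) * exp (\<Lambda> * f z) + R z / \<Lambda> ^ M)"
      by (intro main) auto
  qed (rule Hh Kh)+
qed

lemma exp_le_inverse_power: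
  fixes \<eta> :: real
  assumes "\<eta> > 0"
  obtains C where "C \<ge> 0" "\<And>X. X > 0 \<Longrightarrow> exp (- \<eta> * X) \<le> C / X ^ M"
proof (rule that[of "fact M / \<eta> ^ M"])
  fix X :: real assume X: "X > 0"
  have "(\<eta> * X) ^ M / fact M \<le> exp (\<eta> * X)"
  proof -
    have "(\<Sum>n\<in>{M}. (\<eta> * X) ^ n /\<^sub>R fact n) \<le> (\<Sum>n. (\<eta> * X) ^ n /\<^sub>R fact n)"
      by (rule sum_le_suminf[OF summable_exp_generic]) (use X assms in auto)
    thus ?thesis by (simp add: exp_def divide_inverse mult.commute)
  qed
  hence "\<eta> ^ M * X ^ M \<le> exp (\<eta> * X) * fact M" by (simp add: field_simps)
  thus "exp (- \<eta> * X) \<le> fact M / \<eta> ^ M / X ^ M"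
    using X assms by (simp add: exp_minus field_simps)
qed (use assms in auto)

abbreviation saddle_bound :: "real \<Rightarrow> (nat \<Rightarrow> complex) \<Rightarrow> complex \<Rightarrow> complex \<Rightarrow> real \<Rightarrow> nat \<Rightarrow> real \<Rightarrow> bool" where
  "saddle_bound \<sigma> a \<mu> \<alpha> \<delta> M C \<equiv> (\<forall>X P. X \<ge> 1 \<longrightarrow>
     (\<forall>z. (P has_field_derivative exp (of_real X / \<mu>\<^sup>2 * phase \<sigma> z + z)) (at z)) \<longrightarrow>
     norm (exp (- (of_real X / \<mu>\<^sup>2)) * (P (of_real \<delta> * \<alpha>) - P (- of_real \<delta> * \<alpha>)) -
           of_real (sqrt (2 * pi / \<sigma>) / sqrt X) * \<mu> * (\<Sum>j<M. a j / (of_real X / \<mu>\<^sup>2) ^ j)) \<le> C / X ^ M)"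

text \<open>The unit number \<open>\<mu>\<close> is the direction of steepest descent for the large parameter \<open>X / \<mu>\<^sup>2\<close>, and \<open>\<alpha>\<close> is the direction in
  which the saddle is actually crossed. One sequence \<open>a\<close> has to serve all directions: this is
  what transports the coefficients from \<open>F\<^sub>\<sigma>(x)\<close>, where they are identified, to \<open>F\<^sub>\<sigma>(- x)\<close>.\<close>
definition is_saddle_series :: "real \<Rightarrow> (nat \<Rightarrow> complex) \<Rightarrow> bool" where
  "is_saddle_series \<sigma> a \<longleftrightarrow>
    (\<forall>\<mu> \<alpha>. norm \<mu> = 1 \<longrightarrow> Re (\<alpha> / \<mu>) > 0 \<longrightarrow> Re ((\<alpha> / \<mu>)\<^sup>2) > 0 \<longrightarrow>
       (\<exists>\<delta>1>0. \<forall>\<delta>. 0 < \<delta> \<and> \<delta> < \<delta>1 \<longrightarrow> (\<forall>M. \<exists>C. saddle_bound \<sigma> a \<mu> \<alpha> \<delta> M C)))"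

text \<open>In the Morse coordinate \<open>w\<close> every holomorphic amplitude \<open>h\<close> is \<open>a w' + k f'\<close>, because \<open>f' = - 2 w w'\<close> and \<open>h - a w'\<close>
  vanishes at the saddle for a suitable \<open>a\<close>. Hence the hierarchy applies with the Gaussian amplitude \<open>s = w'\<close>, and the boundary
  terms at the ends of the segment are exponentially small compared with the saddle.\<close>
theorem saddle_expansion:
  assumes \<sigma>: "0 < \<sigma>" "\<sigma> < 1"
  shows "\<exists>a. is_saddle_series \<sigma> a"
proof -
  obtain r \<rho> where r: "r > 0" and \<rho>h: "\<rho> holomorphic_on ball 0 r" and \<rho>0: "\<rho> 0 = of_real (sqrt (\<sigma> / 2))"
    and local: "\<forall>z\<in>ball 0 r. 1 - phase \<sigma> z = (z * \<rho> z)\<^sup>2 \<and> \<rho> z \<noteq> 0 \<and> deriv (\<lambda>z. z * \<rho> z) z \<noteq> 0"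
    using phase_coordinate[OF \<sigma>] by blast
  have ph: "1 - phase \<sigma> z = (z * \<rho> z)\<^sup>2" and \<rho>nz: "\<rho> z \<noteq> 0" and dwnz: "deriv (\<lambda>z. z * \<rho> z) z \<noteq> 0"
    if "z \<in> ball 0 r" for z using local that by auto
  define B where "B = ball (0::complex) r"
  have Bo: "open B" and B0: "0 \<in> B" using r by (auto simp: B_def)
  define w where "w = (\<lambda>z. z * \<rho> z)"
  have wh: "w holomorphic_on B" unfolding w_def B_def by (intro holomorphic_intros \<rho>h)
  have dw: "(w has_field_derivative deriv w z) (at z)" if "z \<in> B" for z by (rule holomorphic_derivI[OF wh Bo that])
  have dwh: "deriv w holomorphic_on B" by (rule holomorphic_deriv[OF wh Bo])
  have fw: "phase \<sigma> z = 1 - (w z)\<^sup>2" if "z \<in> B" for z using ph[of z] that by (simp add: w_def B_def algebra_simps)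
  have df: "deriv (phase \<sigma>) z = - 2 * w z * deriv w z" if "z \<in> B" for z
  proof -
    have "((\<lambda>z. 1 - (w z)\<^sup>2) has_field_derivative - 2 * w z * deriv w z) (at z)"
      by (auto intro!: derivative_eq_intros dw that)
    hence "(phase \<sigma> has_field_derivative - 2 * w z * deriv w z) (at z)"
      by (rule has_field_derivative_transform_within_open[OF _ Bo that]) (simp add: fw)
    thus ?thesis by (rule DERIV_imp_deriv)
  qed
  have dec: "\<exists>a k. k holomorphic_on B \<and> (\<forall>z\<in>B. h z = a * deriv w z + k z * deriv (phase \<sigma>) z)" if h: "h holomorphic_on B" for h
  proof -
    define a where "a = h 0 / deriv w 0"
    define e where "e = (\<lambda>z. h z - a * deriv w z)"
    have eh: "e holomorphic_on B" unfolding e_def by (intro holomorphic_intros h dwh)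
    have e0: "e 0 = 0" using dwnz[of 0] r by (simp add: e_def a_def w_def)
    define e1 where "e1 = (\<lambda>z. if z = 0 then deriv e 0 else (e z - e 0) / (z - 0))"
    have e1h: "e1 holomorphic_on B" unfolding e1_def by (rule pole_lemma[OF eh]) (use B0 Bo in \<open>simp add: interior_open\<close>)
    define k where "k = (\<lambda>z. e1 z / (- 2 * \<rho> z * deriv w z))"
    have kh: "k holomorphic_on B"
      unfolding k_def using \<rho>nz dwnz by (intro holomorphic_intros e1h dwh \<rho>h[folded B_def]) (auto simp: B_def w_def)
    moreover have "h z = a * deriv w z + k z * deriv (phase \<sigma>) z" if z: "z \<in> B" for z
    proof -
      have "k z * deriv (phase \<sigma>) z = z * e1 z"
        unfolding df[OF z] k_def using \<rho>nz[of z] dwnz[of z] z by (simp add: B_def w_def field_simps)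
      also have "\<dots> = e z" using e0 by (simp add: e1_def)
      finally show ?thesis by (simp add: e_def)
    qed
    ultimately show ?thesis by blast
  qed
  have dec': "\<forall>h. h holomorphic_on B \<longrightarrow> (\<exists>a k. k holomorphic_on B \<and> (\<forall>z\<in>B. h z = a * deriv w z + k z * deriv (phase \<sigma>) z))"
    using dec by blast
  have eh: "exp holomorphic_on B" by (rule holomorphic_on_exp)
  obtain a :: "nat \<Rightarrow> complex" and H K :: "nat \<Rightarrow> complex \<Rightarrow> complex" where
    hier: "(\<forall>j. H j holomorphic_on B) \<and> (\<forall>j. K j holomorphic_on B) \<and>
    (\<forall>M \<Lambda> P S. \<Lambda> \<noteq> 0 \<longrightarrow> (\<forall>z\<in>B. (P has_field_derivative exp z * exp (\<Lambda> * phase \<sigma> z)) (at z)) \<longrightarrow>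
       (\<forall>z\<in>B. (S has_field_derivative deriv w z * exp (\<Lambda> * phase \<sigma> z)) (at z)) \<longrightarrow>
       (\<exists>R. (\<forall>z\<in>B. (R has_field_derivative H M z * exp (\<Lambda> * phase \<sigma> z)) (at z)) \<and>
           (\<forall>z. P z = (\<Sum>j<M. a j / \<Lambda> ^ j) * S z + (\<Sum>j<M. K j z / \<Lambda> ^ Suc j) * exp (\<Lambda> * phase \<sigma> z) + R z / \<Lambda> ^ M)))"
    using by_parts_hierarchy[OF Bo phase_holomorphic eh dec'] by (elim exE) (rule that)
  note HK = conjunct1[OF hier] conjunct1[OF conjunct2[OF hier]] and main = conjunct2[OF conjunct2[OF hier]]
  have Hh: "H j holomorphic_on B" and Kh: "K j holomorphic_on B" for j using HK by auto
  \<comment> \<open>\<open>a 0\<close> is \<open>1 / \<rho>(0)\<close>; the factor makes the series start with \<open>1\<close>\<close>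
  define a' where "a' = (\<lambda>j. of_real (sqrt (\<sigma> / 2)) * a j)"
  show ?thesis
    unfolding is_saddle_series_def
  proof (rule exI[of _ a'], intro allI impI)
    fix \<mu> \<alpha> :: complex
    assume \<mu>: "norm \<mu> = 1" and \<alpha>: "Re (\<alpha> / \<mu>) > 0" "Re ((\<alpha> / \<mu>)\<^sup>2) > 0"
    have \<mu>0: "\<mu> \<noteq> 0" using \<mu> by auto
    have Rem: "Re (of_real y * z) = y * Re z" for y z by simp
    define \<beta> where "\<beta> = (\<lambda>\<tau>. \<alpha> / \<mu> * \<rho> (of_real \<tau> * \<alpha>))"
    have w\<beta>: "w (of_real \<tau> * \<alpha>) / \<mu> = of_real \<tau> * \<beta> \<tau>" for \<tau> by (simp add: w_def \<beta>_def)
    have "isCont \<rho> (of_real 0 * \<alpha>)"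
      using holomorphic_on_imp_continuous_on[OF \<rho>h] r by (simp add: continuous_on_eq_continuous_at)
    moreover have "isCont (\<lambda>\<tau>. complex_of_real \<tau> * \<alpha>) 0" by (intro continuous_intros)
    ultimately have "isCont (\<lambda>\<tau>. \<rho> (of_real \<tau> * \<alpha>)) 0" by (rule isCont_o2[rotated])
    from continuous_mult_left[OF this, of "\<alpha> / \<mu>"] have \<beta>c: "isCont \<beta> 0" by (simp only: \<beta>_def)
    have \<beta>0: "\<beta> 0 = of_real (sqrt (\<sigma> / 2)) * (\<alpha> / \<mu>)" by (simp add: \<beta>_def \<rho>0)
    have "(\<beta> \<longlongrightarrow> \<beta> 0) (nhds 0)" using \<beta>c by (simp add: isCont_def tendsto_nhds_iff)
    hence t12: "((\<lambda>\<tau>. Re (\<beta> \<tau>)) \<longlongrightarrow> Re (\<beta> 0)) (nhds 0)" "((\<lambda>\<tau>. Re ((\<beta> \<tau>)\<^sup>2)) \<longlongrightarrow> Re ((\<beta> 0)\<^sup>2)) (nhds 0)"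
      by (auto intro!: tendsto_intros)
    have p1: "Re (\<beta> 0) > 0"
    proof -
      have "Re (\<beta> 0) = sqrt (\<sigma> / 2) * Re (\<alpha> / \<mu>)" unfolding \<beta>0 by (rule Rem)
      thus ?thesis using \<alpha> \<sigma> by simp
    qed
    have p2: "Re ((\<beta> 0)\<^sup>2) > 0"
    proof -
      have "(\<beta> 0)\<^sup>2 = of_real (\<sigma> / 2) * (\<alpha> / \<mu>)\<^sup>2" unfolding \<beta>0 power_mult_distrib using \<sigma> by (simp flip: of_real_power)
      hence "Re ((\<beta> 0)\<^sup>2) = \<sigma> / 2 * Re ((\<alpha> / \<mu>)\<^sup>2)" by (simp only: Rem)
      moreover have "\<sigma> / 2 * Re ((\<alpha> / \<mu>)\<^sup>2) > 0" using \<alpha> \<sigma> by (intro mult_pos_pos) auto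
      ultimately show ?thesis by (simp only:)
    qed
    have "eventually (\<lambda>\<tau>. Re (\<beta> \<tau>) > 0 \<and> Re ((\<beta> \<tau>)\<^sup>2) > 0) (nhds 0)"
      by (rule eventually_conj[OF order_tendstoD(1)[OF t12(1) p1] order_tendstoD(1)[OF t12(2) p2]])
    then obtain \<delta>0 where \<delta>0: "\<delta>0 > 0" "\<And>\<tau>. \<bar>\<tau>\<bar> < \<delta>0 \<Longrightarrow> Re (\<beta> \<tau>) > 0 \<and> Re ((\<beta> \<tau>)\<^sup>2) > 0"
      unfolding eventually_nhds_metric by (auto simp: dist_real_def)
    define \<delta>1 where "\<delta>1 = min \<delta>0 (r / (norm \<alpha> + 1))"
    have \<delta>1: "\<delta>1 > 0" using \<delta>0 r by (simp add: \<delta>1_def add_nonneg_pos)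
    have inB: "of_real \<tau> * \<alpha> \<in> B" if "\<bar>\<tau>\<bar> < \<delta>1" for \<tau>
    proof -
      have "\<bar>\<tau>\<bar> < r / (norm \<alpha> + 1)" using that by (simp add: \<delta>1_def)
      moreover have "norm \<alpha> + 1 > 0" by (simp add: add_nonneg_pos)
      ultimately have "\<bar>\<tau>\<bar> * (norm \<alpha> + 1) < r" by (simp only: pos_less_divide_eq)
      moreover have "\<bar>\<tau>\<bar> * norm \<alpha> \<le> \<bar>\<tau>\<bar> * (norm \<alpha> + 1)" by (intro mult_left_mono) auto
      ultimately show ?thesis by (simp add: B_def norm_mult)
    qed
    show "\<exists>\<delta>1>0. \<forall>\<delta>. 0 < \<delta> \<and> \<delta> < \<delta>1 \<longrightarrow> (\<forall>M. \<exists>C. saddle_bound \<sigma> a' \<mu> \<alpha> \<delta> M C)"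
    proof (rule exI[of _ \<delta>1], intro conjI \<delta>1 allI impI, elim conjE)
      fix \<delta> M assume \<delta>: "0 < \<delta>" "\<delta> < \<delta>1"
      have \<delta>': "\<bar>\<delta>\<bar> < \<delta>0" "\<bar>-\<delta>\<bar> < \<delta>0" using \<delta> by (auto simp: \<delta>1_def)
      define zb where "zb = of_real \<delta> * \<alpha>"
      define za where "za = of_real (- \<delta>) * \<alpha>"
      have zB: "zb \<in> B" "za \<in> B" unfolding zb_def za_def by (rule inB, use \<delta> in simp)+
      define \<eta>b where "\<eta>b = Re ((w zb / \<mu>)\<^sup>2)"
      define \<eta>a where "\<eta>a = Re ((w za / \<mu>)\<^sup>2)"
      have \<eta>: "\<eta>b > 0" "\<eta>a > 0" unfolding \<eta>b_def \<eta>a_def zb_def za_def w\<beta> power_mult_distrib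
        using \<delta>0(2)[OF \<delta>'(1)] \<delta>0(2)[OF \<delta>'(2)] \<delta> by (simp_all flip: of_real_power)
      define \<eta> where "\<eta> = min \<eta>a \<eta>b"
      have \<eta>p: "\<eta> > 0" using \<eta> by (simp add: \<eta>_def)
      obtain CM where CM: "CM \<ge> 0" "\<And>X. X > 0 \<Longrightarrow> exp (- \<eta> * X) \<le> CM / X ^ M" by (rule exp_le_inverse_power[OF \<eta>p]) blast
      define seg where "seg = closed_segment za zb"
      have segeq: "\<exists>\<tau>. z = of_real \<tau> * \<alpha> \<and> \<bar>\<tau>\<bar> \<le> \<delta>" if z: "z \<in> seg" for z
      proof -
        from z obtain t where t: "0 \<le> t" "t \<le> 1" "z = (1 - t) *\<^sub>R za + t *\<^sub>R zb" unfolding seg_def in_segment by auto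
        have "z = of_real ((2 * t - 1) * \<delta>) * \<alpha>" using t(3) by (simp add: za_def zb_def scaleR_conv_of_real algebra_simps)
        moreover have "\<bar>(2 * t - 1) * \<delta>\<bar> \<le> \<delta>" using t \<delta> by (simp add: abs_mult mult_le_cancel_right1 abs_le_iff)
        ultimately show ?thesis by blast
      qed
      have segB: "seg \<subseteq> B" using segeq inB \<delta> by fastforce
      have "compact (H M ` seg)"
        by (intro compact_continuous_image continuous_on_subset[OF holomorphic_on_imp_continuous_on[OF Hh] segB])
           (simp add: seg_def)
      then obtain CH where CH: "\<And>z. z \<in> seg \<Longrightarrow> norm (H M z) \<le> CH"
        by (meson bounded_iff compact_imp_bounded image_eqI)
      have CH0: "CH \<ge> 0" using order_trans[OF norm_ge_zero CH[of za]] by (simp add: seg_def)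
      define Ca where "Ca = (\<Sum>j<M. norm (a j))"
      define CK where "CK = (\<Sum>j<M. norm (K j zb) + norm (K j za))"
      define Cg where "Cg = norm (w zb) / \<eta>b + norm (w za) / \<eta>a"
      have C0: "Ca \<ge> 0" "CK \<ge> 0" "Cg \<ge> 0" using \<eta> by (auto simp: Ca_def CK_def Cg_def intro!: sum_nonneg add_nonneg_nonneg)
      show "\<exists>C. \<forall>X P. X \<ge> 1 \<longrightarrow>
         (\<forall>z. (P has_field_derivative exp (of_real X / \<mu>\<^sup>2 * phase \<sigma> z + z)) (at z)) \<longrightarrow>
         norm (exp (- (of_real X / \<mu>\<^sup>2)) * (P (of_real \<delta> * \<alpha>) - P (- of_real \<delta> * \<alpha>)) -
               of_real (sqrt (2 * pi / \<sigma>) / sqrt X) * \<mu> * (\<Sum>j<M. a' j / (of_real X / \<mu>\<^sup>2) ^ j)) \<le> C / X ^ M"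
      proof (rule exI[of _ "Ca * Cg * CM + CK * CM + CH * norm (zb - za)"], intro allI impI)
        fix X :: real and P :: "complex \<Rightarrow> complex"
        assume X: "X \<ge> 1" and P: "\<forall>z. (P has_field_derivative exp (of_real X / \<mu>\<^sup>2 * phase \<sigma> z + z)) (at z)"
        define \<Lambda> where "\<Lambda> = of_real X / \<mu>\<^sup>2"
        have \<Lambda>0: "\<Lambda> \<noteq> 0" using X \<mu>0 by (simp add: \<Lambda>_def)
        have n\<Lambda>: "norm \<Lambda> = X" using X \<mu> by (simp add: \<Lambda>_def norm_divide norm_power)
        have P': "(P has_field_derivative exp z * exp (\<Lambda> * phase \<sigma> z)) (at z)" for z
          using P by (simp add: \<Lambda>_def exp_add mult.commute)
        have "(\<lambda>w. exp (- \<Lambda> * w\<^sup>2)) holomorphic_on UNIV" by (intro holomorphic_intros)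
        from entire_primitive[OF this] obtain G where G: "\<And>w. (G has_field_derivative exp (- \<Lambda> * w\<^sup>2)) (at w)" by blast
        define S where "S = (\<lambda>z. exp \<Lambda> * G (w z))"
        have S: "(S has_field_derivative deriv w z * exp (\<Lambda> * phase \<sigma> z)) (at z)" if "z \<in> B" for z
        proof -
          have "(S has_field_derivative exp \<Lambda> * (exp (- \<Lambda> * (w z)\<^sup>2) * deriv w z)) (at z)"
            unfolding S_def by (intro DERIV_cmult DERIV_chain2[OF G] dw that)
          also have "exp \<Lambda> * (exp (- \<Lambda> * (w z)\<^sup>2) * deriv w z) = deriv w z * exp (\<Lambda> * phase \<sigma> z)"
            unfolding fw[OF that] by (simp add: algebra_simps flip: exp_add)
          finally show ?thesis .
        qed
        from main[rule_format, of \<Lambda> P S M, OF \<Lambda>0 P' S] obtain R where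
          R: "\<And>z. z \<in> B \<Longrightarrow> (R has_field_derivative H M z * exp (\<Lambda> * phase \<sigma> z)) (at z)" and
          PR: "\<And>z. P z = (\<Sum>j<M. a j / \<Lambda> ^ j) * S z + (\<Sum>j<M. K j z / \<Lambda> ^ Suc j) * exp (\<Lambda> * phase \<sigma> z) + R z / \<Lambda> ^ M"
          by auto
        have expz: "norm (exp (\<Lambda> * phase \<sigma> z)) = norm (exp \<Lambda>) * exp (- X * Re ((w z / \<mu>)\<^sup>2))" if "z \<in> B" for z
        proof -
          have "\<Lambda> * phase \<sigma> z = \<Lambda> - of_real X * (w z / \<mu>)\<^sup>2"
            unfolding fw[OF that] \<Lambda>_def by (simp add: power_divide right_diff_distrib diff_divide_distrib)
          thus ?thesis by (simp only: norm_exp_eq_Re minus_complex.sel Rem) (simp add: exp_diff exp_minus divide_inverse)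
        qed
        have eb: "exp (- X * \<eta>b) \<le> CM / X ^ M" "exp (- X * \<eta>a) \<le> CM / X ^ M"
        proof -
          have "exp (- X * \<eta>b) \<le> exp (- \<eta> * X)" "exp (- X * \<eta>a) \<le> exp (- \<eta> * X)" using X by (auto simp: \<eta>_def)
          moreover have "exp (- \<eta> * X) \<le> CM / X ^ M" by (rule CM(2)) (use X in simp)
          ultimately show "exp (- X * \<eta>b) \<le> CM / X ^ M" "exp (- X * \<eta>a) \<le> CM / X ^ M" by linarith+
        qed
        have Rb: "norm (R zb - R za) \<le> CH * norm (exp \<Lambda>) * norm (zb - za)"
        proof (rule field_differentiable_bound[where S = seg])
          fix z assume z: "z \<in> seg"
          show "(R has_field_derivative H M z * exp (\<Lambda> * phase \<sigma> z)) (at z within seg)"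
            by (rule has_field_derivative_at_within[OF R]) (use z segB in auto)
          obtain \<tau> where \<tau>: "z = of_real \<tau> * \<alpha>" "\<bar>\<tau>\<bar> \<le> \<delta>" using segeq[OF z] by blast
          have "Re ((w z / \<mu>)\<^sup>2) \<ge> 0"
            unfolding \<tau>(1) w\<beta> power_mult_distrib using \<delta>0(2)[of \<tau>] \<tau>(2) \<delta>'
            by (simp flip: of_real_power)
          hence "exp (- X * Re ((w z / \<mu>)\<^sup>2)) \<le> 1" using X by simp
          hence "norm (exp (\<Lambda> * phase \<sigma> z)) \<le> norm (exp \<Lambda>) * 1"
            using expz[of z] segB z by (metis in_mono mult_left_mono norm_ge_zero)
          hence "norm (H M z) * norm (exp (\<Lambda> * phase \<sigma> z)) \<le> CH * norm (exp \<Lambda>)"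
            using CH[OF z] CH0 by (intro mult_mono) auto
          thus "norm (H M z * exp (\<Lambda> * phase \<sigma> z)) \<le> CH * norm (exp \<Lambda>)" by (simp only: norm_mult)
        qed (auto simp: seg_def)
        have gb: "norm (G (w zb) - G 0 - of_real (sqrt pi / (2 * sqrt X)) * \<mu>) \<le> norm (w zb) * exp (- X * \<eta>b) / (X * \<eta>b)"
        proof -
          have "Re (w zb / \<mu>) > 0" unfolding zb_def w\<beta> using \<delta>0(2)[OF \<delta>'(1)] \<delta> by simp
          from gaussian_segment[OF _ \<mu>0 this _ G[unfolded \<Lambda>_def]] show ?thesis using X \<eta> by (simp add: \<eta>b_def)
        qed
        have ga: "norm (G (w za) - G 0 + of_real (sqrt pi / (2 * sqrt X)) * \<mu>) \<le> norm (w za) * exp (- X * \<eta>a) / (X * \<eta>a)"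
        proof -
          have "Re (w za / (- \<mu>)) > 0" unfolding divide_minus_right za_def w\<beta> using \<delta>0(2)[OF \<delta>'(2)] \<delta> by simp
          moreover have "- \<mu> \<noteq> 0" using \<mu>0 by simp
          moreover have "(G has_field_derivative exp (- (of_real X / (- \<mu>)\<^sup>2) * z\<^sup>2)) (at z)" for z using G[of z] by (simp add: \<Lambda>_def)
          ultimately show ?thesis using gaussian_segment[of X "- \<mu>" "w za" G] X \<eta> by (simp add: \<eta>a_def)
        qed
        have g2: "norm (w z) * exp (- X * e) / (X * e) \<le> norm (w z) / e * (CM / X ^ M)" if "e > 0" "exp (- X * e) \<le> CM / X ^ M" for e z
        proof -
          have "norm (w z) * exp (- X * e) / (X * e) \<le> norm (w z) * exp (- X * e) / (1 * e)"
            using X that by (intro divide_left_mono mult_right_mono mult_pos_pos mult_nonneg_nonneg) auto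
          also have "\<dots> = norm (w z) / e * exp (- X * e)" by simp
          also have "\<dots> \<le> norm (w z) / e * (CM / X ^ M)" using that by (intro mult_left_mono) auto
          finally show ?thesis .
        qed
        define Gd where "Gd = G (w zb) - G (w za) - of_real (sqrt pi / sqrt X) * \<mu>"
        have Gd: "norm Gd \<le> Cg * (CM / X ^ M)"
        proof -
          have "Gd = (G (w zb) - G 0 - of_real (sqrt pi / (2 * sqrt X)) * \<mu>) - (G (w za) - G 0 + of_real (sqrt pi / (2 * sqrt X)) * \<mu>)"
            by (simp add: Gd_def field_simps)
          hence "norm Gd \<le> norm (G (w zb) - G 0 - of_real (sqrt pi / (2 * sqrt X)) * \<mu>) + norm (G (w za) - G 0 + of_real (sqrt pi / (2 * sqrt X)) * \<mu>)"
            by (simp only: norm_triangle_ineq4)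
          also have "\<dots> \<le> norm (w zb) * exp (- X * \<eta>b) / (X * \<eta>b) + norm (w za) * exp (- X * \<eta>a) / (X * \<eta>a)"
            by (rule add_mono[OF gb ga])
          also have "\<dots> \<le> norm (w zb) / \<eta>b * (CM / X ^ M) + norm (w za) / \<eta>a * (CM / X ^ M)"
            by (intro add_mono g2 \<eta> eb)
          finally show ?thesis by (simp only: Cg_def distrib_right)
        qed
        define T1 where "T1 = (\<Sum>j<M. a j / \<Lambda> ^ j) * Gd"
        define T2 where "T2 = exp (- \<Lambda>) * ((\<Sum>j<M. K j zb / \<Lambda> ^ Suc j) * exp (\<Lambda> * phase \<sigma> zb) - (\<Sum>j<M. K j za / \<Lambda> ^ Suc j) * exp (\<Lambda> * phase \<sigma> za))"
        define T3 where "T3 = exp (- \<Lambda>) * (R zb - R za) / \<Lambda> ^ M"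
        have inv1: "norm (y / \<Lambda> ^ j) \<le> norm y" for y j
        proof -
          have "norm (y / \<Lambda> ^ j) = norm y / X ^ j" by (simp add: norm_divide norm_power n\<Lambda>)
          also have "\<dots> \<le> norm y / 1" using X by (intro divide_left_mono) auto
          finally show ?thesis by simp
        qed
        have T1: "norm T1 \<le> Ca * (Cg * (CM / X ^ M))"
          unfolding T1_def norm_mult Ca_def
          by (intro mult_mono Gd order_trans[OF norm_sum sum_mono] inv1) (auto intro!: sum_nonneg)
        have nexp: "norm (exp (- \<Lambda>)) * norm (exp \<Lambda>) = 1" by (simp flip: exp_add)
        have T2: "norm T2 \<le> CK * (CM / X ^ M)"
        proof -
          have k: "norm (exp (- \<Lambda>) * ((\<Sum>j<M. K j z / \<Lambda> ^ Suc j) * exp (\<Lambda> * phase \<sigma> z))) \<le> (\<Sum>j<M. norm (K j z)) * (CM / X ^ M)"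
            if z: "z \<in> B" and e: "exp (- X * Re ((w z / \<mu>)\<^sup>2)) \<le> CM / X ^ M" for z
          proof -
            have "norm (exp (- \<Lambda>) * ((\<Sum>j<M. K j z / \<Lambda> ^ Suc j) * exp (\<Lambda> * phase \<sigma> z))) =
              (norm (exp (- \<Lambda>)) * norm (exp \<Lambda>)) * (norm (\<Sum>j<M. K j z / \<Lambda> ^ Suc j) * exp (- X * Re ((w z / \<mu>)\<^sup>2)))"
              unfolding norm_mult expz[OF z] by (simp only: mult_ac)
            also have "\<dots> \<le> 1 * ((\<Sum>j<M. norm (K j z)) * (CM / X ^ M))"
              unfolding nexp by (intro mult_left_mono mult_mono e order_trans[OF norm_sum sum_mono] inv1) (auto intro!: sum_nonneg)
            finally show ?thesis by simp
          qed
          have "norm T2 \<le> norm (exp (- \<Lambda>) * ((\<Sum>j<M. K j zb / \<Lambda> ^ Suc j) * exp (\<Lambda> * phase \<sigma> zb))) +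
                 norm (exp (- \<Lambda>) * ((\<Sum>j<M. K j za / \<Lambda> ^ Suc j) * exp (\<Lambda> * phase \<sigma> za)))"
            unfolding T2_def right_diff_distrib by (rule norm_triangle_ineq4)
          also have "\<dots> \<le> (\<Sum>j<M. norm (K j zb)) * (CM / X ^ M) + (\<Sum>j<M. norm (K j za)) * (CM / X ^ M)"
            by (intro add_mono k zB) (use eb in \<open>simp_all add: \<eta>b_def \<eta>a_def\<close>)
          also have "\<dots> = CK * (CM / X ^ M)" by (simp only: CK_def sum.distrib distrib_right)
          finally show ?thesis .
        qed
        have T3: "norm T3 \<le> CH * norm (zb - za) / X ^ M"
        proof -
          have "norm T3 = norm (exp (- \<Lambda>)) * norm (R zb - R za) / X ^ M"
            by (simp add: T3_def norm_mult norm_divide norm_power n\<Lambda>)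
          also have "\<dots> \<le> norm (exp (- \<Lambda>)) * (CH * norm (exp \<Lambda>) * norm (zb - za)) / X ^ M"
            using X Rb by (intro divide_right_mono mult_left_mono) auto
          also have "\<dots> = (norm (exp (- \<Lambda>)) * norm (exp \<Lambda>)) * (CH * norm (zb - za)) / X ^ M" by (simp only: mult_ac)
          finally show ?thesis unfolding nexp by simp
        qed
        have "exp (- \<Lambda>) * (P zb - P za) - of_real (sqrt (2 * pi / \<sigma>) / sqrt X) * \<mu> * (\<Sum>j<M. a' j / \<Lambda> ^ j) = T1 + T2 + T3"
        proof -
          have "sqrt (2 * pi / \<sigma>) * sqrt (\<sigma> / 2) = sqrt pi" using \<sigma> by (simp flip: real_sqrt_mult)
          hence "of_real (sqrt (2 * pi / \<sigma>)) * of_real (sqrt (\<sigma> / 2)) = complex_of_real (sqrt pi)" by (simp flip: of_real_mult)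
          hence "of_real (sqrt (2 * pi / \<sigma>) / sqrt X) * \<mu> * (\<Sum>j<M. a' j / \<Lambda> ^ j) = (\<Sum>j<M. a j / \<Lambda> ^ j) * (of_real (sqrt pi / sqrt X) * \<mu>)"
            by (simp add: a'_def sum_distrib_left[symmetric] times_divide_eq_right[symmetric] mult.assoc del: times_divide_eq_right) (simp add: field_simps)
          moreover have "exp (- \<Lambda>) * S z = G (w z)" for z by (simp add: S_def exp_minus)
          hence "exp (- \<Lambda>) * P z = (\<Sum>j<M. a j / \<Lambda> ^ j) * G (w z) + exp (- \<Lambda>) * ((\<Sum>j<M. K j z / \<Lambda> ^ Suc j) * exp (\<Lambda> * phase \<sigma> z)) + exp (- \<Lambda>) * R z / \<Lambda> ^ M" for z
            unfolding PR[of z] by (simp only: distrib_left mult.left_commute[of "exp (- \<Lambda>)"] times_divide_eq_right)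
          ultimately show ?thesis unfolding T1_def T2_def T3_def Gd_def
            by (simp only: right_diff_distrib) (simp add: algebra_simps diff_divide_distrib)
        qed
        also have "norm (T1 + T2 + T3) \<le> norm T1 + norm T2 + norm T3"
          using norm_triangle_ineq[of "T1 + T2" T3] norm_triangle_ineq[of T1 T2] by linarith
        also have "\<dots> \<le> Ca * (Cg * (CM / X ^ M)) + CK * (CM / X ^ M) + CH * norm (zb - za) / X ^ M"
          by (intro add_mono T1 T2 T3)
        also have "\<dots> = (Ca * Cg * CM + CK * CM + CH * norm (zb - za)) / X ^ M" by (simp add: add_divide_distrib)
        finally show "norm (exp (- (of_real X / \<mu>\<^sup>2)) * (P (of_real \<delta> * \<alpha>) - P (- of_real \<delta> * \<alpha>)) -
               of_real (sqrt (2 * pi / \<sigma>) / sqrt X) * \<mu> * (\<Sum>j<M. a' j / (of_real X / \<mu>\<^sup>2) ^ j)) \<le> (Ca * Cg * CM + CK * CM + CH * norm (zb - za)) / X ^ M"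
          by (simp add: zb_def za_def \<Lambda>_def)
      qed
    qed
  qed
qed


section \<open>Expansion on the positive half-axis\<close>

lemma primitive_right_tail_bound:
  assumes P: "\<And>z. (P has_field_derivative f z) (at z)"
    and b: "\<And>u. u \<ge> u0 \<Longrightarrow> norm (f (pt u v)) \<le> A * exp (- (u - u0))"
    and L: "((\<lambda>u. P (pt u v)) \<longlongrightarrow> L) at_top"
  shows "norm (L - P (pt u0 v)) \<le> A"
proof -
  have A: "A \<ge> 0" using order_trans[OF norm_ge_zero b[of u0]] by simp
  show ?thesis
  proof (rule tendsto_upperbound)
    show "((\<lambda>u. norm (P (pt u v) - P (pt u0 v))) \<longlongrightarrow> norm (L - P (pt u0 v))) at_top"
      by (intro tendsto_intros L)
    show "\<forall>\<^sub>F u in at_top. norm (P (pt u v) - P (pt u0 v)) \<le> A"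
      using eventually_gt_at_top[of u0]
    proof eventually_elim
      case (elim V)
      define \<phi> where "\<phi> = (\<lambda>u. - A * exp (- (u - u0)))"
      have "norm (P (pt V v) - P (pt u0 v)) \<le> \<phi> V - \<phi> u0"
      proof (rule differentiable_bound_general[where f' = "\<lambda>u. f (pt u v)" and \<phi>' = "\<lambda>u. A * exp (- (u - u0))"])
        show "continuous_on {u0..V} (\<lambda>u. P (pt u v))"
          by (intro continuous_at_imp_continuous_on ballI has_vector_derivative_continuous[OF primitive_vector_derivative[OF P]])
        show "continuous_on {u0..V} \<phi>" unfolding \<phi>_def by (intro continuous_intros)
        show "((\<lambda>u. P (pt u v)) has_vector_derivative f (pt x v)) (at x)" for x
          by (rule primitive_vector_derivative[OF P])
        show "(\<phi> has_vector_derivative A * exp (- (x - u0))) (at x)" for x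
          unfolding \<phi>_def has_real_derivative_iff_has_vector_derivative[symmetric]
          by (auto intro!: derivative_eq_intros)
      qed (use elim b in auto)
      also have "\<dots> \<le> A" using A by (simp add: \<phi>_def)
      finally show ?case .
    qed
  qed auto
qed

lemma primitive_left_tail_bound:
  assumes P: "\<And>z. (P has_field_derivative f z) (at z)"
    and b: "\<And>u. u \<le> u0 \<Longrightarrow> norm (f (pt u v)) \<le> A * exp (u - u0)"
    and L: "((\<lambda>u. P (pt u v)) \<longlongrightarrow> L) at_bot"
  shows "norm (P (pt u0 v) - L) \<le> A"
proof -
  have A: "A \<ge> 0" using order_trans[OF norm_ge_zero b[of u0]] by simp
  show ?thesis
  proof (rule tendsto_upperbound)
    show "((\<lambda>u. norm (P (pt u0 v) - P (pt u v))) \<longlongrightarrow> norm (P (pt u0 v) - L)) at_bot"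
      by (intro tendsto_intros L)
    show "\<forall>\<^sub>F u in at_bot. norm (P (pt u0 v) - P (pt u v)) \<le> A"
      using eventually_gt_at_bot[of u0]
    proof eventually_elim
      case (elim V)
      define \<phi> where "\<phi> = (\<lambda>u. A * exp (u - u0))"
      have "norm (P (pt u0 v) - P (pt V v)) \<le> \<phi> u0 - \<phi> V"
      proof (rule differentiable_bound_general[where f' = "\<lambda>u. f (pt u v)" and \<phi>' = "\<lambda>u. A * exp (u - u0)"])
        show "continuous_on {V..u0} (\<lambda>u. P (pt u v))"
          by (intro continuous_at_imp_continuous_on ballI has_vector_derivative_continuous[OF primitive_vector_derivative[OF P]])
        show "continuous_on {V..u0} \<phi>" unfolding \<phi>_def by (intro continuous_intros)
        show "((\<lambda>u. P (pt u v)) has_vector_derivative f (pt x v)) (at x)" for x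
          by (rule primitive_vector_derivative[OF P])
        show "(\<phi> has_vector_derivative A * exp (x - u0)) (at x)" for x
          unfolding \<phi>_def has_real_derivative_iff_has_vector_derivative[symmetric]
          by (auto intro!: derivative_eq_intros)
      qed (use elim b in auto)
      also have "\<dots> \<le> A" using A by (simp add: \<phi>_def)
      finally show ?case .
    qed
  qed auto
qed

lemma primitive_cnj:
  assumes P: "\<And>z. (P has_field_derivative f z) (at z)" and f: "\<And>z. f (cnj z) = cnj (f z)"
  shows "P (cnj b) - P (cnj a) = cnj (P b - P a)"
proof -
  have "((\<lambda>z. cnj (P (cnj z)) - P z) has_field_derivative 0) (at z)" for z
  proof -
    have "((cnj \<circ> P \<circ> cnj) has_field_derivative cnj (f (cnj z))) (at z)"
      by (rule has_field_derivative_cnj_cnj) (use P in simp)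
    hence "((\<lambda>z. cnj (P (cnj z))) has_field_derivative f z) (at z)"
      using f[of z] by (simp add: o_def)
    from DERIV_diff[OF this P] show ?thesis by simp
  qed
  hence "\<exists>c. \<forall>z\<in>UNIV. cnj (P (cnj z)) - P z = c"
    by (intro has_field_derivative_zero_constant) auto
  then obtain c where c: "\<And>z. cnj (P (cnj z)) - P z = c" by auto
  have "cnj (P (cnj b)) - P b = cnj (P (cnj a)) - P a" using c[of a] c[of b] by simp
  hence "cnj (P (cnj b) - P (cnj a)) = P b - P a" by (simp add: algebra_simps)
  from arg_cong[OF this, of cnj] show ?thesis by (simp only: complex_cnj_cnj)
qed

text \<open>For integrands real on the real axis the imaginary part of the integral over half of a symmetric
  path is the integral over the whole path divided by \<open>2 \<i>\<close>. It makes the saddle at \<open>0\<close> an interior point.\<close>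
lemma Im_primitive_difference:
  assumes P: "\<And>z. (P has_field_derivative f z) (at z)" and f: "\<And>z. f (cnj z) = cnj (f z)"
  shows "of_real (Im (P z - P (of_real r))) = (P z - P (cnj z)) / (2 * \<i>)"
proof -
  have "P (cnj z) - P (cnj (of_real r)) = cnj (P z - P (of_real r))"
    by (rule primitive_cnj) (fact P, fact f)
  hence "P (cnj z) - P (of_real r) = cnj (P z - P (of_real r))" by simp
  hence "P z - P (cnj z) = (P z - P (of_real r)) - cnj (P z - P (of_real r))" by (simp only: algebra_simps)
  also have "\<dots> = of_real (Im (P z - P (of_real r))) * (2 * \<i>)"
    by (simp add: complex_eq_iff)
  finally have e: "P z - P (cnj z) = of_real (Im (P z - P (of_real r))) * (2 * \<i>)" .
  have "x * (2 * \<i>) / (2 * \<i>) = x" for x by (rule nonzero_mult_div_cancel_right) simp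
  thus ?thesis unfolding e by (rule sym)
qed

lemma bigX_pos: "0 < \<sigma> \<Longrightarrow> \<sigma> < 1 \<Longrightarrow> x > 0 \<Longrightarrow> bigX \<sigma> x > 0"
  by (simp add: bigX_def kap_def hpar_def)

lemma bigX_powr_kap:
  assumes "0 < \<sigma>" "\<sigma> < 1" "x > 0"
  shows "(bigX \<sigma> x / (1 - \<sigma>)) powr (1 - \<sigma>) = \<sigma> powr \<sigma> * x"
  using assms by (simp add: bigX_def kap_def hpar_def powr_powr)

text \<open>The definition of \<open>X\<close> places the saddle at \<open>0\<close>: \<open>d\<close> becomes \<open>X / \<kappa>\<close> when \<open>c = X \<sigma> / \<kappa>\<close>.\<close>
lemma bigX_scale:
  assumes "0 < \<sigma>" "\<sigma> < 1" "x > 0"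
  shows "x * (bigX \<sigma> x * \<sigma> / (1 - \<sigma>)) powr \<sigma> = bigX \<sigma> x / (1 - \<sigma>)"
proof -
  define Y where "Y = bigX \<sigma> x / (1 - \<sigma>)"
  have Y: "Y > 0" using bigX_pos[OF assms] assms by (simp add: Y_def)
  have "bigX \<sigma> x * \<sigma> / (1 - \<sigma>) = Y * \<sigma>" by (simp add: Y_def)
  hence "x * (bigX \<sigma> x * \<sigma> / (1 - \<sigma>)) powr \<sigma> = (\<sigma> powr \<sigma> * x) * Y powr \<sigma>"
    using assms Y by (simp add: powr_mult)
  also have "\<dots> = Y powr (1 - \<sigma>) * Y powr \<sigma>" using bigX_powr_kap[OF assms] by (simp add: Y_def)
  also have "\<dots> = Y" using Y by (simp flip: powr_add)
  finally show ?thesis by (simp add: Y_def)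
qed

lemma wfun_phase_minus:
  assumes "\<sigma> < 1"
  shows "wfun \<sigma> (X * \<sigma> / (1 - \<sigma>)) (- (X / (1 - \<sigma>))) 1 z = exp (of_real X / \<i>\<^sup>2 * phase \<sigma> z + z)"
proof -
  have "of_real (X * \<sigma> / (1 - \<sigma>)) * E + of_real (- (X / (1 - \<sigma>))) * S + of_real 1 * z =
      of_real X / \<i>\<^sup>2 * ((S - of_real \<sigma> * E) / of_real (1 - \<sigma>)) + z" for E S
    by (simp add: diff_divide_distrib algebra_simps)
  thus ?thesis unfolding wfun_def phase_def by (simp only:)
qed

text \<open>On the imaginary axis the saddle is the minimum of the phase, which increases up to the point where the path leaves
  the axis; its derivative is \<open>\<sigma> (sin v - sin \<sigma>v)\<close> up to the factor \<open>1 / \<kappa>\<close>.\<close>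
lemma vertical_phase_increasing:
  assumes \<sigma>: "0 < \<sigma>" "\<sigma> < 1" and ab: "0 \<le> a" "a < b" "b \<le> pi / (1 + \<sigma>)"
  shows "cos (\<sigma> * a) - \<sigma> * cos a < cos (\<sigma> * b) - \<sigma> * cos b"
proof (rule DERIV_pos_imp_increasing_open[OF ab(2)])
  fix v assume v: "a < v" "v < b"
  have v1: "v * (1 + \<sigma>) < pi" proof -
    have "v * (1 + \<sigma>) < b * (1 + \<sigma>)" using v \<sigma> by (intro mult_strict_right_mono) auto
    also have "\<dots> \<le> pi / (1 + \<sigma>) * (1 + \<sigma>)" using ab \<sigma> by (intro mult_right_mono) auto
    finally show ?thesis using \<sigma> by simp
  qed
  have "sin v - sin (\<sigma> * v) = 2 * sin ((v - \<sigma> * v) / 2) * cos ((v + \<sigma> * v) / 2)" by (rule sin_diff_sin)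
  also have "\<dots> > 0"
  proof (intro mult_pos_pos)
    have "\<sigma> * v < 1 * v" using \<sigma> v ab by (intro mult_strict_right_mono) auto
    moreover have "\<sigma> * v > 0" using \<sigma> v ab by simp
    ultimately show "sin ((v - \<sigma> * v) / 2) > 0" using v1 by (intro sin_gt_zero) (auto simp: algebra_simps)
    show "cos ((v + \<sigma> * v) / 2) > 0" using v1 \<open>\<sigma> * v > 0\<close> v ab by (intro cos_gt_zero_pi) (auto simp: algebra_simps)
  qed auto
  finally have "\<sigma> * (sin v - sin (\<sigma> * v)) > 0" using \<sigma> by simp
  moreover have "((\<lambda>v. cos (\<sigma> * v) - \<sigma> * cos v) has_real_derivative \<sigma> * (sin v - sin (\<sigma> * v))) (at v)"
    by (auto intro!: derivative_eq_intros simp: algebra_simps)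
  ultimately show "\<exists>y. ((\<lambda>v. cos (\<sigma> * v) - \<sigma> * cos v) has_real_derivative y) (at v) \<and> y > 0" by blast
qed (intro continuous_intros)

lemma wfun_cnj: "wfun \<sigma> c d m (cnj z) = cnj (wfun \<sigma> c d m z)"
  by (simp add: wfun_def exp_cnj)

lemma Acon'_eq:
  assumes "0 < \<sigma>" "\<sigma> < 1"
  shows "Acon' \<sigma> = sqrt (2 * pi / \<sigma>) * \<sigma> / (1 - \<sigma>)"
proof -
  have "(\<sigma> / (1 - \<sigma>)) powr \<sigma> * (\<sigma> / (1 - \<sigma>)) powr (1 - \<sigma>) = \<sigma> / (1 - \<sigma>)"
    using assms by (simp flip: powr_add)
  thus ?thesis by (simp add: Acon'_def Acon_def kap_def mult.assoc)
qed


text \<open>The path goes from \<open>0\<close> up the imaginary axis to \<open>\<i> \<phi>\<close> with \<open>\<phi> = \<pi> / (1 + \<sigma>)\<close> and then to the right. By symmetry its start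
  is half of a segment through the saddle, and the rest is
  smaller than \<open>e\<^sup>-\<^sup>X\<close> by an exponential factor.\<close>
theorem wright_F_positive:
  assumes \<sigma>: "0 < \<sigma>" "\<sigma> < 1" and a: "is_saddle_series \<sigma> a"
  shows "\<exists>C X0. X0 \<ge> 1 \<and> (\<forall>x>0. bigX \<sigma> x \<ge> X0 \<longrightarrow>
     norm (of_real (wright_F \<sigma> x) - of_real (Acon' \<sigma> / (2 * pi) * sqrt (bigX \<sigma> x) * exp (- bigX \<sigma> x)) * (\<Sum>j<M. a j / (- of_real (bigX \<sigma> x)) ^ j))
       \<le> C * (sqrt (bigX \<sigma> x) * exp (- bigX \<sigma> x) / bigX \<sigma> x ^ M))"
proof -
  define \<kappa> where "\<kappa> = 1 - \<sigma>"
  have \<kappa>: "\<kappa> > 0" using \<sigma> by (simp add: \<kappa>_def)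
  have conds: "norm \<i> = 1" "Re (\<i> / \<i>) > 0" "Re ((\<i> / \<i>)\<^sup>2) > 0" by simp_all
  from a[unfolded is_saddle_series_def, rule_format, OF conds] obtain \<delta>1 where \<delta>1: "\<delta>1 > 0" and
    sad: "\<And>\<delta> M. 0 < \<delta> \<and> \<delta> < \<delta>1 \<Longrightarrow> \<exists>C. saddle_bound \<sigma> a \<i> \<i> \<delta> M C" by blast
  define \<phi> where "\<phi> = pi / (1 + \<sigma>)"
  have \<phi>: "pi / 2 < \<phi>" "\<phi> < pi" "\<sigma> * \<phi> < pi / 2"
    using \<sigma> pi_gt_zero by (auto simp: \<phi>_def field_simps)
  define \<delta> where "\<delta> = min (\<delta>1 / 2) (\<phi> / 2)"
  have \<delta>: "0 < \<delta>" "\<delta> < \<delta>1" "\<delta> < \<phi>" using \<delta>1 \<phi> pi_gt_zero by (auto simp: \<delta>_def min_def)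
  \<comment> \<open>one term more than required: the prefactor \<open>c\<close> is of order \<open>X\<close>\<close>
  obtain C1 where C1: "saddle_bound \<sigma> a \<i> \<i> \<delta> (Suc M) C1"
    using sad[of \<delta> "Suc M"] \<delta> by blast
  define g where "g = (\<lambda>v. (cos (\<sigma> * v) - \<sigma> * cos v) / \<kappa>)"
  have g_mono: "g v < g v'" if "0 \<le> v" "v < v'" "v' \<le> \<phi>" for v v'
    unfolding g_def using vertical_phase_increasing[OF \<sigma> that(1,2)] that(3) \<kappa> by (intro divide_strict_right_mono) (auto simp: \<phi>_def)
  have g0: "g 0 = 1" using \<kappa> by (simp add: g_def \<kappa>_def)
  define \<eta> where "\<eta> = g \<delta> - 1"
  have \<eta>: "\<eta> > 0" using g_mono[of 0 \<delta>] \<delta> g0 by (simp add: \<eta>_def)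
  obtain C2 where C2: "C2 \<ge> 0" "\<And>X. X > 0 \<Longrightarrow> exp (- \<eta> * X) \<le> C2 / X ^ Suc M" by (rule exp_le_inverse_power[OF \<eta>]) blast
  define k where "k = - cos \<phi>"
  have k: "k > 0" using \<phi> cos_monotone_0_pi[of "pi / 2" \<phi>] by (simp add: k_def)
  \<comment> \<open>for \<open>X \<ge> X0\<close> the linear decay of the phase beats the factor \<open>e\<^sup>u\<close>\<close>
  define X0 where "X0 = max 1 (2 * \<kappa> / (\<sigma> * k))"
  define C where "C = \<sigma> / \<kappa> / pi * ((1 + \<phi>) * C2 + \<bar>C1\<bar>) + Acon' \<sigma> / (2 * pi) * norm (a M)"
  show ?thesis
  proof (rule exI[of _ C], rule exI[of _ X0], intro conjI allI impI)
    show "X0 \<ge> 1" by (simp add: X0_def)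
    fix x :: real assume x: "x > 0" and XX: "bigX \<sigma> x \<ge> X0"
    define X where "X = bigX \<sigma> x"
    have X: "X \<ge> 1" "X \<ge> 2 * \<kappa> / (\<sigma> * k)" using XX by (auto simp: X0_def X_def)
    have X0: "X > 0" using X by simp
    define c where "c = X * \<sigma> / (1 - \<sigma>)"
    have c: "c > 0" using X \<sigma> by (simp add: c_def)
    define f where "f = wfun \<sigma> c (- (X / (1 - \<sigma>))) 1"
    obtain P where P: "\<And>z. (P has_field_derivative f z) (at z)"
      using entire_primitive[OF wfun_holomorphic] unfolding f_def by blast
    have sc: "- x * c powr \<sigma> = - (X / (1 - \<sigma>))" using bigX_scale[OF \<sigma> x] by (simp add: c_def X_def)
    have P': "\<And>z. (P has_field_derivative wfun \<sigma> c (- x * c powr \<sigma>) 1 z) (at z)" using P unfolding sc f_def .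
    obtain L where L: "((\<lambda>u. P (pt u pi)) \<longlongrightarrow> L) at_top"
      "\<And>a. wright_F \<sigma> x = c / pi * Im (L - P (of_real a))"
      by (rule wright_F_primitive[OF \<sigma> c P']) blast
    have nf: "norm (f (pt u v)) = exp (- (X / \<kappa>) * (cos (\<sigma> * v) * exp (\<sigma> * u) - \<sigma> * cos v * exp u) + u)" for u v
      unfolding f_def norm_wfun by (simp add: c_def \<kappa>_def algebra_simps)
    have L': "((\<lambda>u. P (pt u \<phi>)) \<longlongrightarrow> L) at_top"
    proof (rule wfun_right_limit[OF \<sigma> c P[unfolded f_def], where S = "{\<phi>..pi}" and a = pi and k = k])
      show "cos v \<le> - k" if "v \<in> {\<phi>..pi}" for v using that \<phi> pi_gt_zero cos_monotone_0_pi_le[of \<phi> v] by (simp add: k_def)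
      show "filterlim (\<lambda>u::real. u) at_top at_top" by (rule filterlim_ident)
    qed (use \<phi> k L in simp_all)
    have tail1: "norm (L - P (pt 0 \<phi>)) \<le> exp (- X * g \<phi>)"
    proof (rule primitive_right_tail_bound[OF P _ L'])
      fix u :: real assume u: "u \<ge> 0"
      have "\<sigma> * \<phi> \<ge> 0" using \<phi> \<sigma> pi_gt_zero by (intro mult_nonneg_nonneg) linarith+
      hence "cos (\<sigma> * \<phi>) \<ge> 0" using \<phi> pi_gt_zero by (intro cos_ge_zero) linarith+
      hence "cos (\<sigma> * \<phi>) * 1 \<le> cos (\<sigma> * \<phi>) * exp (\<sigma> * u)" using u \<sigma> by (intro mult_left_mono) auto
      moreover have "\<sigma> * k * (1 + u) \<le> \<sigma> * k * exp u" using \<sigma> k by (intro mult_left_mono) auto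
      moreover have "\<kappa> * g \<phi> = cos (\<sigma> * \<phi>) + \<sigma> * k" using \<kappa> by (simp add: g_def k_def)
      moreover have "\<sigma> * k * (1 + u) = \<sigma> * k + \<sigma> * k * u" "\<sigma> * k * exp u = - (\<sigma> * cos \<phi> * exp u)"
        by (simp_all add: k_def algebra_simps)
      ultimately have "\<kappa> * g \<phi> + \<sigma> * k * u \<le> cos (\<sigma> * \<phi>) * exp (\<sigma> * u) - \<sigma> * cos \<phi> * exp u"
        by linarith
      hence "(X / \<kappa>) * (\<kappa> * g \<phi> + \<sigma> * k * u) \<le> (X / \<kappa>) * (cos (\<sigma> * \<phi>) * exp (\<sigma> * u) - \<sigma> * cos \<phi> * exp u)"
        using X0 \<kappa> by (intro mult_left_mono) auto
      moreover have "(X / \<kappa>) * (\<kappa> * g \<phi> + \<sigma> * k * u) = X * g \<phi> + X * (\<sigma> * k / \<kappa>) * u" using \<kappa> by (simp add: field_simps)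
      moreover have "2 * u \<le> X * (\<sigma> * k / \<kappa>) * u"
      proof (rule mult_right_mono)
        have "2 * \<kappa> / (\<sigma> * k) * (\<sigma> * k / \<kappa>) \<le> X * (\<sigma> * k / \<kappa>)" using X(2) \<sigma> k \<kappa> by (intro mult_right_mono) auto
        thus "2 \<le> X * (\<sigma> * k / \<kappa>)" using \<sigma> k \<kappa> by simp
      qed (rule u)
      ultimately have "- (X / \<kappa>) * (cos (\<sigma> * \<phi>) * exp (\<sigma> * u) - \<sigma> * cos \<phi> * exp u) + u \<le> - X * g \<phi> + - (u - 0)"
        by simp
      thus "norm (f (pt u \<phi>)) \<le> exp (- X * g \<phi>) * exp (- (u - 0))"
        unfolding nf exp_add[symmetric] exp_le_cancel_iff .
    qed
    have tail2: "norm (P (pt 0 \<phi>) - P (pt 0 \<delta>)) \<le> exp (- X * g \<delta>) * \<bar>\<phi> - \<delta>\<bar>"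
    proof (rule primitive_vertical_bound[OF P])
      fix v assume "v \<in> closed_segment \<delta> \<phi>"
      hence v: "\<delta> \<le> v" "v \<le> \<phi>" using \<delta> by (auto simp: closed_segment_eq_real_ivl)
      have "g \<delta> \<le> g v" using g_mono[of \<delta> v] v \<delta> by (cases "v = \<delta>") auto
      hence "- X * g v \<le> - X * g \<delta>" using X0 by simp
      moreover have "norm (f (pt 0 v)) = exp (- X * g v)" unfolding nf by (simp add: g_def)
      ultimately show "norm (f (pt 0 v)) \<le> exp (- X * g \<delta>)" by simp
    qed
    define O1 where "O1 = (L - P (pt 0 \<phi>)) + (P (pt 0 \<phi>) - P (pt 0 \<delta>))"
    have O1: "norm O1 \<le> (1 + \<phi>) * (C2 / X ^ Suc M) * exp (- X)"
    proof -
      have "norm O1 \<le> exp (- X * g \<phi>) + exp (- X * g \<delta>) * \<bar>\<phi> - \<delta>\<bar>"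
        unfolding O1_def by (rule norm_triangle_le[OF add_mono[OF tail1 tail2]])
      also have "\<dots> \<le> exp (- X * g \<delta>) + exp (- X * g \<delta>) * \<phi>"
        using g_mono[of \<delta> \<phi>] \<delta> X0 by (intro add_mono mult_left_mono) auto
      also have "\<dots> = (1 + \<phi>) * exp (- X * g \<delta>)" by (simp add: algebra_simps)
      also have "exp (- X * g \<delta>) = exp (- \<eta> * X) * exp (- X)" by (simp add: \<eta>_def algebra_simps flip: exp_add)
      also have "(1 + \<phi>) * (exp (- \<eta> * X) * exp (- X)) \<le> (1 + \<phi>) * (C2 / X ^ Suc M * exp (- X))"
        using C2(2)[OF X0] \<phi> pi_gt_zero by (intro mult_left_mono mult_right_mono) auto
      finally show ?thesis by (simp only: mult.assoc)
    qed
    define S where "S = P (of_real \<delta> * \<i>) - P (- of_real \<delta> * \<i>)"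
    define SS where "SS = (\<Sum>j<Suc M. a j / (- of_real X) ^ j)"
    have Sb: "norm (exp (of_real X) * S - of_real (sqrt (2 * pi / \<sigma>) / sqrt X) * \<i> * SS) \<le> C1 / X ^ Suc M"
    proof -
      have "\<forall>z. (P has_field_derivative exp (of_real X / \<i>\<^sup>2 * phase \<sigma> z + z)) (at z)"
        using P wfun_phase_minus[OF \<sigma>(2), of X] by (simp only: f_def c_def) blast
      from C1[THEN spec, THEN spec, THEN mp, THEN mp, OF X(1) this] show ?thesis by (simp only: S_def SS_def power2_i divide_minus_right div_by_1 minus_minus) 
    qed
    have fc: "f (cnj z) = cnj (f z)" for z unfolding f_def by (rule wfun_cnj)
    have half: "of_real (Im (P (of_real \<delta> * \<i>) - P (of_real 0))) = S / (2 * \<i>)"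
    proof -
      have "of_real (Im (P (of_real \<delta> * \<i>) - P (of_real 0))) = (P (of_real \<delta> * \<i>) - P (cnj (of_real \<delta> * \<i>))) / (2 * \<i>)"
        by (rule Im_primitive_difference[of P f]) (fact P, fact fc)
      moreover have "cnj (of_real \<delta> * \<i>) = - of_real \<delta> * \<i>" by simp
      ultimately show ?thesis by (simp only: S_def)
    qed
    have Fdec: "of_real (wright_F \<sigma> x) = of_real (c / pi) * (of_real (Im O1) + S / (2 * \<i>))"
    proof -
      have "L - P (of_real 0) = O1 + (P (of_real \<delta> * \<i>) - P (of_real 0))" by (simp add: O1_def mult.commute)
      hence "wright_F \<sigma> x = c / pi * (Im O1 + Im (P (of_real \<delta> * \<i>) - P (of_real 0)))" using L(2)[of 0] by simp
      thus ?thesis unfolding half[symmetric] by (simp only: of_real_mult of_real_add)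
    qed
    define pref where "pref = Acon' \<sigma> / (2 * pi) * sqrt X * exp (- X)"
    have prefeq: "pref = c / pi / 2 * exp (- X) * (sqrt (2 * pi / \<sigma>) / sqrt X)"
      proof -
      have "sqrt X = X / sqrt X" using X0 by (simp add: real_div_sqrt)
      hence "pref = Acon' \<sigma> / (2 * pi) * (X / sqrt X) * exp (- X)" by (simp only: pref_def)
      thus ?thesis unfolding Acon'_eq[OF \<sigma>] c_def by (simp add: mult_ac)
    qed
    have main: "norm (of_real (wright_F \<sigma> x) - of_real pref * SS) \<le> c / pi * ((1 + \<phi>) * C2 + \<bar>C1\<bar>) * (exp (- X) / X ^ Suc M)"
    proof -
      have alg: "c / pi * ((1 + \<phi>) * (C2 / Y) * E + E * (\<bar>C1\<bar> / Y)) = c / pi * ((1 + \<phi>) * C2 + \<bar>C1\<bar>) * (E / Y)" for Y E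
        by (simp add: distrib_left distrib_right add_divide_distrib mult_ac)
      have e1: "exp (of_real X) * complex_of_real (exp (- X)) = 1" by (simp flip: exp_of_real exp_add)
      have eq: "of_real (wright_F \<sigma> x) - of_real pref * SS = of_real (c / pi) * (of_real (Im O1) +
         of_real (exp (- X)) * ((exp (of_real X) * S - of_real (sqrt (2 * pi / \<sigma>) / sqrt X) * \<i> * SS) / (2 * \<i>)))"
      proof -
        have red: "of_real (exp (- X)) * ((exp (of_real X) * S - of_real (sqrt (2 * pi / \<sigma>) / sqrt X) * \<i> * SS) / (2 * \<i>)) =
          (exp (of_real X) * of_real (exp (- X))) * S / (2 * \<i>) - of_real (exp (- X)) * of_real (sqrt (2 * pi / \<sigma>) / sqrt X) / 2 * SS"
          by (simp add: field_simps)
        show ?thesis unfolding Fdec prefeq red e1 by (simp add: algebra_simps)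
      qed
      have nA: "norm (complex_of_real (Im O1)) \<le> (1 + \<phi>) * (C2 / X ^ Suc M) * exp (- X)"
        unfolding norm_of_real using O1 abs_Im_le_cmod[of O1] by linarith
      have nB: "norm (of_real (exp (- X)) * ((exp (of_real X) * S - of_real (sqrt (2 * pi / \<sigma>) / sqrt X) * \<i> * SS) / (2 * \<i>))) \<le> exp (- X) * (\<bar>C1\<bar> / X ^ Suc M)"
      proof -
        have "norm ((exp (of_real X) * S - of_real (sqrt (2 * pi / \<sigma>) / sqrt X) * \<i> * SS) / (2 * \<i>)) \<le> C1 / 2 / X ^ Suc M"
          using Sb by (simp add: norm_divide norm_mult)
        also have "\<dots> \<le> \<bar>C1\<bar> / X ^ Suc M" using X0 by (intro divide_right_mono) auto
        finally have n1: "norm ((exp (of_real X) * S - of_real (sqrt (2 * pi / \<sigma>) / sqrt X) * \<i> * SS) / (2 * \<i>)) \<le> \<bar>C1\<bar> / X ^ Suc M" .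
        have "norm (complex_of_real (exp (- X))) = exp (- X)" by simp
        with mult_left_mono[OF n1, of "exp (- X)"] show ?thesis by (simp only: norm_mult exp_ge_zero simp_thms)
      qed
      have cp: "norm (complex_of_real (c / pi)) = c / pi" using c by (simp only: norm_of_real) simp
      have "norm (of_real (wright_F \<sigma> x) - of_real pref * SS) \<le> c / pi * ((1 + \<phi>) * (C2 / X ^ Suc M) * exp (- X) + exp (- X) * (\<bar>C1\<bar> / X ^ Suc M))"
        unfolding eq norm_mult[of "of_real (c / pi)"] cp
        by (rule mult_left_mono[OF norm_triangle_mono[OF nA nB]]) (use c in simp)
      also have "\<dots> = c / pi * ((1 + \<phi>) * C2 + \<bar>C1\<bar>) * (exp (- X) / X ^ Suc M)" by (rule alg)
      finally show ?thesis .
    qed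
    have "norm (of_real (wright_F \<sigma> x) - of_real pref * (\<Sum>j<M. a j / (- of_real X) ^ j)) \<le>
      norm (of_real (wright_F \<sigma> x) - of_real pref * SS) + norm (of_real pref * (a M / (- of_real X) ^ M))"
    proof -
      have "of_real (wright_F \<sigma> x) - of_real pref * (\<Sum>j<M. a j / (- of_real X) ^ j) =
        (of_real (wright_F \<sigma> x) - of_real pref * SS) + of_real pref * (a M / (- of_real X) ^ M)"
        by (simp add: SS_def algebra_simps)
      thus ?thesis by (simp only: norm_triangle_ineq)
    qed
    also have "norm (of_real pref * (a M / (- of_real X) ^ M)) = Acon' \<sigma> / (2 * pi) * norm (a M) * (sqrt X * exp (- X) / X ^ M)"
    proof -
      have "Acon' \<sigma> \<ge> 0" using \<sigma> by (simp add: Acon'_eq)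
      thus ?thesis using X0 by (simp add: norm_mult norm_divide norm_power pref_def)
    qed
    also have "norm (of_real (wright_F \<sigma> x) - of_real pref * SS) \<le> \<sigma> / \<kappa> / pi * ((1 + \<phi>) * C2 + \<bar>C1\<bar>) * (sqrt X * exp (- X) / X ^ M)"
    proof -
      have "c / pi * ((1 + \<phi>) * C2 + \<bar>C1\<bar>) * (exp (- X) / X ^ Suc M) = \<sigma> / \<kappa> / pi * ((1 + \<phi>) * C2 + \<bar>C1\<bar>) * (1 * exp (- X) / X ^ M)"
        using X0 \<kappa> by (simp add: c_def \<kappa>_def field_simps)
      also have "\<dots> \<le> \<sigma> / \<kappa> / pi * ((1 + \<phi>) * C2 + \<bar>C1\<bar>) * (sqrt X * exp (- X) / X ^ M)"
        using X \<sigma> \<kappa> C2 \<phi> pi_gt_zero by (intro mult_left_mono divide_right_mono mult_right_mono) auto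
      finally show ?thesis using main by linarith
    qed
    finally show "norm (of_real (wright_F \<sigma> x) - of_real (Acon' \<sigma> / (2 * pi) * sqrt (bigX \<sigma> x) * exp (- bigX \<sigma> x)) * (\<Sum>j<M. a j / (- of_real (bigX \<sigma> x)) ^ j))
       \<le> C * (sqrt (bigX \<sigma> x) * exp (- bigX \<sigma> x) / bigX \<sigma> x ^ M)"
      unfolding X_def[symmetric] pref_def[symmetric] C_def by (simp only: distrib_right)
  qed
qed


section \<open>Stirling's formula in a slit plane\<close>

text \<open>For \<open>q = - cos \<alpha>\<close> with \<open>\<alpha>\<close> in \<open>]0, \<pi>[\<close> this is the punctured sector of the points with argument at most \<open>\<alpha>\<close> in absolute value. The algebraic form gives lower
  bounds for \<open>\<bar>z + n\<bar>\<close> directly.\<close>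
definition slit_sector :: "real \<Rightarrow> complex set" where
  "slit_sector q = {z. z \<noteq> 0 \<and> Re z \<ge> - q * norm z}"

lemma sector_add_nat:
  assumes "z \<in> slit_sector q" "\<bar>q\<bar> < 1" "x \<ge> 0"
  shows "norm (z + of_real x) ^ 2 \<ge> (1 - \<bar>q\<bar>) * (norm z ^ 2 + x ^ 2)"
proof -
  have "norm (z + of_real x) ^ 2 = norm z ^ 2 + x ^ 2 + 2 * x * Re z"
    by (simp add: cmod_power2) (simp add: power2_eq_square algebra_simps)
  moreover have "2 * x * Re z \<ge> 2 * x * (- \<bar>q\<bar> * norm z)"
  proof (intro mult_left_mono)
    have "q * norm z \<le> \<bar>q\<bar> * norm z" by (intro mult_right_mono) auto
    moreover have "- (q * norm z) \<le> Re z" using assms by (auto simp: slit_sector_def)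
    ultimately show "- \<bar>q\<bar> * norm z \<le> Re z" by simp
  qed (use assms in auto)
  moreover have "\<bar>q\<bar> * (2 * x * norm z) \<le> \<bar>q\<bar> * (norm z ^ 2 + x ^ 2)"
    using sum_squares_bound[of x "norm z"] by (intro mult_left_mono) (auto simp: algebra_simps)
  ultimately show ?thesis by (simp add: algebra_simps)
qed

lemma sector_not_nonpos_Reals:
  assumes "z \<in> slit_sector q" "\<bar>q\<bar> < 1"
  shows "z \<notin> \<real>\<^sub>\<le>\<^sub>0"
proof
  assume "z \<in> \<real>\<^sub>\<le>\<^sub>0"
  then obtain r where r: "z = of_real r" "r \<le> 0" by (auto elim!: nonpos_Reals_cases)
  with assms have "- q * \<bar>r\<bar> \<le> r" "r < 0" by (auto simp: slit_sector_def)
  hence "\<bar>r\<bar> * (1 - q) \<le> 0" by (simp add: algebra_simps)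
  moreover have "\<bar>r\<bar> * (1 - q) > 0" using \<open>r < 0\<close> assms(2) by (intro mult_pos_pos) auto
  ultimately show False by linarith
qed

lemma sector_add:
  assumes "z \<in> slit_sector q" "\<bar>q\<bar> < 1" "x \<ge> 0"
  shows "z + of_real x \<in> slit_sector q"
proof -
  have nz: "z + of_real x \<noteq> 0"
  proof
    assume "z + of_real x = 0"
    hence "(1 - \<bar>q\<bar>) * (norm z ^ 2 + x ^ 2) \<le> 0" using sector_add_nat[OF assms] by simp
    moreover have "norm z ^ 2 > 0" using assms by (simp add: slit_sector_def)
    ultimately show False using assms(2) by (simp add: mult_le_0_iff sum_power2_le_zero_iff)
  qed
  have n: "norm (z + of_real x) \<le> norm z + x" using norm_triangle_ineq[of z "of_real x"] assms by simp
  have n': "norm (z + of_real x) \<ge> norm z - x" using norm_triangle_ineq2[of z "- of_real x"] assms by simp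
  have R: "Re z \<ge> - q * norm z" using assms by (auto simp: slit_sector_def)
  have "- q * norm (z + of_real x) \<le> Re z + x"
  proof (cases "q \<ge> 0")
    case True
    have "q * norm (z + of_real x) \<ge> q * (norm z - x)" using True n' by (intro mult_left_mono)
    moreover have "q * x \<le> 1 * x" using assms by (intro mult_right_mono) auto
    ultimately show ?thesis using R by (simp add: algebra_simps)
  next
    case False
    have "(-q) * norm (z + of_real x) \<le> (-q) * (norm z + x)" using False n by (intro mult_left_mono) auto
    moreover have "(-q) * x \<le> 1 * x" using assms by (intro mult_right_mono) auto
    ultimately show ?thesis using R by (simp add: algebra_simps)
  qed
  with nz show ?thesis by (simp add: slit_sector_def)
qed

lemma analytic_zero_factor:
  fixes g :: "complex \<Rightarrow> complex"
  assumes "g analytic_on {0}" "g 0 = 0"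
  obtains h where "h analytic_on {0}" "eventually (\<lambda>x. g x = x * h x) (nhds 0)"
proof -
  from assms(1) obtain S where S: "open S" "0 \<in> S" "g holomorphic_on S" by (auto simp: analytic_at)
  define h where "h = (\<lambda>z. if z = 0 then deriv g 0 else (g z - g 0) / (z - 0))"
  have "h holomorphic_on S" unfolding h_def by (rule pole_lemma) (use S in \<open>auto simp: interior_open\<close>)
  hence "h analytic_on {0}" using S by (auto simp: analytic_at)
  moreover have "g x = x * h x" for x using assms(2) by (simp add: h_def)
  ultimately show ?thesis by (intro that[of h]) auto
qed

lemma analytic_bigo_factor:
  fixes g :: "complex \<Rightarrow> complex"
  assumes "g analytic_on {0}" "g \<in> O[at 0](\<lambda>x. x ^ n)"
  shows "\<exists>h. h analytic_on {0} \<and> eventually (\<lambda>x. g x = x ^ n * h x) (nhds 0)"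
  using assms(2)
proof (induction n)
  case 0
  thus ?case using assms by (intro exI[of _ g]) auto
next
  case (Suc n)
  have "(\<lambda>x::complex. x ^ Suc n) \<in> O[at 0](\<lambda>x. x ^ n)"
    by (rule bigoI[of _ 1]) (auto simp: eventually_at norm_mult norm_power intro!: exI[of _ 1] mult_left_le_one_le)
  with Suc.prems have "g \<in> O[at 0](\<lambda>x. x ^ n)" by (rule landau_o.big.trans)
  from Suc.IH[OF this] obtain h where h: "h analytic_on {0}" "eventually (\<lambda>x. g x = x ^ n * h x) (nhds 0)" by blast
  have "h \<in> O[at 0](\<lambda>x. x)"
  proof -
    have "eventually (\<lambda>x. g x = x ^ n * h x) (at 0)"
      using h(2) by (simp add: eventually_at_filter eventually_mono)
    from landau_o.big.in_cong[OF this] Suc.prems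
      have "(\<lambda>x. x ^ n * h x) \<in> O[at 0](\<lambda>x. x ^ n * x)" by (simp add: mult.commute)
    thus ?thesis
      by (subst (asm) landau_o.big.mult_cancel_left) (auto simp: frequently_def eventually_neq_at_within)
  qed
  then obtain C where "eventually (\<lambda>x. norm (h x) \<le> C * norm x) (at 0)" by (elim landau_o.bigE)
  moreover have "((\<lambda>x::complex. C * norm x) \<longlongrightarrow> 0) (at 0)" by (auto intro!: tendsto_eq_intros)
  ultimately have "(h \<longlongrightarrow> 0) (at 0)" by (rule Lim_null_comparison)
  moreover have "(h \<longlongrightarrow> h 0) (at 0)"
    using analytic_at_imp_isCont[OF h(1)] by (simp add: isCont_def)
  ultimately have "h 0 = 0" using tendsto_unique by (metis at_neq_bot)
  then obtain k where k: "k analytic_on {0}" "eventually (\<lambda>x. h x = x * k x) (nhds 0)"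
    using analytic_zero_factor[OF h(1)] by blast
  show ?case
    by (rule exI[of _ k]) (use k h in \<open>auto elim: eventually_elim2\<close>)
qed

lemma analytic_bigo_1: "g analytic_on {0::complex} \<Longrightarrow> (g::complex \<Rightarrow> complex) \<in> O[at 0](\<lambda>_. 1)"
  using analytic_at_imp_isCont[of g 0] by (intro bigoI_tendsto[of _ _ "g 0"]) (auto simp: isCont_def)

text \<open>The one step by which a germ is expanded along any sequence of functions of exact orders \<open>0, 1, 2, \<dots>\<close>.\<close>
lemma bigo_next_coefficient:
  fixes e V W :: "complex \<Rightarrow> complex"
  assumes e: "e analytic_on {0}" "e \<in> O[at 0](\<lambda>x. x ^ n)"
      and V: "eventually (\<lambda>x. V x = x ^ n * W x) (nhds 0)" "W analytic_on {0}" "W 0 \<noteq> 0"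
  shows "\<exists>a. (\<lambda>x. e x - a * V x) \<in> O[at 0](\<lambda>x. x ^ Suc n)"
proof -
  obtain h where h: "h analytic_on {0}" "eventually (\<lambda>x. e x = x ^ n * h x) (nhds 0)"
    using analytic_bigo_factor[OF e] by blast
  define a where "a = h 0 / W 0"
  have "(\<lambda>x. h x - a * W x) analytic_on {0}" by (intro analytic_intros h V)
  moreover have "h 0 - a * W 0 = 0" using V by (simp add: a_def)
  ultimately obtain k where k: "k analytic_on {0}" "eventually (\<lambda>x. h x - a * W x = x * k x) (nhds 0)"
    using analytic_zero_factor[of "\<lambda>x. h x - a * W x"] by blast
  have "eventually (\<lambda>x. e x - a * V x = x ^ Suc n * k x) (nhds 0)"
    using h(2) V(1) k(2)
  proof eventually_elim
    case (elim x)
    have "e x - a * V x = x ^ n * (h x - a * W x)" by (simp add: elim(1,2) algebra_simps)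
    thus ?case by (simp add: elim(3))
  qed
  hence "eventually (\<lambda>x. e x - a * V x = x ^ Suc n * k x) (at 0)" by (simp add: eventually_at_filter eventually_mono)
  moreover have "(\<lambda>x. x ^ Suc n * k x) \<in> O[at 0](\<lambda>x. x ^ Suc n)"
    using landau_o.big.mult[OF landau_o.big_refl analytic_bigo_1[OF k(1)]] by simp
  ultimately show ?thesis by (intro exI[of _ a]) (subst landau_o.big.in_cong)
qed

lemma poly_analytic:
  assumes "f analytic_on S"
  shows "(\<lambda>x::complex. poly p (f x)) analytic_on S"
  using assms by (induction p) (auto intro!: analytic_intros)

text \<open>The Stirling corrections solve the difference equation \<open>p(1/z) - p(1/(z+1)) = g(1/z)\<close> order by order; in \<open>x = 1/z\<close> the shift is
  \<open>x \<mapsto> x / (1 + x)\<close>.\<close>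
lemma stirling_polynomial:
  fixes g :: "complex \<Rightarrow> complex"
  assumes g: "g analytic_on {0}" "g \<in> O[at 0](\<lambda>x. x ^ 2)"
  shows "\<exists>p::complex poly. poly p 0 = 0 \<and>
     (\<lambda>x. g x - (poly p x - poly p (x / (1 + x)))) \<in> O[at 0](\<lambda>x. x ^ (n + 2))"
proof (induction n)
  case 0
  have "g \<in> O[at 0](\<lambda>x. x ^ (0 + 2))" using g(2) by (simp only: add_0)
  thus ?case by (intro exI[of _ 0]) (simp only: poly_0 diff_zero simp_thms)
next
  case (Suc n)
  then obtain p where p: "poly p 0 = 0"
    "(\<lambda>x. g x - (poly p x - poly p (x / (1 + x)))) \<in> O[at 0](\<lambda>x. x ^ (n + 2))" by blast
  define V where "V = (\<lambda>x::complex. x ^ Suc n - (x / (1 + x)) ^ Suc n)"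
  define q :: "complex poly" where "q = [:1, 1:] ^ Suc n - 1"
  have "poly q 0 = 0" by (simp add: q_def)
  then obtain r where r: "q = [:0, 1:] * r" by (metis poly_eq_0_iff_dvd dvd_def minus_zero)
  have "poly (pderiv q) 0 = of_nat (Suc n)"
    by (simp add: q_def pderiv_diff pderiv_power_Suc pderiv_pCons del: power_Suc)
  moreover have "poly (pderiv q) 0 = poly r 0" by (simp add: r pderiv_mult pderiv_pCons)
  ultimately have r0: "poly r 0 = of_nat (Suc n)" by simp
  define W where "W = (\<lambda>x::complex. poly r x / (1 + x) ^ Suc n)"
  have "\<exists>a. (\<lambda>x. (g x - (poly p x - poly p (x / (1 + x)))) - a * V x) \<in> O[at 0](\<lambda>x. x ^ Suc (n + 2))"
  proof (rule bigo_next_coefficient[OF _ p(2), where W = W])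
    show "(\<lambda>x. g x - (poly p x - poly p (x / (1 + x)))) analytic_on {0}"
      by (intro analytic_intros g poly_analytic) auto
    show "\<forall>\<^sub>F x in nhds 0. V x = x ^ (n + 2) * W x"
    proof -
      have "eventually (\<lambda>x::complex. x \<in> - {-1}) (nhds 0)"
        by (intro eventually_nhds_in_open) auto
      thus ?thesis
      proof eventually_elim
        case (elim x)
        hence "1 + x \<noteq> 0" by (auto simp: add_eq_0_iff)
        have "poly q x = (1 + x) ^ Suc n - 1" by (simp add: q_def algebra_simps)
        hence "x * poly r x = (1 + x) ^ Suc n - 1" by (simp add: r)
        hence "x ^ (n + 2) * W x = x ^ Suc n * ((1 + x) ^ Suc n - 1) / (1 + x) ^ Suc n"
          by (simp add: W_def)
        also have "\<dots> = V x" using \<open>1 + x \<noteq> 0\<close>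
          by (simp add: V_def power_divide diff_divide_distrib right_diff_distrib del: power_Suc)
        finally show ?case ..
      qed
    qed
    show "W analytic_on {0}" unfolding W_def by (auto intro!: analytic_intros poly_analytic)
    show "W 0 \<noteq> 0" by (simp add: W_def r0 del: of_nat_Suc)
  qed
  then obtain a where a: "(\<lambda>x. (g x - (poly p x - poly p (x / (1 + x)))) - a * V x) \<in> O[at 0](\<lambda>x. x ^ Suc (n + 2))" by blast
  show ?case
  proof (rule exI[of _ "p + monom a (Suc n)"], intro conjI)
    show "poly (p + monom a (Suc n)) 0 = 0" using p by (simp add: poly_monom)
    show "(\<lambda>x. g x - (poly (p + monom a (Suc n)) x - poly (p + monom a (Suc n)) (x / (1 + x))))
            \<in> O[at 0](\<lambda>x. x ^ (Suc n + 2))"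
      using a by (simp add: V_def poly_monom algebra_simps)
  qed
qed


lemma stirling_kernel:
  obtains g :: "complex \<Rightarrow> complex" where "g analytic_on {0}" "g \<in> O[at 0](\<lambda>x. x ^ 2)"
    "eventually (\<lambda>x. g x = (1 / x + 1 / 2) * Ln (1 + x) - 1) (at 0)"
proof -
  define D where "D = (\<lambda>x::complex. Ln (1 + x) - x + x ^ 2 / 2)"
  have D': "(D has_field_derivative x ^ 2 / (1 + x)) (at x)" if "norm x < 1" for x
  proof -
    have "1 + x \<notin> \<real>\<^sub>\<le>\<^sub>0" using that abs_Re_le_cmod[of x] by (auto simp: complex_nonpos_Reals_iff)
    moreover have "1 + x \<noteq> 0" using calculation by auto
    moreover from this have "1 / (1 + x) - 1 + x = x ^ 2 / (1 + x)" by (simp add: field_simps power2_eq_square)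
    ultimately show ?thesis unfolding D_def
      by (auto intro!: derivative_eq_intros simp: inverse_eq_divide)
  qed
  have Db: "norm (D x) \<le> 2 * norm x ^ 3" if x: "norm x \<le> 1 / 2" for x
  proof -
    have "norm (D x - D 0) \<le> 2 * norm x ^ 2 * norm (x - 0)"
    proof (rule field_differentiable_bound[where S = "cball 0 (norm x)"])
      fix z :: complex assume z: "z \<in> cball 0 (norm x)"
      hence z': "norm z \<le> norm x" by simp
      show "(D has_field_derivative z ^ 2 / (1 + z)) (at z within cball 0 (norm x))"
        by (rule has_field_derivative_at_within[OF D']) (use z' x in auto)
      have "norm (1 + z) \<ge> 1 / 2" using norm_triangle_ineq2[of 1 "-z"] z' x by simp
      hence "norm (z ^ 2 / (1 + z)) \<le> norm x ^ 2 / (1 / 2)"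
        unfolding norm_divide norm_power using z' by (intro frac_le power_mono) auto
      thus "norm (z ^ 2 / (1 + z)) \<le> 2 * norm x ^ 2" by simp
    qed auto
    thus ?thesis by (simp add: D_def power3_eq_cube power2_eq_square)
  qed
  define H where "H = (\<lambda>x::complex. (1 + x / 2) * Ln (1 + x) - x)"
  have Han: "H analytic_on {0}" unfolding H_def by (auto intro!: analytic_intros simp: complex_nonpos_Reals_iff)
  have "D \<in> O[at 0](\<lambda>x. x ^ 3)"
    by (rule bigoI[of _ 2]) (auto simp: eventually_at norm_power intro!: exI[of _ "1/2"] Db)
  hence "(\<lambda>x. (1 + x / 2) * D x) \<in> O[at 0](\<lambda>x. 1 * x ^ 3)"
    by (intro landau_o.big.mult analytic_bigo_1) (auto intro!: analytic_intros)
  hence "(\<lambda>x. (1 + x / 2) * D x - (1/4) * x ^ 3) \<in> O[at 0](\<lambda>x. x ^ 3)"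
    by (intro sum_in_bigo) simp_all
  also have "(\<lambda>x. (1 + x / 2) * D x - (1/4) * x ^ 3) = H"
    by (auto simp: H_def D_def fun_eq_iff algebra_simps power2_eq_square power3_eq_cube)
  finally obtain k where k: "k analytic_on {0}" "eventually (\<lambda>x. H x = x ^ 3 * k x) (nhds 0)"
    using analytic_bigo_factor[OF Han] by blast
  show ?thesis
  proof (rule that[of "\<lambda>x. x ^ 2 * k x"])
    show "(\<lambda>x. x ^ 2 * k x) analytic_on {0}" by (intro analytic_intros k)
    show "(\<lambda>x. x ^ 2 * k x) \<in> O[at 0](\<lambda>x. x ^ 2)"
      using landau_o.big.mult[OF landau_o.big_refl analytic_bigo_1[OF k(1)]] by simp
    have "eventually (\<lambda>x. H x = x ^ 3 * k x) (at 0)" using k(2) by (simp add: eventually_at_filter eventually_mono)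
    thus "eventually (\<lambda>x. x ^ 2 * k x = (1 / x + 1 / 2) * Ln (1 + x) - 1) (at 0)"
      using eventually_neq_at_within[of 0 0]
    proof eventually_elim
      case (elim x)
      have "x * (x ^ 2 * k x) = H x" using elim by (simp add: power3_eq_cube power2_eq_square)
      also have "\<dots> = x * ((1 / x + 1 / 2) * Ln (1 + x) - 1)" using elim by (simp add: H_def field_simps)
      finally show ?case using elim by simp
    qed
  qed
qed

lemma stirling_correction:
  obtains p :: "complex poly" and B R :: real where "poly p 0 = 0" "R \<ge> 1" "B \<ge> 0"
    "\<And>z. norm z \<ge> R \<Longrightarrow> norm ((z + 1 / 2) * Ln (1 + 1 / z) - 1 - (poly p (1 / z) - poly p (1 / (z + 1)))) \<le> B / norm z ^ (n + 2)"
proof -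
  obtain g where g: "g analytic_on {0}" "g \<in> O[at 0](\<lambda>x. x ^ 2)"
    "eventually (\<lambda>x. g x = (1 / x + 1 / 2) * Ln (1 + x) - 1) (at 0)" by (rule stirling_kernel)
  obtain p where p: "poly p 0 = 0" "(\<lambda>x. g x - (poly p x - poly p (x / (1 + x)))) \<in> O[at 0](\<lambda>x. x ^ (n + 2))"
    using stirling_polynomial[OF g(1,2)] by blast
  from p(2) obtain B where B: "B > 0" "eventually (\<lambda>x. norm (g x - (poly p x - poly p (x / (1 + x)))) \<le> B * norm (x ^ (n + 2))) (at 0)"
    by (elim landau_o.bigE)
  from eventually_conj[OF B(2) g(3)] obtain d where d: "d > 0"
    "\<And>x. x \<noteq> 0 \<Longrightarrow> norm x < d \<Longrightarrow> norm (g x - (poly p x - poly p (x / (1 + x)))) \<le> B * norm (x ^ (n + 2)) \<and>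
        g x = (1 / x + 1 / 2) * Ln (1 + x) - 1"
    unfolding eventually_at by auto
  show ?thesis
  proof (rule that[of p "max 1 (2 / d)" B])
    fix z :: complex assume z: "norm z \<ge> max 1 (2 / d)"
    have "norm z \<ge> 2 / d" using z by simp
    moreover have "2 / d > 0" using d by simp
    ultimately have nz: "z \<noteq> 0" by auto
    have "1 / norm z \<le> 1 / (2 / d)" using \<open>norm z \<ge> 2 / d\<close> \<open>2 / d > 0\<close> nz
      by (intro divide_left_mono mult_pos_pos) auto
    hence "norm (1 / z) < d" using d by (simp add: norm_divide)
    from d(2)[OF _ this] nz have
      "norm (g (1 / z) - (poly p (1 / z) - poly p ((1 / z) / (1 + 1 / z)))) \<le> B * norm ((1 / z) ^ (n + 2))"
      "g (1 / z) = (1 / (1 / z) + 1 / 2) * Ln (1 + 1 / z) - 1" by auto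
    moreover have "(1 / z) / (1 + 1 / z) = 1 / (z + 1)" using nz by (simp add: field_simps)
    ultimately show "norm ((z + 1 / 2) * Ln (1 + 1 / z) - 1 - (poly p (1 / z) - poly p (1 / (z + 1)))) \<le> B / norm z ^ (n + 2)"
      by (simp add: norm_divide norm_power norm_mult power_divide)
  qed (use p B in auto)
qed

lemma Ln_plus_one:
  assumes "z \<notin> \<real>\<^sub>\<le>\<^sub>0"
  shows "Ln (z + 1) = Ln z + Ln (1 + 1 / z)"
proof -
  have nz: "z \<noteq> 0" using assms by auto
  have nz1: "z + 1 \<noteq> 0"
  proof
    assume "z + 1 = 0"
    hence "z = -1" by (simp add: add_eq_0_iff2)
    with assms show False by (simp add: complex_nonpos_Reals_iff)
  qed
  with nz have nz': "1 + 1 / z \<noteq> 0" by (simp add: field_simps add.commute)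
  have range: "- pi < Im (Ln z) + Im (Ln (1 + 1 / z)) \<and> Im (Ln z) + Im (Ln (1 + 1 / z)) \<le> pi"
  proof -
    have I: "Im (1 + 1 / z) = - Im z / (norm z)\<^sup>2" by (simp add: Im_divide cmod_power2)
    consider "Im z > 0" | "Im z < 0" | "Im z = 0" by linarith
    thus ?thesis
    proof cases
      case 1
      hence "Im (1 + 1 / z) < 0" unfolding I using nz by (simp add: divide_neg_pos)
      with 1 show ?thesis using Im_Ln_pos_lt[of z] Im_Ln_pos_lt[of "1 + 1 / z"] nz nz' 
        Im_Ln_less_pi[of z] mpi_less_Im_Ln[of z] mpi_less_Im_Ln[of "1 + 1 / z"] Im_Ln_le_pi[of "1 + 1 / z"]
        Im_Ln_pos_le[of "1 + 1 / z"] by (auto simp: not_le)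
    next
      case 2
      hence "Im z / (norm z)\<^sup>2 < 0" using nz by (intro divide_neg_pos) auto
      hence "Im (1 + 1 / z) > 0" unfolding I by simp
      with 2 show ?thesis using Im_Ln_pos_lt[of z] Im_Ln_pos_lt[of "1 + 1 / z"] nz nz' 
        Im_Ln_less_pi[of z] mpi_less_Im_Ln[of z] mpi_less_Im_Ln[of "1 + 1 / z"] Im_Ln_le_pi[of "1 + 1 / z"]
        Im_Ln_pos_le[of z] Im_Ln_le_pi[of z] by (auto simp: not_le)
    next
      case 3
      hence r: "z = of_real (Re z)" "Re z > 0" using assms nz by (auto simp: complex_eq_iff complex_nonpos_Reals_iff)
      have "Ln z = of_real (ln (Re z))" using r by (metis Ln_of_real)
      moreover have e: "1 + 1 / z = of_real (1 + 1 / Re z)" using r(1) by (metis of_real_add of_real_divide of_real_1)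
      have "Ln (1 + 1 / z) = of_real (ln (1 + 1 / Re z))"
        unfolding e by (rule Ln_of_real) (use r(2) in \<open>auto intro: add_pos_pos\<close>)
      ultimately show ?thesis by simp
    qed
  qed
  have "Ln (z * (1 + 1 / z)) = Ln z + Ln (1 + 1 / z)"
    by (rule Ln_times_simple) (use nz nz' range in auto)
  moreover have "z * (1 + 1 / z) = z + 1" using nz by (simp add: field_simps)
  ultimately show ?thesis by simp
qed


lemma sum_inverse_squares_le:
  assumes "a \<ge> (1::real)"
  shows "(\<Sum>k<m. 1 / (a + real k) ^ 2) \<le> 2 / a - 2 / (a + real m)"
proof (induction m)
  case (Suc m)
  let ?b = "a + real m"
  have b: "?b \<ge> 1" using assms by simp
  have "1 / ?b ^ 2 \<le> 2 / (?b * (?b + 1))"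
    using b by (simp add: divide_simps power2_eq_square)
  also have "\<dots> = 2 / ?b - 2 / (?b + 1)" using b by (simp add: field_simps)
  finally show ?case using Suc by (simp add: algebra_simps)
qed auto

lemma ratio_Ln_limit:
  "(\<lambda>m. (z + of_nat (Suc m) - 1 / 2) * Ln (1 + z / of_nat (Suc m))) \<longlonglongrightarrow> (z::complex)"
proof -
  let ?w = "\<lambda>m. of_nat (Suc m) :: complex"
  have w: "filterlim ?w at_infinity sequentially"
    using filterlim_compose[OF tendsto_of_nat filterlim_Suc] by simp
  have zw: "(\<lambda>m. z / ?w m) \<longlonglongrightarrow> 0" by (rule tendsto_divide_0[OF tendsto_const w])
  have L: "(\<lambda>m. Ln (1 + z / ?w m)) \<longlonglongrightarrow> Ln (1 + 0)"
    by (intro tendsto_intros zw) auto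
  have "(Ln has_field_derivative 1) (at 1)"
    using has_field_derivative_Ln[of 1] by simp
  hence "((\<lambda>h. (Ln (1 + h) - Ln 1) / h) \<longlongrightarrow> 1) (at 0)" by (simp only: DERIV_def)
  hence d: "((\<lambda>h. if h = 0 then 1 else Ln (1 + h) / h) \<longlongrightarrow> 1) (nhds 0)"
    by (subst tendsto_nhds_iff) (auto elim!: Lim_transform_eventually simp: eventually_at intro!: exI[of _ 1])
  have "(\<lambda>m. z * (if z / ?w m = 0 then 1 else Ln (1 + z / ?w m) / (z / ?w m))) \<longlonglongrightarrow> z * 1"
    by (intro tendsto_mult tendsto_const filterlim_compose[OF d zw])
  also have "(\<lambda>m. z * (if z / ?w m = 0 then 1 else Ln (1 + z / ?w m) / (z / ?w m))) = (\<lambda>m. ?w m * Ln (1 + z / ?w m))"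
    by (auto simp: fun_eq_iff simp del: of_nat_Suc)
  finally have 1: "(\<lambda>m. ?w m * Ln (1 + z / ?w m)) \<longlonglongrightarrow> z" by simp
  have "(\<lambda>m. (z - 1 / 2) * Ln (1 + z / ?w m) + ?w m * Ln (1 + z / ?w m)) \<longlonglongrightarrow> (z - 1/2) * Ln (1 + 0) + z"
    by (intro tendsto_intros 1 L)
  thus ?thesis by (simp add: algebra_simps)
qed

lemma Gamma_shift_asymp:
  assumes "z \<notin> \<int>\<^sub>\<le>\<^sub>0"
  shows "(\<lambda>m. Gamma (z + of_nat (Suc m)) / (fact m * exp (z * of_real (ln (real m))))) \<longlonglongrightarrow> (1::complex)"
proof -
  have "(\<lambda>m. Gamma z / Gamma_series z m) \<longlonglongrightarrow> Gamma z / Gamma z"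
    using assms by (intro tendsto_intros) (auto simp: Gamma_eq_zero_iff)
  also have "(\<lambda>m. Gamma z / Gamma_series z m) = (\<lambda>m. Gamma (z + of_nat (Suc m)) / (fact m * exp (z * of_real (ln (real m)))))"
  proof
    fix m
    have "pochhammer z (Suc m) = Gamma (z + of_nat (Suc m)) / Gamma z"
      by (rule pochhammer_Gamma) fact
    thus "Gamma z / Gamma_series z m = Gamma (z + of_nat (Suc m)) / (fact m * exp (z * of_real (ln (real m))))"
      using assms unfolding Gamma_series_def by (simp add: Gamma_eq_zero_iff)
  qed
  also have "Gamma z / Gamma z = 1" using assms by (simp add: Gamma_eq_zero_iff)
  finally show ?thesis .
qed

definition stirling_phase :: "complex poly \<Rightarrow> complex \<Rightarrow> complex" where
  "stirling_phase p z = (z - 1 / 2) * Ln z - z + poly p (1 / z)"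

definition stirling_quot :: "complex poly \<Rightarrow> complex \<Rightarrow> complex" where
  "stirling_quot p z = Gamma z * exp (- stirling_phase p z)"

definition stirling_err :: "complex poly \<Rightarrow> complex \<Rightarrow> complex" where
  "stirling_err p z = (z + 1 / 2) * Ln (1 + 1 / z) - 1 - (poly p (1 / z) - poly p (1 / (z + 1)))"

text \<open>The quotient of \<open>\<Gamma>\<close> by the truncated Stirling formula changes under \<open>z \<mapsto> z + 1\<close> only by a factor, which is
  \<open>exp (O(z\<^sup>-\<^sup>n\<^sup>-\<^sup>2))\<close> for the polynomial of \<open>stirling_correction\<close>. Telescoping this towards \<open>+ \<infinity>\<close>
  determines the quotient up to its limit.\<close>
lemma stirling_quot_step:
  assumes "z \<notin> \<real>\<^sub>\<le>\<^sub>0"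
  shows "stirling_quot p z = stirling_quot p (z + 1) * exp (stirling_err p z)"
proof -
  have z: "z \<noteq> 0" "z \<notin> \<int>\<^sub>\<le>\<^sub>0" using assms nonpos_Ints_subset_nonpos_Reals by auto
  have "stirling_phase p (z + 1) = stirling_phase p z + Ln z + stirling_err p z"
    unfolding stirling_phase_def stirling_err_def Ln_plus_one[OF assms] by (simp add: algebra_simps)
  hence "exp (- stirling_phase p (z + 1)) * exp (stirling_err p z) = exp (- stirling_phase p z) / z"
    using z by (simp add: exp_diff exp_minus exp_add field_simps flip: exp_add)
  moreover have "Gamma (z + 1) = z * Gamma z" using z by (intro Gamma_plus1) auto
  ultimately show ?thesis using z by (simp add: stirling_quot_def mult.assoc)
qed

lemma stirling_quot_steps:
  assumes "z \<in> slit_sector q" "\<bar>q\<bar> < 1"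
  shows "stirling_quot p z = stirling_quot p (z + of_nat m) * exp (\<Sum>k<m. stirling_err p (z + of_nat k))"
proof (induction m)
  case (Suc m)
  have "z + of_nat m \<notin> \<real>\<^sub>\<le>\<^sub>0"
    using sector_not_nonpos_Reals[OF sector_add[OF assms, of "real m"]] assms by simp
  from stirling_quot_step[OF this, of p] Suc show ?case by (simp add: exp_add algebra_simps)
qed auto

lemma stirling_quot_ratio:
  assumes "z \<in> slit_sector q" "\<bar>q\<bar> < 1" "poly p 0 = 0"
  shows "(\<lambda>m. stirling_quot p (z + of_nat (Suc m)) / stirling_quot p (of_nat (Suc m))) \<longlonglongrightarrow> 1"
proof -
  let ?w = "\<lambda>m. of_nat (Suc m) :: complex"
  have z: "z \<notin> \<int>\<^sub>\<le>\<^sub>0" using sector_not_nonpos_Reals[OF assms(1,2)] nonpos_Ints_subset_nonpos_Reals by auto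
  have w: "filterlim ?w at_infinity sequentially"
    using filterlim_compose[OF tendsto_of_nat filterlim_Suc] by simp
  have zw: "filterlim (\<lambda>m. z + ?w m) at_infinity sequentially"
    by (rule tendsto_add_filterlim_at_infinity[OF tendsto_const w])
  have p1: "(\<lambda>m. poly p (1 / ?w m)) \<longlonglongrightarrow> poly p 0"
    by (intro tendsto_intros tendsto_divide_0[OF tendsto_const w])
  have p2: "(\<lambda>m. poly p (1 / (z + ?w m))) \<longlonglongrightarrow> poly p 0"
    by (intro tendsto_intros tendsto_divide_0[OF tendsto_const zw])
  have ll: "(\<lambda>m. z * of_real (ln (real (Suc m)) - ln (real m))) \<longlonglongrightarrow> z * of_real 0"
    by (intro tendsto_intros) real_asymp
  define ee where "ee = (\<lambda>m. z - (z + ?w m - 1 / 2) * Ln (1 + z / ?w m) - z * of_real (ln (real (Suc m)) - ln (real m))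
         + poly p (1 / ?w m) - poly p (1 / (z + ?w m)))"
  have ee: "ee \<longlonglongrightarrow> z - z - z * of_real 0 + poly p 0 - poly p 0"
    unfolding ee_def by (intro tendsto_intros ratio_Ln_limit p1 p2 ll)
  have "(\<lambda>m. Gamma (z + of_nat (Suc m)) / (fact m * exp (z * of_real (ln (real m)))) * exp (ee m)) \<longlonglongrightarrow> 1 * exp (z - z - z * of_real 0 + poly p 0 - poly p 0)"
    by (intro tendsto_intros Gamma_shift_asymp z ee)
  hence "(\<lambda>m. Gamma (z + of_nat (Suc m)) / (fact m * exp (z * of_real (ln (real m)))) * exp (ee m)) \<longlonglongrightarrow> 1" by simp
  thus ?thesis
  proof (rule Lim_transform_eventually)
    show "\<forall>\<^sub>F m in sequentially. Gamma (z + of_nat (Suc m)) / (fact m * exp (z * of_real (ln (real m)))) * exp (ee m) =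
       stirling_quot p (z + of_nat (Suc m)) / stirling_quot p (of_nat (Suc m))"
    proof (rule always_eventually, rule allI)
      fix m
      have nz: "z + ?w m \<noteq> 0"
      proof
        assume "z + ?w m = 0"
        hence "z = of_int (- int (Suc m))" by (simp add: eq_neg_iff_add_eq_0 del: of_nat_Suc)
        hence "z \<in> \<int>\<^sub>\<le>\<^sub>0" unfolding nonpos_Ints_def
          by (intro CollectI exI[of _ "- int (Suc m)"] conjI) auto
        with z show False ..
      qed
      have "1 + z / ?w m \<noteq> 0" using nz by (simp add: field_simps add.commute del: of_nat_Suc)
      hence "Ln (of_real (real (Suc m)) * (1 + z / ?w m)) = of_real (ln (real (Suc m))) + Ln (1 + z / ?w m)"
        by (subst Ln_times_of_real) (auto simp: Ln_of_real simp del: of_nat_Suc)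
      moreover have "of_real (real (Suc m)) * (1 + z / ?w m) = z + ?w m"
        by (simp add: field_simps del: of_nat_Suc)
      ultimately have L: "Ln (z + ?w m) = of_real (ln (real (Suc m))) + Ln (1 + z / ?w m)" by simp
      have L': "Ln (?w m) = of_real (ln (real (Suc m)))" using Ln_of_real[of "real (Suc m)"] by simp
      have "stirling_phase p (?w m) - stirling_phase p (z + ?w m) + z * of_real (ln (real m)) = ee m"
        unfolding stirling_phase_def L L' ee_def by (simp add: algebra_simps)
      hence "stirling_phase p (?w m) - stirling_phase p (z + ?w m) = ee m - z * of_real (ln (real m))"
        by (metis add_diff_cancel_right')
      moreover have "exp (- stirling_phase p (z + ?w m)) / exp (- stirling_phase p (?w m)) =
         exp (stirling_phase p (?w m) - stirling_phase p (z + ?w m))"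
        by (simp only: exp_minus exp_diff divide_inverse inverse_inverse_eq mult.commute)
      ultimately have "exp (- stirling_phase p (z + ?w m)) / exp (- stirling_phase p (?w m)) = exp (ee m - z * of_real (ln (real m)))"
        by (simp only:)
      hence "exp (- stirling_phase p (z + ?w m)) / exp (- stirling_phase p (?w m)) = exp (ee m) / exp (z * of_real (ln (real m)))"
        by (simp add: exp_diff)
      moreover have "Gamma (?w m) = fact m" by (simp add: Gamma_fact)
      ultimately show "Gamma (z + of_nat (Suc m)) / (fact m * exp (z * of_real (ln (real m)))) * exp (ee m) =
       stirling_quot p (z + of_nat (Suc m)) / stirling_quot p (of_nat (Suc m))"
        unfolding stirling_quot_def by (simp add: divide_simps del: of_nat_Suc)
    qed
  qed
qed


text \<open>The telescoped errors are summable uniformly in the sector, because \<open>\<bar>z + k\<bar>\<close> is at least a multiple of \<open>\<bar>z\<bar> + k\<close> there, and the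
  quotient at \<open>z + m\<close> tends to the same constant \<open>K\<close> for all \<open>z\<close>. The value of \<open>K\<close> is left open since it
  cancels in the gamma quotient below. The polynomial serves all sectors at once.\<close>
theorem stirling_sector:
  "\<exists>p K. poly p 0 = 0 \<and> K \<noteq> (0::complex) \<and> (\<forall>q. \<bar>q\<bar> < 1 \<longrightarrow> (\<exists>B R. B \<ge> 0 \<and> (\<forall>z\<in>slit_sector q. norm z \<ge> R \<longrightarrow>
      (\<exists>d. Gamma z = K * exp (stirling_phase p z + d) \<and> norm d \<le> B / norm z ^ (n + 1)))))"
proof -
  obtain p B R where p: "poly p 0 = 0" "R \<ge> 1" "B \<ge> 0"
    and err: "\<And>z. norm z \<ge> R \<Longrightarrow> norm (stirling_err p z) \<le> B / norm z ^ (n + 2)"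
    unfolding stirling_err_def by (rule stirling_correction[of n]) blast
  define c where "c = (\<lambda>q. sqrt ((1 - \<bar>q\<bar>) / 2))"
  have c: "0 < c q" "c q \<le> 1" if "\<bar>q\<bar> < 1" for q using that by (auto simp: c_def)
  have low: "norm (z + of_nat k) \<ge> c q * (norm z + real k)" if q: "\<bar>q\<bar> < 1" and z: "z \<in> slit_sector q" for q z k
  proof (rule power2_le_imp_le)
    have "(c q * (norm z + real k))\<^sup>2 = (1 - \<bar>q\<bar>) / 2 * (norm z + real k)\<^sup>2"
      using q by (simp add: c_def power_mult_distrib)
    also have "\<dots> \<le> (1 - \<bar>q\<bar>) / 2 * (2 * (norm z ^ 2 + real k ^ 2))"
      using q sum_squares_bound[of "norm z" "real k"]
      by (intro mult_left_mono) (auto simp: power2_eq_square algebra_simps)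
    also have "\<dots> = (1 - \<bar>q\<bar>) * (norm z ^ 2 + real k ^ 2)" by (simp add: field_simps)
    also have "\<dots> \<le> norm (z + of_real (real k)) ^ 2" by (rule sector_add_nat[OF z q]) auto
    finally show "(c q * (norm z + real k))\<^sup>2 \<le> (norm (z + of_nat k))\<^sup>2" by simp
  qed simp
  have termb: "norm (stirling_err p (z + of_nat k)) \<le> B / c q ^ (n + 2) / norm z ^ n * (1 / (norm z + real k) ^ 2)"
    if q: "\<bar>q\<bar> < 1" and z: "z \<in> slit_sector q" "norm z \<ge> R / c q" for q z k
  proof -
    note cq = c[OF q]
    have R: "R > 0" using p by simp
    have z0: "norm z > 0" using z cq R by (simp add: slit_sector_def)
    have l: "norm (z + of_nat k) \<ge> c q * (norm z + real k)" by (rule low[OF q z(1)])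
    have a0: "0 < c q * (norm z + real k)" using cq z0 by (intro mult_pos_pos add_pos_nonneg) auto
    have a1: "0 < norm (z + of_nat k)" using a0 l by linarith
    have "R \<le> c q * norm z" using z(2) cq by (simp add: field_simps)
    also have "\<dots> \<le> c q * (norm z + real k)" using cq by (intro mult_left_mono) auto
    finally have "R \<le> norm (z + of_nat k)" using l by simp
    hence "norm (stirling_err p (z + of_nat k)) \<le> B / norm (z + of_nat k) ^ (n + 2)" by (rule err)
    also have "\<dots> \<le> B / (c q * (norm z + real k)) ^ (n + 2)"
      using p l a0 a1 cq z0 add_pos_nonneg[of "norm z" "real k"] by (intro divide_left_mono power_mono mult_pos_pos zero_less_power) auto
    also have "\<dots> = B / c q ^ (n + 2) * (1 / ((norm z + real k) ^ n * (norm z + real k) ^ 2))"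
      by (simp add: power_mult_distrib power_add power2_eq_square)
    also have "\<dots> \<le> B / c q ^ (n + 2) * (1 / (norm z ^ n * (norm z + real k) ^ 2))"
      using p cq z0 by (intro mult_left_mono divide_left_mono mult_right_mono power_mono mult_pos_pos zero_less_power)
        (auto intro!: add_pos_nonneg)
    finally show ?thesis by (simp add: mult.assoc)
  qed
  have sb: "(\<Sum>k<m. norm (stirling_err p (z + of_nat k))) \<le> 2 * B / c q ^ (n + 2) / norm z ^ (n + 1)"
    if q: "\<bar>q\<bar> < 1" and z: "z \<in> slit_sector q" "norm z \<ge> R / c q" for q z m
  proof -
    note cq = c[OF q]
    have "1 \<le> R" by (rule p)
    also have "R \<le> R / c q" using cq p by (simp add: field_simps mult_left_le)
    finally have z1: "norm z \<ge> 1" using z by simp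
    have "(\<Sum>k<m. norm (stirling_err p (z + of_nat k))) \<le> (\<Sum>k<m. B / c q ^ (n + 2) / norm z ^ n * (1 / (norm z + real k) ^ 2))"
      by (intro sum_mono termb[OF q z])
    also have "\<dots> = B / c q ^ (n + 2) / norm z ^ n * (\<Sum>k<m. 1 / (norm z + real k) ^ 2)"
      by (simp add: sum_distrib_left)
    also have "\<dots> \<le> B / c q ^ (n + 2) / norm z ^ n * (2 / norm z)"
    proof (rule mult_left_mono)
      have "(\<Sum>k<m. 1 / (norm z + real k) ^ 2) \<le> 2 / norm z - 2 / (norm z + real m)"
        by (rule sum_inverse_squares_le[OF z1])
      also have "\<dots> \<le> 2 / norm z" by simp
      finally show "(\<Sum>k<m. 1 / (norm z + real k) ^ 2) \<le> 2 / norm z" .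
    qed (use p cq in auto)
    finally show ?thesis by (simp add: mult_ac)
  qed
  have summ: "summable (\<lambda>k. norm (stirling_err p (z + of_nat k)))"
    if q: "\<bar>q\<bar> < 1" and z: "z \<in> slit_sector q" "norm z \<ge> R / c q" for q z
    by (rule summableI_nonneg_bounded[OF _ sb[OF q z]]) auto
  define m0 where "m0 = nat \<lceil>R / c 0\<rceil> + 1"
  have m0: "complex_of_nat m0 \<in> slit_sector 0" "norm (complex_of_nat m0) \<ge> R / c 0"
  proof -
    have "m0 > 0" "real m0 \<ge> R / c 0" unfolding m0_def by linarith+
    thus "complex_of_nat m0 \<in> slit_sector 0" "norm (complex_of_nat m0) \<ge> R / c 0"
      by (simp_all add: slit_sector_def)
  qed
  have E0: "stirling_quot p (of_nat m0) \<noteq> 0"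
  proof -
    obtain k where k: "m0 = Suc k" by (simp add: m0_def)
    hence "Gamma (of_nat m0 :: complex) = fact k" using Gamma_fact[of k, where ?'a = complex] by simp
    thus ?thesis by (simp add: stirling_quot_def)
  qed
  define K where "K = stirling_quot p (of_nat m0) * exp (- (\<Sum>k. stirling_err p (of_nat m0 + of_nat k)))"
  have K0: "K \<noteq> 0" using E0 by (simp add: K_def)
  have K: "(\<lambda>m. stirling_quot p (of_nat (Suc m))) \<longlonglongrightarrow> K"
  proof -
    have "(\<lambda>m. stirling_quot p (of_nat m0) * exp (- (\<Sum>k<m. stirling_err p (of_nat m0 + of_nat k)))) \<longlonglongrightarrow> K"
      unfolding K_def
      by (intro tendsto_intros summable_LIMSEQ summable_norm_cancel[OF summ[OF _ m0]]) auto
    also have "(\<lambda>m. stirling_quot p (of_nat m0) * exp (- (\<Sum>k<m. stirling_err p (of_nat m0 + of_nat k)))) =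
      (\<lambda>m. stirling_quot p (of_nat (m + m0)))"
    proof
      fix m
      have "stirling_quot p (of_nat m0) = stirling_quot p (of_nat (m + m0)) * exp (\<Sum>k<m. stirling_err p (of_nat m0 + of_nat k))"
        using stirling_quot_steps[OF m0(1), of p m] by (simp add: add.commute)
      thus "stirling_quot p (of_nat m0) * exp (- (\<Sum>k<m. stirling_err p (of_nat m0 + of_nat k))) = stirling_quot p (of_nat (m + m0))"
        by (simp add: exp_minus)
    qed
    finally have "(\<lambda>m. stirling_quot p (of_nat m)) \<longlonglongrightarrow> K" by (rule LIMSEQ_offset)
    thus ?thesis by (rule LIMSEQ_Suc)
  qed
  show ?thesis
  proof (intro exI conjI allI impI, rule p, rule K0)
    fix q :: real assume q: "\<bar>q\<bar> < 1"
    show "0 \<le> 2 * B / c q ^ (n + 2)" using p c[OF q] by simp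
    show "\<forall>z\<in>slit_sector q. R / c q \<le> norm z \<longrightarrow> (\<exists>d. Gamma z = K * exp (stirling_phase p z + d) \<and>
        norm d \<le> 2 * B / c q ^ (n + 2) / norm z ^ (n + 1))"
    proof (intro ballI impI)
      fix z assume z: "z \<in> slit_sector q" "R / c q \<le> norm z"
      define d where "d = (\<Sum>k. stirling_err p (z + of_nat k))"
      have "(\<lambda>m. stirling_quot p (z + of_nat (Suc m)) / stirling_quot p (of_nat (Suc m)) * stirling_quot p (of_nat (Suc m)) *
              exp (\<Sum>k<Suc m. stirling_err p (z + of_nat k))) \<longlonglongrightarrow> 1 * K * exp d"
        unfolding d_def
        by (intro tendsto_intros K stirling_quot_ratio[OF z(1) q p(1)] LIMSEQ_Suc summable_LIMSEQ summable_norm_cancel[OF summ[OF q z]])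
      moreover have "stirling_quot p (of_nat (Suc m)) \<noteq> 0" for m
        using Gamma_fact[of m, where ?'a = complex] by (simp add: stirling_quot_def)
      hence "(\<lambda>m. stirling_quot p (z + of_nat (Suc m)) / stirling_quot p (of_nat (Suc m)) * stirling_quot p (of_nat (Suc m)) *
              exp (\<Sum>k<Suc m. stirling_err p (z + of_nat k))) = (\<lambda>m. stirling_quot p z)"
        using stirling_quot_steps[OF z(1) q, of p] by (simp add: fun_eq_iff del: of_nat_Suc sum.lessThan_Suc)
      ultimately have "stirling_quot p z = K * exp d" by (simp add: LIMSEQ_const_iff)
      hence "Gamma z = K * exp (stirling_phase p z + d)"
        by (simp add: stirling_quot_def exp_add exp_minus field_simps)
      moreover have "norm d \<le> 2 * B / c q ^ (n + 2) / norm z ^ (n + 1)"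
      proof -
        have "norm d \<le> (\<Sum>k. norm (stirling_err p (z + of_nat k)))"
          unfolding d_def by (rule summable_norm[OF summ[OF q z]])
        also have "\<dots> \<le> 2 * B / c q ^ (n + 2) / norm z ^ (n + 1)"
          by (rule suminf_le_const[OF summ[OF q z] sb[OF q z]])
        finally show ?thesis .
      qed
      ultimately show "\<exists>d. Gamma z = K * exp (stirling_phase p z + d) \<and> norm d \<le> 2 * B / c q ^ (n + 2) / norm z ^ (n + 1)" by blast
    qed
  qed
qed


section \<open>Inverse factorial series and the normalised gamma quotient\<close>

text \<open>The function \<open>1 / (\<kappa>u + 1/2)\<^sub>j\<close> in the variable \<open>x = 1 / u\<close>. In this variable it is analytic at \<open>0\<close> and expansions become statements about germs.\<close>
definition invfac :: "real \<Rightarrow> nat \<Rightarrow> complex \<Rightarrow> complex" where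
  "invfac \<kappa> j x = x ^ j * (1 / (\<Prod>i<j. of_real \<kappa> + (1 / 2 + of_nat i) * x))"

abbreviation invfac_cofactor :: "real \<Rightarrow> nat \<Rightarrow> complex \<Rightarrow> complex" where
  "invfac_cofactor \<kappa> j x \<equiv> 1 / (\<Prod>i<j. of_real \<kappa> + (1 / 2 + of_nat i) * x)"

lemma invfac_inverse:
  assumes "u \<noteq> 0"
  shows "invfac \<kappa> j (1 / u) = 1 / pochhammer (of_real \<kappa> * u + 1 / 2) j"
proof -
  have "pochhammer (of_real \<kappa> * u + 1 / 2) j = (\<Prod>i<j. u * (of_real \<kappa> + (1 / 2 + of_nat i) * (1 / u)))"
    unfolding pochhammer_prod atLeast0LessThan using assms by (intro prod.cong) (auto simp: field_simps)
  also have "\<dots> = u ^ j * (\<Prod>i<j. of_real \<kappa> + (1 / 2 + of_nat i) * (1 / u))"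
    by (simp only: prod.distrib prod_constant card_lessThan)
  finally show ?thesis by (simp add: invfac_def power_divide)
qed

lemma invfac_cofactor_analytic:
  assumes "\<kappa> \<noteq> 0" shows "invfac_cofactor \<kappa> j analytic_on {0}"
  using assms by (intro analytic_intros) auto

lemma invfac_analytic:
  assumes "\<kappa> \<noteq> 0" shows "invfac \<kappa> j analytic_on {0}"
  unfolding invfac_def[abs_def] using assms by (intro analytic_intros) auto

lemma invfac_bigo:
  assumes "\<kappa> \<noteq> 0" "n \<le> j" "F \<le> at 0"
  shows "invfac \<kappa> j \<in> O[F](\<lambda>x. x ^ n)"
proof -
  have "(\<lambda>x. x ^ n * (x ^ (j - n) * invfac_cofactor \<kappa> j x)) \<in> O[at 0](\<lambda>x. x ^ n * 1)"
    using assms by (intro landau_o.big.mult landau_o.big_refl analytic_bigo_1) (auto intro!: analytic_intros)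
  also have "(\<lambda>x. x ^ n * (x ^ (j - n) * invfac_cofactor \<kappa> j x)) = invfac \<kappa> j"
    using assms by (auto simp: invfac_def fun_eq_iff simp flip: power_add mult.assoc)
  finally show ?thesis using landau_o.big.filter_mono[OF assms(3)] by auto
qed

lemma invfac_expansion:
  assumes g: "g analytic_on {0}" and \<kappa>: "\<kappa> \<noteq> 0"
  shows "\<exists>c. (\<lambda>x. g x - (\<Sum>j<M. c j * invfac \<kappa> j x)) \<in> O[at 0](\<lambda>x. x ^ M)"
proof (induction M)
  case 0
  show ?case using analytic_bigo_1[OF g] by simp
next
  case (Suc M)
  then obtain c where c: "(\<lambda>x. g x - (\<Sum>j<M. c j * invfac \<kappa> j x)) \<in> O[at 0](\<lambda>x. x ^ M)" by blast
  have "\<exists>a. (\<lambda>x. (g x - (\<Sum>j<M. c j * invfac \<kappa> j x)) - a * invfac \<kappa> M x) \<in> O[at 0](\<lambda>x. x ^ Suc M)"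
  proof (rule bigo_next_coefficient[OF _ c])
    show "(\<lambda>x. g x - (\<Sum>j<M. c j * invfac \<kappa> j x)) analytic_on {0}"
      by (intro analytic_intros g invfac_analytic \<kappa>)
    show "invfac_cofactor \<kappa> M analytic_on {0}" by (rule invfac_cofactor_analytic[OF \<kappa>])
  qed (use \<kappa> in \<open>auto simp: invfac_def\<close>)
  then obtain a where a: "(\<lambda>x. (g x - (\<Sum>j<M. c j * invfac \<kappa> j x)) - a * invfac \<kappa> M x) \<in> O[at 0](\<lambda>x. x ^ Suc M)" by blast
  show ?case
    by (rule exI[of _ "c(M := a)"]) (use a in \<open>simp add: algebra_simps\<close>)
qed

text \<open>Uniqueness holds along every filter converging to \<open>0\<close>, so an expansion on a single sequence
  determines the coefficients.\<close>
lemma invfac_unique: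
  assumes \<kappa>: "\<kappa> \<noteq> 0" and F: "F \<le> at 0" "F \<noteq> bot"
      and O: "(\<lambda>x. \<Sum>j<M. d j * invfac \<kappa> j x) \<in> O[F](\<lambda>x. x ^ M)" and "j < M"
  shows "d j = 0"
  using \<open>j < M\<close>
proof (induction j rule: less_induct)
  case (less j)
  show ?case
  proof (rule ccontr)
    assume dj: "d j \<noteq> 0"
    have pw: "(\<lambda>x. x ^ m) \<in> O[F](\<lambda>x::complex. x ^ n)" if "n \<le> m" for m n
    proof -
      have "(\<lambda>x. x ^ n * x ^ (m - n)) \<in> O[at 0](\<lambda>x::complex. x ^ n * 1)"
        by (intro landau_o.big.mult landau_o.big_refl analytic_bigo_1) (auto intro!: analytic_intros)
      thus ?thesis using that landau_o.big.filter_mono[OF F(1)] by (auto simp flip: power_add)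
    qed
    have "(\<lambda>x. (\<Sum>i<M. d i * invfac \<kappa> i x) - (\<Sum>i\<in>{Suc j..<M}. d i * invfac \<kappa> i x)) \<in> O[F](\<lambda>x. x ^ Suc j)"
    proof (rule sum_in_bigo)
      show "(\<lambda>x. \<Sum>i<M. d i * invfac \<kappa> i x) \<in> O[F](\<lambda>x. x ^ Suc j)"
        using O pw[of "Suc j" M] less.prems by (auto intro: landau_o.big.trans)
      show "(\<lambda>x. \<Sum>i\<in>{Suc j..<M}. d i * invfac \<kappa> i x) \<in> O[F](\<lambda>x. x ^ Suc j)"
        by (intro big_sum_in_bigo) (use invfac_bigo[OF \<kappa> _ F(1), of "Suc j"] in simp)
    qed
    also have "(\<lambda>x. (\<Sum>i<M. d i * invfac \<kappa> i x) - (\<Sum>i\<in>{Suc j..<M}. d i * invfac \<kappa> i x)) = (\<lambda>x. d j * invfac \<kappa> j x)"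
    proof
      fix x
      have "(\<Sum>i<M. d i * invfac \<kappa> i x) = (\<Sum>i\<in>{j} \<union> {Suc j..<M}. d i * invfac \<kappa> i x)"
        by (rule sum.mono_neutral_right) (use less in \<open>auto simp: not_less_eq le_less_Suc_eq not_le intro!: less.IH\<close>)
      also have "\<dots> = d j * invfac \<kappa> j x + (\<Sum>i\<in>{Suc j..<M}. d i * invfac \<kappa> i x)"
        by (subst sum.union_disjoint) auto
      finally show "(\<Sum>i<M. d i * invfac \<kappa> i x) - (\<Sum>i\<in>{Suc j..<M}. d i * invfac \<kappa> i x) = d j * invfac \<kappa> j x" by simp
    qed
    finally have "invfac \<kappa> j \<in> O[F](\<lambda>x. x ^ Suc j)" using dj by simp
    then obtain C where C: "eventually (\<lambda>x. norm (invfac \<kappa> j x) \<le> C * norm (x ^ Suc j)) F" by (elim landau_o.bigE)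
    have nz: "eventually (\<lambda>x::complex. x \<noteq> 0) F"
      by (rule filter_leD[OF F(1) eventually_neq_at_within])
    have id: "((\<lambda>x::complex. x) \<longlongrightarrow> 0) F" using F(1) tendsto_ident_at[of 0] tendsto_mono by blast
    have "eventually (\<lambda>x. norm (invfac_cofactor \<kappa> j x) \<le> C * norm x) F"
      using C nz
    proof eventually_elim
      case (elim x)
      have "norm x ^ j * norm (invfac_cofactor \<kappa> j x) \<le> norm x ^ j * (C * norm x)"
        using elim(1) by (simp add: invfac_def norm_mult norm_power norm_divide mult_ac)
      thus ?case using elim(2) by (subst (asm) mult_le_cancel_left_pos) auto
    qed
    moreover have "((\<lambda>x. C * norm x) \<longlongrightarrow> 0) F" by (auto intro!: tendsto_eq_intros id)
    ultimately have "(invfac_cofactor \<kappa> j \<longlongrightarrow> 0) F" by (rule Lim_null_comparison)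
    moreover have "(invfac_cofactor \<kappa> j \<longlongrightarrow> 1 / (\<Prod>i<j. of_real \<kappa> + (1 / 2 + of_nat i) * 0)) F"
      by (intro tendsto_intros id) (use \<kappa> in auto)
    ultimately have "1 / (\<Prod>i<j. complex_of_real \<kappa> + (1 / 2 + of_nat i) * 0) = 0" using F(2) tendsto_unique by blast
    thus False using \<kappa> by simp
  qed
qed

lemma invfac_truncate:
  assumes \<kappa>: "\<kappa> \<noteq> 0" and F: "F \<le> at 0" and "N \<le> M"
      and O: "(\<lambda>x. f x - (\<Sum>j<M. d j * invfac \<kappa> j x)) \<in> O[F](\<lambda>x. x ^ M)"
  shows "(\<lambda>x. f x - (\<Sum>j<N. d j * invfac \<kappa> j x)) \<in> O[F](\<lambda>x. x ^ N)"
proof -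
  have "(\<lambda>x. x ^ N * x ^ (M - N)) \<in> O[at 0](\<lambda>x::complex. x ^ N * 1)"
    by (intro landau_o.big.mult landau_o.big_refl analytic_bigo_1) (auto intro!: analytic_intros)
  hence "(\<lambda>x::complex. x ^ M) \<in> O[F](\<lambda>x. x ^ N)"
    using assms landau_o.big.filter_mono[OF F(1)] by (auto simp flip: power_add)
  hence "(\<lambda>x. f x - (\<Sum>j<M. d j * invfac \<kappa> j x)) \<in> O[F](\<lambda>x. x ^ N)" using O by (rule landau_o.big.trans[rotated])
  moreover have "(\<lambda>x. \<Sum>j\<in>{N..<M}. d j * invfac \<kappa> j x) \<in> O[F](\<lambda>x. x ^ N)"
    by (intro big_sum_in_bigo) (use invfac_bigo[OF \<kappa> _ F] in auto)
  ultimately have "(\<lambda>x. (f x - (\<Sum>j<M. d j * invfac \<kappa> j x)) + (\<Sum>j\<in>{N..<M}. d j * invfac \<kappa> j x)) \<in> O[F](\<lambda>x. x ^ N)"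
    by (rule sum_in_bigo)
  moreover have "(\<Sum>j<M. d j * invfac \<kappa> j x) = (\<Sum>j<N. d j * invfac \<kappa> j x) + (\<Sum>j\<in>{N..<M}. d j * invfac \<kappa> j x)" for x
    using assms(3) sum.atLeastLessThan_concat[of 0 N M "\<lambda>j. d j * invfac \<kappa> j x"] by (simp add: atLeast0LessThan)
  ultimately show ?thesis by simp
qed

text \<open>The quotient of the inverse factorial expansion divided by its leading term, at \<open>u = s + 1\<close>; then
  \<open>\<kappa>s + \<vartheta>' = \<kappa>u + 1/2\<close> and the formula becomes symmetric under reflection.\<close>
definition norm_quot :: "real \<Rightarrow> complex \<Rightarrow> complex" where
  "norm_quot \<sigma> u = Gamma (of_real \<sigma> * u) * Gamma (of_real (1 - \<sigma>) * u + 1 / 2) / Gamma u /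
     (of_real (sqrt (2 * pi / \<sigma>)) * exp (u * of_real (\<sigma> * ln \<sigma> + (1 - \<sigma>) * ln (1 - \<sigma>))))"

lemma gamma_quot_shift:
  assumes "0 < \<sigma>" "\<sigma> < 1"
  shows "gamma_quot \<sigma> s / gamma_quot_factor \<sigma> s = norm_quot \<sigma> (s + 1)"
proof -
  have "gamma_quot_factor \<sigma> s = of_real (kap \<sigma> * Acon \<sigma>) * exp (s * of_real (\<sigma> * ln \<sigma> + (1 - \<sigma>) * ln (1 - \<sigma>)))"
  proof -
    define y where "y = hpar \<sigma> * kap \<sigma> powr kap \<sigma>"
    have pos: "y > 0" using assms by (simp add: y_def hpar_def kap_def)
    hence "of_real y powr s = exp (s * of_real (ln y))" by (simp add: powr_def Ln_of_real)
    moreover have "ln (hpar \<sigma> * kap \<sigma> powr kap \<sigma>) = \<sigma> * ln \<sigma> + (1 - \<sigma>) * ln (1 - \<sigma>)"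
      using assms by (simp add: hpar_def kap_def ln_mult ln_powr)
    ultimately show ?thesis by (simp only: gamma_quot_factor_def y_def)
  qed
  also have "\<dots> = of_real (sqrt (2 * pi / \<sigma>)) * exp ((s + 1) * of_real (\<sigma> * ln \<sigma> + (1 - \<sigma>) * ln (1 - \<sigma>)))"
  proof -
    have "kap \<sigma> * Acon \<sigma> = sqrt (2 * pi / \<sigma>) * exp (\<sigma> * ln \<sigma> + (1 - \<sigma>) * ln (1 - \<sigma>))"
    proof -
      have "kap \<sigma> * (\<sigma> / kap \<sigma>) powr \<sigma> = exp (ln (kap \<sigma>) + \<sigma> * ln (\<sigma> / kap \<sigma>))"
        using assms by (simp add: powr_def kap_def exp_add)
      also have "ln (kap \<sigma>) + \<sigma> * ln (\<sigma> / kap \<sigma>) = \<sigma> * ln \<sigma> + (1 - \<sigma>) * ln (1 - \<sigma>)"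
        using assms by (simp add: kap_def ln_div algebra_simps)
      finally show ?thesis by (simp add: Acon_def)
    qed
    moreover have "exp ((s + 1) * of_real t) = of_real (exp t) * exp (s * of_real t)" for t
      by (simp add: distrib_right exp_add exp_of_real)
    ultimately show ?thesis by (simp only: of_real_mult mult.assoc)
  qed
  finally have 1: "gamma_quot_factor \<sigma> s = of_real (sqrt (2 * pi / \<sigma>)) * exp ((s + 1) * of_real (\<sigma> * ln \<sigma> + (1 - \<sigma>) * ln (1 - \<sigma>)))" .
  have 2: "of_real \<sigma> * s + of_real \<sigma> = of_real \<sigma> * (s + 1)" by (simp add: algebra_simps)
  have 3: "of_real (kap \<sigma>) * s + of_real (theta' \<sigma>) = of_real (1 - \<sigma>) * (s + 1) + 1 / 2"
    by (simp add: kap_def theta'_def algebra_simps)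
  show ?thesis unfolding gamma_quot_def norm_quot_def 1 2 3 by (simp add: add.commute)
qed


lemma slit_sector_scale: "z \<in> slit_sector q \<Longrightarrow> a > 0 \<Longrightarrow> of_real a * z \<in> slit_sector q"
  unfolding slit_sector_def by (auto simp: norm_mult mult.assoc mult.left_commute intro: mult_left_mono)
    (metis mult_left_mono mult_minus_right less_imp_le mult.left_commute)

lemma slit_sector_inverse: "1 / z \<in> slit_sector q \<longleftrightarrow> z \<in> slit_sector q"
proof (cases "z = 0")
  case False
  have "Re (1 / z) = Re z / norm z ^ 2" by (simp add: Re_divide cmod_power2)
  hence e: "Re z = Re (1 / z) * norm z * norm z" using False by (simp add: power2_eq_square)
  have *: "(- q * (1 / n) \<le> t) = (- q * n \<le> t * n * n)" if "n > 0" for n t :: real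
    using that mult_le_cancel_right[of "-q" n "t * n"] by (simp add: field_simps)
  have "(- q * norm (1 / z) \<le> Re (1 / z)) = (- q * norm z \<le> Re z)"
    using *[of "norm z" "Re (1 / z)"] e False by (simp add: norm_divide)
  with False show ?thesis by (simp add: slit_sector_def)
qed (auto simp: slit_sector_def)

text \<open>The duplication formula removes the shift by \<open>1/2\<close>, and Stirling's formula is applied to real multiples of \<open>u\<close>
  only. All leading terms and the four constants \<open>K\<close> cancel.\<close>
lemma norm_quot_stirling:
  assumes \<sigma>: "0 < \<sigma>" "\<sigma> < 1" and u: "u \<in> slit_sector q" "\<bar>q\<bar> < 1" and K: "K \<noteq> 0"
    and G: "Gamma (of_real \<sigma> * u) = K * exp (stirling_phase p (of_real \<sigma> * u) + d1)"
      "Gamma (of_real (2 * (1 - \<sigma>)) * u) = K * exp (stirling_phase p (of_real (2 * (1 - \<sigma>)) * u) + d2)"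
      "Gamma u = K * exp (stirling_phase p u + d3)"
      "Gamma (of_real (1 - \<sigma>) * u) = K * exp (stirling_phase p (of_real (1 - \<sigma>) * u) + d4)"
  shows "norm_quot \<sigma> u = exp (poly p (1 / (of_real \<sigma> * u)) + poly p (1 / (of_real (2 * (1 - \<sigma>)) * u)) -
           poly p (1 / u) - poly p (1 / (of_real (1 - \<sigma>) * u)) + (d1 + d2 - d3 - d4))"
proof -
  define \<kappa> where "\<kappa> = 1 - \<sigma>"
  have \<kappa>: "\<kappa> > 0" using \<sigma> by (simp add: \<kappa>_def)
  have u0: "u \<noteq> 0" using u by (simp add: slit_sector_def)
  define L where "L = Ln u"
  define z where "z = of_real \<kappa> * u"
  have zS: "z \<in> slit_sector q" unfolding z_def by (intro slit_sector_scale u \<kappa>)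
  have Lna: "Ln (of_real a * u) = of_real (ln a) + L" if "a > 0" for a
    using Ln_times_of_real[OF that u0] that by (simp add: L_def Ln_of_real)
  have np: "w \<notin> \<int>\<^sub>\<le>\<^sub>0" if "w \<in> slit_sector q" for w
    using sector_not_nonpos_Reals[OF that u(2)] nonpos_Ints_subset_nonpos_Reals by auto
  have z12: "z + 1 / 2 \<in> slit_sector q" using sector_add[OF zS u(2), of "1/2"] by simp
  have dup: "Gamma z * Gamma (z + 1 / 2) = exp ((1 - 2 * z) * of_real (ln 2)) * of_real (sqrt pi) * Gamma (2 * z)"
    by (rule Gamma_legendre_duplication[OF np[OF zS] np[OF z12]])
  have z2: "2 * z = of_real (2 * (1 - \<sigma>)) * u" by (simp add: z_def \<kappa>_def)
  have z1: "z = of_real (1 - \<sigma>) * u" by (simp add: z_def \<kappa>_def)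
  define e1 where "e1 = stirling_phase p (of_real \<sigma> * u) + d1"
  define e2 where "e2 = stirling_phase p (2 * z) + d2"
  define e3 where "e3 = stirling_phase p u + d3"
  define e4 where "e4 = stirling_phase p z + d4"
  have G': "Gamma (of_real \<sigma> * u) = K * exp e1" "Gamma (2 * z) = K * exp e2" "Gamma u = K * exp e3" "Gamma z = K * exp e4"
    using G(1,3) G(2)[folded z2] G(4)[folded z1] by (simp_all add: e1_def e2_def e3_def e4_def)
  have g12: "Gamma (z + 1 / 2) = exp ((1 - 2 * z) * of_real (ln 2)) * of_real (sqrt pi) * exp e2 / exp e4"
    using dup K unfolding G' by (simp add: field_simps)
  have sq: "of_real (sqrt pi) / of_real (sqrt (2 * pi / \<sigma>)) = exp (complex_of_real ((ln \<sigma> - ln 2) / 2))"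
  proof -
    have "sqrt pi / sqrt (2 * pi / \<sigma>) = sqrt (\<sigma> / 2)" using \<sigma> by (simp add: real_sqrt_divide real_sqrt_mult field_simps)
    also have "\<dots> = exp (ln (\<sigma> / 2) / 2)" using \<sigma> by (simp flip: powr_half_sqrt add: powr_def)
    also have "ln (\<sigma> / 2) = ln \<sigma> - ln 2" using \<sigma> by (simp add: ln_div)
    finally show ?thesis by (metis exp_of_real of_real_divide)
  qed
  define lc where "lc = complex_of_real (\<sigma> * ln \<sigma> + (1 - \<sigma>) * ln (1 - \<sigma>))"
  have "norm_quot \<sigma> u = K * exp e1 * (exp ((1 - 2 * z) * of_real (ln 2)) * of_real (sqrt pi) * exp e2 / exp e4) / (K * exp e3) /
     (of_real (sqrt (2 * pi / \<sigma>)) * exp (u * lc))"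
    unfolding norm_quot_def z1[symmetric] G' g12 lc_def by simp
  also have "\<dots> = exp e1 * exp ((1 - 2 * z) * of_real (ln 2)) * exp e2 / exp e4 / exp e3 / exp (u * lc) *
      (of_real (sqrt pi) / of_real (sqrt (2 * pi / \<sigma>)))"
    using K by (simp add: field_simps)
  also have "\<dots> = exp (e1 + (1 - 2 * z) * of_real (ln 2) + e2 - e4 - e3 - u * lc + of_real ((ln \<sigma> - ln 2) / 2))"
    unfolding sq by (simp add: exp_add exp_diff)
  also have "e1 + (1 - 2 * z) * of_real (ln 2) + e2 - e4 - e3 - u * lc + of_real ((ln \<sigma> - ln 2) / 2) =
     poly p (1 / (of_real \<sigma> * u)) + poly p (1 / (of_real (2 * (1 - \<sigma>)) * u)) -
           poly p (1 / u) - poly p (1 / (of_real (1 - \<sigma>) * u)) + (d1 + d2 - d3 - d4)"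
  proof -
    have l: "Ln (of_real \<sigma> * u) = of_real (ln \<sigma>) + L" "Ln u = L" "Ln z = of_real (ln \<kappa>) + L"
      "Ln (2 * z) = of_real (ln 2) + of_real (ln \<kappa>) + L"
      using Lna[of \<sigma>] Lna[of \<kappa>] Lna[of "2 * \<kappa>"] \<sigma> \<kappa> by (simp_all add: z_def L_def ln_mult mult.assoc)
    have kk: "complex_of_real (1 - \<sigma>) = 1 - of_real \<sigma>" "z = (1 - of_real \<sigma>) * u" by (simp_all add: z_def \<kappa>_def)
    show ?thesis
      unfolding e1_def e2_def e3_def e4_def stirling_phase_def l z2[symmetric] z1[symmetric] lc_def \<kappa>_def[symmetric]
      by (simp add: kk(2) \<kappa>_def[symmetric]) (simp add: \<kappa>_def field_simps)
  qed
  finally show ?thesis .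
qed

lemma norm_quot_sector:
  assumes \<sigma>: "0 < \<sigma>" "\<sigma> < 1"
  shows "\<exists>g. g analytic_on {0} \<and> (\<forall>q. \<bar>q\<bar> < 1 \<longrightarrow> (\<lambda>x. norm_quot \<sigma> (1 / x) - g x) \<in> O[at 0 within slit_sector q](\<lambda>x. x ^ (n + 1)))"
proof -
  obtain p K where p: "poly p 0 = 0" "K \<noteq> (0::complex)" and st: "\<And>q. \<bar>q\<bar> < 1 \<Longrightarrow> (\<exists>B R. B \<ge> 0 \<and> (\<forall>z\<in>slit_sector q. norm z \<ge> R \<longrightarrow>
      (\<exists>d. Gamma z = K * exp (stirling_phase p z + d) \<and> norm d \<le> B / norm z ^ (n + 1))))"
    using stirling_sector[of n] by blast
  define P where "P = (\<lambda>x. poly p (1 / of_real \<sigma> * x) + poly p (1 / of_real (2 * (1 - \<sigma>)) * x) - poly p x - poly p (1 / of_real (1 - \<sigma>) * x))"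
  have Pan: "P analytic_on {0}" unfolding P_def by (intro analytic_intros poly_analytic)
  hence gan: "(\<lambda>x. exp (P x)) analytic_on {0}" by (intro analytic_intros)
  show ?thesis
  proof (intro exI[of _ "\<lambda>x. exp (P x)"] conjI allI impI gan)
    fix q :: real assume q: "\<bar>q\<bar> < 1"
    from st[OF this] obtain B R where B: "B \<ge> 0" and st': "\<And>z. z\<in>slit_sector q \<Longrightarrow> norm z \<ge> R \<Longrightarrow>
      (\<exists>d. Gamma z = K * exp (stirling_phase p z + d) \<and> norm d \<le> B / norm z ^ (n + 1))" by blast
    define m where "m = min \<sigma> (1 - \<sigma>)"
    have m: "0 < m" "m \<le> \<sigma>" "m \<le> 1 - \<sigma>" "m \<le> 2 * (1 - \<sigma>)" "m \<le> 1" using \<sigma> by (auto simp: m_def)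
    define C where "C = B / m ^ (n + 1)"
    have C: "C \<ge> 0" using B m by (simp add: C_def)
    have key: "\<exists>d. Gamma (of_real a * (1 / x)) = K * exp (stirling_phase p (of_real a * (1 / x)) + d) \<and> norm d \<le> C * norm x ^ (n + 1)"
      if a: "m \<le> a" and x: "x \<in> slit_sector q" "norm x \<le> m / (1 + \<bar>R\<bar>)" for a x
    proof -
      have x0: "x \<noteq> 0" using x by (simp add: slit_sector_def)
      have "of_real a * (1 / x) \<in> slit_sector q"
        using a m x by (intro slit_sector_scale) (auto simp: slit_sector_inverse)
      moreover have "norm (of_real a * (1 / x)) \<ge> R"
      proof -
        have "norm x * (1 + \<bar>R\<bar>) \<le> m" using x(2) by (simp add: field_simps)
        hence "norm x * R \<le> a" using a by (smt (verit) mult_left_mono norm_ge_zero distrib_left)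
        thus ?thesis using x0 a m by (simp add: norm_mult norm_divide field_simps)
      qed
      ultimately obtain d where d: "Gamma (of_real a * (1 / x)) = K * exp (stirling_phase p (of_real a * (1 / x)) + d)"
        "norm d \<le> B / norm (of_real a * (1 / x)) ^ (n + 1)" using st' by blast
      have "B / norm (of_real a * (1 / x)) ^ (n + 1) = B / a ^ (n + 1) * norm x ^ (n + 1)"
        using a m by (simp add: norm_mult norm_divide power_mult_distrib power_divide)
      also have "\<dots> \<le> C * norm x ^ (n + 1)" unfolding C_def
        using a m B by (intro mult_right_mono divide_left_mono power_mono mult_pos_pos zero_less_power) auto
      finally show ?thesis using d by (intro exI[of _ d]) auto
    qed
    have "\<exists>D. norm_quot \<sigma> (1 / x) = exp (P x + D) \<and> norm D \<le> 4 * C * norm x ^ (n + 1)"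
      if x: "x \<in> slit_sector q" "norm x \<le> m / (1 + \<bar>R\<bar>)" for x
    proof -
      have x0: "x \<noteq> 0" using x by (simp add: slit_sector_def)
      have xi: "1 / x \<in> slit_sector q" using x by (simp add: slit_sector_inverse)
      from key[OF m(2) x] obtain d1 where d1: "Gamma (of_real \<sigma> * (1 / x)) = K * exp (stirling_phase p (of_real \<sigma> * (1 / x)) + d1)" "norm d1 \<le> C * norm x ^ (n + 1)" by blast
      from key[OF m(4) x] obtain d2 where d2: "Gamma (of_real (2 * (1 - \<sigma>)) * (1 / x)) = K * exp (stirling_phase p (of_real (2 * (1 - \<sigma>)) * (1 / x)) + d2)" "norm d2 \<le> C * norm x ^ (n + 1)" by blast
      from key[OF m(5) x] obtain d3 where d3: "Gamma (1 / x) = K * exp (stirling_phase p (1 / x) + d3)" "norm d3 \<le> C * norm x ^ (n + 1)" by auto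
      from key[OF m(3) x] obtain d4 where d4: "Gamma (of_real (1 - \<sigma>) * (1 / x)) = K * exp (stirling_phase p (of_real (1 - \<sigma>) * (1 / x)) + d4)" "norm d4 \<le> C * norm x ^ (n + 1)" by blast
      have "norm (d1 + d2 - d3 - d4) \<le> norm d1 + norm d2 + norm d3 + norm d4"
        using norm_triangle_ineq4[of "d1 + d2 - d3" d4] norm_triangle_ineq4[of "d1 + d2" d3] norm_triangle_ineq[of d1 d2] by linarith
      also have "\<dots> \<le> 4 * C * norm x ^ (n + 1)" using d1 d2 d3 d4 by simp
      finally have "norm (d1 + d2 - d3 - d4) \<le> 4 * C * norm x ^ (n + 1)" .
      moreover have "norm_quot \<sigma> (1 / x) = exp (P x + (d1 + d2 - d3 - d4))"
        using norm_quot_stirling[OF \<sigma> xi q p(2) d1(1) d2(1) d3(1) d4(1)] x0 by (simp add: P_def)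
      ultimately show ?thesis by blast
    qed
    note expr = this
    define r where "r = min (m / (1 + \<bar>R\<bar>)) (min 1 (1 / (8 * C + 1)))"
    have r: "r > 0" using m C by (simp add: r_def)
    have "(\<lambda>x. (norm_quot \<sigma> (1 / x) - exp (P x)) / exp (P x)) \<in> O[at 0 within slit_sector q](\<lambda>x. x ^ (n + 1))"
    proof (rule bigoI[of _ "8 * C"])
      show "\<forall>\<^sub>F x in at 0 within slit_sector q. norm ((norm_quot \<sigma> (1 / x) - exp (P x)) / exp (P x)) \<le> 8 * C * norm (x ^ (n + 1))"
        unfolding eventually_at
      proof (intro exI[of _ r] conjI r ballI impI)
        fix x assume x: "x \<in> slit_sector q" "x \<noteq> 0 \<and> dist x 0 < r"
        hence xr: "norm x \<le> m / (1 + \<bar>R\<bar>)" "norm x \<le> 1" "norm x \<le> 1 / (8 * C + 1)" by (auto simp: r_def)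
        from expr[OF x(1) xr(1)] obtain D where D: "norm_quot \<sigma> (1 / x) = exp (P x + D)" "norm D \<le> 4 * C * norm x ^ (n + 1)" by blast
        have "norm x ^ (n + 1) \<le> norm x" using xr(2) by (simp add: mult_left_le power_le_one)
        hence "4 * C * norm x ^ (n + 1) \<le> 4 * C * (1 / (8 * C + 1))" using xr(3) C by (intro mult_left_mono) auto
        also have "\<dots> \<le> 1 / 2" using C by (simp add: field_simps)
        finally have D1: "norm D \<le> 1 / 2" using D by simp
        have "norm ((norm_quot \<sigma> (1 / x) - exp (P x)) / exp (P x)) = norm (exp D - 1)"
          by (simp add: D exp_add diff_divide_distrib)
        also have "\<dots> \<le> 2 * norm D" using norm_exp_bounds(2)[OF D1] norm_ge_zero[of D] by linarith
        also have "\<dots> \<le> 8 * C * norm (x ^ (n + 1))" using D(2) by (simp add: norm_power norm_mult)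
        finally show "norm ((norm_quot \<sigma> (1 / x) - exp (P x)) / exp (P x)) \<le> 8 * C * norm (x ^ (n + 1))" .
      qed
    qed
    hence "(\<lambda>x. ((norm_quot \<sigma> (1 / x) - exp (P x)) / exp (P x)) * exp (P x)) \<in> O[at 0 within slit_sector q](\<lambda>x. x ^ (n + 1) * 1)"
      using landau_o.big.filter_mono[OF at_le[OF subset_UNIV] analytic_bigo_1[OF gan]] by (intro landau_o.big.mult)
    thus "(\<lambda>x. norm_quot \<sigma> (1 / x) - exp (P x)) \<in> O[at 0 within slit_sector q](\<lambda>x. x ^ (n + 1))" by simp
  qed
qed


text \<open>On the positive real axis the gamma quotient is real; this shows that the coefficients are real.\<close>
definition real_germ :: "complex filter" where
  "real_germ = filtermap complex_of_real (at_right 0)"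

lemma real_germ_le_sector: "\<bar>q\<bar> < 1 \<Longrightarrow> real_germ \<le> at 0 within slit_sector q"
proof -
  assume q: "\<bar>q\<bar> < 1"
  have "filterlim complex_of_real (at 0 within slit_sector q) (at_right 0)"
    unfolding filterlim_at
  proof
    show "((complex_of_real) \<longlongrightarrow> 0) (at_right 0)" by (auto intro!: tendsto_eq_intros)
    show "\<forall>\<^sub>F x in at_right 0. complex_of_real x \<in> slit_sector q \<and> complex_of_real x \<noteq> 0"
      using eventually_at_right_less[of 0]
    proof eventually_elim
      case (elim x)
      have "- q * x \<le> 1 * x" using q elim by (intro mult_right_mono) auto
      thus ?case using elim by (simp add: slit_sector_def)
    qed
  qed
  thus ?thesis by (simp add: real_germ_def filterlim_def)
qed

lemma real_germ_le: "real_germ \<le> at 0"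
  using order_trans[OF real_germ_le_sector[of 0] at_le[OF subset_UNIV]] by simp

lemma real_germ_neq_bot: "real_germ \<noteq> bot"
  by (simp add: real_germ_def filtermap_bot_iff)


lemma norm_quot_real:
  assumes "0 < \<sigma>" "\<sigma> < 1"
  shows "norm_quot \<sigma> (of_real u) \<in> \<real>"
proof -
  have 2: "Gamma (of_real ((1 - \<sigma>) * u) + 1 / 2) = complex_of_real (Gamma ((1 - \<sigma>) * u + 1 / 2))"
    by (simp flip: Gamma_complex_of_real)
  show ?thesis unfolding norm_quot_def of_real_mult[symmetric] 2 Gamma_complex_of_real exp_of_real
    by (intro Reals_divide Reals_mult Reals_of_real)
qed

lemma invfac_cnj: "invfac \<kappa> j (of_real x) \<in> \<real>"
proof -
  have "invfac \<kappa> j (of_real x) = of_real (x ^ j * (1 / (\<Prod>i<j. \<kappa> + (1 / 2 + real i) * x)))"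
    by (simp add: invfac_def)
  thus ?thesis by (metis Reals_of_real)
qed

lemma norm_quot_expansion:
  assumes \<sigma>: "0 < \<sigma>" "\<sigma> < 1"
  shows "\<exists>c. \<forall>q. \<bar>q\<bar> < 1 \<longrightarrow>
     (\<lambda>x. norm_quot \<sigma> (1 / x) - (\<Sum>j<M. c j * invfac (1 - \<sigma>) j x)) \<in> O[at 0 within slit_sector q](\<lambda>x. x ^ M)"
proof -
  obtain g where g: "g analytic_on {0}" "\<And>q. \<bar>q\<bar> < 1 \<Longrightarrow> (\<lambda>x. norm_quot \<sigma> (1 / x) - g x) \<in> O[at 0 within slit_sector q](\<lambda>x. x ^ (M + 1))"
    using norm_quot_sector[OF \<sigma>, of M] by blast
  obtain c where c: "(\<lambda>x. g x - (\<Sum>j<M. c j * invfac (1 - \<sigma>) j x)) \<in> O[at 0](\<lambda>x. x ^ M)"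
    using invfac_expansion[OF g(1), of "1 - \<sigma>" M] \<sigma> by auto
  show ?thesis
  proof (intro exI[of _ c] allI impI)
    fix q :: real assume q: "\<bar>q\<bar> < 1"
    let ?F = "at 0 within slit_sector q"
    have F: "?F \<le> at 0" by (rule at_le) simp
    have "(\<lambda>x. x ^ M * x) \<in> O[at 0](\<lambda>x::complex. x ^ M * 1)"
      by (intro landau_o.big.mult landau_o.big_refl analytic_bigo_1) (auto intro!: analytic_intros)
    from landau_o.big.filter_mono[OF F this] have "(\<lambda>x. x ^ (M + 1)) \<in> O[?F](\<lambda>x::complex. x ^ M)" by (simp add: mult.commute)
    with g(2)[OF q] have 1: "(\<lambda>x. norm_quot \<sigma> (1 / x) - g x) \<in> O[?F](\<lambda>x. x ^ M)" by (rule landau_o.big.trans)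
    from sum_in_bigo(1)[OF 1 landau_o.big.filter_mono[OF F c]]
    show "(\<lambda>x. norm_quot \<sigma> (1 / x) - (\<Sum>j<M. c j * invfac (1 - \<sigma>) j x)) \<in> O[?F](\<lambda>x. x ^ M)" by simp
  qed
qed

lemma norm_quot_real_expansion:
  assumes \<sigma>: "0 < \<sigma>" "\<sigma> < 1"
  obtains c :: "nat \<Rightarrow> real" where "\<And>q M. \<bar>q\<bar> < 1 \<Longrightarrow>
     (\<lambda>x. norm_quot \<sigma> (1 / x) - (\<Sum>j<M. of_real (c j) * invfac (1 - \<sigma>) j x)) \<in> O[at 0 within slit_sector q](\<lambda>x. x ^ M)"
proof -
  have \<kappa>: "1 - \<sigma> \<noteq> 0" using \<sigma> by simp
  obtain C where C: "\<And>M q. \<bar>q\<bar> < 1 \<Longrightarrow>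
     (\<lambda>x. norm_quot \<sigma> (1 / x) - (\<Sum>j<M. C M j * invfac (1 - \<sigma>) j x)) \<in> O[at 0 within slit_sector q](\<lambda>x. x ^ M)"
    using norm_quot_expansion[OF \<sigma>] by metis
  have CR: "(\<lambda>x. norm_quot \<sigma> (1 / x) - (\<Sum>j<M. C M j * invfac (1 - \<sigma>) j x)) \<in> O[real_germ](\<lambda>x. x ^ M)" for M
    by (rule landau_o.big.filter_mono[OF real_germ_le_sector[of 0] C]) auto
  have un: "d j = d' j"
    if d: "(\<lambda>x. norm_quot \<sigma> (1 / x) - (\<Sum>j<M. d j * invfac (1 - \<sigma>) j x)) \<in> O[real_germ](\<lambda>x. x ^ M)"
      "(\<lambda>x. norm_quot \<sigma> (1 / x) - (\<Sum>j<M. d' j * invfac (1 - \<sigma>) j x)) \<in> O[real_germ](\<lambda>x. x ^ M)" and j: "j < M" for d d' j M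
  proof -
    have "(\<lambda>x. \<Sum>j<M. (d' j - d j) * invfac (1 - \<sigma>) j x) \<in> O[real_germ](\<lambda>x. x ^ M)"
      using sum_in_bigo(2)[OF d] by (simp add: left_diff_distrib sum_subtractf)
    from invfac_unique[OF \<kappa> real_germ_le real_germ_neq_bot this j] show ?thesis by simp
  qed
  have Ccnj: "cnj (C M j) = C M j" if "j < M" for M j
  proof (rule un[where M = M])
    have ev: "eventually (\<lambda>x. norm_quot \<sigma> (1 / x) - (\<Sum>j<M. cnj (C M j) * invfac (1 - \<sigma>) j x) =
       cnj (norm_quot \<sigma> (1 / x) - (\<Sum>j<M. C M j * invfac (1 - \<sigma>) j x))) real_germ"
      unfolding real_germ_def eventually_filtermap
    proof (intro always_eventually allI)
      fix x
      have "cnj (norm_quot \<sigma> (1 / of_real x)) = norm_quot \<sigma> (1 / of_real x)"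
        using norm_quot_real[OF \<sigma>, of "1 / x"] by (simp add: Reals_cnj_iff)
      moreover have "cnj (invfac (1 - \<sigma>) j (of_real x)) = invfac (1 - \<sigma>) j (of_real x)" for j
        using invfac_cnj by (simp add: Reals_cnj_iff)
      ultimately show "norm_quot \<sigma> (1 / of_real x) - (\<Sum>j<M. cnj (C M j) * invfac (1 - \<sigma>) j (of_real x)) =
       cnj (norm_quot \<sigma> (1 / of_real x) - (\<Sum>j<M. C M j * invfac (1 - \<sigma>) j (of_real x)))" by simp
    qed
    show "(\<lambda>x. norm_quot \<sigma> (1 / x) - (\<Sum>j<M. cnj (C M j) * invfac (1 - \<sigma>) j x)) \<in> O[real_germ](\<lambda>x. x ^ M)"
      unfolding landau_o.big.in_cong[OF ev]
      using CR[of M] by (subst landau_o.big.norm_iff[symmetric]) (simp only: complex_mod_cnj landau_o.big.norm_iff)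
  qed (use CR that in auto)
  define c where "c = (\<lambda>j. Re (C (Suc j) j))"
  have Cc: "C M j = of_real (c j)" if "j < M" for M j
  proof -
    have "C M j = C (Suc j) j"
      by (rule un[of "C M" "Suc j" "C (Suc j)"]) (use invfac_truncate[OF \<kappa> real_germ_le _ CR[of M], of "Suc j"] CR[of "Suc j"] that in auto)
    also have "\<dots> = of_real (c j)"
      using Ccnj[of j "Suc j"] by (simp add: c_def complex_eq_iff)
    finally show ?thesis .
  qed
  show ?thesis
  proof (rule that[of c])
    fix q :: real and M assume "\<bar>q\<bar> < 1"
    from C[OF this, of M] show "(\<lambda>x. norm_quot \<sigma> (1 / x) - (\<Sum>j<M. of_real (c j) * invfac (1 - \<sigma>) j x)) \<in> O[at 0 within slit_sector q](\<lambda>x. x ^ M)"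
      by (simp add: Cc)
  qed
qed

lemma pochhammer_invfac:
  assumes "s + 1 \<noteq> 0"
  shows "1 / pochhammer (of_real (kap \<sigma>) * s + of_real (theta' \<sigma>)) j = invfac (1 - \<sigma>) j (1 / (s + 1))"
proof -
  have "of_real (kap \<sigma>) * s + of_real (theta' \<sigma>) = of_real (1 - \<sigma>) * (s + 1) + 1 / 2"
    by (simp add: kap_def theta'_def algebra_simps)
  thus ?thesis using invfac_inverse[OF assms, of "1 - \<sigma>" j] by simp
qed

lemma inverse_power_bigo_invfac:
  assumes "\<kappa> \<noteq> 0" "F \<le> at 0"
  shows "(\<lambda>x. x ^ M) \<in> O[F](invfac \<kappa> M)"
proof -
  have "(\<lambda>x. invfac \<kappa> M x * (\<Prod>i<M. of_real \<kappa> + (1 / 2 + of_nat i) * x)) \<in> O[at 0](\<lambda>x. invfac \<kappa> M x * 1)"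
    by (intro landau_o.big.mult landau_o.big_refl analytic_bigo_1) (auto intro!: analytic_intros)
  moreover have "eventually (\<lambda>x. invfac \<kappa> M x * (\<Prod>i<M. of_real \<kappa> + (1 / 2 + of_nat i) * x) = x ^ M) (at 0)"
  proof -
    have "((\<lambda>x. \<Prod>i<M. of_real \<kappa> + (1 / 2 + of_nat i) * x) \<longlongrightarrow> (\<Prod>i<M. of_real \<kappa> + (1 / 2 + of_nat i) * (0::complex))) (at 0)"
      by (intro tendsto_intros)
    hence "eventually (\<lambda>x::complex. (\<Prod>i<M. of_real \<kappa> + (1 / 2 + of_nat i) * x) \<noteq> 0) (at 0)"
      by (rule tendsto_imp_eventually_ne) (use assms in auto)
    thus ?thesis by eventually_elim (auto simp: invfac_def)
  qed
  ultimately have "(\<lambda>x. x ^ M) \<in> O[at 0](invfac \<kappa> M)" by (simp add: landau_o.big.in_cong)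
  thus ?thesis by (rule landau_o.big.filter_mono[OF assms(2)])
qed

lemma sector_shift_filterlim:
  assumes "0 < \<epsilon>" "\<epsilon> < pi"
  shows "filterlim (\<lambda>s. 1 / (s + 1)) (at 0 within slit_sector (cos \<epsilon>)) (sector_at_infinity \<epsilon>)"
  unfolding filterlim_at
proof
  have i: "filterlim (\<lambda>s::complex. s + 1) at_infinity at_infinity"
    by (rule tendsto_add_filterlim_at_infinity'[OF filterlim_ident tendsto_const])
  have le: "sector_at_infinity \<epsilon> \<le> at_infinity" by (simp add: sector_at_infinity_def)
  show "((\<lambda>s. 1 / (s + 1)) \<longlongrightarrow> 0) (sector_at_infinity \<epsilon>)"
    by (rule tendsto_mono[OF le tendsto_divide_0[OF tendsto_const i]])
  have ce: "\<bar>cos \<epsilon>\<bar> < 1"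
    using assms cos_monotone_0_pi[of 0 \<epsilon>] cos_monotone_0_pi[of \<epsilon> pi] by (auto simp: abs_less_iff)
  have "eventually (\<lambda>s::complex. norm s \<ge> 1) at_infinity" by (auto simp: eventually_at_infinity)
  hence "eventually (\<lambda>s::complex. norm s \<ge> 1) (sector_at_infinity \<epsilon>)" by (rule filter_leD[OF le])
  moreover have "eventually (\<lambda>s. \<bar>Arg s\<bar> \<le> pi - \<epsilon>) (sector_at_infinity \<epsilon>)"
    by (simp add: sector_at_infinity_def eventually_inf_principal)
  ultimately show "\<forall>\<^sub>F s in sector_at_infinity \<epsilon>. 1 / (s + 1) \<in> slit_sector (cos \<epsilon>) \<and> 1 / (s + 1) \<noteq> 0"
  proof eventually_elim
    case (elim s)
    have "s \<noteq> 0" using elim by auto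
    have "cos (Arg s) = cos \<bar>Arg s\<bar>" by simp
    also have "\<dots> \<ge> cos (pi - \<epsilon>)" using elim assms by (intro cos_monotone_0_pi_le) auto
    finally have "- cos \<epsilon> \<le> cos (Arg s)" by simp
    hence "norm s * (- cos \<epsilon>) \<le> norm s * cos (Arg s)" by (intro mult_left_mono) auto
    also have "\<dots> = Re s" using \<open>s \<noteq> 0\<close> by (simp add: cos_Arg)
    finally have "s \<in> slit_sector (cos \<epsilon>)" using \<open>s \<noteq> 0\<close> by (simp add: slit_sector_def mult.commute)
    from sector_add[OF this ce, of 1] have "s + 1 \<in> slit_sector (cos \<epsilon>)" by simp
    thus ?case using slit_sector_inverse[of "s + 1"] by (simp add: slit_sector_def)
  qed
qed

text \<open>The definite description defining the \<open>c\<^sub>j\<close> is meaningful: existence comes from Stirling's formula,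
  uniqueness from \<open>invfac_unique\<close>. The sector \<open>q = cos \<epsilon>\<close> corresponds to \<open>\<bar>arg s\<bar> \<le> \<pi> - \<epsilon>\<close>.\<close>
theorem c_coeff_expansion:
  assumes \<sigma>: "0 < \<sigma>" "\<sigma> < 1" and q: "\<bar>q\<bar> < 1"
  shows "(\<lambda>x. norm_quot \<sigma> (1 / x) - (\<Sum>j<M. of_real (c_coeff \<sigma> j) * invfac (1 - \<sigma>) j x)) \<in> O[at 0 within slit_sector q](\<lambda>x. x ^ M)"
proof -
  have \<kappa>: "1 - \<sigma> \<noteq> 0" using \<sigma> by simp
  obtain c :: "nat \<Rightarrow> real" where c: "\<And>q M. \<bar>q\<bar> < 1 \<Longrightarrow>
     (\<lambda>x. norm_quot \<sigma> (1 / x) - (\<Sum>j<M. of_real (c j) * invfac (1 - \<sigma>) j x)) \<in> O[at 0 within slit_sector q](\<lambda>x. x ^ M)"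
    using norm_quot_real_expansion[OF \<sigma>] by blast
  have ife: "inverse_factorial_expansion \<sigma> d \<longleftrightarrow> (\<forall>M\<ge>1. \<forall>\<epsilon>. 0 < \<epsilon> \<and> \<epsilon> < pi \<longrightarrow>
     (\<lambda>s. norm_quot \<sigma> (s + 1) - (\<Sum>j<M. of_real (d j) * invfac (1 - \<sigma>) j (1 / (s + 1))))
       \<in> O[sector_at_infinity \<epsilon>](\<lambda>s. invfac (1 - \<sigma>) M (1 / (s + 1))))" for d
  proof -
    have "((\<lambda>s. gamma_quot \<sigma> s / gamma_quot_factor \<sigma> s
              - (\<Sum>j<M. of_real (d j) / pochhammer (of_real (kap \<sigma>) * s + of_real (theta' \<sigma>)) j))
        \<in> O[sector_at_infinity \<epsilon>](\<lambda>s. 1 / pochhammer (of_real (kap \<sigma>) * s + of_real (theta' \<sigma>)) M)) \<longleftrightarrow>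
      ((\<lambda>s. norm_quot \<sigma> (s + 1) - (\<Sum>j<M. of_real (d j) * invfac (1 - \<sigma>) j (1 / (s + 1))))
       \<in> O[sector_at_infinity \<epsilon>](\<lambda>s. invfac (1 - \<sigma>) M (1 / (s + 1))))" for M \<epsilon>
    proof (rule landau_o.big.cong_ex)
      have "eventually (\<lambda>s::complex. norm s \<ge> 2) at_infinity" by (auto simp: eventually_at_infinity)
      hence "eventually (\<lambda>s::complex. s + 1 \<noteq> 0) at_infinity"
        by (rule eventually_mono) (auto simp: add_eq_0_iff2)
      hence ev: "eventually (\<lambda>s. s + 1 \<noteq> 0) (sector_at_infinity \<epsilon>)"
        unfolding sector_at_infinity_def by (rule filter_leD[OF inf_le1])
      show "\<forall>\<^sub>F s in sector_at_infinity \<epsilon>. gamma_quot \<sigma> s / gamma_quot_factor \<sigma> s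
              - (\<Sum>j<M. of_real (d j) / pochhammer (of_real (kap \<sigma>) * s + of_real (theta' \<sigma>)) j) =
         norm_quot \<sigma> (s + 1) - (\<Sum>j<M. of_real (d j) * invfac (1 - \<sigma>) j (1 / (s + 1)))"
        using ev
      proof eventually_elim
        case (elim s)
        show ?case unfolding pochhammer_invfac[OF elim, symmetric] gamma_quot_shift[OF \<sigma>] by simp
      qed
      show "\<forall>\<^sub>F s in sector_at_infinity \<epsilon>. 1 / pochhammer (of_real (kap \<sigma>) * s + of_real (theta' \<sigma>)) M = invfac (1 - \<sigma>) M (1 / (s + 1))"
        using ev by eventually_elim (rule pochhammer_invfac)
    qed
    thus ?thesis by (simp add: inverse_factorial_expansion_def)
  qed
  have "inverse_factorial_expansion \<sigma> c"
    unfolding ife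
  proof (intro allI impI, elim conjE)
    fix M \<epsilon> assume \<epsilon>: "0 < \<epsilon>" "\<epsilon> < pi"
    have ce: "\<bar>cos \<epsilon>\<bar> < 1"
      using \<epsilon> cos_monotone_0_pi[of 0 \<epsilon>] cos_monotone_0_pi[of \<epsilon> pi] by (auto simp: abs_less_iff)
    have "(\<lambda>x. norm_quot \<sigma> (1 / x) - (\<Sum>j<M. of_real (c j) * invfac (1 - \<sigma>) j x)) \<in> O[at 0 within slit_sector (cos \<epsilon>)](invfac (1 - \<sigma>) M)"
    proof (rule landau_o.big.trans[OF c[OF ce]])
      show "(\<lambda>x. x ^ M) \<in> O[at 0 within slit_sector (cos \<epsilon>)](invfac (1 - \<sigma>) M)"
        by (rule inverse_power_bigo_invfac[OF \<kappa> at_le[OF subset_UNIV]])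
    qed
    from landau_o.big.compose[OF this sector_shift_filterlim[OF \<epsilon>]]
    show "(\<lambda>s. norm_quot \<sigma> (s + 1) - (\<Sum>j<M. of_real (c j) * invfac (1 - \<sigma>) j (1 / (s + 1))))
       \<in> O[sector_at_infinity \<epsilon>](\<lambda>s. invfac (1 - \<sigma>) M (1 / (s + 1)))" by simp
  qed
  moreover have "d = c" if "inverse_factorial_expansion \<sigma> d" for d
  proof
    fix j
    have h: "0 < pi / 2" "pi / 2 < pi" by (auto simp: pi_gt_zero)
    have lim: "filterlim (\<lambda>x. 1 / x - 1) (sector_at_infinity (pi / 2)) real_germ"
      unfolding sector_at_infinity_def filterlim_inf filterlim_principal
    proof
      have "filterlim (\<lambda>x::complex. 1 / x) at_infinity (at 0)"
        by (rule filterlim_cong[THEN iffD1, OF refl refl _ filterlim_inverse_at_infinity])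
           (simp add: inverse_eq_divide)
      hence "filterlim (\<lambda>x::complex. 1 / x + (- 1)) at_infinity (at 0)"
        by (intro tendsto_add_filterlim_at_infinity'[OF _ tendsto_const])
      thus "filterlim (\<lambda>x::complex. 1 / x - 1) at_infinity real_germ"
        using real_germ_le by (auto elim: filterlim_mono)
      have "eventually (\<lambda>x::real. x \<in> {0<..<1}) (at_right 0)" by (rule eventually_at_rightI[of _ 1]) auto
      hence "eventually (\<lambda>x. \<bar>Arg (1 / complex_of_real x - 1)\<bar> \<le> pi - pi / 2) (at_right 0)"
      proof eventually_elim
        case (elim x)
        have e: "1 / complex_of_real x - 1 = of_real (1 / x - 1)" by simp
        have "1 / x - 1 > 0" using elim by (simp add: field_simps)
        hence "Arg (1 / complex_of_real x - 1) = 0" unfolding e by (subst Arg_of_real) auto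
        thus ?case by simp
      qed
      thus "\<forall>\<^sub>F x in real_germ. 1 / x - 1 \<in> {s. \<bar>Arg s\<bar> \<le> pi - pi / 2}"
        by (simp add: real_germ_def eventually_filtermap)
    qed
    have d: "(\<lambda>x. norm_quot \<sigma> (1 / x) - (\<Sum>j<Suc j. of_real (d j) * invfac (1 - \<sigma>) j x)) \<in> O[real_germ](\<lambda>x. x ^ Suc j)"
    proof -
      have "(\<lambda>s. norm_quot \<sigma> (s + 1) - (\<Sum>j<Suc j. of_real (d j) * invfac (1 - \<sigma>) j (1 / (s + 1))))
       \<in> O[sector_at_infinity (pi / 2)](\<lambda>s. invfac (1 - \<sigma>) (Suc j) (1 / (s + 1)))"
        by (rule that[unfolded ife, rule_format]) (use h in auto)
      from landau_o.big.compose[OF this lim]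
      have "(\<lambda>x. norm_quot \<sigma> (1 / x) - (\<Sum>j<Suc j. of_real (d j) * invfac (1 - \<sigma>) j x)) \<in> O[real_germ](invfac (1 - \<sigma>) (Suc j))"
        by (simp only: diff_add_cancel divide_divide_eq_right div_by_1 mult_1_left)
      also have "invfac (1 - \<sigma>) (Suc j) \<in> O[real_germ](\<lambda>x. x ^ Suc j)" by (rule invfac_bigo[OF \<kappa> _ real_germ_le]) simp
      finally show ?thesis .
    qed
    have c': "(\<lambda>x. norm_quot \<sigma> (1 / x) - (\<Sum>j<Suc j. of_real (c j) * invfac (1 - \<sigma>) j x)) \<in> O[real_germ](\<lambda>x. x ^ Suc j)"
      by (rule landau_o.big.filter_mono[OF real_germ_le_sector[of 0] c]) auto
    have "(\<lambda>x. \<Sum>j<Suc j. (of_real (c j) - of_real (d j)) * invfac (1 - \<sigma>) j x) \<in> O[real_germ](\<lambda>x. x ^ Suc j)"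
      using sum_in_bigo(2)[OF d c'] by (simp add: left_diff_distrib sum_subtractf del: sum.lessThan_Suc)
    from invfac_unique[OF \<kappa> real_germ_le real_germ_neq_bot this, of j]
    have "complex_of_real (c j) - of_real (d j) = 0" by simp
    thus "d j = c j" by simp
  qed
  ultimately have cc: "c_coeff \<sigma> = c" unfolding c_coeff_def by (rule the_equality)
  show ?thesis unfolding cc by (rule c[OF q])
qed


section \<open>The algebraic expansion on the negative half-axis\<close>

text \<open>In the left half-plane the Taylor remainder of \<open>exp\<close> is bounded by a power alone, without an exponential
  factor. This is what makes Watson's argument work for the large values of \<open>w = c e\<^sup>z\<close>.\<close>
lemma exp_taylor_half_plane:
  fixes w :: complex
  shows "norm (exp w - (\<Sum>k<N. w ^ k / fact k)) \<le> norm w ^ N * exp (max 0 (Re w))"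
proof (cases N)
  case 0
  then show ?thesis by simp
next
  case (Suc n)
  have "norm (exp w - (\<Sum>i\<le>n. exp 0 * (w - 0) ^ i / fact i)) \<le> exp (max 0 (Re w)) * norm (w - 0) ^ Suc n / fact n"
  proof (rule complex_Taylor[of "closed_segment 0 w" n "\<lambda>_. exp"])
    fix x assume "x \<in> closed_segment 0 w"
    then obtain t where t: "0 \<le> t" "t \<le> 1" "x = t *\<^sub>R w" by (auto simp: in_segment)
    have "Re x = t * Re w" using t by simp
    also have "\<dots> \<le> max 0 (Re w)"
    proof (cases "Re w \<ge> 0")
      case True
      then show ?thesis using mult_right_mono[OF t(2), of "Re w"] by simp
    next
      case False
      then show ?thesis using t by (simp add: mult_nonneg_nonpos)
    qed
    finally show "norm (exp x) \<le> exp (max 0 (Re w))" by simp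
  qed (auto intro!: derivative_eq_intros)
  also have "\<dots> \<le> exp (max 0 (Re w)) * norm (w - 0) ^ Suc n / 1"
    by (rule divide_left_mono) simp_all
  finally show ?thesis by (simp add: Suc lessThan_Suc_atMost mult_ac)
qed

text \<open>The powers of \<open>c\<close> cancel, since \<open>c d\<^sup>-\<^sup>1\<^sup>/\<^sup>\<sigma> = x\<^sup>-\<^sup>1\<^sup>/\<^sup>\<sigma>\<close>, and the reflection formula turns \<open>\<Gamma>(p) sin (\<pi>p)\<close> into \<open>\<pi> / \<Gamma>(1 - p)\<close>.\<close>
lemma H'_trunc_eq:
  assumes \<sigma>: "0 < \<sigma>" "\<sigma> < 1" and c: "c > 0" and x: "x > 0" and d: "d = x * c powr \<sigma>"
  shows "c / pi * Im (\<Sum>k<N. of_real (c ^ k / fact k) *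
      (exp (\<i> * of_real (pi * (real (k + 1) / \<sigma>))) * of_real (Gamma (real (k + 1) / \<sigma>) / \<sigma> * d powr - (real (k + 1) / \<sigma>))))
    = H'_trunc \<sigma> N x"
proof -
  have t: "c / pi * Im (of_real (c ^ k / fact k) *
      (exp (\<i> * of_real (pi * (real (k + 1) / \<sigma>))) * of_real (Gamma (real (k + 1) / \<sigma>) / \<sigma> * d powr - (real (k + 1) / \<sigma>))))
    = 1 / \<sigma> * (x powr (- (real (k + 1) / \<sigma>)) / fact k * rGamma (1 - real (k + 1) / \<sigma>))" for k
  proof -
    define p where "p = real (k + 1) / \<sigma>"
    have p: "p > 0" using \<sigma> by (simp add: p_def)
    have sp: "\<sigma> * p = real (k + 1)" using \<sigma> by (simp add: p_def)
    have "d powr - p = x powr - p * (c powr \<sigma>) powr - p" using x c by (simp add: d powr_mult)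
    also have "(c powr \<sigma>) powr - p = c powr - real (k + 1)" by (simp only: powr_powr mult_minus_right sp)
    also have "\<dots> = 1 / (c * c ^ k)" using c by (simp only: powr_minus powr_realpow power_Suc Suc_eq_plus1[symmetric] inverse_eq_divide)
    finally have dp: "d powr - p = x powr - p / (c * c ^ k)" by simp
    have "rGamma (1 - p) = Gamma p * sin (pi * p) / pi"
      using rGamma_real_reflection[of "1 - p"] p by (simp add: right_diff_distrib sin_diff)
    moreover have "exp (\<i> * of_real (pi * p)) = cis (pi * p)" by (simp add: cis_conv_exp)
    moreover have "Im (of_real u * (cis v * of_real w)) = u * (sin v * w)" for u v w by simp
    moreover have "c / pi * (c ^ k / fact k * (S * (G / \<sigma> * (Y / (c * c ^ k))))) = 1 / \<sigma> * (Y / fact k * (G * S / pi))" for S G Y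
      using c \<sigma> by (simp add: field_simps)
    ultimately show ?thesis unfolding p_def[symmetric] by (simp only: dp)
  qed
  have "c / pi * Im (\<Sum>k<N. of_real (c ^ k / fact k) *
      (exp (\<i> * of_real (pi * (real (k + 1) / \<sigma>))) * of_real (Gamma (real (k + 1) / \<sigma>) / \<sigma> * d powr - (real (k + 1) / \<sigma>))))
    = (\<Sum>k<N. c / pi * Im (of_real (c ^ k / fact k) *
      (exp (\<i> * of_real (pi * (real (k + 1) / \<sigma>))) * of_real (Gamma (real (k + 1) / \<sigma>) / \<sigma> * d powr - (real (k + 1) / \<sigma>)))))"
    by (simp only: Im_sum sum_distrib_left)
  also have "\<dots> = H'_trunc \<sigma> N x" unfolding t H'_trunc_def sum_distrib_left[symmetric] ..
  finally show ?thesis .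
qed

text \<open>Watson's lemma on a horizontal line. On \<open>S\<close> the factor \<open>exp (c e\<^sup>z)\<close> is replaced by its Taylor polynomial.
  Outside \<open>S\<close> the polynomial is kept although the integrand is cut off: there \<open>\<bar>c e\<^sup>z\<bar> \<ge> 1\<close>, so that the polynomial is not larger
  than a multiple of the error term. Therefore the polynomial can be integrated over the whole line in both cases.\<close>
lemma watson_line:
  fixes S :: "real set"
  assumes \<sigma>: "0 < \<sigma>" "\<sigma> < 1" and \<theta>: "pi / 2 < \<sigma> * \<theta>" "\<sigma> * \<theta> < 3 * pi / 2" and b: "b > 0" "cos (\<sigma> * \<theta>) \<le> - b"
    and c: "c > 0" and d: "d > 0" and S: "S \<in> sets lborel"
    and inS: "\<And>u. u \<in> S \<Longrightarrow> max 0 (c * cos \<theta> * exp u) + d * cos (\<sigma> * \<theta>) * exp (\<sigma> * u) \<le> - (b * d * exp (\<sigma> * u))"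
    and notS: "\<And>u. u \<notin> S \<Longrightarrow> 1 \<le> c * exp u"
    and int: "set_integrable lborel S (\<lambda>u. wfun \<sigma> c d 1 (pt u \<theta>))"
  shows "norm ((LINT u:S|lborel. wfun \<sigma> c d 1 (pt u \<theta>)) - (\<Sum>k<N. of_real (c ^ k / fact k) *
      (exp (\<i> * of_real (pi * (real (k + 1) / \<sigma>))) * of_real (Gamma (real (k + 1) / \<sigma>) / \<sigma> * d powr - (real (k + 1) / \<sigma>)))))
     \<le> real (N + 1) * c ^ N * (Gamma (real (N + 1) / \<sigma>) / \<sigma> * (b * d) powr - (real (N + 1) / \<sigma>))"
proof -
  \<comment> \<open>the coefficient of \<open>e\<^sup>\<sigma>\<^sup>u\<close>, written as an exponential so that its principal logarithm is visible\<close>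
  define c' where "c' = exp (pt (ln d) (\<sigma> * \<theta> - pi))"
  have c'eq: "c' = - (of_real d * exp (\<i> * of_real (\<sigma> * \<theta>)))"
    using d by (simp add: c'_def exp_add exp_diff exp_of_real right_diff_distrib)
  have Rec': "Re c' = - (d * cos (\<sigma> * \<theta>))" unfolding c'eq by (simp add: Re_exp)
  have c'pos: "Re c' > 0" using b d by (simp add: Rec' mult_pos_neg)
  have Lnc': "Ln c' = of_real (ln d) + \<i> * of_real (\<sigma> * \<theta> - pi)"
    unfolding c'_def by (rule Ln_exp) (use \<theta> pi_gt_zero in \<open>simp; linarith\<close>)+
  define t where "t = (\<lambda>k u. exp (of_real (real (k + 1) * u) - c' * of_real (exp (\<sigma> * u))) * exp (\<i> * of_real (real (k + 1) * \<theta>)))"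
  have p: "real (k + 1) > 0" for k by simp
  have tint: "complex_integrable lborel (t k)" for k
    unfolding t_def by (intro integrable_mult_left exp_gamma_integrable_complex[OF p \<sigma>(1) c'pos])
  have tval: "(LINT u|lborel. t k u) = exp (\<i> * of_real (pi * (real (k + 1) / \<sigma>))) * of_real (Gamma (real (k + 1) / \<sigma>) / \<sigma> * d powr - (real (k + 1) / \<sigma>))" for k
  proof -
    define q where "q = real (k + 1) / \<sigma>"
    have q: "real (k + 1) = q * \<sigma>" using \<sigma> by (simp add: q_def)
    have dq: "d powr - q = exp (- q * ln d)" using d by (simp add: powr_def)
    have "(LINT u|lborel. t k u) = of_real (Gamma q / \<sigma>) * exp (- of_real q * Ln c') * exp (\<i> * of_real (real (k + 1) * \<theta>))"
      unfolding t_def integral_mult_left_zero exp_gamma_integral_complex[OF p \<sigma>(1) c'pos] q_def ..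
    also have "\<dots> = of_real (Gamma q / \<sigma>) * exp (- of_real q * Ln c' + \<i> * of_real (real (k + 1) * \<theta>))"
      by (simp only: exp_add mult.assoc)
    also have "- of_real q * Ln c' + \<i> * of_real (real (k + 1) * \<theta>) = \<i> * of_real (pi * q) + of_real (- q * ln d)"
      unfolding Lnc' q by (simp add: algebra_simps)
    finally show ?thesis unfolding q_def[symmetric] dq exp_add exp_of_real by (simp add: mult_ac)
  qed
  define f where "f = (\<lambda>u. indicat_real S u *\<^sub>R wfun \<sigma> c d 1 (pt u \<theta>))"
  have fint: "complex_integrable lborel f" using int by (simp only: f_def set_integrable_def)
  define g where "g = (\<lambda>u. f u - (\<Sum>k<N. of_real (c ^ k / fact k) * t k u))"
  have gint: "complex_integrable lborel g"
    unfolding g_def by (intro Bochner_Integration.integrable_diff fint Bochner_Integration.integrable_sum integrable_mult_right tint)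
  have gval: "(LINT u|lborel. g u) = (LINT u:S|lborel. wfun \<sigma> c d 1 (pt u \<theta>)) - (\<Sum>k<N. of_real (c ^ k / fact k) *
      (exp (\<i> * of_real (pi * (real (k + 1) / \<sigma>))) * of_real (Gamma (real (k + 1) / \<sigma>) / \<sigma> * d powr - (real (k + 1) / \<sigma>))))"
  proof -
    have "(LINT u|lborel. g u) = (LINT u|lborel. f u) - (LINT u|lborel. (\<Sum>k<N. of_real (c ^ k / fact k) * t k u))"
      unfolding g_def by (intro Bochner_Integration.integral_diff fint Bochner_Integration.integrable_sum integrable_mult_right tint)
    also have "(LINT u|lborel. (\<Sum>k<N. of_real (c ^ k / fact k) * t k u)) = (\<Sum>k<N. (LINT u|lborel. of_real (c ^ k / fact k) * t k u))"
      by (intro Bochner_Integration.integral_sum integrable_mult_right tint)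
    also have "\<dots> = (\<Sum>k<N. of_real (c ^ k / fact k) * (LINT u|lborel. t k u))" by simp
    finally show ?thesis by (simp only: tval f_def set_lebesgue_integral_def)
  qed
  define h where "h = (\<lambda>u. exp (real (N + 1) * u - (b * d) * exp (\<sigma> * u)))"
  have bd: "b * d > 0" using b d by simp
  have hint: "integrable lborel h" unfolding h_def by (rule exp_gamma_integral_pos(1)[OF p \<sigma>(1) bd])
  have hval: "(LINT u|lborel. h u) = Gamma (real (N + 1) / \<sigma>) / \<sigma> * (b * d) powr - (real (N + 1) / \<sigma>)"
    unfolding h_def by (rule exp_gamma_integral_pos(2)[OF p \<sigma>(1) bd])
  have bound: "norm (g u) \<le> real (N + 1) * c ^ N * h u" for u
  proof -
    define z where "z = of_real u + \<i> * of_real \<theta>"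
    define w where "w = of_real c * exp z"
    define e where "e = exp (of_real d * exp (of_real \<sigma> * z) + z)"
    have zs: "of_real \<sigma> * z = of_real (\<sigma> * u) + \<i> * of_real (\<sigma> * \<theta>)" by (simp add: z_def algebra_simps)
    have nw: "norm w = c * exp u" using c by (simp add: w_def z_def norm_mult)
    have Rew: "Re w = c * cos \<theta> * exp u" by (simp add: w_def z_def Re_exp)
    have ne: "norm e = exp (d * cos (\<sigma> * \<theta>) * exp (\<sigma> * u) + u)"
      unfolding e_def norm_exp_eq_Re zs by (simp add: Re_exp z_def mult_ac)
    have te: "of_real (c ^ k / fact k) * t k u = e * (w ^ k / fact k)" for k
    proof -
      have "t k u = exp ((of_real (real (k + 1) * u) - c' * of_real (exp (\<sigma> * u))) + \<i> * of_real (real (k + 1) * \<theta>))"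
        by (simp only: t_def exp_add)
      also have "(of_real (real (k + 1) * u) - c' * of_real (exp (\<sigma> * u))) + \<i> * of_real (real (k + 1) * \<theta>) =
          (of_real d * exp (of_real \<sigma> * z) + z) + of_nat k * z"
        unfolding c'eq zs exp_add exp_of_real by (simp add: z_def algebra_simps)
      also have "exp \<dots> = e * exp z ^ k" by (simp only: exp_add e_def exp_of_nat_mult)
      finally show ?thesis by (simp add: w_def power_mult_distrib)
    qed
    have hu: "c ^ N * h u = exp (u - (b * d) * exp (\<sigma> * u)) * norm w ^ N"
      by (simp add: h_def nw power_mult_distrib algebra_simps flip: exp_of_nat_mult exp_add)
    have sum: "(\<Sum>k<N. of_real (c ^ k / fact k) * t k u) = e * (\<Sum>k<N. w ^ k / fact k)"
      unfolding te by (simp only: sum_distrib_left)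
    have hnn: "c ^ N * h u \<ge> 0" using c by (simp add: h_def)
    show ?thesis
    proof (cases "u \<in> S")
      case True
      have "f u = e * exp w" using True
        by (simp add: f_def wfun_def e_def w_def z_def[symmetric] flip: exp_add) (simp add: add_ac)
      hence "norm (g u) = norm e * norm (exp w - (\<Sum>k<N. w ^ k / fact k))"
        unfolding g_def sum by (simp only: right_diff_distrib[symmetric] norm_mult)
      also have "\<dots> \<le> norm e * (norm w ^ N * exp (max 0 (Re w)))"
        by (intro mult_left_mono exp_taylor_half_plane) simp
      also have "\<dots> = exp (max 0 (c * cos \<theta> * exp u) + d * cos (\<sigma> * \<theta>) * exp (\<sigma> * u) + u) * norm w ^ N"
        unfolding ne Rew by (simp add: exp_add mult_ac)
      also have "\<dots> \<le> exp (u - (b * d) * exp (\<sigma> * u)) * norm w ^ N"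
        using inS[OF True] by (intro mult_right_mono) simp_all
      also have "\<dots> = 1 * (c ^ N * h u)" by (simp add: hu)
      also have "\<dots> \<le> real (N + 1) * (c ^ N * h u)" using hnn by (intro mult_right_mono) auto
      finally show ?thesis by (simp only: mult.assoc)
    next
      case False
      have w1: "norm w \<ge> 1" using notS[OF False] by (simp add: nw)
      have "norm (\<Sum>k<N. w ^ k / fact k) \<le> (\<Sum>k<N. norm w ^ N)"
      proof (rule sum_norm_le)
        fix k assume k: "k \<in> {..<N}"
        have "norm (w ^ k / fact k) = norm w ^ k / fact k" by (simp add: norm_divide norm_power)
        also have "\<dots> \<le> norm w ^ k / 1" by (intro divide_left_mono) auto
        also have "\<dots> \<le> norm w ^ N" using w1 k by (simp add: power_increasing)
        finally show "norm (w ^ k / fact k) \<le> norm w ^ N" .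
      qed
      also have "\<dots> = real N * norm w ^ N" by simp
      also have "\<dots> \<le> real (N + 1) * norm w ^ N" by (intro mult_right_mono) auto
      finally have n1: "norm (\<Sum>k<N. w ^ k / fact k) \<le> real (N + 1) * norm w ^ N" .
      have n2: "norm e \<le> exp (u - (b * d) * exp (\<sigma> * u))"
      proof -
        have "d * cos (\<sigma> * \<theta>) * exp (\<sigma> * u) \<le> d * (- b) * exp (\<sigma> * u)"
          using b d by (intro mult_right_mono mult_left_mono) auto
        thus ?thesis unfolding ne by (simp add: mult_ac)
      qed
      have "g u = - (e * (\<Sum>k<N. w ^ k / fact k))" using False unfolding g_def sum by (simp add: f_def)
      hence "norm (g u) = norm e * norm (\<Sum>k<N. w ^ k / fact k)" by (simp only: norm_minus_cancel norm_mult)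
      also have "\<dots> \<le> exp (u - (b * d) * exp (\<sigma> * u)) * (real (N + 1) * norm w ^ N)"
        by (rule mult_mono[OF n2 n1]) auto
      also have "\<dots> = real (N + 1) * (c ^ N * h u)" unfolding hu by (simp only: mult_ac)
      finally show ?thesis by (simp only: mult.assoc)
    qed
  qed
  have "norm (LINT u|lborel. g u) \<le> (LINT u|lborel. norm (g u))" by (rule integral_norm_bound)
  also have "\<dots> \<le> (LINT u|lborel. real (N + 1) * c ^ N * h u)"
    by (rule integral_mono[OF integrable_norm[OF gint] integrable_mult_right[OF hint] bound])
  also have "\<dots> = real (N + 1) * c ^ N * (LINT u|lborel. h u)" by (rule integral_mult_right_zero)
  finally show ?thesis unfolding gval hval .
qed

lemma cos_neg_third_quadrant: "pi / 2 < v \<Longrightarrow> v < 3 * pi / 2 \<Longrightarrow> cos v < 0"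
proof -
  assume "pi / 2 < v" "v < 3 * pi / 2"
  hence "cos (v - pi) > 0" by (intro cos_gt_zero_pi) auto
  thus ?thesis by (simp add: cos_diff)
qed

lemma cos_le_third_quadrant: "pi \<le> v \<Longrightarrow> v \<le> w \<Longrightarrow> w \<le> 2 * pi \<Longrightarrow> cos v \<le> cos w"
proof -
  assume "pi \<le> v" "v \<le> w" "w \<le> 2 * pi"
  hence "cos (w - pi) \<le> cos (v - pi)" by (intro cos_monotone_0_pi_le) auto
  thus ?thesis by (simp add: cos_diff)
qed

text \<open>For \<open>\<sigma> > 1/3\<close> the intervals \<open>]\<pi>/2, 3\<pi>/2[\<close> for \<open>\<theta>\<close> and for \<open>\<sigma>\<theta>\<close> have a common solution to the right of
  \<open>\<pi>\<close>. On that line both exponentials decay, and the choice \<open>c = 1\<close> suffices as no saddle is involved.\<close>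
theorem wright_F_negative_algebraic:
  assumes \<sigma>: "1 / 3 < \<sigma>" "\<sigma> < 1"
  shows "\<exists>K. \<forall>x>0. \<bar>wright_F \<sigma> (- x) - H'_trunc \<sigma> N x\<bar> \<le> K * x powr - (real (N + 1) / \<sigma>)"
proof -
  have \<sigma>0: "0 < \<sigma>" using \<sigma> by simp
  \<comment> \<open>any \<open>\<theta>\<close> strictly between \<open>m\<close> and \<open>3\<pi>/2\<close> will do; \<open>\<pi> / (2\<sigma>) < 3\<pi>/2\<close> is the condition \<open>\<sigma> > 1/3\<close>\<close>
  define m where "m = max pi (pi / (2 * \<sigma>))"
  define \<theta> where "\<theta> = (m + 3 * pi / 2) / 2"
  have "1 * pi < (3 * \<sigma>) * pi" by (rule mult_strict_right_mono) (use \<sigma> pi_gt_zero in auto)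
  hence "pi / (2 * \<sigma>) < 3 * pi / 2" using \<sigma>0 by (simp add: field_simps)
  hence m: "m < 3 * pi / 2" using pi_gt_zero by (simp add: m_def max_def)
  have m': "pi \<le> m" "pi / (2 * \<sigma>) \<le> m" by (simp_all add: m_def)
  define q where "q = 3 * pi / 2"
  have q: "pi < q" "m < q" using m pi_gt_zero by (simp_all add: q_def)
  have th1: "pi \<le> \<theta>" and th2: "\<theta> < 3 * pi / 2" and th3: "pi / (2 * \<sigma>) < \<theta>"
    using q m' unfolding \<theta>_def q_def[symmetric] by simp_all
  note th = th1 th2 th3
  have s1: "pi / 2 < \<sigma> * \<theta>" using th(3) \<sigma>0 by (simp add: field_simps)
  have s2: "\<sigma> * \<theta> < 3 * pi / 2"
  proof -
    have "\<sigma> * \<theta> \<le> 1 * \<theta>" using \<sigma> th pi_gt_zero by (intro mult_right_mono) auto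
    thus ?thesis using th(2) by linarith
  qed
  define b where "b = - cos (\<sigma> * \<theta>)"
  have b: "b > 0" "cos (\<sigma> * \<theta>) \<le> - b" using cos_neg_third_quadrant[OF s1 s2] by (auto simp: b_def)
  define k where "k = - cos \<theta>"
  have k: "k > 0" using cos_neg_third_quadrant[of \<theta>] th pi_gt_zero by (simp add: k_def)
  have cosk: "cos v \<le> - k" if "v \<in> {pi..\<theta>}" for v
    unfolding k_def minus_minus by (rule cos_le_third_quadrant) (use that th pi_gt_zero in simp_all)
  define C where "C = real (N + 1) * (Gamma (real (N + 1) / \<sigma>) / \<sigma> * b powr - (real (N + 1) / \<sigma>)) / pi"
  show ?thesis
  proof (rule exI[of _ C], intro allI impI)
    fix x :: real assume x: "x > 0"
    define f where "f = wfun \<sigma> 1 x 1"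
    obtain P where P: "\<And>z. (P has_field_derivative f z) (at z)"
      using entire_primitive[OF wfun_holomorphic] unfolding f_def by blast
    have one: "(1::real) > 0" by simp
    have sc: "- (- x) * 1 powr \<sigma> = x" by simp
    have P': "\<And>z. (P has_field_derivative wfun \<sigma> 1 (- (- x) * 1 powr \<sigma>) 1 z) (at z)" using P unfolding sc f_def .
    obtain L L0 where L: "((\<lambda>u. P (pt u pi)) \<longlongrightarrow> L) at_top"
      "((\<lambda>u. P (pt u pi)) \<longlongrightarrow> L0) at_bot"
      "\<And>a. Im L0 = Im (P (of_real a))"
      "\<And>a. wright_F \<sigma> (- x) = 1 / pi * Im (L - P (of_real a))"
      by (rule wright_F_primitive[OF \<sigma>0 \<sigma>(2) one P'], rule that)
    have R': "((\<lambda>u. P (pt u \<theta>)) \<longlongrightarrow> L) at_top"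
    proof (rule wfun_right_limit[OF \<sigma>0 \<sigma>(2) one P[unfolded f_def], where S = "{pi..\<theta>}" and a = pi and k = k])
      show "filterlim (\<lambda>u::real. u) at_top at_top" by (rule filterlim_ident)
    qed (use th k L cosk in simp_all)
    have L': "((\<lambda>u. P (pt u \<theta>)) \<longlongrightarrow> L0) at_bot"
      by (rule wfun_left_limit[OF \<sigma>0 one one P[unfolded f_def] L(2)])
    have int: "complex_integrable lborel (\<lambda>u. f (pt u \<theta>))"
      unfolding f_def by (rule wfun_integrable[OF \<sigma>0 \<sigma>(2) one one]) (use cos_neg_third_quadrant[of \<theta>] th pi_gt_zero in simp)
    have hol: "f holomorphic_on UNIV" unfolding f_def by (rule wfun_holomorphic)
    have val: "(LINT u|lborel. f (pt u \<theta>)) = L - L0"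
    proof -
      obtain A B where AB: "((\<lambda>u. P (pt u \<theta>)) \<longlongrightarrow> A) at_bot"
        "((\<lambda>u. P (pt u \<theta>)) \<longlongrightarrow> B) at_top"
        "(LINT u|lborel. f (pt u \<theta>)) = B - A"
        by (rule primitive_line_integral[OF P hol int])
      have "A = L0" by (rule tendsto_unique[OF _ AB(1) L']) simp
      moreover have "B = L" by (rule tendsto_unique[OF _ AB(2) R']) simp
      ultimately show ?thesis using AB(3) by simp
    qed
    define D where "D = (\<Sum>k<N. of_real (1 ^ k / fact k) *
      (exp (\<i> * of_real (pi * (real (k + 1) / \<sigma>))) * of_real (Gamma (real (k + 1) / \<sigma>) / \<sigma> * x powr - (real (k + 1) / \<sigma>))))"
    have "norm ((LINT u:UNIV|lborel. f (pt u \<theta>)) - D)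
      \<le> real (N + 1) * 1 ^ N * (Gamma (real (N + 1) / \<sigma>) / \<sigma> * (b * x) powr - (real (N + 1) / \<sigma>))"
      unfolding f_def D_def
    proof (rule watson_line[OF \<sigma>0 \<sigma>(2) s1 s2 b one x])
      show "max 0 (1 * cos \<theta> * exp u) + x * cos (\<sigma> * \<theta>) * exp (\<sigma> * u) \<le> - (b * x * exp (\<sigma> * u))" for u
      proof -
        have "1 * cos \<theta> * exp u \<le> 0" using k by (simp add: k_def mult_nonpos_nonneg)
        thus ?thesis by (simp add: b_def)
      qed
      show "set_integrable lborel UNIV (\<lambda>u. wfun \<sigma> 1 x 1 (pt u \<theta>))"
        using int by (simp add: set_integrable_def f_def)
    qed auto
    hence n: "norm (L - L0 - D) \<le> real (N + 1) * (Gamma (real (N + 1) / \<sigma>) / \<sigma> * (b * x) powr - (real (N + 1) / \<sigma>))"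
      by (simp add: set_lebesgue_integral_def val)
    have HD: "H'_trunc \<sigma> N x = 1 / pi * Im D"
      unfolding D_def by (rule H'_trunc_eq[OF \<sigma>0 \<sigma>(2) one x, symmetric]) simp
    have FL: "wright_F \<sigma> (- x) = 1 / pi * Im (L - L0)" using L(3)[of 0] L(4)[of 0] by simp
    have "\<bar>wright_F \<sigma> (- x) - H'_trunc \<sigma> N x\<bar> = 1 / pi * \<bar>Im (L - L0 - D)\<bar>"
      unfolding HD FL by (simp add: abs_mult flip: right_diff_distrib diff_divide_distrib)
    also have "\<dots> \<le> 1 / pi * (real (N + 1) * (Gamma (real (N + 1) / \<sigma>) / \<sigma> * (b * x) powr - (real (N + 1) / \<sigma>)))"
      using order_trans[OF abs_Im_le_cmod n] by (intro mult_left_mono) auto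
    also have "\<dots> = C * x powr - (real (N + 1) / \<sigma>)" using b x by (simp add: C_def powr_mult mult_ac)
    finally show "\<bar>wright_F \<sigma> (- x) - H'_trunc \<sigma> N x\<bar> \<le> C * x powr - (real (N + 1) / \<sigma>)" .
  qed
qed


section \<open>The exponential expansion on the negative half-axis\<close>

lemma divide_cis_half_square: "a / (cis (- (\<beta> / 2)))\<^sup>2 = a * cis \<beta>"
proof -
  have "real 2 * - (\<beta> / 2) = - \<beta>" by simp
  hence "(cis (- (\<beta> / 2)))\<^sup>2 = inverse (cis \<beta>)" by (simp only: Complex.DeMoivre cis_inverse)
  thus ?thesis by (simp only: divide_inverse inverse_inverse_eq)
qed

text \<open>The height \<open>\<theta> = \<pi> / \<kappa>\<close> satisfies \<open>\<theta> = \<sigma>\<theta> + \<pi>\<close>: both exponentials are rotated by the same angle up to the sign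
  which is missing for \<open>\<xi> < 0\<close>.\<close>
lemma wfun_phase_rotated:
  assumes \<sigma>: "\<sigma> < 1"
  defines "\<theta> \<equiv> pi / (1 - \<sigma>)" and "\<beta> \<equiv> pi * \<sigma> / (1 - \<sigma>)"
  shows "wfun \<sigma> (X * \<sigma> / (1 - \<sigma>)) (X / (1 - \<sigma>)) 1 (z + \<i> * of_real \<theta>)
    = cis \<theta> * exp (of_real X / (cis (- (\<beta> / 2)))\<^sup>2 * phase \<sigma> z + z)"
proof -
  have \<theta>\<beta>: "\<theta> = \<beta> + pi" using \<sigma> by (simp add: \<theta>_def \<beta>_def field_simps)
  have \<sigma>\<theta>: "\<sigma> * \<theta> = \<beta>" by (simp add: \<theta>_def \<beta>_def)
  have e1: "exp (z + \<i> * of_real \<theta>) = - (cis \<beta> * exp z)"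
    by (simp add: exp_add cis_conv_exp \<theta>\<beta> distrib_left)
  have e2: "exp (of_real \<sigma> * (z + \<i> * of_real \<theta>)) = cis \<beta> * exp (of_real \<sigma> * z)"
  proof -
    have "of_real \<sigma> * (z + \<i> * of_real \<theta>) = \<i> * of_real (\<sigma> * \<theta>) + of_real \<sigma> * z" by (simp add: algebra_simps)
    thus ?thesis by (simp only: exp_add cis_conv_exp \<sigma>\<theta>)
  qed
  have m: "of_real X / (cis (- (\<beta> / 2)))\<^sup>2 = of_real X * cis \<beta>"
    by (rule divide_cis_half_square)
  have "of_real (X * \<sigma> / (1 - \<sigma>)) * (- (w * E)) + of_real (X / (1 - \<sigma>)) * (w * S) + of_real 1 * (z + \<i> * of_real \<theta>) =
      \<i> * of_real \<theta> + (of_real X * w * ((S - of_real \<sigma> * E) / of_real (1 - \<sigma>)) + z)" for w E S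
    by (simp add: diff_divide_distrib algebra_simps)
  hence "wfun \<sigma> (X * \<sigma> / (1 - \<sigma>)) (X / (1 - \<sigma>)) 1 (z + \<i> * of_real \<theta>) =
      exp (\<i> * of_real \<theta> + (of_real X * cis \<beta> * phase \<sigma> z + z))"
    unfolding wfun_def e1 e2 phase_def by (simp only:)
  thus ?thesis unfolding m exp_add by (simp only: cis_conv_exp)
qed

lemma rotated_primitive:
  assumes \<sigma>: "\<sigma> < 1" and P: "\<And>z. (P has_field_derivative wfun \<sigma> (X * \<sigma> / (1 - \<sigma>)) (X / (1 - \<sigma>)) 1 z) (at z)"
  shows "((\<lambda>z. P (z + \<i> * of_real (pi / (1 - \<sigma>))) / cis (pi / (1 - \<sigma>))) has_field_derivative
    exp (of_real X / (cis (- (pi * \<sigma> / (1 - \<sigma>) / 2)))\<^sup>2 * phase \<sigma> z + z)) (at z)"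
proof -
  have "((\<lambda>z. P (z + \<i> * of_real (pi / (1 - \<sigma>)))) has_field_derivative
      cis (pi / (1 - \<sigma>)) * exp (of_real X / (cis (- (pi * \<sigma> / (1 - \<sigma>) / 2)))\<^sup>2 * phase \<sigma> z + z)) (at z)"
    using P[of "z + \<i> * of_real (pi / (1 - \<sigma>))"] unfolding wfun_phase_rotated[OF \<sigma>] by (simp only: DERIV_shift)
  from DERIV_cdivide[OF this, of "cis (pi / (1 - \<sigma>))"] show ?thesis
    by (simp only: nonzero_mult_div_cancel_left[OF cis_neq_zero])
qed

text \<open>The saddle contribution with \<open>\<mu> = e\<^sup>-\<^sup>\<i>\<^sup>\<beta>\<^sup>/\<^sup>2\<close> is \<open>E'\<close>: a turn by \<open>\<pi> / 2\<close> changes sine into cosine, and the \<open>j\<close> half-turns between \<open>\<beta> j\<close> and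
  \<open>\<theta> j\<close> account for the sign in \<open>(- X)\<^sup>j\<close>.\<close>
lemma E'_trunc_eq:
  assumes \<sigma>: "0 < \<sigma>" "\<sigma> < 1" and x: "x > 0"
  defines "\<theta> \<equiv> pi / (1 - \<sigma>)" and "\<beta> \<equiv> pi * \<sigma> / (1 - \<sigma>)" and "X \<equiv> bigX \<sigma> x"
  shows "X * \<sigma> / (1 - \<sigma>) / pi * Im (cis \<theta> * (exp (of_real X / (cis (- (\<beta> / 2)))\<^sup>2) *
     (of_real (sqrt (2 * pi / \<sigma>) / sqrt X) * cis (- (\<beta> / 2)) * (\<Sum>j<M. of_real (c_coeff \<sigma> j) / (of_real X / (cis (- (\<beta> / 2)))\<^sup>2) ^ j))))
    = E'_trunc \<sigma> M x"
proof -
  have X: "X > 0" unfolding X_def by (rule bigX_pos[OF \<sigma> x])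
  have \<theta>\<beta>: "\<theta> = \<beta> + pi" using \<sigma> by (simp add: \<theta>_def \<beta>_def field_simps)
  have m: "of_real X / (cis (- (\<beta> / 2)))\<^sup>2 = of_real X * cis \<beta>"
    by (rule divide_cis_half_square)
  have eX: "exp (of_real X * cis \<beta>) = of_real (exp (X * cos \<beta>)) * cis (X * sin \<beta>)"
    by (simp add: complex_eq_iff Re_exp Im_exp)
  have t: "Im (cis \<theta> * (of_real (exp (X * cos \<beta>)) * cis (X * sin \<beta>) *
     (of_real r * cis (- (\<beta> / 2)) * (of_real b / (of_real X * cis \<beta>) ^ j)))) =
     r * exp (X * cos \<beta>) * (b / (- X) ^ j * cos (X * sin \<beta> + \<theta> * (1 / 2 - real j)))" for r b j
  proof -
    have d: "of_real b / (of_real X * cis \<beta>) ^ j = of_real (b / X ^ j) * cis (- (real j * \<beta>))"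
      by (simp add: power_mult_distrib Complex.DeMoivre divide_inverse)
    have ang: "\<theta> + X * sin \<beta> + - (\<beta> / 2) + - (real j * \<beta>) = pi / 2 + (X * sin \<beta> + \<theta> * (1 / 2 - real j)) + real j * pi"
      unfolding \<theta>\<beta> by (simp add: field_simps)
    have "cis \<theta> * (of_real (exp (X * cos \<beta>)) * cis (X * sin \<beta>) * (of_real r * cis (- (\<beta> / 2)) * (of_real b / (of_real X * cis \<beta>) ^ j)))
      = of_real (r * exp (X * cos \<beta>) * (b / X ^ j)) * (cis \<theta> * cis (X * sin \<beta>) * cis (- (\<beta> / 2)) * cis (- (real j * \<beta>)))"
      unfolding d by (simp add: mult_ac)
    also have "cis \<theta> * cis (X * sin \<beta>) * cis (- (\<beta> / 2)) * cis (- (real j * \<beta>)) =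
        cis (pi / 2 + (X * sin \<beta> + \<theta> * (1 / 2 - real j)) + real j * pi)"
      by (simp only: cis_mult ang)
    also have "Im (of_real (r * exp (X * cos \<beta>) * (b / X ^ j)) * \<dots>) =
       r * exp (X * cos \<beta>) * (b / X ^ j) * sin (pi / 2 + (X * sin \<beta> + \<theta> * (1 / 2 - real j)) + real j * pi)"
      by simp
    also have "sin (pi / 2 + (X * sin \<beta> + \<theta> * (1 / 2 - real j)) + real j * pi) = (- 1) ^ j * cos (X * sin \<beta> + \<theta> * (1 / 2 - real j))"
      by (simp only: sin_add[of _ "real j * pi"] sin_npi cos_npi sin_add[of "pi / 2"] sin_pi_half cos_pi_half) simp
    also have "(b / X ^ j) = b / (- X) ^ j * (- 1) ^ j"
      by (cases "even j") simp_all
    finally have "Im (cis \<theta> * (of_real (exp (X * cos \<beta>)) * cis (X * sin \<beta>) * (of_real r * cis (- (\<beta> / 2)) * (of_real b / (of_real X * cis \<beta>) ^ j))))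
      = r * exp (X * cos \<beta>) * (b / (- X) ^ j * (- 1) ^ j) * ((- 1) ^ j * cos (X * sin \<beta> + \<theta> * (1 / 2 - real j)))" .
    also have "\<dots> = r * exp (X * cos \<beta>) * (b / (- X) ^ j * cos (X * sin \<beta> + \<theta> * (1 / 2 - real j))) * ((- 1) ^ j * (- 1) ^ j)"
      by (simp only: mult_ac)
    also have "(- 1 :: real) ^ j * (- 1) ^ j = 1" by (simp flip: power_mult_distrib)
    finally show ?thesis by (simp only: mult_1_right)
  qed
  have Kb: "pi * \<sigma> / kap \<sigma> = \<beta>" "pi / kap \<sigma> = \<theta>" by (simp_all add: kap_def \<theta>_def \<beta>_def)
  have "X * \<sigma> / (1 - \<sigma>) / pi * (sqrt (2 * pi / \<sigma>) / sqrt X) = sqrt (2 * pi / \<sigma>) * \<sigma> / (1 - \<sigma>) / pi * (X / sqrt X)"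
    by (simp add: mult_ac)
  also have "\<dots> = Acon' \<sigma> / pi * X powr (1 / 2)"
    unfolding Acon'_eq[OF \<sigma>] using X by (simp add: powr_half_sqrt real_div_sqrt)
  finally have pref: "X * \<sigma> / (1 - \<sigma>) / pi * (sqrt (2 * pi / \<sigma>) / sqrt X) = Acon' \<sigma> / pi * X powr (1 / 2)" .
  show ?thesis
    unfolding m eX E'_trunc_def X_def[symmetric] Kb pref[symmetric] sum_distrib_left Im_sum t by (simp only: mult.assoc)
qed

text \<open>\<open>R\<close> collects whatever the path contributes besides the saddle. The prefactor \<open>c\<close> costs one power of \<open>X\<close>, which is
  recovered by using one more term of the saddle expansion than the result shows.\<close>
lemma wright_F_negative_assembly:
  fixes S R :: complex
  assumes \<sigma>: "0 < \<sigma>" "\<sigma> < 1" and x: "x > 0"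
  defines "\<theta> \<equiv> pi / (1 - \<sigma>)" and "\<beta> \<equiv> pi * \<sigma> / (1 - \<sigma>)" and "X \<equiv> bigX \<sigma> x"
  assumes X1: "X \<ge> 1"
    and S: "norm (exp (- (of_real X / (cis (- (\<beta> / 2)))\<^sup>2)) * S - of_real (sqrt (2 * pi / \<sigma>) / sqrt X) * cis (- (\<beta> / 2)) *
      (\<Sum>j<Suc M. of_real (c_coeff \<sigma> j) / (of_real X / (cis (- (\<beta> / 2)))\<^sup>2) ^ j)) \<le> C / X ^ Suc M"
    and F: "wright_F \<sigma> (- x) = X * \<sigma> / (1 - \<sigma>) / pi * Im (R + cis \<theta> * S)"
  shows "\<bar>wright_F \<sigma> (- x) - E'_trunc \<sigma> M x - X * \<sigma> / (1 - \<sigma>) / pi * Im R\<bar>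
    \<le> (\<sigma> / (1 - \<sigma>) / pi * \<bar>C\<bar> + Acon' \<sigma> / pi * \<bar>c_coeff \<sigma> M\<bar>) * (X powr (1 / 2 - real M) * exp (X * cos \<beta>))"
proof -
  define c where "c = X * \<sigma> / (1 - \<sigma>)"
  have c: "c \<ge> 0" using X1 \<sigma> by (simp add: c_def)
  define \<nu> where "\<nu> = of_real X / (cis (- (\<beta> / 2)))\<^sup>2"
  define T where "T = of_real (sqrt (2 * pi / \<sigma>) / sqrt X) * cis (- (\<beta> / 2)) * (\<Sum>j<Suc M. of_real (c_coeff \<sigma> j) / \<nu> ^ j)"
  have \<nu>: "\<nu> = of_real X * cis \<beta>" unfolding \<nu>_def by (rule divide_cis_half_square)
  have n\<nu>: "norm (exp \<nu>) = exp (X * cos \<beta>)" by (simp add: \<nu>)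
  have Eq: "E'_trunc \<sigma> (Suc M) x = c / pi * Im (cis \<theta> * (exp \<nu> * T))"
    unfolding c_def \<nu>_def T_def \<theta>_def \<beta>_def X_def by (rule E'_trunc_eq[OF \<sigma> x, symmetric])
  have pw: "X powr (1 / 2 - real M) = X powr (1 / 2) / X ^ M" using X1 by (simp add: powr_diff powr_realpow)
  have Xh: "X powr (1 / 2) \<ge> 1" using X1 by (simp add: ge_one_powr_ge_zero)
  have "wright_F \<sigma> (- x) - E'_trunc \<sigma> (Suc M) x - c / pi * Im R = c / pi * Im (cis \<theta> * (exp \<nu> * (exp (- \<nu>) * S - T)))"
    unfolding F Eq c_def[symmetric] by (simp add: algebra_simps exp_minus)
  hence "\<bar>wright_F \<sigma> (- x) - E'_trunc \<sigma> (Suc M) x - c / pi * Im R\<bar> = c / pi * \<bar>Im (cis \<theta> * (exp \<nu> * (exp (- \<nu>) * S - T)))\<bar>"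
    using c by (simp add: abs_mult)
  also have "\<dots> \<le> c / pi * norm (cis \<theta> * (exp \<nu> * (exp (- \<nu>) * S - T)))"
    by (rule mult_left_mono[OF abs_Im_le_cmod]) (use c in simp)
  also have "\<dots> = c / pi * (exp (X * cos \<beta>) * norm (exp (- \<nu>) * S - T))" by (simp only: norm_mult n\<nu> norm_cis mult_1)
  also have "\<dots> \<le> c / pi * (exp (X * cos \<beta>) * (C / X ^ Suc M))"
    using S c by (intro mult_left_mono) (simp_all add: \<nu>_def T_def)
  also have "\<dots> = \<sigma> / (1 - \<sigma>) / pi * (C * (1 / X ^ M * exp (X * cos \<beta>)))"
    using X1 by (simp add: c_def mult_ac)
  also have "\<dots> \<le> \<sigma> / (1 - \<sigma>) / pi * (\<bar>C\<bar> * (X powr (1 / 2) / X ^ M * exp (X * cos \<beta>)))"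
  proof (rule mult_left_mono)
    have "1 / X ^ M * exp (X * cos \<beta>) \<le> X powr (1 / 2) / X ^ M * exp (X * cos \<beta>)"
      using Xh X1 by (intro mult_right_mono divide_right_mono) auto
    moreover have "C * (1 / X ^ M * exp (X * cos \<beta>)) \<le> \<bar>C\<bar> * (1 / X ^ M * exp (X * cos \<beta>))"
      using X1 by (intro mult_right_mono) auto
    ultimately show "C * (1 / X ^ M * exp (X * cos \<beta>)) \<le> \<bar>C\<bar> * (X powr (1 / 2) / X ^ M * exp (X * cos \<beta>))"
      using mult_left_mono[of "1 / X ^ M * exp (X * cos \<beta>)" _ "\<bar>C\<bar>"] by fastforce
  qed (use \<sigma> in simp)
  finally have A: "\<bar>wright_F \<sigma> (- x) - E'_trunc \<sigma> (Suc M) x - c / pi * Im R\<bar> \<le>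
     \<sigma> / (1 - \<sigma>) / pi * \<bar>C\<bar> * (X powr (1 / 2 - real M) * exp (X * cos \<beta>))"
    unfolding pw by (simp only: mult.assoc)
  have Kb: "pi * \<sigma> / kap \<sigma> = \<beta>" by (simp add: kap_def \<beta>_def)
  have Ac: "Acon' \<sigma> \<ge> 0" using \<sigma> by (simp add: Acon'_eq)
  have "E'_trunc \<sigma> (Suc M) x - E'_trunc \<sigma> M x = Acon' \<sigma> / pi * X powr (1 / 2) * exp (X * cos \<beta>) *
     (c_coeff \<sigma> M / (- X) ^ M * cos (X * sin \<beta> + pi / kap \<sigma> * (1 / 2 - real M)))"
    unfolding E'_trunc_def X_def[symmetric] Kb by (simp add: distrib_left)
  hence "\<bar>E'_trunc \<sigma> (Suc M) x - E'_trunc \<sigma> M x\<bar> = Acon' \<sigma> / pi * X powr (1 / 2) * exp (X * cos \<beta>) *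
     (\<bar>c_coeff \<sigma> M\<bar> / X ^ M * \<bar>cos (X * sin \<beta> + pi / kap \<sigma> * (1 / 2 - real M))\<bar>)"
    using X1 Ac by (simp add: abs_mult power_abs)
  also have "\<dots> \<le> Acon' \<sigma> / pi * X powr (1 / 2) * exp (X * cos \<beta>) * (\<bar>c_coeff \<sigma> M\<bar> / X ^ M * 1)"
    by (intro mult_left_mono mult_nonneg_nonneg divide_nonneg_nonneg) (use Ac X1 in simp_all)
  also have "\<dots> = Acon' \<sigma> / pi * \<bar>c_coeff \<sigma> M\<bar> * (X powr (1 / 2 - real M) * exp (X * cos \<beta>))"
    unfolding pw by (simp add: mult_ac)
  finally have B: "\<bar>E'_trunc \<sigma> (Suc M) x - E'_trunc \<sigma> M x\<bar> \<le> Acon' \<sigma> / pi * \<bar>c_coeff \<sigma> M\<bar> * (X powr (1 / 2 - real M) * exp (X * cos \<beta>))" .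
  have "\<bar>wright_F \<sigma> (- x) - E'_trunc \<sigma> M x - c / pi * Im R\<bar> \<le>
    \<bar>wright_F \<sigma> (- x) - E'_trunc \<sigma> (Suc M) x - c / pi * Im R\<bar> + \<bar>E'_trunc \<sigma> (Suc M) x - E'_trunc \<sigma> M x\<bar>" by linarith
  also note add_mono[OF A B]
  finally show ?thesis unfolding c_def by (simp only: distrib_right)
qed

lemma H'_trunc_bounded: "0 < \<sigma> \<Longrightarrow> \<exists>K. \<forall>x\<ge>1. \<bar>H'_trunc \<sigma> N x\<bar> \<le> K"
proof -
  assume \<sigma>: "0 < \<sigma>"
  have "\<bar>H'_trunc \<sigma> N x\<bar> \<le> 1 / \<sigma> * (\<Sum>k<N. \<bar>rGamma (1 - real (k + 1) / \<sigma>)\<bar>)" if x: "x \<ge> 1" for x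
  proof -
    have "\<bar>\<Sum>k<N. x powr (- (real (k + 1) / \<sigma>)) / fact k * rGamma (1 - real (k + 1) / \<sigma>)\<bar> \<le>
      (\<Sum>k<N. \<bar>x powr (- (real (k + 1) / \<sigma>)) / fact k * rGamma (1 - real (k + 1) / \<sigma>)\<bar>)" by (rule sum_abs)
    also have "\<dots> \<le> (\<Sum>k<N. 1 * \<bar>rGamma (1 - real (k + 1) / \<sigma>)\<bar>)"
    proof (rule sum_mono)
      fix k assume "k \<in> {..<N}"
      have "x powr (- (real (k + 1) / \<sigma>)) \<le> x powr 0" using x \<sigma> by (intro powr_mono) auto
      hence "x powr (- (real (k + 1) / \<sigma>)) / fact k \<le> 1 / 1" using x by (intro frac_le) auto
      thus "\<bar>x powr (- (real (k + 1) / \<sigma>)) / fact k * rGamma (1 - real (k + 1) / \<sigma>)\<bar> \<le> 1 * \<bar>rGamma (1 - real (k + 1) / \<sigma>)\<bar>"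
        unfolding abs_mult by (intro mult_right_mono) auto
    qed
    finally show ?thesis using \<sigma> by (simp add: H'_trunc_def abs_mult divide_right_mono)
  qed
  thus ?thesis by blast
qed


text \<open>To the right of the saddle the phase lies below its tangents, since its derivative \<open>\<sigma> (e\<^sup>\<sigma>\<^sup>u - e\<^sup>u) / \<kappa>\<close> decreases there. A
  linear bound is what the tail estimate needs.\<close>
lemma real_phase_tangent:
  fixes \<delta> u \<sigma> :: real
  assumes \<sigma>: "0 < \<sigma>" "\<sigma> < 1" and u: "0 \<le> \<delta>" "\<delta> \<le> u"
  shows "exp (\<sigma> * u) - \<sigma> * exp u \<le> exp (\<sigma> * \<delta>) - \<sigma> * exp \<delta> - \<sigma> * (exp \<delta> - exp (\<sigma> * \<delta>)) * (u - \<delta>)"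
proof -
  define l where "l = exp \<delta> - exp (\<sigma> * \<delta>)"
  have "exp (\<sigma> * u) - \<sigma> * exp u + \<sigma> * l * u \<le> exp (\<sigma> * \<delta>) - \<sigma> * exp \<delta> + \<sigma> * l * \<delta>"
  proof (rule DERIV_nonpos_imp_nonincreasing[OF u(2)])
    fix v assume v: "\<delta> \<le> v" "v \<le> u"
    have ge: "exp (\<sigma> * \<delta>) * (exp ((1 - \<sigma>) * \<delta>) - 1) \<le> exp (\<sigma> * v) * (exp ((1 - \<sigma>) * v) - 1)"
      using v u \<sigma> by (intro mult_mono) auto
    have sp: "exp (\<sigma> * w) * (exp ((1 - \<sigma>) * w) - 1) = exp w - exp (\<sigma> * w)" for w :: real
    proof -
      have "\<sigma> * w + (1 - \<sigma>) * w = w" by (simp add: algebra_simps)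
      hence "exp (\<sigma> * w) * exp ((1 - \<sigma>) * w) = exp w" by (simp only: exp_add[symmetric])
      thus ?thesis by (simp add: right_diff_distrib)
    qed
    have "l \<le> exp v - exp (\<sigma> * v)" using ge unfolding sp l_def .
    hence "\<sigma> * l \<le> \<sigma> * (exp v - exp (\<sigma> * v))" using \<sigma> by (intro mult_left_mono) auto
    hence le: "\<sigma> * exp (\<sigma> * v) - \<sigma> * exp v + \<sigma> * l \<le> 0" by (simp add: right_diff_distrib)
    have "((\<lambda>u. exp (\<sigma> * u) - \<sigma> * exp u + \<sigma> * l * u) has_real_derivative (\<sigma> * exp (\<sigma> * v) - \<sigma> * exp v + \<sigma> * l)) (at v)"
      by (auto intro!: derivative_eq_intros)
    with le show "\<exists>y. ((\<lambda>u. exp (\<sigma> * u) - \<sigma> * exp u + \<sigma> * l * u) has_real_derivative y) (at v) \<and> y \<le> 0" by blast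
  qed
  moreover have "\<sigma> * l * (u - \<delta>) = \<sigma> * l * u - \<sigma> * l * \<delta>" by (rule right_diff_distrib)
  ultimately show ?thesis unfolding l_def[symmetric] by linarith
qed

lemma real_phase_max_right:
  fixes \<delta> \<sigma> :: real
  assumes \<sigma>: "0 < \<sigma>" "\<sigma> < 1" and u: "0 < \<delta>"
  shows "exp (\<sigma> * \<delta>) - \<sigma> * exp \<delta> < 1 - \<sigma>"
proof -
  have "\<sigma> * (\<delta> / 2) < 1 * (\<delta> / 2)" using \<sigma> u by (intro mult_strict_right_mono) auto
  hence "0 < \<sigma> * (exp (\<delta> / 2) - exp (\<sigma> * (\<delta> / 2))) * (\<delta> - \<delta> / 2)" using \<sigma> u by (intro mult_pos_pos) auto
  with real_phase_tangent[OF \<sigma>, of 0 "\<delta> / 2"] real_phase_tangent[OF \<sigma>, of "\<delta> / 2" \<delta>] u show ?thesis by simp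
qed

lemma real_phase_increasing_left:
  fixes u v \<sigma> :: real
  assumes \<sigma>: "0 < \<sigma>" "\<sigma> < 1" and u: "u < v" "v \<le> 0"
  shows "exp (\<sigma> * u) - \<sigma> * exp u < exp (\<sigma> * v) - \<sigma> * exp v"
proof (rule DERIV_pos_imp_increasing_open[OF u(1)])
  fix w assume w: "u < w" "w < v"
  have "w < \<sigma> * w" using mult_strict_right_mono_neg[of \<sigma> 1 w] w u \<sigma> by simp
  hence "\<sigma> * (exp (\<sigma> * w) - exp w) > 0" using \<sigma> by simp
  moreover have "((\<lambda>u. exp (\<sigma> * u) - \<sigma> * exp u) has_real_derivative \<sigma> * (exp (\<sigma> * w) - exp w)) (at w)"
    by (auto intro!: derivative_eq_intros simp: right_diff_distrib)
  ultimately show "\<exists>y. ((\<lambda>u. exp (\<sigma> * u) - \<sigma> * exp u) has_real_derivative y) (at w) \<and> y > 0" by blast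
qed (intro continuous_intros)

text \<open>For \<open>\<sigma> < 1/3\<close> the height \<open>\<pi> / \<kappa>\<close> is below \<open>3\<pi>/2\<close>, so the line through the rotated saddle is reached without leaving the
  region of convergence. On it the modulus of the integrand is \<open>exp (X cos \<beta> f(u) + u)\<close>, with the maximum of \<open>f\<close> at the saddle.\<close>
theorem wright_F_negative_exponential:
  assumes \<sigma>: "0 < \<sigma>" "\<sigma> < 1 / 3" and a: "is_saddle_series \<sigma> (\<lambda>j. of_real (c_coeff \<sigma> j))"
  shows "\<exists>K X0. \<forall>x>0. bigX \<sigma> x \<ge> X0 \<longrightarrow> \<bar>wright_F \<sigma> (- x) - E'_trunc \<sigma> M x\<bar> \<le>
     K * (bigX \<sigma> x powr (1 / 2 - real M) * exp (bigX \<sigma> x * cos (pi * \<sigma> / (1 - \<sigma>))))"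
proof -
  have \<sigma>1: "\<sigma> < 1" using \<sigma> by simp
  define \<kappa> where "\<kappa> = 1 - \<sigma>"
  have \<kappa>: "\<kappa> > 0" using \<sigma> by (simp add: \<kappa>_def)
  define \<beta> where "\<beta> = pi * \<sigma> / (1 - \<sigma>)"
  define \<theta> where "\<theta> = pi / (1 - \<sigma>)"
  have \<theta>\<beta>: "\<theta> = \<beta> + pi" using \<sigma>1 by (simp add: \<theta>_def \<beta>_def field_simps)
  have \<sigma>\<theta>: "\<sigma> * \<theta> = \<beta>" by (simp add: \<theta>_def \<beta>_def)
  have \<beta>: "0 < \<beta>" "\<beta> < pi / 2"
  proof -
    show "0 < \<beta>" using \<sigma> \<sigma>1 by (simp add: \<beta>_def)
    have "pi * (2 * \<sigma>) < pi * (1 - \<sigma>)" by (rule mult_strict_left_mono) (use \<sigma> in auto)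
    thus "\<beta> < pi / 2" using \<sigma>1 by (simp add: \<beta>_def field_simps)
  qed
  define r where "r = cos \<beta>"
  have r: "r > 0" unfolding r_def by (rule cos_gt_zero_pi) (use \<beta> in linarith)+
  have cos\<theta>: "cos \<theta> = - r" by (simp add: \<theta>\<beta> r_def)
  define \<mu> where "\<mu> = cis (- (\<beta> / 2))"
  have \<mu>2: "1 / \<mu> = cis (\<beta> / 2)" "(1 / \<mu>)\<^sup>2 = cis \<beta>"
  proof -
    show "1 / \<mu> = cis (\<beta> / 2)" by (simp only: \<mu>_def inverse_eq_divide[symmetric] cis_inverse minus_minus)
    show "(1 / \<mu>)\<^sup>2 = cis \<beta>" using divide_cis_half_square[of 1 \<beta>] by (simp only: \<mu>_def power_divide power_one mult_1)
  qed
  have conds: "norm \<mu> = 1" "Re (1 / \<mu>) > 0" "Re ((1 / \<mu>)\<^sup>2) > 0"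
  proof -
    show "norm \<mu> = 1" by (simp add: \<mu>_def)
    have "cos (\<beta> / 2) > 0" by (rule cos_gt_zero_pi) (use \<beta> in linarith)+
    thus "Re (1 / \<mu>) > 0" unfolding \<mu>2(1) by simp
    show "Re ((1 / \<mu>)\<^sup>2) > 0" unfolding \<mu>2(2) using r by (simp add: r_def)
  qed
  from a[unfolded is_saddle_series_def, rule_format, OF conds] obtain \<delta>1 where \<delta>1: "\<delta>1 > 0" and
    sad: "\<And>\<delta> M. 0 < \<delta> \<and> \<delta> < \<delta>1 \<Longrightarrow> \<exists>C. saddle_bound \<sigma> (\<lambda>j. of_real (c_coeff \<sigma> j)) \<mu> 1 \<delta> M C" by blast
  define \<delta> where "\<delta> = \<delta>1 / 2"
  have \<delta>: "0 < \<delta>" "\<delta> < \<delta>1" using \<delta>1 by (auto simp: \<delta>_def)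
  obtain C1 where C1: "saddle_bound \<sigma> (\<lambda>j. of_real (c_coeff \<sigma> j)) \<mu> 1 \<delta> (Suc M) C1"
    using sad[of \<delta> "Suc M"] \<delta> by blast
  define G where "G = (\<lambda>u. exp (\<sigma> * u) - \<sigma> * exp u)"
  \<comment> \<open>at both ends of the segment \<open>\<kappa> f\<close> is strictly below its value \<open>\<kappa>\<close> at the saddle\<close>
  define g where "g = max (G \<delta>) (G (- \<delta>))"
  define \<eta> where "\<eta> = r / \<kappa> * (\<kappa> - g)"
  have gk: "g < \<kappa>" using real_phase_max_right[OF \<sigma>(1) \<sigma>1 \<delta>(1)] real_phase_increasing_left[OF \<sigma>(1) \<sigma>1, of "- \<delta>" 0] \<delta>
    by (simp add: g_def G_def \<kappa>_def)
  have \<eta>: "\<eta> > 0" using gk r \<kappa> by (simp add: \<eta>_def)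
  obtain C2 where C2: "C2 \<ge> 0" "\<And>X. X > 0 \<Longrightarrow> exp (- \<eta> * X) \<le> C2 / X ^ Suc M" by (rule exp_le_inverse_power[OF \<eta>]) blast
  define l where "l = exp \<delta> - exp (\<sigma> * \<delta>)"
  have l: "l > 0"
  proof -
    have "\<sigma> * \<delta> < 1 * \<delta>" using \<sigma>1 \<delta> by (intro mult_strict_right_mono) auto
    thus ?thesis by (simp add: l_def)
  qed
  define X0 where "X0 = max 1 (2 * \<kappa> / (\<sigma> * l * r))"
  define K where "K = (\<sigma> / (1 - \<sigma>) / pi * \<bar>C1\<bar> + Acon' \<sigma> / pi * \<bar>c_coeff \<sigma> M\<bar>) + \<sigma> / \<kappa> / pi * ((exp \<delta> + 1) * C2)"
  show ?thesis unfolding \<beta>_def[symmetric]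
  proof (rule exI[of _ K], rule exI[of _ X0], intro allI impI)
    fix x :: real assume x: "x > 0" and XX: "bigX \<sigma> x \<ge> X0"
    define X where "X = bigX \<sigma> x"
    have X: "X \<ge> 1" "X \<ge> 2 * \<kappa> / (\<sigma> * l * r)" using XX by (auto simp: X0_def X_def)
    have X0: "X > 0" using X by simp
    define c where "c = X * \<sigma> / (1 - \<sigma>)"
    have c: "c > 0" using X \<sigma> by (simp add: c_def)
    define f where "f = wfun \<sigma> c (X / (1 - \<sigma>)) 1"
    obtain P where P: "\<And>z. (P has_field_derivative f z) (at z)"
      using entire_primitive[OF wfun_holomorphic] unfolding f_def by blast
    have sc: "- (- x) * c powr \<sigma> = X / (1 - \<sigma>)" using bigX_scale[OF \<sigma>(1) \<sigma>1 x] by (simp add: c_def X_def)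
    have P': "\<And>z. (P has_field_derivative wfun \<sigma> c (- (- x) * c powr \<sigma>) 1 z) (at z)" using P unfolding sc f_def .
    obtain L L0 where L: "((\<lambda>u. P (pt u pi)) \<longlongrightarrow> L) at_top"
      "((\<lambda>u. P (pt u pi)) \<longlongrightarrow> L0) at_bot"
      "\<And>a. Im L0 = Im (P (of_real a))"
      "\<And>a. wright_F \<sigma> (- x) = c / pi * Im (L - P (of_real a))"
      by (rule wright_F_primitive[OF \<sigma>(1) \<sigma>1 c P'], rule that)
    have FL: "wright_F \<sigma> (- x) = c / pi * Im (L - L0)" using L(3)[of 0] L(4)[of 0] by simp
    have R': "((\<lambda>u. P (pt u \<theta>)) \<longlongrightarrow> L) at_top"
    proof (rule wfun_right_limit[OF \<sigma>(1) \<sigma>1 c P[unfolded f_def], where S = "{pi..\<theta>}" and a = pi and k = r])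
      show "filterlim (\<lambda>u::real. u) at_top at_top" by (rule filterlim_ident)
      show "cos v \<le> - r" if "v \<in> {pi..\<theta>}" for v
        unfolding cos\<theta>[symmetric] by (rule cos_le_third_quadrant) (use that \<beta> \<theta>\<beta> in simp_all)
    qed (use \<beta> \<theta>\<beta> r L in simp_all)
    have L': "((\<lambda>u. P (pt u \<theta>)) \<longlongrightarrow> L0) at_bot"
      by (rule wfun_left_limit[OF \<sigma>(1) c zero_less_one P[unfolded f_def] L(2)])
    have nf: "norm (f (pt u \<theta>)) = exp (X * r / \<kappa> * G u + u)" for u
      unfolding f_def norm_wfun \<sigma>\<theta> cos\<theta> r_def[symmetric] by (simp add: c_def \<kappa>_def[symmetric] G_def right_diff_distrib diff_divide_distrib mult_ac)
    have Xr: "X * r / \<kappa> \<ge> 0" using X0 r \<kappa> by simp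
    have gb: "exp (X * r / \<kappa> * G v) \<le> exp (- \<eta> * X) * exp (X * r)" if "v = \<delta> \<or> v = - \<delta>" for v
    proof -
      have "G v \<le> g" using that by (auto simp: g_def)
      hence "X * r / \<kappa> * G v \<le> X * r / \<kappa> * g" using Xr by (rule mult_left_mono)
      also have "\<dots> = - \<eta> * X + X * r" using \<kappa> by (simp add: \<eta>_def field_simps)
      finally show ?thesis by (simp flip: exp_add)
    qed
    have tail1: "norm (L - P (pt \<delta> \<theta>)) \<le> exp (X * r / \<kappa> * G \<delta> + \<delta>)"
    proof (rule primitive_right_tail_bound[OF P _ R'])
      fix u :: real assume u: "u \<ge> \<delta>"
      have "G u \<le> G \<delta> - \<sigma> * l * (u - \<delta>)" unfolding G_def l_def
        by (rule real_phase_tangent[OF \<sigma>(1) \<sigma>1]) (use \<delta> u in auto)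
      hence "X * r / \<kappa> * G u \<le> X * r / \<kappa> * (G \<delta> - \<sigma> * l * (u - \<delta>))" using Xr by (rule mult_left_mono)
      also have "\<dots> = X * r / \<kappa> * G \<delta> - X * (\<sigma> * l * r / \<kappa>) * (u - \<delta>)" unfolding right_diff_distrib[of _ "G \<delta>"] by (simp only: times_divide_eq_left times_divide_eq_right mult_ac)
      finally have d1: "X * r / \<kappa> * G u \<le> X * r / \<kappa> * G \<delta> - X * (\<sigma> * l * r / \<kappa>) * (u - \<delta>)" .
      have d2: "2 * (u - \<delta>) \<le> X * (\<sigma> * l * r / \<kappa>) * (u - \<delta>)"
      proof (rule mult_right_mono)
        have "2 * \<kappa> / (\<sigma> * l * r) * (\<sigma> * l * r / \<kappa>) \<le> X * (\<sigma> * l * r / \<kappa>)" using X(2) \<sigma> l r \<kappa> by (intro mult_right_mono) auto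
        thus "2 \<le> X * (\<sigma> * l * r / \<kappa>)" using \<sigma> l r \<kappa> by simp
      qed (use u in simp)
      have "X * r / \<kappa> * G u + u \<le> (X * r / \<kappa> * G \<delta> + \<delta>) + - (u - \<delta>)"
      proof -
        have "a + u \<le> (b + \<delta>) + - (u - \<delta>)" if "a \<le> b - y" "2 * (u - \<delta>) \<le> y" for a b y using that by simp
        from this[OF d1 d2] show ?thesis .
      qed
      thus "norm (f (pt u \<theta>)) \<le> exp (X * r / \<kappa> * G \<delta> + \<delta>) * exp (- (u - \<delta>))"
        unfolding nf exp_add[symmetric] exp_le_cancel_iff .
    qed
    have tail2: "norm (P (pt (- \<delta>) \<theta>) - L0) \<le> exp (X * r / \<kappa> * G (- \<delta>) + - \<delta>)"
    proof (rule primitive_left_tail_bound[OF P _ L'])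
      fix u :: real assume u: "u \<le> - \<delta>"
      have "G u \<le> G (- \<delta>)" unfolding G_def using real_phase_increasing_left[OF \<sigma>(1) \<sigma>1, of u "- \<delta>"] u \<delta> by (cases "u = - \<delta>") auto
      hence "X * r / \<kappa> * G u \<le> X * r / \<kappa> * G (- \<delta>)" using Xr by (rule mult_left_mono)
      hence "X * r / \<kappa> * G u + u \<le> (X * r / \<kappa> * G (- \<delta>) + - \<delta>) + (u - - \<delta>)" by simp
      thus "norm (f (pt u \<theta>)) \<le> exp (X * r / \<kappa> * G (- \<delta>) + - \<delta>) * exp (u - - \<delta>)"
        unfolding nf exp_add[symmetric] exp_le_cancel_iff .
    qed
    define R where "R = (L - P (pt \<delta> \<theta>)) + (P (pt (- \<delta>) \<theta>) - L0)"
    have Rb: "norm R \<le> (exp \<delta> + 1) * C2 / X ^ Suc M * exp (X * r)"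
    proof -
      have "norm R \<le> exp (X * r / \<kappa> * G \<delta> + \<delta>) + exp (X * r / \<kappa> * G (- \<delta>) + - \<delta>)"
        unfolding R_def by (rule norm_triangle_le[OF add_mono[OF tail1 tail2]])
      also have "\<dots> = exp (X * r / \<kappa> * G \<delta>) * exp \<delta> + exp (X * r / \<kappa> * G (- \<delta>)) * exp (- \<delta>)" by (simp only: exp_add)
      also have "\<dots> \<le> (exp (- \<eta> * X) * exp (X * r)) * exp \<delta> + (exp (- \<eta> * X) * exp (X * r)) * 1"
        using gb \<delta> by (intro add_mono mult_mono) auto
      also have "\<dots> = ((exp \<delta> + 1) * exp (X * r)) * exp (- \<eta> * X)" by (simp add: algebra_simps)
      also have "\<dots> \<le> ((exp \<delta> + 1) * exp (X * r)) * (C2 / X ^ Suc M)"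
        by (rule mult_left_mono[OF C2(2)[OF X0]]) (simp add: add_nonneg_nonneg)
      also have "\<dots> = (exp \<delta> + 1) * C2 / X ^ Suc M * exp (X * r)" by simp
      finally show ?thesis .
    qed
    define Q where "Q = (\<lambda>z. P (z + \<i> * of_real \<theta>) / cis \<theta>)"
    have Q: "(Q has_field_derivative exp (of_real X / \<mu>\<^sup>2 * phase \<sigma> z + z)) (at z)" for z
      unfolding Q_def \<theta>_def \<mu>_def \<beta>_def by (rule rotated_primitive[OF \<sigma>1 P[unfolded f_def c_def]])
    define S where "S = Q (of_real \<delta> * 1) - Q (- of_real \<delta> * 1)"
    have SP: "cis \<theta> * S = P (pt \<delta> \<theta>) - P (pt (- \<delta>) \<theta>)"
      by (simp add: S_def Q_def right_diff_distrib)
    have F: "wright_F \<sigma> (- x) = X * \<sigma> / (1 - \<sigma>) / pi * Im (R + cis \<theta> * S)"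
      unfolding FL c_def SP R_def by simp
    have Q': "\<forall>z. (Q has_field_derivative exp (of_real X / \<mu>\<^sup>2 * phase \<sigma> z + z)) (at z)" using Q by blast
    have main: "\<bar>wright_F \<sigma> (- x) - E'_trunc \<sigma> M x - X * \<sigma> / (1 - \<sigma>) / pi * Im R\<bar>
      \<le> (\<sigma> / (1 - \<sigma>) / pi * \<bar>C1\<bar> + Acon' \<sigma> / pi * \<bar>c_coeff \<sigma> M\<bar>) * (X powr (1 / 2 - real M) * exp (X * cos \<beta>))"
      unfolding X_def \<beta>_def
      by (rule wright_F_negative_assembly[OF \<sigma>(1) \<sigma>1 x _ C1[THEN spec, THEN spec, THEN mp, THEN mp, OF X(1) Q', folded S_def, unfolded \<mu>_def \<beta>_def X_def] F[unfolded X_def \<theta>_def]])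
         (use X in \<open>simp add: X_def\<close>)
    have Rt: "\<bar>X * \<sigma> / (1 - \<sigma>) / pi * Im R\<bar> \<le> \<sigma> / \<kappa> / pi * ((exp \<delta> + 1) * C2) * (X powr (1 / 2 - real M) * exp (X * r))"
    proof -
      have "\<bar>X * \<sigma> / (1 - \<sigma>) / pi * Im R\<bar> = X * (\<sigma> / \<kappa> / pi) * \<bar>Im R\<bar>" using X0 \<sigma> \<kappa> by (simp add: abs_mult \<kappa>_def)
      also have "\<dots> \<le> X * (\<sigma> / \<kappa> / pi) * ((exp \<delta> + 1) * C2 / X ^ Suc M * exp (X * r))"
        using order_trans[OF abs_Im_le_cmod Rb] X0 \<sigma> \<kappa> by (intro mult_left_mono) auto
      also have "\<dots> = \<sigma> / \<kappa> / pi * ((exp \<delta> + 1) * C2) * (1 / X ^ M * exp (X * r))" using X0 by simp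
      also have "\<dots> \<le> \<sigma> / \<kappa> / pi * ((exp \<delta> + 1) * C2) * (X powr (1 / 2 - real M) * exp (X * r))"
      proof (intro mult_left_mono mult_right_mono)
        have "X powr (1 / 2) \<ge> 1" using X by (simp add: ge_one_powr_ge_zero)
        thus "1 / X ^ M \<le> X powr (1 / 2 - real M)" using X0 by (simp add: powr_diff powr_realpow divide_right_mono)
        show "\<sigma> / \<kappa> / pi * ((exp \<delta> + 1) * C2) \<ge> 0" using \<sigma> \<kappa> C2 by (intro mult_nonneg_nonneg divide_nonneg_nonneg add_nonneg_nonneg) auto
      qed simp
      finally show ?thesis .
    qed
    have "\<bar>wright_F \<sigma> (- x) - E'_trunc \<sigma> M x\<bar> \<le> K * (X powr (1 / 2 - real M) * exp (X * cos \<beta>))"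
      using main Rt unfolding K_def r_def[symmetric] distrib_right[of _ "\<sigma> / \<kappa> / pi * ((exp \<delta> + 1) * C2)"] by linarith
    thus "\<bar>wright_F \<sigma> (- x) - E'_trunc \<sigma> M x\<bar> \<le> K * (bigX \<sigma> x powr (1 / 2 - real M) * exp (bigX \<sigma> x * cos \<beta>))"
      by (simp only: X_def)
  qed
qed


section \<open>The transition value \<open>\<sigma> = 1 / 3\<close>\<close>

text \<open>On the line just below \<open>3\<pi>/2\<close> the exponent at \<open>u = \<delta>\<close> has the sign of the difference of the two sides, which
  vanishes to second order at \<open>\<delta> = 0\<close>. The right-hand side minus the left-hand side has the derivative \<open>k(\<delta>) - k(\<delta>/3)\<close> with \<open>k\<close> increasing.\<close>
lemma third_phase_negative:
  fixes \<delta> :: real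
  assumes \<delta>: "0 < \<delta>" "\<delta> < pi / 2"
  shows "3 * exp (\<delta> / 3) * sin (\<delta> / 3) < exp \<delta> * sin \<delta>"
proof -
  define k where "k = (\<lambda>p::real. exp p * (sin p + cos p))"
  have k: "k p < k q" if "0 \<le> p" "p < q" "q < pi / 2" for p q
  proof (rule DERIV_pos_imp_increasing_open[where f = k, OF that(2)])
    fix v assume v: "p < v" "v < q"
    have "cos v > 0" by (rule cos_gt_zero_pi) (use v that pi_gt_zero in linarith)+
    hence "2 * exp v * cos v > 0" by simp
    moreover have "(k has_real_derivative 2 * exp v * cos v) (at v)"
      unfolding k_def by (auto intro!: derivative_eq_intros simp: algebra_simps)
    ultimately show "\<exists>y. (k has_real_derivative y) (at v) \<and> y > 0" by blast
  qed (unfold k_def, intro continuous_intros)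
  define G where "G = (\<lambda>p::real. exp p * sin p - 3 * exp (p / 3) * sin (p / 3))"
  have "G 0 < G \<delta>"
  proof (rule DERIV_pos_imp_increasing_open[where f = G, OF \<delta>(1)])
    fix v assume v: "0 < v" "v < \<delta>"
    have "k v - k (v / 3) > 0" using k[of "v / 3" v] v \<delta> by simp
    moreover have "(G has_real_derivative (k v - k (v / 3))) (at v)"
      unfolding G_def k_def by (auto intro!: derivative_eq_intros simp: algebra_simps)
    ultimately show "\<exists>y. (G has_real_derivative y) (at v) \<and> y > 0" by blast
  qed (unfold G_def, intro continuous_intros, auto)
  thus ?thesis by (simp add: G_def)
qed

lemma third_phase_tail:
  fixes \<delta> :: real
  assumes \<delta>: "0 < \<delta>" "\<delta> < pi / 2"
  shows "\<exists>l>0. \<forall>u\<ge>\<delta>. l * (u - \<delta>) \<le> exp u * sin \<delta> - 3 * exp (u / 3) * sin (\<delta> / 3) - (exp \<delta> * sin \<delta> - 3 * exp (\<delta> / 3) * sin (\<delta> / 3))"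
proof -
  define l where "l = exp \<delta> * sin \<delta> - exp (\<delta> / 3) * sin (\<delta> / 3)"
  have s: "0 < sin (\<delta> / 3)" "sin (\<delta> / 3) < sin \<delta>"
  proof -
    show "0 < sin (\<delta> / 3)" by (rule sin_gt_zero) (use \<delta> pi_gt_zero in linarith)+
    show "sin (\<delta> / 3) < sin \<delta>" by (rule sin_monotone_2pi) (use \<delta> pi_gt_zero in linarith)+
  qed
  have "exp (\<delta> / 3) * sin (\<delta> / 3) < exp \<delta> * sin \<delta>"
    using \<delta> s by (intro mult_strict_mono) auto
  hence "l > 0" by (simp add: l_def)
  moreover have "l * (u - \<delta>) \<le> exp u * sin \<delta> - 3 * exp (u / 3) * sin (\<delta> / 3) - (exp \<delta> * sin \<delta> - 3 * exp (\<delta> / 3) * sin (\<delta> / 3))" if u: "u \<ge> \<delta>" for u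
  proof -
  define q where "q = (\<lambda>u. exp u * sin \<delta> - 3 * exp (u / 3) * sin (\<delta> / 3) - l * u)"
  have "q \<delta> \<le> q u"
  proof (rule DERIV_nonneg_imp_nondecreasing[OF u])
    fix v assume v: "\<delta> \<le> v" "v \<le> u"
    have f: "exp w * sin \<delta> - exp (w / 3) * sin (\<delta> / 3) = exp (w / 3) * (exp (2 * w / 3) * sin \<delta> - sin (\<delta> / 3))" for w :: real
    proof -
      have "w / 3 + 2 * w / 3 = w" by simp
      hence "exp (w / 3) * exp (2 * w / 3) = exp w" by (simp only: exp_add[symmetric])
      thus ?thesis by (simp add: right_diff_distrib flip: mult.assoc)
    qed
    have "exp (\<delta> / 3) * (exp (2 * \<delta> / 3) * sin \<delta> - sin (\<delta> / 3)) \<le> exp (v / 3) * (exp (2 * v / 3) * sin \<delta> - sin (\<delta> / 3))"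
    proof (rule mult_mono)
      have "1 * sin \<delta> \<le> exp (2 * \<delta> / 3) * sin \<delta>" using \<delta> s by (intro mult_right_mono) auto
      thus "0 \<le> exp (2 * \<delta> / 3) * sin \<delta> - sin (\<delta> / 3)" using s by linarith
      show "exp (2 * \<delta> / 3) * sin \<delta> - sin (\<delta> / 3) \<le> exp (2 * v / 3) * sin \<delta> - sin (\<delta> / 3)"
        using v s by (intro diff_right_mono mult_right_mono) auto
    qed (use v in auto)
    hence "l \<le> exp v * sin \<delta> - exp (v / 3) * sin (\<delta> / 3)" unfolding f l_def .
    hence "0 \<le> exp v * sin \<delta> - exp (v / 3) * sin (\<delta> / 3) - l" by simp
    moreover have "(q has_real_derivative (exp v * sin \<delta> - exp (v / 3) * sin (\<delta> / 3) - l)) (at v)"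
      unfolding q_def by (auto intro!: derivative_eq_intros)
    ultimately show "\<exists>y. (q has_real_derivative y) (at v) \<and> y \<ge> 0" by blast
  qed
  moreover have "l * (u - \<delta>) = l * u - l * \<delta>" by (rule right_diff_distrib)
  ultimately show ?thesis
    unfolding q_def by linarith
  qed
  ultimately show ?thesis by blast
qed

lemma wfun_left_set_integrable:
  assumes \<sigma>: "0 < \<sigma>" and c: "c > 0" and d: "d > 0" and s: "cos (\<sigma> * \<theta>) \<le> 0" and \<delta>: "0 < \<delta>"
  shows "set_integrable lborel {..- \<delta>} (\<lambda>u. wfun \<sigma> c d 1 (pt u \<theta>))"
proof -
  have cont: "continuous_on UNIV (\<lambda>u::real. wfun \<sigma> c d 1 (pt u \<theta>))"
    unfolding wfun_def by (intro continuous_intros)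
  have i: "integrable lborel (\<lambda>u. exp (c + 1) * exp (1 * u - 1 * exp (1 * u)))"
    by (intro integrable_mult_right exp_gamma_integral_pos(1)) auto
  show ?thesis unfolding set_integrable_def
  proof (rule Bochner_Integration.integrable_bound[OF i])
    show "(\<lambda>u. indicat_real {..- \<delta>} u *\<^sub>R wfun \<sigma> c d 1 (pt u \<theta>)) \<in> borel_measurable lborel"
      using borel_measurable_continuous_onI[OF cont] by (intro borel_measurable_scaleR borel_measurable_indicator) simp_all
    show "AE u in lborel. norm (indicat_real {..- \<delta>} u *\<^sub>R wfun \<sigma> c d 1 (pt u \<theta>)) \<le> norm (exp (c + 1) * exp (1 * u - 1 * exp (1 * u)))"
    proof (rule AE_I2)
      fix u :: real
      show "norm (indicat_real {..- \<delta>} u *\<^sub>R wfun \<sigma> c d 1 (pt u \<theta>)) \<le> norm (exp (c + 1) * exp (1 * u - 1 * exp (1 * u)))"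
      proof (cases "u \<le> - \<delta>")
        case True
        have e1: "exp u \<le> 1" using True \<delta> by simp
        have "c * exp u * cos \<theta> \<le> c * exp u * 1" using c by (intro mult_left_mono) auto
        also have "\<dots> \<le> c * 1 * 1" using c e1 by (intro mult_right_mono mult_left_mono) auto
        finally have "c * exp u * cos \<theta> \<le> c" by simp
        moreover have "d * exp (\<sigma> * u) * cos (\<sigma> * \<theta>) \<le> 0" using d s by (intro mult_nonneg_nonpos) auto
        ultimately have "c * exp u * cos \<theta> + d * exp (\<sigma> * u) * cos (\<sigma> * \<theta>) + 1 * u \<le> (c + 1) + (u - exp u)" using e1 by linarith
        hence "norm (wfun \<sigma> c d 1 (pt u \<theta>)) \<le> exp ((c + 1) + (u - exp u))"
          unfolding norm_wfun by (simp only: exp_le_cancel_iff)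
        thus ?thesis using True by (simp add: exp_add)
      qed simp
    qed
  qed
qed

text \<open>Here \<open>\<pi> / \<kappa> = 3\<pi>/2\<close> is the boundary of the region of convergence, and the horizontal line through the saddle is useless
  on both sides. The saddle is crossed in the direction \<open>\<alpha> = 1 - \<i>\<close> of steepest descent instead, from height \<open>3\<pi>/2 + \<delta>\<close> to
  \<open>3\<pi>/2 - \<delta>\<close>. On the incoming half-line \<open>exp (c e\<^sup>z)\<close> grows, but for \<open>u \<le> - \<delta>\<close> it is still
  compensated by the decay of \<open>exp (d e\<^sup>\<sigma>\<^sup>z)\<close>.\<close>
theorem wright_F_negative_third:
  assumes a: "is_saddle_series \<sigma> (\<lambda>j. of_real (c_coeff \<sigma> j))" and \<sigma>: "\<sigma> = 1 / 3"
  shows "\<exists>K X0. \<forall>x>0. bigX \<sigma> x \<ge> X0 \<longrightarrow> \<bar>wright_F \<sigma> (- x) - E'_trunc \<sigma> M x - H'_trunc \<sigma> N x\<bar> \<le>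
     K * (bigX \<sigma> x powr (1 / 2 - real M) * exp (bigX \<sigma> x * cos (pi * \<sigma> / (1 - \<sigma>))) + x powr - (real (N + 1) / \<sigma>))"
proof -
  have \<sigma>0: "0 < \<sigma>" and \<sigma>1: "\<sigma> < 1" using \<sigma> by auto
  define \<theta> where "\<theta> = pi / (1 - \<sigma>)"
  define \<beta> where "\<beta> = pi * \<sigma> / (1 - \<sigma>)"
  have \<theta>: "\<theta> = 3 * pi / 2" by (simp add: \<theta>_def \<sigma>)
  have \<beta>: "\<beta> = pi / 2" by (simp add: \<beta>_def \<sigma>)
  define \<mu> where "\<mu> = cis (- (\<beta> / 2))"
  define \<alpha> where "\<alpha> = 1 - \<i>"
  have am: "\<alpha> / \<mu> = of_real (sqrt 2)"
  proof -
    have m: "inverse \<mu> = cis (pi / 4)" by (simp only: \<mu>_def \<beta> cis_inverse minus_minus) simp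
    have h: "sqrt 2 / 2 + sqrt 2 / 2 = sqrt 2" by simp
    show ?thesis unfolding divide_inverse m \<alpha>_def by (simp add: complex_eq_iff cos_45 sin_45 h)
  qed
  have conds: "norm \<mu> = 1" "Re (\<alpha> / \<mu>) > 0" "Re ((\<alpha> / \<mu>)\<^sup>2) > 0"
    unfolding am by (simp_all add: \<mu>_def flip: of_real_power)
  from a[unfolded is_saddle_series_def, rule_format, OF conds] obtain \<delta>1 where \<delta>1: "\<delta>1 > 0" and
    sad: "\<And>\<delta> M. 0 < \<delta> \<and> \<delta> < \<delta>1 \<Longrightarrow> \<exists>C. saddle_bound \<sigma> (\<lambda>j. of_real (c_coeff \<sigma> j)) \<mu> \<alpha> \<delta> M C" by blast
  define \<delta> where "\<delta> = min (\<delta>1 / 2) 1"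
  have \<delta>: "0 < \<delta>" "\<delta> < \<delta>1" "\<delta> < pi / 2" using \<delta>1 pi_gt3 by (auto simp: \<delta>_def)
  obtain C1 where C1: "saddle_bound \<sigma> (\<lambda>j. of_real (c_coeff \<sigma> j)) \<mu> \<alpha> \<delta> (Suc M) C1"
    using sad[of \<delta> "Suc M"] \<delta> by blast
  have sd: "sin \<delta> > 0" "sin (\<delta> / 3) > 0"
    by (rule sin_gt_zero; use \<delta> pi_gt_zero in linarith)+
  define q where "q = exp \<delta> * sin \<delta> - 3 * exp (\<delta> / 3) * sin (\<delta> / 3)"
  have q: "q > 0" using third_phase_negative[OF \<delta>(1,3)] by (simp add: q_def)
  have "\<exists>l>0. \<forall>u\<ge>\<delta>. l * (u - \<delta>) \<le> exp u * sin \<delta> - 3 * exp (u / 3) * sin (\<delta> / 3) - q"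
    unfolding q_def by (rule third_phase_tail[OF \<delta>(1,3)])
  then obtain l where l: "l > 0" "\<forall>u\<ge>\<delta>. l * (u - \<delta>) \<le> exp u * sin \<delta> - 3 * exp (u / 3) * sin (\<delta> / 3) - q" by blast
  note l = l(1) l(2)[rule_format]
  \<comment> \<open>\<open>b\<close> is the decay rate of the integrand at \<open>u = 0\<close>; it is positive because \<open>sin \<delta> < 3 sin (\<delta>/3)\<close>\<close>
  define b where "b = sin (\<delta> / 3) - sin \<delta> / 3"
  have b: "b > 0"
  proof -
    define y where "y = \<delta> / 3"
    have "sin (y + 2 * y) = sin y * (1 - 2 * (sin y)\<^sup>2) + 2 * sin y * (cos y)\<^sup>2"
      unfolding sin_add cos_double_sin[of y] sin_double[of y] by (simp add: power2_eq_square)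
    also have "\<dots> = 3 * sin y - 4 * sin y ^ 3"
      unfolding cos_squared_eq by (simp add: right_diff_distrib power2_eq_square power3_eq_cube)
    also have "y + 2 * y = \<delta>" by (simp add: y_def)
    finally have "sin \<delta> = 3 * sin (\<delta> / 3) - 4 * sin (\<delta> / 3) ^ 3" by (simp only: y_def)
    hence "b = 4 / 3 * sin (\<delta> / 3) ^ 3" by (simp add: b_def diff_divide_distrib)
    moreover have "sin (\<delta> / 3) ^ 3 > 0" using sd(2) by (rule zero_less_power)
    ultimately show ?thesis by linarith
  qed
  define \<eta> where "\<eta> = q / 2"
  have \<eta>: "\<eta> > 0" using q by (simp add: \<eta>_def)
  obtain C2 where C2: "C2 \<ge> 0" "\<And>X. X > 0 \<Longrightarrow> exp (- \<eta> * X) \<le> C2 / X ^ Suc M" by (rule exp_le_inverse_power[OF \<eta>]) blast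
  \<comment> \<open>\<open>X \<ge> 2 e\<^sup>\<delta>\<close> means \<open>c e\<^sup>u \<ge> 1\<close> for \<open>u \<ge> - \<delta>\<close>\<close>
  define X0 where "X0 = max 1 (max (4 / l) (2 * exp \<delta>))"
  define W where "W = real (N + 1) * (Gamma (real (N + 1) / \<sigma>) / \<sigma> * b powr - (real (N + 1) / \<sigma>)) / pi"
  define K where "K = max ((\<sigma> / (1 - \<sigma>) / pi * \<bar>C1\<bar> + Acon' \<sigma> / pi * \<bar>c_coeff \<sigma> M\<bar>) + 1 / 2 / pi * (C2 * exp \<delta>)) W"
  show ?thesis unfolding \<beta>_def[symmetric]
  proof (rule exI[of _ K], rule exI[of _ X0], intro allI impI)
    fix x :: real assume x: "x > 0" and XX: "bigX \<sigma> x \<ge> X0"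
    define X where "X = bigX \<sigma> x"
    have X: "X \<ge> 1" "X \<ge> 4 / l" "X \<ge> 2 * exp \<delta>" using XX by (auto simp: X0_def X_def)
    have X0: "X > 0" using X by simp
    define c where "c = X * \<sigma> / (1 - \<sigma>)"
    define d where "d = X / (1 - \<sigma>)"
    have c: "c > 0" "c = X / 2" and d: "d > 0" "d = 3 * X / 2" using X0 by (simp_all add: c_def d_def \<sigma>)
    define f where "f = wfun \<sigma> c d 1"
    have hol: "f holomorphic_on UNIV" unfolding f_def by (rule wfun_holomorphic)
    obtain P where P: "\<And>z. (P has_field_derivative f z) (at z)"
      using entire_primitive[OF hol] by blast
    have dx: "d = x * c powr \<sigma>" using bigX_scale[OF \<sigma>0 \<sigma>1 x] by (simp add: c_def d_def X_def)
    have sc: "- (- x) * c powr \<sigma> = d" by (simp add: dx)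
    have P': "\<And>z. (P has_field_derivative wfun \<sigma> c (- (- x) * c powr \<sigma>) 1 z) (at z)" using P unfolding sc f_def .
    obtain L L0 where L: "((\<lambda>u. P (pt u pi)) \<longlongrightarrow> L) at_top"
      "((\<lambda>u. P (pt u pi)) \<longlongrightarrow> L0) at_bot"
      "\<And>a. Im L0 = Im (P (of_real a))"
      "\<And>a. wright_F \<sigma> (- x) = c / pi * Im (L - P (of_real a))"
      by (rule wright_F_primitive[OF \<sigma>0 \<sigma>1 c(1) P'], rule that)
    have FL: "wright_F \<sigma> (- x) = c / pi * Im (L - L0)" using L(3)[of 0] L(4)[of 0] by simp
    have cosm: "cos (\<theta> - \<delta>) = - sin \<delta>" "cos (\<sigma> * (\<theta> - \<delta>)) = sin (\<delta> / 3)"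
      "cos (\<theta> + \<delta>) = sin \<delta>" "cos (\<sigma> * (\<theta> + \<delta>)) = - sin (\<delta> / 3)"
    proof -
      have "\<theta> = 3 / 2 * pi" by (simp add: \<theta>)
      hence "cos \<theta> = 0" "sin \<theta> = - 1" by (simp_all only: cos_3over2_pi sin_3over2_pi)
      thus "cos (\<theta> - \<delta>) = - sin \<delta>" "cos (\<theta> + \<delta>) = sin \<delta>" by (simp_all add: cos_add cos_diff)
      have "\<sigma> * (\<theta> - \<delta>) = pi / 2 - \<delta> / 3" "\<sigma> * (\<theta> + \<delta>) = pi / 2 + \<delta> / 3" by (simp_all add: \<theta> \<sigma> field_simps)
      thus "cos (\<sigma> * (\<theta> - \<delta>)) = sin (\<delta> / 3)" "cos (\<sigma> * (\<theta> + \<delta>)) = - sin (\<delta> / 3)"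
        by (simp_all add: cos_add cos_diff)
    qed
    have thr: "pi \<le> \<theta> - \<delta>" "\<theta> - \<delta> \<le> 2 * pi" using \<delta> by (simp_all add: \<theta>)
    have R': "((\<lambda>u. P (pt u (\<theta> - \<delta>))) \<longlongrightarrow> L) at_top"
    proof (rule wfun_right_limit[OF \<sigma>0 \<sigma>1 c(1) P[unfolded f_def], where S = "{pi..\<theta> - \<delta>}" and a = pi and k = "sin \<delta>"])
      show "filterlim (\<lambda>u::real. u) at_top at_top" by (rule filterlim_ident)
      show "cos v \<le> - sin \<delta>" if "v \<in> {pi..\<theta> - \<delta>}" for v
        unfolding cosm(1)[symmetric] by (rule cos_le_third_quadrant) (use that thr in simp_all)
    qed (use thr sd L in simp_all)
    have L': "((\<lambda>u. P (pt u (\<theta> + \<delta>))) \<longlongrightarrow> L0) at_bot"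
      by (rule wfun_left_limit[OF \<sigma>0 c(1) zero_less_one P[unfolded f_def] L(2)])
    have nf: "norm (f (pt u (\<theta> - \<delta>))) = exp (- (X / 2) * (exp u * sin \<delta> - 3 * exp (u / 3) * sin (\<delta> / 3)) + u)" for u
      unfolding f_def norm_wfun cosm c(2) d(2) by (simp add: \<sigma> algebra_simps)
    have tail1: "norm (L - P (pt \<delta> (\<theta> - \<delta>))) \<le> exp (- \<eta> * X + \<delta>)"
    proof (rule primitive_right_tail_bound[OF P _ R'])
      fix u :: real assume u: "u \<ge> \<delta>"
      define Y where "Y = exp u * sin \<delta> - 3 * exp (u / 3) * sin (\<delta> / 3)"
      have "X / 2 * (l * (u - \<delta>) + q) \<le> X / 2 * Y" using l(2)[OF u] X0 by (intro mult_left_mono) (simp_all add: Y_def)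
      moreover have "X / 2 * (l * (u - \<delta>) + q) = (X * l / 2) * (u - \<delta>) + \<eta> * X" by (simp add: \<eta>_def distrib_left mult_ac)
      moreover have "2 * (u - \<delta>) \<le> (X * l / 2) * (u - \<delta>)"
      proof (rule mult_right_mono)
        have "4 / l * l \<le> X * l" using X(2) l(1) by (intro mult_right_mono) auto
        thus "2 \<le> X * l / 2" using l(1) by simp
      qed (use u in simp)
      ultimately have le: "(X * l / 2) * (u - \<delta>) + \<eta> * X \<le> X / 2 * Y" "2 * (u - \<delta>) \<le> (X * l / 2) * (u - \<delta>)" by simp_all
      have "- A + u \<le> (- B + \<delta>) + - (u - \<delta>)" if "D + B \<le> A" "2 * (u - \<delta>) \<le> D" for A B D using that by simp
      from this[OF le] have "- (X / 2 * Y) + u \<le> (- (\<eta> * X) + \<delta>) + - (u - \<delta>)" .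
      hence "- (X / 2) * Y + u \<le> (- \<eta> * X + \<delta>) + - (u - \<delta>)" by (simp only: mult_minus_left)
      thus "norm (f (pt u (\<theta> - \<delta>))) \<le> exp (- \<eta> * X + \<delta>) * exp (- (u - \<delta>))"
        unfolding nf exp_add[symmetric] exp_le_cancel_iff Y_def .
    qed
    have sint: "set_integrable lborel {..- \<delta>} (\<lambda>u. f (pt u (\<theta> + \<delta>)))"
      unfolding f_def by (rule wfun_left_set_integrable[OF \<sigma>0 c(1) d(1) _ \<delta>(1)]) (use cosm sd in simp)
    have val: "(LINT u:{..- \<delta>}|lborel. f (pt u (\<theta> + \<delta>))) = P (pt (- \<delta>) (\<theta> + \<delta>)) - L0"
    proof -
      have "L0 = P (pt (- \<delta>) (\<theta> + \<delta>)) - (LINT u:{..- \<delta>}|lborel. f (pt u (\<theta> + \<delta>)))"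
        by (rule tendsto_unique[OF _ L' primitive_tail_left[OF P hol sint]]) simp
      thus ?thesis by simp
    qed
    define D where "D = (\<Sum>k<N. of_real (c ^ k / fact k) *
      (exp (\<i> * of_real (pi * (real (k + 1) / \<sigma>))) * of_real (Gamma (real (k + 1) / \<sigma>) / \<sigma> * d powr - (real (k + 1) / \<sigma>))))"
    have Hn: "norm ((LINT u:{..- \<delta>}|lborel. f (pt u (\<theta> + \<delta>))) - D)
      \<le> real (N + 1) * c ^ N * (Gamma (real (N + 1) / \<sigma>) / \<sigma> * (b * d) powr - (real (N + 1) / \<sigma>))"
      unfolding f_def D_def
    proof (rule watson_line[OF \<sigma>0 \<sigma>1 _ _ b _ c(1) d(1)])
      show "pi / 2 < \<sigma> * (\<theta> + \<delta>)" "\<sigma> * (\<theta> + \<delta>) < 3 * pi / 2" using \<delta> by (simp_all add: \<sigma> \<theta>)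
      show "cos (\<sigma> * (\<theta> + \<delta>)) \<le> - b" using sd by (simp add: cosm b_def)
      show "max 0 (c * cos (\<theta> + \<delta>) * exp u) + d * cos (\<sigma> * (\<theta> + \<delta>)) * exp (\<sigma> * u) \<le> - (b * d * exp (\<sigma> * u))" if "u \<in> {..- \<delta>}" for u
      proof -
        have "exp u \<le> exp (\<sigma> * u)" using that \<delta> \<sigma> by simp
        hence "c * sin \<delta> * exp u \<le> c * sin \<delta> * exp (\<sigma> * u)" using c sd by (intro mult_left_mono) auto
        moreover have "c * sin \<delta> * exp u \<ge> 0" using c sd by simp
        moreover have "c * sin \<delta> * E + d * (- sin (\<delta> / 3)) * E = - (b * d * E)" for E
          unfolding c(2) d(2) b_def by (simp add: algebra_simps)
        ultimately have le: "c * sin \<delta> * exp u \<le> c * sin \<delta> * exp (\<sigma> * u)" and mx: "max 0 (c * sin \<delta> * exp u) = c * sin \<delta> * exp u"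
          and eq: "c * sin \<delta> * exp (\<sigma> * u) + d * (- sin (\<delta> / 3)) * exp (\<sigma> * u) = - (b * d * exp (\<sigma> * u))" by (auto simp only: max_absorb2)
        show ?thesis unfolding cosm mx eq[symmetric] by (rule add_right_mono[OF le])
      qed
      show "1 \<le> c * exp u" if "u \<notin> {..- \<delta>}" for u
      proof -
        have "exp \<delta> * exp (- \<delta>) \<le> c * exp u" using that X(3) c by (intro mult_mono) auto
        thus ?thesis by (simp flip: exp_add)
      qed
      show "set_integrable lborel {..- \<delta>} (\<lambda>u. wfun \<sigma> c d 1 (pt u (\<theta> + \<delta>)))"
        using sint unfolding f_def .
    qed simp
    define R1 where "R1 = L - P (pt \<delta> (\<theta> - \<delta>))"
    define R2 where "R2 = P (pt (- \<delta>) (\<theta> + \<delta>)) - L0"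
    have R1: "norm R1 \<le> exp \<delta> * (C2 / X ^ Suc M)"
    proof -
      have "exp (- \<eta> * X + \<delta>) = exp \<delta> * exp (- \<eta> * X)" by (simp only: exp_add mult.commute)
      also have "\<dots> \<le> exp \<delta> * (C2 / X ^ Suc M)" by (rule mult_left_mono[OF C2(2)[OF X0]]) simp
      finally show ?thesis using tail1 unfolding R1_def by linarith
    qed
    have HD: "H'_trunc \<sigma> N x = c / pi * Im D"
      unfolding D_def by (rule H'_trunc_eq[OF \<sigma>0 \<sigma>1 c(1) x dx, symmetric])
    have R2: "\<bar>c / pi * Im R2 - H'_trunc \<sigma> N x\<bar> \<le> W * x powr - (real (N + 1) / \<sigma>)"
    proof -
      define p where "p = real (N + 1) / \<sigma>"
      have sp: "\<sigma> * p = real (N + 1)" using \<sigma>0 by (simp add: p_def)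
      have "\<bar>c / pi * Im R2 - H'_trunc \<sigma> N x\<bar> = c / pi * \<bar>Im (R2 - D)\<bar>"
        unfolding HD using c by (simp add: abs_mult flip: right_diff_distrib diff_divide_distrib)
      also have "\<dots> \<le> c / pi * (real (N + 1) * c ^ N * (Gamma p / \<sigma> * (b * d) powr - p))"
        using order_trans[OF abs_Im_le_cmod Hn] c unfolding val R2_def[symmetric] p_def[symmetric] by (intro mult_left_mono) auto
      also have "(b * d) powr - p = b powr - p * (x powr - p * (c powr \<sigma>) powr - p)" using b x c by (simp add: dx powr_mult)
      also have "(c powr \<sigma>) powr - p = c powr - real (N + 1)" by (simp only: powr_powr mult_minus_right sp)
      also have "\<dots> = 1 / (c * c ^ N)" using c(1) by (simp only: powr_minus powr_realpow power_Suc Suc_eq_plus1[symmetric] inverse_eq_divide)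
      also have "c / pi * (real (N + 1) * c ^ N * (Gamma p / \<sigma> * (b powr - p * (x powr - p * (1 / (c * c ^ N)))))) = W * x powr - p"
        unfolding W_def p_def[symmetric] using c(1) by (simp add: mult_ac)
      finally show ?thesis unfolding p_def .
    qed
    define Q where "Q = (\<lambda>z. P (z + \<i> * of_real \<theta>) / cis \<theta>)"
    have Q: "(Q has_field_derivative exp (of_real X / \<mu>\<^sup>2 * phase \<sigma> z + z)) (at z)" for z
      unfolding Q_def \<theta>_def \<mu>_def \<beta>_def by (rule rotated_primitive[OF \<sigma>1 P[unfolded f_def c_def d_def]])
    define S where "S = Q (of_real \<delta> * \<alpha>) - Q (- of_real \<delta> * \<alpha>)"
    have SP: "cis \<theta> * S = P (pt \<delta> (\<theta> - \<delta>)) - P (pt (- \<delta>) (\<theta> + \<delta>))"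
    proof -
      have e: "of_real \<delta> * \<alpha> + \<i> * of_real \<theta> = of_real \<delta> + \<i> * of_real (\<theta> - \<delta>)"
        "- of_real \<delta> * \<alpha> + \<i> * of_real \<theta> = of_real (- \<delta>) + \<i> * of_real (\<theta> + \<delta>)" by (simp_all add: \<alpha>_def algebra_simps)
      show ?thesis unfolding S_def Q_def e by (simp add: right_diff_distrib)
    qed
    have F: "wright_F \<sigma> (- x) = X * \<sigma> / (1 - \<sigma>) / pi * Im ((R1 + R2) + cis \<theta> * S)"
      unfolding FL c_def SP R1_def R2_def by simp
    have Q': "\<forall>z. (Q has_field_derivative exp (of_real X / \<mu>\<^sup>2 * phase \<sigma> z + z)) (at z)" using Q by blast
    define Z where "Z = X powr (1 / 2 - real M) * exp (X * cos \<beta>)"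
    have main: "\<bar>wright_F \<sigma> (- x) - E'_trunc \<sigma> M x - X * \<sigma> / (1 - \<sigma>) / pi * Im (R1 + R2)\<bar>
      \<le> (\<sigma> / (1 - \<sigma>) / pi * \<bar>C1\<bar> + Acon' \<sigma> / pi * \<bar>c_coeff \<sigma> M\<bar>) * Z"
      unfolding X_def \<beta>_def Z_def
      by (rule wright_F_negative_assembly[OF \<sigma>0 \<sigma>1 x _ C1[THEN spec, THEN spec, THEN mp, THEN mp, OF X(1) Q', folded S_def, unfolded \<mu>_def \<beta>_def X_def] F[unfolded X_def \<theta>_def]])
         (use X in \<open>simp add: X_def\<close>)
    have Rt: "\<bar>c / pi * Im R1\<bar> \<le> 1 / 2 / pi * (C2 * exp \<delta>) * Z"
    proof -
      have "\<bar>c / pi * Im R1\<bar> = c / pi * \<bar>Im R1\<bar>" using c by (simp add: abs_mult)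
      also have "\<dots> \<le> c / pi * (exp \<delta> * (C2 / X ^ Suc M))"
        using order_trans[OF abs_Im_le_cmod R1] c by (intro mult_left_mono) auto
      also have "\<dots> = 1 / 2 / pi * (C2 * exp \<delta>) * (1 / X ^ M)" unfolding c(2) using X0 by (simp add: mult_ac)
      also have "\<dots> \<le> 1 / 2 / pi * (C2 * exp \<delta>) * Z"
      proof (intro mult_left_mono)
        have "X powr (1 / 2) \<ge> 1" using X by (simp add: ge_one_powr_ge_zero)
        thus "1 / X ^ M \<le> Z" using X0 by (simp add: Z_def \<beta> powr_diff powr_realpow divide_right_mono)
      qed (use C2 in simp)
      finally show ?thesis .
    qed
    have Znn: "Z \<ge> 0" by (simp add: Z_def)
    have Imadd: "X * \<sigma> / (1 - \<sigma>) / pi * Im (R1 + R2) = c / pi * Im R1 + c / pi * Im R2" by (simp add: c_def distrib_left)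
    define K1 where "K1 = (\<sigma> / (1 - \<sigma>) / pi * \<bar>C1\<bar> + Acon' \<sigma> / pi * \<bar>c_coeff \<sigma> M\<bar>) + 1 / 2 / pi * (C2 * exp \<delta>)"
    have "\<bar>wright_F \<sigma> (- x) - E'_trunc \<sigma> M x - H'_trunc \<sigma> N x\<bar> \<le> K1 * Z + W * x powr - (real (N + 1) / \<sigma>)"
    proof -
      have "\<bar>F - E - h\<bar> \<le> u1 + u2 + u3" if "\<bar>F - E - (a + b)\<bar> \<le> u1" "\<bar>a\<bar> \<le> u2" "\<bar>b - h\<bar> \<le> u3" for F E h a b u1 u2 u3 :: real
        using that by linarith
      from this[OF main[unfolded Imadd] Rt R2] show ?thesis
        unfolding K1_def distrib_right[of _ "1 / 2 / pi * (C2 * exp \<delta>)"] .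
    qed
    also have "\<dots> \<le> K * Z + K * x powr - (real (N + 1) / \<sigma>)"
      using Znn by (intro add_mono mult_right_mono) (simp_all add: K_def K1_def)
    finally show "\<bar>wright_F \<sigma> (- x) - E'_trunc \<sigma> M x - H'_trunc \<sigma> N x\<bar> \<le>
       K * (bigX \<sigma> x powr (1 / 2 - real M) * exp (bigX \<sigma> x * cos \<beta>) + x powr - (real (N + 1) / \<sigma>))"
      by (simp only: X_def Z_def distrib_left)
  qed
qed


section \<open>The Mellin transform of the saddle point expansion\<close>

lemma wright_ray_standard: "0 < \<sigma> \<Longrightarrow> \<sigma> < 1 \<Longrightarrow> wright_ray \<sigma> (pi / (1 + \<sigma>))"
  unfolding wright_ray_def using pi_gt_zero by (auto simp: field_simps)

text \<open>For the Mellin transform the expansion is needed on the whole half-axis. For small \<open>X\<close> it holds trivially: \<open>F\<^sub>\<sigma>\<close> is bounded and the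
  error term \<open>X\<^sup>1\<^sup>/\<^sup>2\<^sup>-\<^sup>M\<close> dominates all terms of the sum.\<close>
theorem wright_F_positive_uniform:
  assumes \<sigma>: "0 < \<sigma>" "\<sigma> < 1" and a: "is_saddle_series \<sigma> a" and M: "M \<ge> 1"
  shows "\<exists>C. \<forall>x>0. norm (of_real (wright_F \<sigma> x) - of_real (Acon' \<sigma> / (2 * pi) * sqrt (bigX \<sigma> x) * exp (- bigX \<sigma> x)) * (\<Sum>j<M. a j / (- of_real (bigX \<sigma> x)) ^ j))
       \<le> C * (sqrt (bigX \<sigma> x) * exp (- bigX \<sigma> x) / bigX \<sigma> x ^ M)"
proof -
  obtain C1 X0 where X0: "X0 \<ge> 1" and C1: "\<forall>x>0. bigX \<sigma> x \<ge> X0 \<longrightarrow>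
     norm (of_real (wright_F \<sigma> x) - of_real (Acon' \<sigma> / (2 * pi) * sqrt (bigX \<sigma> x) * exp (- bigX \<sigma> x)) * (\<Sum>j<M. a j / (- of_real (bigX \<sigma> x)) ^ j))
       \<le> C1 * (sqrt (bigX \<sigma> x) * exp (- bigX \<sigma> x) / bigX \<sigma> x ^ M)"
    using wright_F_positive[OF \<sigma> a, of M] by blast
  have "\<exists>C0. \<forall>x\<ge>0. \<bar>wright_F \<sigma> x\<bar> \<le> C0"
    by (rule wright_ray.wright_F_bounded[OF wright_ray_standard[OF \<sigma>]]) blast
  then obtain C0 where "\<forall>x\<ge>0. \<bar>wright_F \<sigma> x\<bar> \<le> C0" ..
  hence C0: "\<And>x. x \<ge> 0 \<Longrightarrow> \<bar>wright_F \<sigma> x\<bar> \<le> C0" by blast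
  have C0nn: "C0 \<ge> 0" using C0[of 0] by simp
  define A where "A = Acon' \<sigma> / (2 * pi)"
  have A: "A \<ge> 0" using \<sigma> by (simp add: A_def Acon'_eq)
  define B where "B = (\<Sum>j<M. norm (a j))"
  have B: "B \<ge> 0" by (simp add: B_def sum_nonneg)
  define C where "C = \<bar>C1\<bar> + (C0 * exp X0 * X0 ^ M + A * B * X0 ^ M)"
  show ?thesis
  proof (rule exI[of _ C], intro allI impI)
    fix x :: real assume x: "x > 0"
    define X where "X = bigX \<sigma> x"
    have X: "X > 0" unfolding X_def by (rule bigX_pos[OF \<sigma> x])
    define r where "r = sqrt X * exp (- X) / X ^ M"
    have r: "r \<ge> 0" using X by (simp add: r_def)
    have "norm (of_real (wright_F \<sigma> x) - of_real (A * sqrt X * exp (- X)) * (\<Sum>j<M. a j / (- of_real X) ^ j)) \<le> C * r"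
    proof (cases "X \<ge> X0")
      case True
      have "norm (of_real (wright_F \<sigma> x) - of_real (A * sqrt X * exp (- X)) * (\<Sum>j<M. a j / (- of_real X) ^ j)) \<le> C1 * r"
        using C1[rule_format, OF x] True unfolding A_def r_def X_def by blast
      also have "\<dots> \<le> C * r"
      proof (rule mult_right_mono[OF _ r])
        have "0 \<le> C0 * exp X0 * X0 ^ M + A * B * X0 ^ M"
          by (intro add_nonneg_nonneg mult_nonneg_nonneg) (use C0nn A B X0 in simp_all)
        thus "C1 \<le> C" unfolding C_def by simp
      qed
      finally show ?thesis .
    next
      case False
      have Xle: "X \<le> X0" using False by simp
      \<comment> \<open>for \<open>X \<le> 1\<close> this needs \<open>M \<ge> 1\<close>\<close>
      have pw: "X ^ M \<le> sqrt X * X0 ^ M"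
      proof (cases "X \<le> 1")
        case True
        have "X ^ M \<le> X ^ 1" using True X M by (intro power_decreasing) auto
        also have "X ^ 1 = sqrt X * sqrt X" using X by simp
        also have "sqrt X * sqrt X \<le> sqrt X * X0 ^ M"
        proof (rule mult_left_mono)
          have "sqrt X \<le> 1" using True by simp
          also have "1 \<le> X0 ^ M" using X0 by (rule one_le_power)
          finally show "sqrt X \<le> X0 ^ M" .
        qed (use X in simp)
        finally show ?thesis .
      next
        case False
        have "1 * X ^ M \<le> sqrt X * X0 ^ M" using False X Xle by (intro mult_mono power_mono) auto
        thus ?thesis by simp
      qed
      have n1: "norm (complex_of_real (wright_F \<sigma> x)) \<le> C0 * exp X0 * X0 ^ M * r"
      proof -
        have "exp (- X0) \<le> exp (- X)" using Xle by simp
        hence "exp (- X0) * X ^ M \<le> exp (- X) * (sqrt X * X0 ^ M)" using pw X by (intro mult_mono) auto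
        hence "exp X0 * (exp (- X0) * X ^ M) \<le> exp X0 * (exp (- X) * (sqrt X * X0 ^ M))" by (rule mult_left_mono) simp
        moreover have "exp X0 * exp (- X0) = 1" by (simp flip: exp_add)
        ultimately have "1 * X ^ M \<le> exp X0 * (exp (- X) * (sqrt X * X0 ^ M))" by (simp only: mult.assoc[symmetric])
        hence "1 * X ^ M / X ^ M \<le> exp X0 * (exp (- X) * (sqrt X * X0 ^ M)) / X ^ M" by (rule divide_right_mono) (use X in simp)
        hence "1 \<le> exp X0 * (exp (- X) * (sqrt X * X0 ^ M)) / X ^ M" using X by simp
        also have "\<dots> = exp X0 * X0 ^ M * r" by (simp only: r_def times_divide_eq_left times_divide_eq_right mult_ac)
        finally have "1 \<le> exp X0 * X0 ^ M * r" .
        from mult_left_mono[OF this C0nn] C0[of x] x show ?thesis by simp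
      qed
      have n2: "norm (of_real (A * sqrt X * exp (- X)) * (\<Sum>j<M. a j / (- of_real X) ^ j)) \<le> A * B * X0 ^ M * r"
      proof -
        have "norm (\<Sum>j<M. a j / (- of_real X) ^ j) \<le> (\<Sum>j<M. norm (a j) * (X0 ^ M / X ^ M))"
        proof (rule sum_norm_le)
          fix j assume j: "j \<in> {..<M}"
          have "X ^ (M - j) \<le> X0 ^ (M - j)" using X Xle by (intro power_mono) auto
          also have "\<dots> \<le> X0 ^ M" using X0 by (intro power_increasing) auto
          finally have "X ^ j * X ^ (M - j) \<le> X ^ j * X0 ^ M" using X by (intro mult_left_mono) auto
          hence "X ^ M \<le> X ^ j * X0 ^ M" using j by (simp flip: power_add)
          hence "1 / X ^ j \<le> X0 ^ M / X ^ M" using X by (simp add: field_simps)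
          hence "norm (a j) * (1 / X ^ j) \<le> norm (a j) * (X0 ^ M / X ^ M)" by (intro mult_left_mono) auto
          thus "norm (a j / (- of_real X) ^ j) \<le> norm (a j) * (X0 ^ M / X ^ M)"
            using X by (simp add: norm_divide norm_power)
        qed
        also have "\<dots> = B * (X0 ^ M / X ^ M)" by (simp only: B_def sum_distrib_right)
        finally have "norm (\<Sum>j<M. a j / (- of_real X) ^ j) \<le> B * (X0 ^ M / X ^ M)" .
        hence "A * sqrt X * exp (- X) * norm (\<Sum>j<M. a j / (- of_real X) ^ j) \<le> A * sqrt X * exp (- X) * (B * (X0 ^ M / X ^ M))"
          using A X by (intro mult_left_mono) auto
        also have "\<dots> = A * B * X0 ^ M * r" by (simp add: r_def)
        finally show ?thesis using A X by (simp add: norm_mult abs_mult)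
      qed
      have "norm (of_real (wright_F \<sigma> x) - of_real (A * sqrt X * exp (- X)) * (\<Sum>j<M. a j / (- of_real X) ^ j)) \<le>
          C0 * exp X0 * X0 ^ M * r + A * B * X0 ^ M * r"
        by (rule order_trans[OF norm_triangle_ineq4 add_mono[OF n1 n2]])
      also have "\<dots> = (C0 * exp X0 * X0 ^ M + A * B * X0 ^ M) * r" by (simp only: distrib_right)
      also have "\<dots> \<le> C * r" using r by (intro mult_right_mono) (simp_all add: C_def)
      finally show ?thesis .
    qed
    thus "norm (of_real (wright_F \<sigma> x) - of_real (Acon' \<sigma> / (2 * pi) * sqrt (bigX \<sigma> x) * exp (- bigX \<sigma> x)) * (\<Sum>j<M. a j / (- of_real (bigX \<sigma> x)) ^ j))
       \<le> C * (sqrt (bigX \<sigma> x) * exp (- bigX \<sigma> x) / bigX \<sigma> x ^ M)"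
      by (simp only: A_def r_def X_def)
  qed
qed

text \<open>In logarithmic coordinates \<open>X\<close> is an exponential, and each term of the expansion is an Euler integral.\<close>
lemma bigX_mellin:
  fixes \<sigma> s :: real
  assumes \<sigma>: "0 < \<sigma>" "\<sigma> < 1" and p: "(1 - \<sigma>) * s + 1 / 2 - real j > 0"
  defines "B \<equiv> (1 - \<sigma>) * (\<sigma> powr \<sigma>) powr (1 / (1 - \<sigma>))"
  shows "integrable lborel (\<lambda>w. exp (s * w) * (sqrt (bigX \<sigma> (exp w)) * exp (- bigX \<sigma> (exp w)) / bigX \<sigma> (exp w) ^ j))"
    and "(LINT w|lborel. exp (s * w) * (sqrt (bigX \<sigma> (exp w)) * exp (- bigX \<sigma> (exp w)) / bigX \<sigma> (exp w) ^ j))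
      = (1 - \<sigma>) * B powr (- ((1 - \<sigma>) * s)) * Gamma ((1 - \<sigma>) * s + 1 / 2 - real j)"
proof -
  define \<kappa> where "\<kappa> = 1 - \<sigma>"
  have \<kappa>: "\<kappa> > 0" using \<sigma> by (simp add: \<kappa>_def)
  define p where "p = \<kappa> * s + 1 / 2 - real j"
  have p: "p > 0" using assms by (simp add: p_def \<kappa>_def)
  have B: "B > 0" using \<sigma> by (simp add: B_def)
  define q where "q = 1 / 2 - real j"
  have X: "bigX \<sigma> (exp w) = B * exp (1 / \<kappa> * w)" for w
  proof -
    have "bigX \<sigma> (exp w) = \<kappa> * ((\<sigma> powr \<sigma>) powr (1 / \<kappa>) * exp w powr (1 / \<kappa>))"
      using \<sigma> by (simp add: bigX_def kap_def hpar_def \<kappa>_def powr_mult)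
    also have "exp w powr (1 / \<kappa>) = exp (1 / \<kappa> * w)" by (simp add: powr_def)
    finally show ?thesis by (simp add: B_def \<kappa>_def)
  qed
  have Y: "sqrt Y / Y ^ j = Y powr q" if "Y > 0" for Y :: real
    using that by (simp add: q_def powr_diff powr_realpow powr_half_sqrt)
  have eq: "exp (s * w) * (sqrt (bigX \<sigma> (exp w)) * exp (- bigX \<sigma> (exp w)) / bigX \<sigma> (exp w) ^ j)
      = B powr q * exp (p / \<kappa> * w - B * exp (1 / \<kappa> * w))" for w
  proof -
    define Z where "Z = B * exp (1 / \<kappa> * w)"
    have Zp: "Z > 0" using B by (simp add: Z_def)
    have "Z powr q = B powr q * exp (q / \<kappa> * w)" using B by (simp add: Z_def powr_mult exp_powr_real mult_ac)
    moreover have "sqrt Z * exp (- Z) / Z ^ j = Z powr q * exp (- Z)" 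
    proof -
      have "sqrt Z * exp (- Z) / Z ^ j = (sqrt Z / Z ^ j) * exp (- Z)" by simp
      thus ?thesis by (simp only: Y[OF Zp])
    qed
    moreover have "s * w + q / \<kappa> * w - Z = p / \<kappa> * w - Z" using \<kappa> by (simp add: p_def q_def field_simps)
    moreover have "exp (s * w) * (B powr q * exp (q / \<kappa> * w) * exp (- Z)) = B powr q * exp (s * w + q / \<kappa> * w - Z)"
      by (simp add: exp_add exp_diff exp_minus field_simps)
    ultimately show ?thesis unfolding X Z_def[symmetric] by (simp only:)
  qed
  have pk: "p / \<kappa> > 0" "1 / \<kappa> > 0" using p \<kappa> by auto
  show "integrable lborel (\<lambda>w. exp (s * w) * (sqrt (bigX \<sigma> (exp w)) * exp (- bigX \<sigma> (exp w)) / bigX \<sigma> (exp w) ^ j))"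
    unfolding eq by (intro integrable_mult_right exp_gamma_integral_pos(1)[OF pk B])
  have e: "p / \<kappa> / (1 / \<kappa>) = p" using \<kappa> by simp
  have "(LINT w|lborel. exp (s * w) * (sqrt (bigX \<sigma> (exp w)) * exp (- bigX \<sigma> (exp w)) / bigX \<sigma> (exp w) ^ j)) =
     B powr q * (Gamma p / (1 / \<kappa>) * B powr (- p))"
    unfolding eq integral_mult_right_zero exp_gamma_integral_pos(2)[OF pk B] e ..
  also have "\<dots> = \<kappa> * (B powr q * B powr (- p)) * Gamma p" by simp
  also have "B powr q * B powr (- p) = B powr (- (\<kappa> * s))"
    by (simp add: p_def q_def flip: powr_add)
  finally show "(LINT w|lborel. exp (s * w) * (sqrt (bigX \<sigma> (exp w)) * exp (- bigX \<sigma> (exp w)) / bigX \<sigma> (exp w) ^ j))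
      = (1 - \<sigma>) * B powr (- ((1 - \<sigma>) * s)) * Gamma ((1 - \<sigma>) * s + 1 / 2 - real j)"
    by (simp only: \<kappa>_def p_def)
qed

lemma Gamma_descending_invfac:
  fixes y :: real
  assumes "y + 1 / 2 - real j > 0"
  shows "(- 1) ^ j * (Gamma (y + 1 / 2 - real j) / Gamma (y + 1 / 2)) = 1 / pochhammer (- y + 1 / 2) j"
  using assms
proof (induction j)
  case 0
  hence pos: "0 < y + 1 / 2" by simp
  have "Gamma (y + 1 / 2) \<noteq> 0" using Gamma_real_pos[OF pos] by linarith
  thus ?case by simp
next
  case (Suc j)
  define z where "z = y + 1 / 2 - real (Suc j)"
  have z: "z > 0" using Suc by (simp add: z_def)
  have "Gamma (z + 1) = z * Gamma z" by (rule Gamma_plus1) (use z in auto)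
  moreover have "z + 1 = y + 1 / 2 - real j" by (simp add: z_def)
  ultimately have G: "Gamma (y + 1 / 2 - real j) = z * Gamma z" by simp
  have IH: "(- 1) ^ j * (z * Gamma z / Gamma (y + 1 / 2)) = 1 / pochhammer (- y + 1 / 2) j"
    using Suc.IH Suc.prems unfolding G by simp
  have "(- 1) ^ Suc j * (Gamma z / Gamma (y + 1 / 2)) = (- 1) ^ j * (z * Gamma z / Gamma (y + 1 / 2)) / (- z)"
    using z by simp
  also have "\<dots> = 1 / (pochhammer (- y + 1 / 2) j * (- z))" unfolding IH by simp
  also have "- z = - y + 1 / 2 + real j" by (simp add: z_def)
  finally show ?case by (simp only: pochhammer_Suc z_def)
qed

text \<open>The term with index \<open>j\<close> contributes \<open>\<Gamma>(\<kappa>s + 1/2 - j)\<close> to the Mellin transform. Divided by \<open>\<Gamma>(\<kappa>s + 1/2)\<close> it is an inverse factorial term at \<open>- s\<close>,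
  and the error of the expansion of \<open>F\<^sub>\<sigma>\<close> is of the size of the first omitted term. The positivity condition makes all integrals converge.\<close>
theorem norm_quot_reciprocal_expansion:
  assumes \<sigma>: "0 < \<sigma>" "\<sigma> < 1" and a: "is_saddle_series \<sigma> a" and M: "M \<ge> 1"
  obtains C where "\<And>n. (1 - \<sigma>) * ((real n + 1 / 2) / \<sigma>) + 1 / 2 - real M > 0 \<Longrightarrow>
     norm (1 / norm_quot \<sigma> (of_real ((real n + 1 / 2) / \<sigma>)) - (\<Sum>j<M. a j * invfac (1 - \<sigma>) j (- (1 / of_real ((real n + 1 / 2) / \<sigma>)))))
      \<le> C * norm (invfac (1 - \<sigma>) M (- (1 / of_real ((real n + 1 / 2) / \<sigma>))))"
proof -
  define \<kappa> where "\<kappa> = 1 - \<sigma>"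
  have \<kappa>: "\<kappa> > 0" using \<sigma> by (simp add: \<kappa>_def)
  obtain C where C: "\<forall>x>0. norm (of_real (wright_F \<sigma> x) - of_real (Acon' \<sigma> / (2 * pi) * sqrt (bigX \<sigma> x) * exp (- bigX \<sigma> x)) * (\<Sum>j<M. a j / (- of_real (bigX \<sigma> x)) ^ j))
       \<le> C * (sqrt (bigX \<sigma> x) * exp (- bigX \<sigma> x) / bigX \<sigma> x ^ M)"
    using wright_F_positive_uniform[OF \<sigma> a M] by blast
  define B where "B = (1 - \<sigma>) * (\<sigma> powr \<sigma>) powr (1 / (1 - \<sigma>))"
  have B: "B > 0" using \<sigma> by (simp add: B_def)
  define A where "A = Acon' \<sigma> / (2 * pi)"
  have A: "A > 0" using \<sigma> by (simp add: A_def Acon'_eq)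
  show ?thesis
  proof (rule that[of "C / A"])
    fix n :: nat
    define s where "s = (real n + 1 / 2) / \<sigma>"
    assume pM: "(1 - \<sigma>) * ((real n + 1 / 2) / \<sigma>) + 1 / 2 - real M > 0"
    have pj: "(1 - \<sigma>) * s + 1 / 2 - real j > 0" if "j \<le> M" for j using pM that unfolding s_def by linarith
    have s: "s > 0" using \<sigma> by (simp add: s_def)
    have \<sigma>s: "\<sigma> * s = real n + 1 / 2" using \<sigma> by (simp add: s_def)
    define T where "T = (\<lambda>j w. exp (s * w) * (sqrt (bigX \<sigma> (exp w)) * exp (- bigX \<sigma> (exp w)) / bigX \<sigma> (exp w) ^ j))"
    define D where "D = \<kappa> * B powr (- (\<kappa> * s))"
    have D: "D > 0" using \<kappa> B by (simp add: D_def)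
    define G where "G = (\<lambda>j. Gamma (\<kappa> * s + 1 / 2 - real j))"
    have T: "integrable lborel (T j)" "(LINT w|lborel. T j w) = D * G j" if "j \<le> M" for j
      using bigX_mellin[OF \<sigma> pj[OF that]] unfolding T_def D_def G_def \<kappa>_def B_def by simp_all
    define \<Phi> where "\<Phi> = (\<lambda>w. exp (s * w) * wright_F \<sigma> (exp w))"
    have \<Phi>: "integrable lborel \<Phi>" "(LINT w|lborel. \<Phi> w) = Gamma s * rGamma (\<sigma> * s)"
      unfolding \<Phi>_def s_def using wright_ray.wright_F_mellin[OF wright_ray_standard[OF \<sigma>], of n] \<sigma> by simp_all
    define E where "E = (\<lambda>w. of_real (\<Phi> w) - (\<Sum>j<M. of_real A * (a j * (- 1) ^ j) * of_real (T j w)))"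
    have Eint: "complex_integrable lborel E"
      unfolding E_def by (intro Bochner_Integration.integrable_diff Bochner_Integration.integrable_sum integrable_mult_right integrable_of_real \<Phi> T) simp
    have Eval: "(LINT w|lborel. E w) = of_real (Gamma s * rGamma (\<sigma> * s)) - (\<Sum>j<M. of_real A * (a j * (- 1) ^ j) * of_real (D * G j))"
    proof -
      have "(LINT w|lborel. E w) = (LINT w|lborel. complex_of_real (\<Phi> w)) - (LINT w|lborel. (\<Sum>j<M. of_real A * (a j * (- 1) ^ j) * of_real (T j w)))"
        unfolding E_def by (intro Bochner_Integration.integral_diff Bochner_Integration.integrable_sum integrable_mult_right integrable_of_real \<Phi> T) simp
      also have "(LINT w|lborel. (\<Sum>j<M. of_real A * (a j * (- 1) ^ j) * of_real (T j w))) = (\<Sum>j<M. (LINT w|lborel. of_real A * (a j * (- 1) ^ j) * of_real (T j w)))"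
        by (intro Bochner_Integration.integral_sum integrable_mult_right integrable_of_real T) simp
      also have "\<dots> = (\<Sum>j<M. of_real A * (a j * (- 1) ^ j) * of_real (D * G j))"
      proof (rule sum.cong[OF refl])
        fix j assume "j \<in> {..<M}"
        hence "j \<le> M" by simp
        show "(LINT w|lborel. of_real A * (a j * (- 1) ^ j) * of_real (T j w)) = of_real A * (a j * (- 1) ^ j) * of_real (D * G j)"
          by (simp only: integral_mult_right_zero integral_complex_of_real T(2)[OF \<open>j \<le> M\<close>])
      qed
      finally show ?thesis by (simp only: integral_complex_of_real \<Phi>(2))
    qed
    have Ebound: "norm (E w) \<le> C * T M w" for w
    proof -
      define X where "X = bigX \<sigma> (exp w)"
      have X: "X > 0" unfolding X_def by (rule bigX_pos[OF \<sigma>]) simp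
      have tj: "of_real A * (a j * (- 1) ^ j) * of_real (T j w) = of_real (exp (s * w)) * (of_real (A * sqrt X * exp (- X)) * (a j / (- of_real X) ^ j))" for j
      proof -
        have "a j / (- of_real X) ^ j = a j * (- 1) ^ j / of_real X ^ j" by (cases "even j") simp_all
        thus ?thesis by (simp add: T_def X_def)
      qed
      have "E w = of_real (exp (s * w)) * (of_real (wright_F \<sigma> (exp w)) - of_real (A * sqrt X * exp (- X)) * (\<Sum>j<M. a j / (- of_real X) ^ j))"
        unfolding E_def tj \<Phi>_def sum_distrib_left[symmetric] of_real_mult right_diff_distrib ..
      hence "norm (E w) = exp (s * w) * norm (of_real (wright_F \<sigma> (exp w)) - of_real (A * sqrt X * exp (- X)) * (\<Sum>j<M. a j / (- of_real X) ^ j))"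
        by (simp only: norm_mult norm_of_real abs_exp_cancel)
      also have "\<dots> \<le> exp (s * w) * (C * (sqrt X * exp (- X) / X ^ M))"
        using C[rule_format, of "exp w"] unfolding A_def X_def by (intro mult_left_mono) simp_all
      finally show ?thesis by (simp add: T_def X_def mult.left_commute)
    qed
    have "norm (LINT w|lborel. E w) \<le> (LINT w|lborel. norm (E w))" by (rule integral_norm_bound)
    also have "\<dots> \<le> (LINT w|lborel. C * T M w)"
      by (rule integral_mono[OF integrable_norm[OF Eint] integrable_mult_right[OF T(1)[OF order_refl]] Ebound])
    also have "\<dots> = C * (D * G M)" by (simp only: integral_mult_right_zero T(2)[OF order_refl])
    finally have main: "norm (of_real (Gamma s * rGamma (\<sigma> * s)) - (\<Sum>j<M. of_real A * (a j * (- 1) ^ j) * of_real (D * G j))) \<le> C * (D * G M)"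
      unfolding Eval .
    have gj: "complex_of_real ((- 1) ^ j * (G j / G 0)) = invfac \<kappa> j (- (1 / of_real s))" if "j \<le> M" for j
    proof -
      have "invfac \<kappa> j (1 / (- of_real s)) = 1 / pochhammer (of_real \<kappa> * (- of_real s) + 1 / 2) j"
        by (rule invfac_inverse) (use s in simp)
      also have "of_real \<kappa> * (- of_real s) + 1 / 2 = complex_of_real (- (\<kappa> * s) + 1 / 2)" by simp
      also have "1 / pochhammer \<dots> j = complex_of_real (1 / pochhammer (- (\<kappa> * s) + 1 / 2) j)"
        by (simp only: pochhammer_of_real of_real_divide of_real_1)
      also have "1 / pochhammer (- (\<kappa> * s) + 1 / 2) j = (- 1) ^ j * (G j / G 0)"
        using Gamma_descending_invfac[of "\<kappa> * s" j] pj[OF that] by (simp add: G_def \<kappa>_def)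
      finally show ?thesis by (simp only: minus_divide_right)
    qed
    have G0: "G 0 > 0" using pj[of 0] by (simp add: G_def \<kappa>_def)
    have nq: "of_real (Gamma s * rGamma (\<sigma> * s)) = of_real (A * D * G 0) * (1 / norm_quot \<sigma> (of_real s))"
    proof -
      define K where "K = sqrt (2 * pi / \<sigma>) * exp (s * (\<sigma> * ln \<sigma> + (1 - \<sigma>) * ln (1 - \<sigma>)))"
      have AD: "A * D = 1 / K"
      proof -
        have "ln B = ln \<kappa> + \<sigma> * ln \<sigma> / \<kappa>" using \<sigma> \<kappa> by (simp add: B_def \<kappa>_def ln_mult ln_powr)
        hence "\<kappa> * ln B = \<sigma> * ln \<sigma> + \<kappa> * ln \<kappa>" using \<kappa> by (simp add: field_simps)
        hence "- (\<kappa> * s) * ln B = - (s * (\<sigma> * ln \<sigma> + \<kappa> * ln \<kappa>))" by (simp add: mult_ac)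
        hence "B powr (- (\<kappa> * s)) = 1 / exp (s * (\<sigma> * ln \<sigma> + \<kappa> * ln \<kappa>))" using B by (simp add: powr_def exp_minus inverse_eq_divide)
        moreover have "A * \<kappa> = 1 / sqrt (2 * pi / \<sigma>)"
        proof -
          define r where "r = sqrt (2 * pi / \<sigma>)"
          have r2: "r * r = 2 * pi / \<sigma>" using \<sigma> by (simp add: r_def)
          have r: "r > 0" using \<sigma> by (simp add: r_def)
          have "A * \<kappa> = r * \<sigma> / (2 * pi)" using \<sigma> by (simp add: A_def Acon'_eq \<kappa>_def r_def)
          also have "\<dots> = r / (r * r)" unfolding r2 by simp
          finally have "A * \<kappa> = 1 / r" using r by simp
          thus ?thesis by (simp only: r_def)
        qed
        ultimately show ?thesis unfolding D_def K_def \<kappa>_def[symmetric] by (simp flip: mult.assoc)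
      qed
      have "norm_quot \<sigma> (of_real s) = Gamma (of_real (\<sigma> * s)) * Gamma (of_real (\<kappa> * s + 1 / 2)) / Gamma (of_real s) / of_real K"
        by (simp add: norm_quot_def K_def \<kappa>_def exp_of_real[symmetric])
      also have "\<dots> = of_real (Gamma (\<sigma> * s) * G 0 / Gamma s / K)"
        unfolding Gamma_complex_of_real by (simp add: G_def)
      finally have nqeq: "norm_quot \<sigma> (of_real s) = of_real (Gamma (\<sigma> * s) * G 0 / Gamma s / K)" .
      have "Gamma (\<sigma> * s) > 0" "Gamma s > 0" using \<sigma> s by (auto intro: Gamma_real_pos)
      moreover have "K > 0" using \<sigma> by (simp add: K_def)
      ultimately have eq: "1 / K * G 0 * (1 / (Gamma (\<sigma> * s) * G 0 / Gamma s / K)) = Gamma s * rGamma (\<sigma> * s)"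
        using G0 by (simp add: rGamma_inverse_Gamma field_simps)
      have "complex_of_real (1 / K * G 0) * (1 / of_real z) = of_real (1 / K * G 0 * (1 / z))" for z by simp
      thus ?thesis unfolding AD nqeq eq[symmetric] by (rule sym)
    qed
    have sumeq: "(\<Sum>j<M. of_real A * (a j * (- 1) ^ j) * of_real (D * G j)) = of_real (A * D * G 0) * (\<Sum>j<M. a j * invfac \<kappa> j (- (1 / of_real s)))"
      unfolding sum_distrib_left
    proof (rule sum.cong[OF refl])
      fix j assume "j \<in> {..<M}"
      hence j: "j \<le> M" by simp
      show "of_real A * (a j * (- 1) ^ j) * of_real (D * G j) = of_real (A * D * G 0) * (a j * invfac \<kappa> j (- (1 / of_real s)))"
        unfolding gj[OF j, symmetric] using G0 by simp
    qed
    have ADG: "A * D * G 0 > 0" using A D G0 by simp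
    have "A * D * G 0 * norm (1 / norm_quot \<sigma> (of_real s) - (\<Sum>j<M. a j * invfac \<kappa> j (- (1 / of_real s)))) =
       norm (of_real (A * D * G 0) * (1 / norm_quot \<sigma> (of_real s) - (\<Sum>j<M. a j * invfac \<kappa> j (- (1 / of_real s)))))"
      unfolding norm_mult norm_of_real using ADG by simp
    also have "\<dots> \<le> C * (D * G M)" using main unfolding nq sumeq right_diff_distrib .
    also have "\<dots> = A * D * G 0 * (C / A * norm (invfac \<kappa> M (- (1 / of_real s))))"
    proof -
      have "G M > 0" using pj[of M] by (simp add: G_def \<kappa>_def)
      hence "norm (invfac \<kappa> M (- (1 / of_real s))) = G M / G 0"
        unfolding gj[OF order_refl, symmetric] norm_of_real using G0 by (simp add: abs_mult power_abs)
      thus ?thesis using A G0 by simp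
    qed
    finally have "norm (1 / norm_quot \<sigma> (of_real s) - (\<Sum>j<M. a j * invfac \<kappa> j (- (1 / of_real s)))) \<le> C / A * norm (invfac \<kappa> M (- (1 / of_real s)))"
      using ADG by (simp only: mult_le_cancel_left_pos)
    thus "norm (1 / norm_quot \<sigma> (of_real ((real n + 1 / 2) / \<sigma>)) - (\<Sum>j<M. a j * invfac (1 - \<sigma>) j (- (1 / of_real ((real n + 1 / 2) / \<sigma>)))))
      \<le> C / A * norm (invfac (1 - \<sigma>) M (- (1 / of_real ((real n + 1 / 2) / \<sigma>))))"
      by (simp only: s_def \<kappa>_def)
  qed
qed


section \<open>The saddle coefficients are the inverse factorial coefficients\<close>

text \<open>The order of vanishing of a germ can be tested along any one approach to \<open>0\<close>. This carries an identity from the imaginary axis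
  to the real one.\<close>
lemma analytic_bigo_transfer:
  assumes g: "g analytic_on {0}" and F: "F \<le> at (0::complex)" "F \<noteq> bot" and O: "g \<in> O[F](\<lambda>x. x ^ M)"
  shows "g \<in> O[at 0](\<lambda>x. x ^ M)"
  using O
proof (induction M)
  case 0
  then show ?case using analytic_bigo_1[OF g] by simp
next
  case (Suc M)
  have id: "((\<lambda>x::complex. x) \<longlongrightarrow> 0) F" using F(1) tendsto_ident_at[of 0] tendsto_mono by blast
  have nz: "eventually (\<lambda>x::complex. x \<noteq> 0) F" by (rule filter_leD[OF F(1) eventually_neq_at_within])
  obtain C where C: "eventually (\<lambda>x. norm (g x) \<le> C * norm (x ^ Suc M)) F" using Suc.prems by (elim landau_o.bigE)
  have "(\<lambda>x::complex. x ^ Suc M) \<in> O[F](\<lambda>x. x ^ M)"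
  proof (rule bigoI[of _ 1])
    have "eventually (\<lambda>x::complex. norm x < 1) F" using order_tendstoD(2)[OF tendsto_norm[OF id], of 1] by simp
    thus "eventually (\<lambda>x::complex. norm (x ^ Suc M) \<le> 1 * norm (x ^ M)) F"
    proof eventually_elim
      case (elim x)
      have "norm x * norm x ^ M \<le> 1 * norm x ^ M" using elim by (intro mult_right_mono) auto
      thus ?case by (simp add: norm_mult norm_power)
    qed
  qed
  from Suc.IH[OF landau_o.big.trans[OF Suc.prems this]] have "g \<in> O[at 0](\<lambda>x. x ^ M)" .
  from analytic_bigo_factor[OF g this] obtain h where h: "h analytic_on {0}" "eventually (\<lambda>x. g x = x ^ M * h x) (nhds 0)" by blast
  have at_nhds: "at (0::complex) \<le> nhds 0" by (simp add: at_within_def)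
  have hF: "eventually (\<lambda>x. norm (h x) \<le> C * norm x) F"
    using C nz filter_leD[OF order_trans[OF F(1) at_nhds] h(2)]
  proof eventually_elim
    case (elim x)
    have "norm (x ^ M) * norm (h x) \<le> norm (x ^ M) * (C * norm x)" using elim by (simp add: norm_mult mult_ac)
    thus ?case using elim by (simp add: mult_le_cancel_left_pos)
  qed
  have "isCont h 0" using h(1) by (rule analytic_at_imp_isCont)
  hence "(h \<longlongrightarrow> h 0) (at 0)" by (simp add: isCont_def)
  hence hl: "(h \<longlongrightarrow> h 0) F" using F(1) tendsto_mono by blast
  have "((\<lambda>x. C * norm x) \<longlongrightarrow> C * norm (0::complex)) F" by (intro tendsto_intros id)
  hence "((\<lambda>x. C * norm x) \<longlongrightarrow> 0) F" by simp
  hence "(h \<longlongrightarrow> 0) F" by (rule Lim_null_comparison[OF hF])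
  hence h0: "h 0 = 0" using tendsto_unique[OF F(2) hl] by simp
  obtain h' where "(h has_field_derivative h') (at 0)"
    using analytic_on_imp_differentiable_at[OF h(1)] by (auto simp: field_differentiable_def)
  hence "((\<lambda>x. (h x - h 0) / (x - 0)) \<longlongrightarrow> h') (at 0)" by (simp add: has_field_derivative_iff)
  hence "((\<lambda>x. h x / x) \<longlongrightarrow> h') (at 0)" by (simp add: h0)
  hence "h \<in> O[at 0](\<lambda>x. x)"
    by (rule bigoI_tendsto) (auto simp: eventually_at_filter)
  hence "(\<lambda>x. x ^ M * h x) \<in> O[at 0](\<lambda>x. x ^ M * x)" by (rule landau_o.big.mult_left)
  moreover have "eventually (\<lambda>x. g x = x ^ M * h x) (at 0)" by (rule filter_leD[OF at_nhds h(2)])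
  ultimately show ?case using landau_o.big.in_cong[of g "\<lambda>x. x ^ M * h x" "at 0"] by (simp add: mult.commute)
qed

lemma Gamma_times_minus:
  fixes z :: complex
  assumes "z \<notin> \<int>"
  shows "Gamma z * Gamma (- z) = - of_real pi / (z * sin (of_real pi * z))"
proof -
  have z: "z \<noteq> 0" using assms by auto
  have "- z \<notin> \<int>\<^sub>\<le>\<^sub>0" using assms nonpos_Ints_subset_Ints by (metis minus_in_Ints_iff subsetD)
  hence "Gamma (- z + 1) = - z * Gamma (- z)" by (rule Gamma_plus1)
  hence "- z * (Gamma z * Gamma (- z)) = Gamma z * Gamma (1 - z)" by (simp add: mult_ac)
  also have "\<dots> = of_real pi / sin (of_real pi * z)" by (rule Gamma_reflection_complex)
  finally have e: "- z * (Gamma z * Gamma (- z)) = of_real pi / sin (of_real pi * z)" .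
  have "Gamma z * Gamma (- z) = (- z * (Gamma z * Gamma (- z))) / (- z)" using z by simp
  also have "\<dots> = - of_real pi / (z * sin (of_real pi * z))" unfolding e by (simp add: mult.commute)
  finally show ?thesis .
qed

lemma sin_imaginary: "sin (\<i> * complex_of_real y) = \<i> * of_real (sinh y)"
  by (simp add: complex_eq_iff Re_sin Im_sin sinh_field_def)

lemma cos_imaginary: "cos (\<i> * complex_of_real y) = of_real (cosh y)"
  by (simp add: complex_eq_iff Re_cos Im_cos cosh_field_def)

text \<open>All factors come in pairs \<open>\<Gamma>(z) \<Gamma>(- z)\<close> or \<open>\<Gamma>(1/2 + z) \<Gamma>(1/2 - z)\<close>, and the exponential factors cancel.\<close>
lemma norm_quot_reflection:
  assumes \<sigma>: "0 < \<sigma>" "\<sigma> < 1" and t: "t > 0"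
  shows "norm_quot \<sigma> (\<i> * of_real t) * norm_quot \<sigma> (- (\<i> * of_real t))
    = of_real (sinh (pi * t) / (2 * sinh (pi * \<sigma> * t) * cosh (pi * (1 - \<sigma>) * t)))"
proof -
  define u where "u = \<i> * of_real t"
  define \<kappa> where "\<kappa> = 1 - \<sigma>"
  have nonint: "\<i> * of_real y \<notin> \<int>" if "y \<noteq> 0" for y
    using that by (auto elim!: Ints_cases simp: complex_eq_iff)
  have sini: "sin (of_real pi * (of_real a * u)) = \<i> * of_real (sinh (pi * a * t))"
    and cosi: "cos (of_real pi * (of_real a * u)) = of_real (cosh (pi * a * t))" for a
  proof -
    have e: "of_real pi * (of_real a * u) = \<i> * of_real (pi * a * t)" by (simp add: u_def)
    show "sin (of_real pi * (of_real a * u)) = \<i> * of_real (sinh (pi * a * t))"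
      unfolding e by (rule sin_imaginary)
    show "cos (of_real pi * (of_real a * u)) = of_real (cosh (pi * a * t))"
      unfolding e by (rule cos_imaginary)
  qed
  have u: "u \<noteq> 0" using t by (simp add: u_def)
  have g1: "Gamma (of_real a * u) * Gamma (of_real a * - u) = - of_real pi / ((of_real a * u) * (\<i> * of_real (sinh (pi * a * t))))" if "a > 0" for a
  proof -
    have "of_real a * u \<notin> \<int>" using nonint[of "a * t"] that t by (simp add: u_def mult_ac)
    from Gamma_times_minus[OF this] show ?thesis unfolding sini by simp
  qed
  have g2: "Gamma (of_real \<kappa> * u + 1 / 2) * Gamma (of_real \<kappa> * - u + 1 / 2) = of_real pi / of_real (cosh (pi * \<kappa> * t))"
  proof -
    have "Gamma (of_real \<kappa> * u + 1 / 2) * Gamma (1 - (of_real \<kappa> * u + 1 / 2)) = of_real pi / sin (of_real pi * (of_real \<kappa> * u + 1 / 2))"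
      by (rule Gamma_reflection_complex)
    also have "1 - (of_real \<kappa> * u + 1 / 2) = of_real \<kappa> * - u + 1 / 2" by simp
    also have "of_real pi * (of_real \<kappa> * u + 1 / 2) = of_real pi * (of_real \<kappa> * u) + of_real (pi / 2)" by (simp add: distrib_left)
    also have "sin (of_real pi * (of_real \<kappa> * u) + of_real (pi / 2)) = cos (of_real pi * (of_real \<kappa> * u))"
    proof -
      have "cos (complex_of_real (pi / 2)) = 0" "sin (complex_of_real (pi / 2)) = 1"
        by (simp_all only: cos_of_real sin_of_real cos_pi_half sin_pi_half of_real_0 of_real_1)
      thus ?thesis by (simp only: sin_add mult_zero_right mult_1_right add_0_left add_0_right)
    qed
    finally show ?thesis unfolding cosi .
  qed
  define S S1 Cc where "S = sinh (pi * \<sigma> * t)" and "S1 = sinh (pi * t)" and "Cc = cosh (pi * \<kappa> * t)"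
  have pos: "S > 0" "S1 > 0" "Cc > 0" using \<sigma> t by (simp_all add: S_def S1_def Cc_def cosh_real_pos)
  define K where "K = sqrt (2 * pi / \<sigma>)"
  have K: "K * K = 2 * pi / \<sigma>" using \<sigma> by (simp add: K_def)
  define w where "w = complex_of_real (\<sigma> * ln \<sigma> + (1 - \<sigma>) * ln (1 - \<sigma>))"
  have ex: "exp (u * w) * exp (- u * w) = 1" by (simp flip: exp_add)
  have "norm_quot \<sigma> u * norm_quot \<sigma> (- u) =
     (Gamma (of_real \<sigma> * u) * Gamma (of_real \<sigma> * - u)) * (Gamma (of_real \<kappa> * u + 1 / 2) * Gamma (of_real \<kappa> * - u + 1 / 2)) /
     (Gamma (of_real 1 * u) * Gamma (of_real 1 * - u)) / (of_real (K * K) * (exp (u * w) * exp (- u * w)))"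
  proof -
    have gen: "(a * b / c / (k * e)) * (a' * b' / c' / (k * e')) = (a * a') * (b * b') / (c * c') / ((k * k) * (e * e'))"
      for a b c k e a' b' c' e' :: complex
      by (simp only: times_divide_times_eq divide_divide_eq_left mult_ac)
    show ?thesis unfolding norm_quot_def w_def K_def \<kappa>_def of_real_1 mult_1 of_real_mult by (rule gen)
  qed
  also have "\<dots> = (- of_real pi / ((of_real \<sigma> * u) * (\<i> * of_real S))) * (of_real pi / of_real Cc) /
      (- of_real pi / ((of_real 1 * u) * (\<i> * of_real S1))) / of_real (2 * pi / \<sigma>)"
    unfolding g1[OF \<sigma>(1)] g1[OF zero_less_one] g2 ex K S_def S1_def Cc_def by simp
  also have "\<dots> = of_real (S1 / (2 * S * Cc))"
  proof -
    have "(- p / ((s * u) * (\<i> * a))) * (p / b) / (- p / ((1 * u) * (\<i> * c))) / (2 * p / s) = c / (2 * a * b)"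
      if "p \<noteq> 0" "s \<noteq> 0" "a \<noteq> 0" "b \<noteq> 0" "c \<noteq> 0" for p s a b c :: complex
      using that u by (simp add: divide_simps)
    from this[of "of_real pi" "of_real \<sigma>" "of_real S" "of_real Cc" "of_real S1"] pos \<sigma> show ?thesis by simp
  qed
  finally show ?thesis unfolding u_def S_def S1_def Cc_def \<kappa>_def .
qed

text \<open>The numerator differs from the denominator by \<open>sinh (B - A)\<close>.\<close>
lemma sinh_ratio_bound:
  fixes A B :: real
  assumes "A \<ge> 1" "B \<ge> 0"
  shows "\<bar>sinh (A + B) / (2 * sinh A * cosh B) - 1\<bar> \<le> 4 * exp (- 2 * min A B)"
proof -
  have "exp A \<ge> 2" using exp_ge_add_one_self[of A] assms by linarith
  moreover have "exp (- A) \<le> 1" using assms by simp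
  ultimately have "exp (- A) * 2 \<le> exp A" by linarith
  hence sA: "sinh A \<ge> exp A / 4" unfolding sinh_field_def by (simp add: field_simps)
  have cB: "cosh B \<ge> exp B / 2" unfolding cosh_field_def by simp
  have pos: "sinh A > 0" "cosh B > 0" using assms by (simp_all add: cosh_real_pos)
  have den: "exp (A + B) / 4 \<le> 2 * sinh A * cosh B"
  proof -
    have "exp A / 4 * (exp B / 2) \<le> sinh A * cosh B" by (rule mult_mono[OF sA cB]) (use pos in auto)
    thus ?thesis by (simp add: exp_add)
  qed
  have num: "\<bar>sinh (B - A)\<bar> \<le> exp \<bar>B - A\<bar>"
  proof -
    have "exp (B - A) \<le> exp \<bar>B - A\<bar>" "exp (- (B - A)) \<le> exp \<bar>B - A\<bar>" by simp_all
    moreover have "exp (B - A) > 0" "exp (- (B - A)) > 0" by simp_all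
    moreover have "\<bar>(x - y) / 2\<bar> \<le> z" if "x \<le> z" "y \<le> z" "x > 0" "y > 0" for x y z :: real
      using that unfolding abs_le_iff by (simp add: field_simps)
    ultimately show ?thesis unfolding sinh_field_def by blast
  qed
  have "sinh (A + B) - 2 * sinh A * cosh B = sinh (B - A)" by (simp add: sinh_add sinh_diff mult_ac)
  hence "sinh (A + B) / (2 * sinh A * cosh B) - 1 = sinh (B - A) / (2 * sinh A * cosh B)" using pos by (simp add: field_simps)
  hence "\<bar>sinh (A + B) / (2 * sinh A * cosh B) - 1\<bar> = \<bar>sinh (B - A)\<bar> / (2 * sinh A * cosh B)" using pos by (simp add: abs_divide abs_mult)
  also have "\<dots> \<le> exp \<bar>B - A\<bar> / (exp (A + B) / 4)" by (rule frac_le[OF _ num _ den]) auto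
  also have "\<dots> = 4 * exp (\<bar>B - A\<bar> - (A + B))" by (simp add: exp_diff)
  also have "\<bar>B - A\<bar> - (A + B) = - 2 * min A B" by (simp add: min_def abs_if)
  finally show ?thesis .
qed

text \<open>Write \<open>p\<close> for the truncated series with coefficients \<open>c\<^sub>j\<close>. On the imaginary axis \<open>p(x) p(- x) - 1\<close> has order \<open>x\<^sup>M\<close>, hence everywhere near
  \<open>0\<close>. On the sequence of the Mellin transform, \<open>p(x)\<close> approximates the quotient and the series with coefficients \<open>a\<^sub>j\<close>, at \<open>- x\<close>, its
  reciprocal. So \<open>p(- x)\<close> and that series agree up to order \<open>x\<^sup>M\<close>.\<close>
theorem saddle_series_eq_c_coeff:
  assumes \<sigma>: "0 < \<sigma>" "\<sigma> < 1" and a: "is_saddle_series \<sigma> a"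
  shows "a j = of_real (c_coeff \<sigma> j)"
proof -
  define M where "M = Suc j"
  define \<kappa> where "\<kappa> = 1 - \<sigma>"
  have \<kappa>: "\<kappa> > 0" "\<kappa> \<noteq> 0" using \<sigma> by (auto simp: \<kappa>_def)
  define N where "N = norm_quot \<sigma>"
  define p where "p = (\<lambda>x. \<Sum>j<M. of_real (c_coeff \<sigma> j) * invfac \<kappa> j x)"
  have pan: "p analytic_on {0}" unfolding p_def by (intro analytic_intros invfac_analytic \<kappa>)
  have p1: "p \<in> O[at 0](\<lambda>_. 1)" by (rule analytic_bigo_1[OF pan])
  have Np: "(\<lambda>x. N (1 / x) - p x) \<in> O[at 0 within slit_sector 0](\<lambda>x. x ^ M)"
    using c_coeff_expansion[OF \<sigma>, of 0 M] by (simp add: N_def p_def \<kappa>_def)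
  define Q where "Q = (\<lambda>x. p x * p (- x) - 1)"
  have pman: "(\<lambda>x. p (- x)) analytic_on {0}"
  proof -
    have "(\<lambda>x::complex. - x) analytic_on {0}" by (intro analytic_intros)
    hence "(p \<circ> (\<lambda>x. - x)) analytic_on {0}" by (rule analytic_on_compose_gen[OF _ pan]) simp
    thus ?thesis by (simp only: o_def)
  qed
  have pwan: "(\<lambda>x::complex. x ^ M) analytic_on {0}" by (intro analytic_intros)
  have pm1: "(\<lambda>x. p (- x)) \<in> O[at 0](\<lambda>_. 1)" by (rule analytic_bigo_1[OF pman])
  have Qan: "Q analytic_on {0}" unfolding Q_def by (intro analytic_intros pan pman)
  have Qbig: "Q \<in> O[at 0](\<lambda>x. x ^ M)"
  proof -
    \<comment> \<open>the approach to \<open>0\<close> along the imaginary axis, \<open>x = 1 / (\<i> t)\<close>\<close>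
    define h where "h = (\<lambda>t::real. 1 / (\<i> * complex_of_real t))"
    have hl: "(h \<longlongrightarrow> 0) at_top" unfolding h_def
    proof (rule tendstoI)
      fix e :: real assume "e > 0"
      have "eventually (\<lambda>t::real. t > 1 / e \<and> t > 0) at_top" by (intro eventually_conj eventually_gt_at_top)
      thus "eventually (\<lambda>t. dist (1 / (\<i> * complex_of_real t)) 0 < e) at_top"
        by eventually_elim (use \<open>e > 0\<close> in \<open>simp add: norm_divide norm_mult field_simps\<close>)
    qed
    have hnz: "eventually (\<lambda>t. h t \<noteq> 0) at_top"
      using eventually_gt_at_top[of 0] by eventually_elim (simp add: h_def)
    have h0: "filterlim h (at 0) at_top" using hl hnz by (simp add: filterlim_at)
    have h1: "filterlim h (at 0 within slit_sector 0) at_top" "filterlim (\<lambda>t. - h t) (at 0 within slit_sector 0) at_top"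
    proof -
      have s: "eventually (\<lambda>t. h t \<in> slit_sector 0 \<and> - h t \<in> slit_sector 0) at_top"
        using hnz by eventually_elim (simp add: slit_sector_def h_def Re_divide)
      have m: "((\<lambda>t. - h t) \<longlongrightarrow> 0) at_top" using tendsto_minus[OF hl] by simp
      show "filterlim h (at 0 within slit_sector 0) at_top"
        unfolding filterlim_at using hl hnz s by (auto elim: eventually_elim2)
      show "filterlim (\<lambda>t. - h t) (at 0 within slit_sector 0) at_top"
        unfolding filterlim_at using m hnz s by (auto elim: eventually_elim2)
    qed
    have gm: "(\<lambda>t. (- h t) ^ M) \<in> O[at_top](\<lambda>t. h t ^ M)"
      by (rule bigoI[of _ 1]) (simp add: norm_power)
    have e1: "(\<lambda>t. N (1 / h t) - p (h t)) \<in> O[at_top](\<lambda>t. h t ^ M)"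
      using landau_o.big.compose[OF Np h1(1)] by simp
    have e2: "(\<lambda>t. N (1 / - h t) - p (- h t)) \<in> O[at_top](\<lambda>t. h t ^ M)"
      by (rule landau_o.big.trans[OF landau_o.big.compose[OF Np h1(2)] gm])
    have hM1: "(\<lambda>t. h t ^ M) \<in> O[at_top](\<lambda>_. 1)"
      using landau_o.big.compose[OF analytic_bigo_1[OF pwan] h0] by simp
    have ph: "(\<lambda>t. p (h t)) \<in> O[at_top](\<lambda>_. 1)" using landau_o.big.compose[OF p1 h0] by simp
    have pmh: "(\<lambda>t. p (- h t)) \<in> O[at_top](\<lambda>_. 1)" using landau_o.big.compose[OF pm1 h0] by simp
    have N2: "(\<lambda>t. N (1 / - h t)) \<in> O[at_top](\<lambda>_. 1)"
      using sum_in_bigo(1)[OF landau_o.big.trans[OF e2 hM1] pmh] by simp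
    have e3: "(\<lambda>t. N (1 / h t) * N (1 / - h t) - 1) \<in> O[at_top](\<lambda>t. h t ^ M)"
    proof -
      define \<eta> where "\<eta> = 2 * pi * min \<sigma> \<kappa>"
      have \<eta>: "\<eta> > 0" using \<sigma> \<kappa> by (simp add: \<eta>_def)
      obtain C where C: "C \<ge> 0" "\<And>X. X > 0 \<Longrightarrow> exp (- \<eta> * X) \<le> C / X ^ M" by (rule exp_le_inverse_power[OF \<eta>]) blast
      show ?thesis
      proof (rule bigoI[of _ "4 * C"])
        show "eventually (\<lambda>t. norm (N (1 / h t) * N (1 / - h t) - 1) \<le> 4 * C * norm (h t ^ M)) at_top"
          using eventually_ge_at_top[of "1 / (pi * \<sigma>)"] eventually_gt_at_top[of 0]
        proof eventually_elim
          case (elim t)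
          have ht: "1 / h t = \<i> * of_real t" "1 / - h t = - (\<i> * of_real t)" by (simp_all add: h_def)
          have A: "pi * \<sigma> * t \<ge> 1" using elim \<sigma> by (simp add: field_simps)
          have B: "pi * (1 - \<sigma>) * t \<ge> 0" using elim \<sigma> by simp
          have AB: "pi * \<sigma> * t + pi * (1 - \<sigma>) * t = pi * t" by (simp add: algebra_simps)
          have mn: "- 2 * min (pi * \<sigma> * t) (pi * (1 - \<sigma>) * t) = - \<eta> * t"
          proof -
            have "pi * t * min \<sigma> \<kappa> = min (pi * t * \<sigma>) (pi * t * \<kappa>)" by (rule min_mult_distrib_left[of "pi * t" \<sigma> \<kappa>, THEN trans]) (use elim in simp)
            thus ?thesis by (simp add: \<eta>_def \<kappa>_def mult_ac)
          qed
          have "norm (N (1 / h t) * N (1 / - h t) - 1) = norm (complex_of_real (sinh (pi * t) / (2 * sinh (pi * \<sigma> * t) * cosh (pi * (1 - \<sigma>) * t)) - 1))"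
            unfolding ht N_def norm_quot_reflection[OF \<sigma> elim(2)] by (simp only: of_real_diff of_real_1)
          also have "\<dots> \<le> 4 * exp (- \<eta> * t)"
            unfolding norm_of_real using sinh_ratio_bound[OF A B] unfolding AB mn .
          also have "\<dots> \<le> 4 * (C / t ^ M)" using C(2)[OF elim(2)] by simp
          also have "\<dots> = 4 * C * norm (h t ^ M)" using elim by (simp add: h_def norm_power norm_divide norm_mult power_one_over)
          finally show ?case .
        qed
      qed
    qed
    have "(\<lambda>t. (N (1 / h t) * N (1 / - h t) - 1) - (N (1 / h t) - p (h t)) * N (1 / - h t) - p (h t) * (N (1 / - h t) - p (- h t))) \<in> O[at_top](\<lambda>t. h t ^ M)"
      using landau_o.big.mult[OF e1 N2] landau_o.big.mult[OF ph e2] by (intro sum_in_bigo(2) e3) simp_all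
    also have "(\<lambda>t. (N (1 / h t) * N (1 / - h t) - 1) - (N (1 / h t) - p (h t)) * N (1 / - h t) - p (h t) * (N (1 / - h t) - p (- h t))) = (\<lambda>t. Q (h t))"
      by (rule ext) (simp add: Q_def algebra_simps)
    finally have Qh: "(\<lambda>t. Q (h t)) \<in> O[at_top](\<lambda>t. h t ^ M)" .
    show ?thesis
    proof (rule analytic_bigo_transfer[OF Qan])
      show "filtermap h at_top \<le> at 0" using h0 by (simp add: filterlim_def)
      show "filtermap h at_top \<noteq> bot" by (simp add: filtermap_bot_iff)
      show "Q \<in> O[filtermap h at_top](\<lambda>x. x ^ M)" using Qh by (simp add: landau_o.big.in_filtermap_iff)
    qed
  qed
  \<comment> \<open>the arguments at which the Mellin transform is known\<close>
  define s where "s = (\<lambda>n. (real n + 1 / 2) / \<sigma>)"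
  have s: "s n > 0" for n using \<sigma> by (simp add: s_def)
  have slim: "filterlim s at_top sequentially"
    unfolding s_def using \<sigma> by real_asymp
  define k where "k = (\<lambda>n. 1 / complex_of_real (s n))"
  have knz: "k n \<noteq> 0" for n using s[of n] by (simp add: k_def)
  have kl: "k \<longlonglongrightarrow> 0"
  proof -
    have "(\<lambda>n. 1 / s n) \<longlonglongrightarrow> 0" using tendsto_divide_0[OF tendsto_const filterlim_at_top_imp_at_infinity[OF slim]] .
    from tendsto_of_real[OF this, where 'a = complex] show ?thesis by (simp add: k_def)
  qed
  have k0: "filterlim k (at 0) sequentially" using kl knz by (simp add: filterlim_at)
  have k1: "filterlim k (at 0 within slit_sector 0) sequentially"
    unfolding filterlim_at using kl knz s by (auto simp: slit_sector_def k_def less_imp_le)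
  have mk0: "filterlim (\<lambda>n. - k n) (at 0) sequentially"
    using tendsto_minus[OF kl] knz by (simp add: filterlim_at)
  define g where "g = (\<lambda>n. k n ^ M)"
  have mg: "(\<lambda>n. (- k n) ^ M) \<in> O[sequentially](g)" unfolding g_def by (rule bigoI[of _ 1]) (simp add: norm_power)
  have g1: "g \<in> O[sequentially](\<lambda>_. 1)"
    unfolding g_def using landau_o.big.compose[OF analytic_bigo_1[OF pwan] k0] by simp
  define r where "r = (\<lambda>n. 1 / N (of_real (s n)))"
  define A where "A = (\<lambda>n. \<Sum>j<M. a j * invfac \<kappa> j (- k n))"
  have rA: "(\<lambda>n. r n - A n) \<in> O[sequentially](g)"
  proof -
    have M1: "M \<ge> 1" by (simp add: M_def)
    obtain C where C: "\<And>n. (1 - \<sigma>) * ((real n + 1 / 2) / \<sigma>) + 1 / 2 - real M > 0 \<Longrightarrow>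
     norm (1 / norm_quot \<sigma> (of_real ((real n + 1 / 2) / \<sigma>)) - (\<Sum>j<M. a j * invfac (1 - \<sigma>) j (- (1 / of_real ((real n + 1 / 2) / \<sigma>)))))
      \<le> C * norm (invfac (1 - \<sigma>) M (- (1 / of_real ((real n + 1 / 2) / \<sigma>))))"
      by (rule norm_quot_reciprocal_expansion[OF \<sigma> a M1], rule that, assumption)
    have "eventually (\<lambda>n. s n > real M / \<kappa>) sequentially" using slim by (simp add: filterlim_at_top_dense)
    hence ev: "eventually (\<lambda>n. norm (r n - A n) \<le> C * norm (invfac \<kappa> M (- k n))) sequentially"
    proof eventually_elim
      case (elim n)
      have "(1 - \<sigma>) * s n > real M" using elim \<kappa> by (simp add: field_simps \<kappa>_def)
      hence "(1 - \<sigma>) * ((real n + 1 / 2) / \<sigma>) + 1 / 2 - real M > 0" unfolding s_def by linarith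
      from C[OF this] show ?case unfolding r_def A_def N_def k_def s_def \<kappa>_def .
    qed
    have "(\<lambda>n. r n - A n) \<in> O[sequentially](\<lambda>n. invfac \<kappa> M (- k n))" by (rule bigoI[OF ev])
    moreover have "(\<lambda>n. invfac \<kappa> M (- k n)) \<in> O[sequentially](\<lambda>n. (- k n) ^ M)"
      by (rule landau_o.big.compose[OF invfac_bigo[OF \<kappa>(2) order_refl order_refl] mk0])
    ultimately show ?thesis using landau_o.big.trans mg by blast
  qed
  have A1: "A \<in> O[sequentially](\<lambda>_. 1)"
  proof -
    have "(\<lambda>x. \<Sum>j<M. a j * invfac \<kappa> j x) analytic_on {0}" by (intro analytic_intros invfac_analytic \<kappa>)
    from landau_o.big.compose[OF analytic_bigo_1[OF this] mk0] show ?thesis by (simp add: A_def)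
  qed
  have r1: "r \<in> O[sequentially](\<lambda>_. 1)"
    using sum_in_bigo(1)[OF landau_o.big.trans[OF rA g1] A1] by simp
  define P where "P = (\<lambda>n. p (k n))"
  define q where "q = (\<lambda>n. p (- k n))"
  define n1 where "n1 = (\<lambda>n. N (of_real (s n)))"
  have q1: "q \<in> O[sequentially](\<lambda>_. 1)" unfolding q_def using landau_o.big.compose[OF pm1 k0] by simp
  have kinv: "1 / k n = of_real (s n)" for n by (simp add: k_def)
  have d: "(\<lambda>n. n1 n - P n) \<in> O[sequentially](g)"
    using landau_o.big.compose[OF Np k1] by (simp add: kinv n1_def P_def g_def)
  have Qk: "(\<lambda>n. P n * q n - 1) \<in> O[sequentially](g)"
    using landau_o.big.compose[OF Qbig k0] by (simp add: Q_def P_def q_def g_def)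
  have n1nz: "n1 n \<noteq> 0" for n
  proof -
    have cp: "complex_of_real (1 - \<sigma>) * of_real (s n) + 1 / 2 = of_real ((1 - \<sigma>) * s n + 1 / 2)" by simp
    have "(1 - \<sigma>) * s n + 1 / 2 > 0" using \<sigma> s[of n] by (intro add_pos_pos mult_pos_pos) auto
    hence "Gamma ((1 - \<sigma>) * s n + 1 / 2) > 0" "Gamma (\<sigma> * s n) > 0" "Gamma (s n) > 0" using s[of n] \<sigma> by (auto intro: Gamma_real_pos)
    moreover have "Gamma (complex_of_real (1 - \<sigma>) * of_real (s n) + 1 / 2) = of_real (Gamma ((1 - \<sigma>) * s n + 1 / 2))"
      unfolding cp Gamma_complex_of_real ..
    moreover have "Gamma (complex_of_real \<sigma> * of_real (s n)) = of_real (Gamma (\<sigma> * s n))"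
      by (simp only: of_real_mult[symmetric] Gamma_complex_of_real)
    moreover have "Gamma (complex_of_real (s n)) = of_real (Gamma (s n))" by (rule Gamma_complex_of_real)
    ultimately show ?thesis unfolding n1_def N_def norm_quot_def using \<sigma> by (simp del: of_real_diff)
  qed
  have rn: "r n * n1 n = 1" for n using n1nz[of n] by (simp add: r_def n1_def)
  define Y where "Y = (\<lambda>n. r n - q n)"
  have Y1: "Y \<in> O[sequentially](\<lambda>_. 1)" unfolding Y_def by (rule sum_in_bigo(2)[OF r1 q1])
  have t1: "(\<lambda>n. (r n * r n) * (n1 n - P n)) \<in> O[sequentially](g)"
    using landau_o.big.mult[OF landau_o.big.mult[OF r1 r1] d] by simp
  have t2: "(\<lambda>n. r n * (P n * q n - 1)) \<in> O[sequentially](g)" using landau_o.big.mult[OF r1 Qk] by simp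
  have t3: "(\<lambda>n. (r n * (n1 n - P n)) * Y n) \<in> O[sequentially](g)"
    using landau_o.big.mult[OF landau_o.big.mult[OF r1 d] Y1] by simp
  \<comment> \<open>\<open>Y\<close> is expressed by small quantities and itself, with \<open>r\<close> as an approximate inverse of \<open>P\<close>\<close>
  have Yeq: "Y n = (r n * (n1 n - P n)) * Y n - (r n * r n) * (n1 n - P n) - r n * (P n * q n - 1)" for n
  proof -
    have "(r n * (n1 n - P n)) * Y n - (r n * r n) * (n1 n - P n) - r n * (P n * q n - 1)
       = (r n * n1 n) * Y n - r n * (r n * n1 n) + r n" by (simp add: Y_def algebra_simps)
    thus ?thesis unfolding rn by simp
  qed
  have "(\<lambda>n. (r n * (n1 n - P n)) * Y n - (r n * r n) * (n1 n - P n) - r n * (P n * q n - 1)) \<in> O[sequentially](g)"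
    by (intro sum_in_bigo(2) t1 t2 t3)
  hence Yg: "Y \<in> O[sequentially](g)" unfolding Yeq[symmetric] .
  have "(\<lambda>n. (r n - A n) - Y n) \<in> O[sequentially](g)" by (rule sum_in_bigo(2)[OF rA Yg])
  also have "(\<lambda>n. (r n - A n) - Y n) = (\<lambda>n. \<Sum>j<M. (of_real (c_coeff \<sigma> j) - a j) * invfac \<kappa> j (- k n))"
    by (rule ext) (simp add: Y_def A_def q_def p_def sum_subtractf left_diff_distrib)
  finally have fin: "(\<lambda>n. \<Sum>j<M. (of_real (c_coeff \<sigma> j) - a j) * invfac \<kappa> j (- k n)) \<in> O[sequentially](g)" .
  have gm: "g \<in> O[sequentially](\<lambda>n. (- k n) ^ M)" unfolding g_def by (rule bigoI[of _ 1]) (simp add: norm_power)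
  have "of_real (c_coeff \<sigma> j) - a j = 0"
  proof (rule invfac_unique[OF \<kappa>(2), of "filtermap (\<lambda>n. - k n) sequentially" "\<lambda>j. of_real (c_coeff \<sigma> j) - a j" M j])
    show "filtermap (\<lambda>n. - k n) sequentially \<le> at 0" using mk0 by (simp add: filterlim_def)
    show "filtermap (\<lambda>n. - k n) sequentially \<noteq> bot" by (simp add: filtermap_bot_iff)
    show "(\<lambda>x. \<Sum>j<M. (of_real (c_coeff \<sigma> j) - a j) * invfac \<kappa> j x) \<in> O[filtermap (\<lambda>n. - k n) sequentially](\<lambda>x. x ^ M)"
      using landau_o.big.trans[OF fin gm] by (simp add: landau_o.big.in_filtermap_iff)
  qed (simp add: M_def)
  thus ?thesis by simp
qed

corollary c_coeff_saddle_series: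
  assumes "0 < \<sigma>" "\<sigma> < 1"
  shows "is_saddle_series \<sigma> (\<lambda>j. of_real (c_coeff \<sigma> j))"
proof -
  obtain a where a: "is_saddle_series \<sigma> a" using saddle_expansion[OF assms] by blast
  moreover have "a = (\<lambda>j. of_real (c_coeff \<sigma> j))" using saddle_series_eq_c_coeff[OF assms a] by blast
  ultimately show ?thesis by simp
qed


section \<open>The asymptotic expansions\<close>

lemma eventually_bigX_ge:
  assumes \<sigma>: "0 < \<sigma>" "\<sigma> < 1" and Y: "Y > 0"
  shows "eventually (\<lambda>x. bigX \<sigma> x \<ge> Y) at_top"
proof -
  define \<kappa> where "\<kappa> = 1 - \<sigma>"
  have \<kappa>: "\<kappa> > 0" using \<sigma> by (simp add: \<kappa>_def)
  define h where "h = \<sigma> powr \<sigma>"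
  have h: "h > 0" using \<sigma> by (simp add: h_def)
  show ?thesis using eventually_ge_at_top[of "(Y / \<kappa>) powr \<kappa> / h"]
  proof eventually_elim
    case (elim x)
    have "(Y / \<kappa>) powr \<kappa> \<le> h * x" using elim h by (simp add: field_simps)
    hence "((Y / \<kappa>) powr \<kappa>) powr (1 / \<kappa>) \<le> (h * x) powr (1 / \<kappa>)" using \<kappa> by (intro powr_mono2) auto
    hence "Y / \<kappa> \<le> (h * x) powr (1 / \<kappa>)" using \<kappa> Y by (simp add: powr_powr)
    hence "\<kappa> * (Y / \<kappa>) \<le> \<kappa> * (h * x) powr (1 / \<kappa>)" using \<kappa> by (intro mult_left_mono) auto
    thus ?case using \<kappa> by (simp add: bigX_def kap_def hpar_def \<kappa>_def h_def)
  qed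
qed

lemma arg_le_bigX:
  assumes \<sigma>: "0 < \<sigma>" "\<sigma> < 1" and x: "x > 0" and X: "bigX \<sigma> x \<ge> 1"
  shows "x \<le> bigX \<sigma> x / ((1 - \<sigma>) * \<sigma> powr \<sigma>)"
proof -
  define Y where "Y = bigX \<sigma> x / (1 - \<sigma>)"
  have Y: "Y \<ge> 1" using X \<sigma> by (simp add: Y_def field_simps)
  have "\<sigma> powr \<sigma> * x = Y powr (1 - \<sigma>)" unfolding Y_def by (rule bigX_powr_kap[OF \<sigma> x, symmetric])
  also have "\<dots> \<le> Y powr 1" using Y \<sigma> by (intro powr_mono) auto
  finally have "\<sigma> powr \<sigma> * x \<le> Y" using Y by simp
  thus ?thesis using \<sigma> by (simp add: Y_def field_simps)
qed

text \<open>The crude factor \<open>X\<close> in place of \<open>X\<^sup>1\<^sup>/\<^sup>2\<close> is harmless: the bound is used when the exponential decays.\<close>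
lemma E'_trunc_bound:
  assumes \<sigma>: "0 < \<sigma>" "\<sigma> < 1"
  shows "\<exists>K. \<forall>x>0. bigX \<sigma> x \<ge> 1 \<longrightarrow> \<bar>E'_trunc \<sigma> M x\<bar> \<le> K * (bigX \<sigma> x * exp (bigX \<sigma> x * cos (pi * \<sigma> / (1 - \<sigma>))))"
proof -
  define A where "A = Acon' \<sigma> / pi"
  have A: "A \<ge> 0" using \<sigma> by (simp add: A_def Acon'_eq)
  define S where "S = (\<Sum>j<M. \<bar>c_coeff \<sigma> j\<bar>)"
  have "\<bar>E'_trunc \<sigma> M x\<bar> \<le> A * S * (bigX \<sigma> x * exp (bigX \<sigma> x * cos (pi * \<sigma> / (1 - \<sigma>))))" if x: "x > 0" and X1: "bigX \<sigma> x \<ge> 1" for x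
  proof -
    define X where "X = bigX \<sigma> x"
    have X: "X \<ge> 1" using X1 by (simp add: X_def)
    define e where "e = exp (X * cos (pi * \<sigma> / (1 - \<sigma>)))"
    define s where "s = (\<Sum>j<M. c_coeff \<sigma> j / (- X) ^ j * cos (X * sin (pi * \<sigma> / kap \<sigma>) + pi / kap \<sigma> * (1 / 2 - real j)))"
    have "\<bar>s\<bar> \<le> (\<Sum>j<M. \<bar>c_coeff \<sigma> j / (- X) ^ j * cos (X * sin (pi * \<sigma> / kap \<sigma>) + pi / kap \<sigma> * (1 / 2 - real j))\<bar>)"
      unfolding s_def by (rule sum_abs)
    also have "\<dots> \<le> S" unfolding S_def
    proof (rule sum_mono)
      fix j assume "j \<in> {..<M}"
      have "\<bar>c_coeff \<sigma> j / (- X) ^ j * cos y\<bar> = \<bar>c_coeff \<sigma> j\<bar> * (1 / X ^ j * \<bar>cos y\<bar>)" for y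
        using X by (simp add: abs_mult power_abs)
      moreover have "\<bar>c_coeff \<sigma> j\<bar> * (1 / X ^ j * \<bar>cos y\<bar>) \<le> \<bar>c_coeff \<sigma> j\<bar> * (1 * 1)" for y
        using X by (intro mult_left_mono mult_mono) (auto simp: one_le_power)
      ultimately show "\<bar>c_coeff \<sigma> j / (- X) ^ j * cos (X * sin (pi * \<sigma> / kap \<sigma>) + pi / kap \<sigma> * (1 / 2 - real j))\<bar> \<le> \<bar>c_coeff \<sigma> j\<bar>"
        by simp
    qed
    finally have s: "\<bar>s\<bar> \<le> S" .
    have "X powr (1 / 2) \<le> X powr 1" using X by (intro powr_mono) auto
    hence ph: "X powr (1 / 2) \<le> X" using X by simp
    have "E'_trunc \<sigma> M x = A * X powr (1 / 2) * e * s"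
      by (simp only: E'_trunc_def A_def X_def e_def s_def kap_def)
    hence "\<bar>E'_trunc \<sigma> M x\<bar> = A * (X powr (1 / 2) * e) * \<bar>s\<bar>" using A by (simp add: abs_mult e_def)
    also have "\<dots> \<le> A * (X * e) * S"
      using A X ph s by (intro mult_mono mult_left_mono mult_right_mono mult_nonneg_nonneg) (auto simp: e_def)
    finally show ?thesis unfolding X_def[symmetric] e_def[symmetric] by (simp only: mult_ac)
  qed
  thus ?thesis by blast
qed

theorem theorem1:
  fixes \<sigma> :: real
  assumes "0 < \<sigma>" and "\<sigma> < 1"
  shows "(\<forall>M\<ge>1.
            (\<lambda>x. wright_F \<sigma> x / (Acon' \<sigma> / (2 * pi) * bigX \<sigma> x powr (1 / 2) * exp (- bigX \<sigma> x))
                 - (\<Sum>j<M. c_coeff \<sigma> j / (- bigX \<sigma> x) ^ j))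
            \<in> O[at_top](\<lambda>x. 1 / bigX \<sigma> x ^ M))
       \<and> (\<sigma> < 1 / 2 \<longrightarrow>
            (\<forall>M\<ge>1. \<forall>N\<ge>1.
               (\<lambda>x. wright_F \<sigma> (- x) - (E'_trunc \<sigma> M x + H'_trunc \<sigma> N x))
               \<in> O[at_top](\<lambda>x. bigX \<sigma> x powr (1 / 2 - real M) * exp (bigX \<sigma> x * cos (pi * \<sigma> / kap \<sigma>))
                                + x powr (- (real (N + 1) / \<sigma>)))))
       \<and> (1 / 2 < \<sigma> \<longrightarrow>
            (\<forall>N\<ge>1.
               (\<lambda>x. wright_F \<sigma> (- x) - H'_trunc \<sigma> N x)
               \<in> O[at_top](\<lambda>x. x powr (- (real (N + 1) / \<sigma>)))))"
proof (intro conjI allI impI)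
  note \<sigma> = assms
  note saddle = c_coeff_saddle_series[OF assms]
  have ev: "eventually (\<lambda>x. x \<ge> 1 \<and> bigX \<sigma> x \<ge> Y) at_top" if "Y > 0" for Y
    using eventually_bigX_ge[OF \<sigma> that] eventually_ge_at_top[of 1] by eventually_elim simp
  {
    fix M :: nat assume "M \<ge> 1"
    obtain C X0 where X0: "X0 \<ge> 1" and C: "\<forall>x>0. bigX \<sigma> x \<ge> X0 \<longrightarrow>
       norm (of_real (wright_F \<sigma> x) - of_real (Acon' \<sigma> / (2 * pi) * sqrt (bigX \<sigma> x) * exp (- bigX \<sigma> x)) * (\<Sum>j<M. complex_of_real (c_coeff \<sigma> j) / (- of_real (bigX \<sigma> x)) ^ j))
         \<le> C * (sqrt (bigX \<sigma> x) * exp (- bigX \<sigma> x) / bigX \<sigma> x ^ M)"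
      using wright_F_positive[OF \<sigma> saddle, of M] by blast
    define A where "A = Acon' \<sigma> / (2 * pi)"
    have A: "A > 0" using \<sigma> by (simp add: A_def Acon'_eq)
    show "(\<lambda>x. wright_F \<sigma> x / (Acon' \<sigma> / (2 * pi) * bigX \<sigma> x powr (1 / 2) * exp (- bigX \<sigma> x))
                 - (\<Sum>j<M. c_coeff \<sigma> j / (- bigX \<sigma> x) ^ j)) \<in> O[at_top](\<lambda>x. 1 / bigX \<sigma> x ^ M)"
    proof (rule bigoI[of _ "C / A"])
      have "X0 > 0" using X0 by simp
      from ev[OF this] show "eventually (\<lambda>x. norm (wright_F \<sigma> x / (Acon' \<sigma> / (2 * pi) * bigX \<sigma> x powr (1 / 2) * exp (- bigX \<sigma> x))
                 - (\<Sum>j<M. c_coeff \<sigma> j / (- bigX \<sigma> x) ^ j)) \<le> C / A * norm (1 / bigX \<sigma> x ^ M)) at_top"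
      proof eventually_elim
        case (elim x)
        define X where "X = bigX \<sigma> x"
        have X: "X > 0" using elim X0 by (simp add: X_def)
        define r where "r = sqrt X * exp (- X)"
        have r: "r > 0" using X by (simp add: r_def)
        define s where "s = (\<Sum>j<M. c_coeff \<sigma> j / (- X) ^ j)"
        have "norm (complex_of_real (wright_F \<sigma> x - A * r * s)) \<le> C * (r / X ^ M)"
          using C[rule_format, of x] elim unfolding A_def X_def r_def s_def by (simp add: mult.assoc)
        hence "\<bar>wright_F \<sigma> x - A * r * s\<bar> \<le> C * (r / X ^ M)" unfolding norm_of_real .
        hence "\<bar>wright_F \<sigma> x - A * r * s\<bar> / (A * r) \<le> C * (r / X ^ M) / (A * r)" by (rule divide_right_mono) (use A r in simp)
        also have "\<dots> = C / A * (1 / X ^ M)" using r by simp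
        finally have le: "\<bar>wright_F \<sigma> x - A * r * s\<bar> / (A * r) \<le> C / A * (1 / X ^ M)" .
        have "\<bar>wright_F \<sigma> x / (A * r) - s\<bar> = \<bar>wright_F \<sigma> x - A * r * s\<bar> / (A * r)"
        proof -
          have "wright_F \<sigma> x / (A * r) - s = (wright_F \<sigma> x - A * r * s) / (A * r)" using A r by (simp add: diff_divide_distrib)
          thus ?thesis using A r by simp
        qed
        moreover have "Acon' \<sigma> / (2 * pi) * X powr (1 / 2) * exp (- X) = A * r"
          using X by (simp add: A_def r_def powr_half_sqrt)
        ultimately show ?case using le X unfolding X_def[symmetric] s_def[symmetric] by simp
      qed
    qed
  next
    fix M N :: nat assume half: "\<sigma> < 1 / 2" and "M \<ge> 1" "N \<ge> 1"
    define p where "p = real (N + 1) / \<sigma>"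
    have p: "p > 0" using \<sigma> by (simp add: p_def)
    define r where "r = cos (pi * \<sigma> / (1 - \<sigma>))"
    define Z where "Z = (\<lambda>x. bigX \<sigma> x powr (1 / 2 - real M) * exp (bigX \<sigma> x * r))"
    have Znn: "Z x \<ge> 0" for x by (simp add: Z_def)
    have "\<exists>K Y. Y > 0 \<and> (\<forall>x\<ge>1. bigX \<sigma> x \<ge> Y \<longrightarrow> \<bar>wright_F \<sigma> (- x) - (E'_trunc \<sigma> M x + H'_trunc \<sigma> N x)\<bar> \<le> K * (Z x + x powr - p))"
    proof (cases "\<sigma> < 1 / 3")
      case True
      have r: "r > 0"
      proof -
        have "pi * (2 * \<sigma>) < pi * (1 - \<sigma>)" by (rule mult_strict_left_mono) (use True in auto)
        hence "pi * \<sigma> / (1 - \<sigma>) < pi / 2" using \<sigma> by (simp add: field_simps)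
        moreover have "pi * \<sigma> / (1 - \<sigma>) > 0" using \<sigma> by simp
        ultimately show ?thesis unfolding r_def by (intro cos_gt_zero_pi) auto
      qed
      obtain K X0 where K: "\<forall>x>0. bigX \<sigma> x \<ge> X0 \<longrightarrow> \<bar>wright_F \<sigma> (- x) - E'_trunc \<sigma> M x\<bar> \<le> K * Z x"
        using wright_F_negative_exponential[OF \<sigma>(1) True saddle, of M] unfolding Z_def r_def by blast
      obtain KH where KH: "\<forall>x\<ge>1. \<bar>H'_trunc \<sigma> N x\<bar> \<le> KH" using H'_trunc_bounded[OF \<sigma>(1)] by blast
      \<comment> \<open>the growth of the exponential turns constants into multiples of the error term\<close>
      obtain C where C: "C \<ge> 0" "\<And>X. X > 0 \<Longrightarrow> exp (- r * X) \<le> C / X ^ M" by (rule exp_le_inverse_power[OF r]) blast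
      have "\<bar>wright_F \<sigma> (- x) - (E'_trunc \<sigma> M x + H'_trunc \<sigma> N x)\<bar> \<le> (\<bar>K\<bar> + \<bar>KH\<bar> * C) * (Z x + x powr - p)"
        if x: "x \<ge> 1" and XX: "bigX \<sigma> x \<ge> max 1 X0" for x
      proof -
        define X where "X = bigX \<sigma> x"
        have X: "X \<ge> 1" "X \<ge> X0" using XX by (auto simp: X_def)
        have "1 \<le> C * Z x"
        proof -
          have Zx: "Z x = X powr (1 / 2) / X ^ M * exp (X * r)" using X by (simp add: Z_def X_def powr_diff powr_realpow)
          have "1 \<le> X powr (1 / 2)" using X by (simp add: ge_one_powr_ge_zero)
          moreover have "1 = exp (- r * X) * exp (X * r)" by (simp flip: exp_add)
          moreover have "exp (- r * X) * exp (X * r) \<le> C / X ^ M * exp (X * r)" using C(2)[of X] X by (intro mult_right_mono) auto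
          ultimately have "1 * 1 \<le> X powr (1 / 2) * (C / X ^ M * exp (X * r))" by (intro mult_mono) auto
          thus ?thesis unfolding Zx by (simp add: mult_ac)
        qed
        hence "\<bar>KH\<bar> * 1 \<le> \<bar>KH\<bar> * (C * Z x)" by (intro mult_left_mono) auto
        moreover have "\<bar>H'_trunc \<sigma> N x\<bar> \<le> \<bar>KH\<bar>" using KH x by (meson abs_ge_self order_trans)
        ultimately have h: "\<bar>H'_trunc \<sigma> N x\<bar> \<le> \<bar>KH\<bar> * C * Z x" by simp
        have "K * Z x \<le> \<bar>K\<bar> * Z x" using Znn[of x] by (intro mult_right_mono) auto
        hence "\<bar>wright_F \<sigma> (- x) - E'_trunc \<sigma> M x\<bar> \<le> \<bar>K\<bar> * Z x"
          using K[rule_format, of x] x X unfolding X_def by linarith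
        hence "\<bar>wright_F \<sigma> (- x) - (E'_trunc \<sigma> M x + H'_trunc \<sigma> N x)\<bar> \<le> \<bar>K\<bar> * Z x + \<bar>KH\<bar> * C * Z x" using h by linarith
        also have "\<dots> = (\<bar>K\<bar> + \<bar>KH\<bar> * C) * Z x" by (simp only: distrib_right)
        also have "\<dots> \<le> (\<bar>K\<bar> + \<bar>KH\<bar> * C) * (Z x + x powr - p)" using C(1) by (intro mult_left_mono) auto
        finally show ?thesis .
      qed
      thus ?thesis by (intro exI[of _ "\<bar>K\<bar> + \<bar>KH\<bar> * C"] exI[of _ "max 1 X0"]) auto
    next
      case nlt: False
      show ?thesis
      proof (cases "\<sigma> = 1 / 3")
        case True
        obtain K X0 where K: "\<forall>x>0. bigX \<sigma> x \<ge> X0 \<longrightarrow> \<bar>wright_F \<sigma> (- x) - E'_trunc \<sigma> M x - H'_trunc \<sigma> N x\<bar> \<le> K * (Z x + x powr - p)"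
          using wright_F_negative_third[OF saddle True, of M N] unfolding Z_def r_def p_def by blast
        have "\<bar>wright_F \<sigma> (- x) - (E'_trunc \<sigma> M x + H'_trunc \<sigma> N x)\<bar> \<le> K * (Z x + x powr - p)"
          if "x \<ge> 1" "bigX \<sigma> x \<ge> max 1 X0" for x
          using K[rule_format, of x] that by (simp add: diff_diff_eq)
        thus ?thesis by (intro exI[of _ K] exI[of _ "max 1 X0"]) auto
      next
        case False
        hence third: "1 / 3 < \<sigma>" using nlt by linarith
        have r: "- r > 0"
        proof -
          have "pi * (1 - \<sigma>) < pi * (2 * \<sigma>)" by (rule mult_strict_left_mono) (use third in auto)
          hence "pi / 2 < pi * \<sigma> / (1 - \<sigma>)" using \<sigma> by (simp add: field_simps)
          moreover have "pi * \<sigma> < pi * (1 - \<sigma>)" by (rule mult_strict_left_mono) (use half in auto)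
          hence "pi * \<sigma> / (1 - \<sigma>) < pi" using \<sigma> by (simp add: field_simps)
          hence "pi * \<sigma> / (1 - \<sigma>) < 3 * pi / 2" using pi_gt_zero by linarith
          ultimately show ?thesis unfolding r_def using cos_neg_third_quadrant[of "pi * \<sigma> / (1 - \<sigma>)"] by simp
        qed
        obtain K where K: "\<forall>x>0. \<bar>wright_F \<sigma> (- x) - H'_trunc \<sigma> N x\<bar> \<le> K * x powr - p"
          using wright_F_negative_algebraic[OF third \<sigma>(2), of N] unfolding p_def by blast
        obtain K' where K': "\<forall>x>0. bigX \<sigma> x \<ge> 1 \<longrightarrow> \<bar>E'_trunc \<sigma> M x\<bar> \<le> K' * (bigX \<sigma> x * exp (bigX \<sigma> x * r))"
          using E'_trunc_bound[OF \<sigma>, of M] unfolding r_def by blast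
        \<comment> \<open>\<open>X\<close> is at least a multiple of \<open>x\<close>, so \<open>X\<^sup>-\<^sup>m\<close> is small enough and an exponentially small term is negligible\<close>
        obtain m :: nat where m: "p \<le> real m" using real_arch_simple by blast
        obtain C where C: "C \<ge> 0" "\<And>X. X > 0 \<Longrightarrow> exp (- (- r) * X) \<le> C / X ^ Suc m" by (rule exp_le_inverse_power[OF r]) blast
        define D where "D = ((1 - \<sigma>) * \<sigma> powr \<sigma>) powr - p"
        have "\<bar>wright_F \<sigma> (- x) - (E'_trunc \<sigma> M x + H'_trunc \<sigma> N x)\<bar> \<le> (\<bar>K\<bar> + \<bar>K'\<bar> * (C * D)) * (Z x + x powr - p)"
          if x: "x \<ge> 1" and X1: "bigX \<sigma> x \<ge> 1" for x
        proof -
          define X where "X = bigX \<sigma> x"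
          have X: "X \<ge> 1" using X1 by (simp add: X_def)
          have Xm: "1 / X ^ m \<le> D * x powr - p"
          proof -
            have "x \<le> X / ((1 - \<sigma>) * \<sigma> powr \<sigma>)" unfolding X_def using arg_le_bigX[OF \<sigma>, of x] x X1 by simp
            hence "(X / ((1 - \<sigma>) * \<sigma> powr \<sigma>)) powr - p \<le> x powr - p" using x p by (intro powr_mono2') auto
            hence le: "X powr - p / D \<le> x powr - p" using X \<sigma> by (simp add: D_def powr_divide)
            have D: "D > 0" using \<sigma> by (simp add: D_def)
            have "1 / X ^ m = X powr - real m" using X by (simp add: powr_minus powr_realpow inverse_eq_divide)
            also have "\<dots> \<le> X powr - p" using X m by (intro powr_mono) auto
            also have "\<dots> \<le> D * x powr - p" using le D by (simp add: field_simps)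
            finally show ?thesis .
          qed
          have "X * exp (X * r) \<le> X * (C / X ^ Suc m)" using C(2)[of X] X by (intro mult_left_mono) (auto simp: mult.commute)
          also have "\<dots> = C * (1 / X ^ m)" using X by simp
          also have "\<dots> \<le> C * (D * x powr - p)" using Xm C(1) by (rule mult_left_mono)
          finally have e: "X * exp (X * r) \<le> C * D * x powr - p" by (simp only: mult.assoc)
          have "\<bar>E'_trunc \<sigma> M x\<bar> \<le> K' * (X * exp (X * r))" using K'[rule_format, of x] x X1 by (simp add: X_def)
          also have "\<dots> \<le> \<bar>K'\<bar> * (X * exp (X * r))" using X by (intro mult_right_mono) auto
          also have "\<dots> \<le> \<bar>K'\<bar> * (C * D * x powr - p)" using e by (rule mult_left_mono) simp
          finally have E: "\<bar>E'_trunc \<sigma> M x\<bar> \<le> \<bar>K'\<bar> * (C * D) * x powr - p" by (simp only: mult.assoc)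
          have "K * x powr - p \<le> \<bar>K\<bar> * x powr - p" by (intro mult_right_mono) auto
          hence "\<bar>wright_F \<sigma> (- x) - H'_trunc \<sigma> N x\<bar> \<le> \<bar>K\<bar> * x powr - p" using K[rule_format, of x] x by linarith
          hence "\<bar>wright_F \<sigma> (- x) - (E'_trunc \<sigma> M x + H'_trunc \<sigma> N x)\<bar> \<le> \<bar>K\<bar> * x powr - p + \<bar>K'\<bar> * (C * D) * x powr - p"
            using E by linarith
          also have "\<dots> = (\<bar>K\<bar> + \<bar>K'\<bar> * (C * D)) * x powr - p" by (simp only: distrib_right)
          also have "\<dots> \<le> (\<bar>K\<bar> + \<bar>K'\<bar> * (C * D)) * (Z x + x powr - p)"
            using C(1) Znn[of x] by (intro mult_left_mono) (auto simp: D_def)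
          finally show ?thesis .
        qed
        thus ?thesis by (intro exI[of _ "\<bar>K\<bar> + \<bar>K'\<bar> * (C * D)"] exI[of _ 1]) auto
      qed
    qed
    then obtain K Y where Y: "Y > 0" and
      K: "\<forall>x\<ge>1. bigX \<sigma> x \<ge> Y \<longrightarrow> \<bar>wright_F \<sigma> (- x) - (E'_trunc \<sigma> M x + H'_trunc \<sigma> N x)\<bar> \<le> K * (Z x + x powr - p)" by blast
    have "eventually (\<lambda>x. norm (wright_F \<sigma> (- x) - (E'_trunc \<sigma> M x + H'_trunc \<sigma> N x)) \<le> K * norm (Z x + x powr - p)) at_top"
      using ev[OF Y]
    proof eventually_elim
      case (elim x)
      have "\<bar>Z x + x powr - p\<bar> = Z x + x powr - p" using Znn[of x] by simp
      thus ?case using K[rule_format, of x] elim by simp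
    qed
    hence "(\<lambda>x. wright_F \<sigma> (- x) - (E'_trunc \<sigma> M x + H'_trunc \<sigma> N x)) \<in> O[at_top](\<lambda>x. Z x + x powr - p)" by (rule bigoI)
    thus "(\<lambda>x. wright_F \<sigma> (- x) - (E'_trunc \<sigma> M x + H'_trunc \<sigma> N x))
               \<in> O[at_top](\<lambda>x. bigX \<sigma> x powr (1 / 2 - real M) * exp (bigX \<sigma> x * cos (pi * \<sigma> / kap \<sigma>))
                                + x powr (- (real (N + 1) / \<sigma>)))"
      by (simp only: Z_def r_def p_def kap_def)
  next
    fix N :: nat assume half: "1 / 2 < \<sigma>" and "N \<ge> 1"
    have "1 / 3 < \<sigma>" using half by simp
    then obtain K where K: "\<forall>x>0. \<bar>wright_F \<sigma> (- x) - H'_trunc \<sigma> N x\<bar> \<le> K * x powr - (real (N + 1) / \<sigma>)"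
      using wright_F_negative_algebraic[OF _ \<sigma>(2), of N] by blast
    show "(\<lambda>x. wright_F \<sigma> (- x) - H'_trunc \<sigma> N x) \<in> O[at_top](\<lambda>x. x powr (- (real (N + 1) / \<sigma>)))"
    proof (rule bigoI[of _ K])
      show "eventually (\<lambda>x. norm (wright_F \<sigma> (- x) - H'_trunc \<sigma> N x) \<le> K * norm (x powr (- (real (N + 1) / \<sigma>)))) at_top"
        using eventually_gt_at_top[of 0] by eventually_elim (use K in simp)
    qed
  }
qed


end
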